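(* Let $\ell\ge5$ be a prime, $m$ a positive integer, $t:=\ell^m$, and $0\le r<t$. For every integer $u\ge0$ there exist a Dirichlet character $\chi$, integers $\lambda,\lambda',N,N'$, and cusp forms $h\in S_{\lambda+\frac12}(\Gamma_0(N),\chi)$ and $h_r\in S_{\lambda'+\frac12}(\Gamma_1(N'))$ such that, as $q$-expansions ($q=e^{2\pi i z}$), $$t\sum_{\substack{n\ge1\\ \left(\frac{-n}{\ell}\right)=-1}}\overline{N}(r,t;n)\,q^n\equiv h(z)+h_r(z)\pmod{\ell^u},$$ the congruence meaning that every Fourier coefficient of the difference is divisible by $\ell^u$.
   Context: An overpartition of a positive integer $n$ is a partition of $n$ in which the first occurrence of each distinct part may be overlined. The rank of an overpartition is its largest part minus its number of parts. $\overline{N}(r,t;n)$ is the number of overpartitions of $n$ whose rank is congruent to $r$ modulo $t$. $\left(\frac{\cdot}{\ell}\right)$ is the Legendre symbol. $S_{\kappa}(\Gamma,\chi)$ denotes the space of holomorphic cusp forms of half-integral weight $\kappa$ on $\Gamma$ with Nebentypus $\chi$. *)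

theory Defs
  imports "HOL-Analysis.Analysis" "HOL-Number_Theory.Number_Theory" "HOL-Library.Multiset"
begin

text \<open>An overpartition of n: a multiset P of positive parts summing to n, together with
  the set O of those distinct part sizes whose first occurrence is overlined.\<close>
definition is_overpartition :: "nat \<Rightarrow> nat multiset \<times> nat set \<Rightarrow> bool" where
  "is_overpartition n PO \<longleftrightarrow> (0 \<notin># fst PO) \<and> sum_mset (fst PO) = n \<and> snd PO \<subseteq> set_mset (fst PO)"

text \<open>rank = largest part minus number of parts (only used for n \<ge> 1, so P is nonempty)\<close>
definition overpartition_rank :: "nat multiset \<times> nat set \<Rightarrow> int" where
  "overpartition_rank PO = int (Max (set_mset (fst PO))) - int (size (fst PO))"

definition Nbar :: "int \<Rightarrow> nat \<Rightarrow> nat \<Rightarrow> nat" where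
  "Nbar r t n = card {PO. is_overpartition n PO \<and> [overpartition_rank PO = r] (mod int t)}"

definition upper_half_plane :: "complex set" where
  "upper_half_plane = {z. Im z > 0}"

type_synonym mat2 = "int \<times> int \<times> int \<times> int"

definition SL2Z :: "mat2 set" where
  "SL2Z = {(a,b,c,d). a*d - b*c = 1}"

definition Gamma0 :: "nat \<Rightarrow> mat2 set" where
  "Gamma0 N = {(a,b,c,d). a*d - b*c = 1 \<and> int N dvd c}"

definition Gamma1 :: "nat \<Rightarrow> mat2 set" where
  "Gamma1 N = {(a,b,c,d). a*d - b*c = 1 \<and> int N dvd c \<and> [a = 1] (mod int N) \<and> [d = 1] (mod int N)}"

definition moebius_act :: "mat2 \<Rightarrow> complex \<Rightarrow> complex" where
  "moebius_act g z = (case g of (a,b,c,d) \<Rightarrow> (of_int a * z + of_int b) / (of_int c * z + of_int d))"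

definition Jacobi :: "int \<Rightarrow> int \<Rightarrow> int" where
  "Jacobi c d = prod_mset (image_mset (\<lambda>p. Legendre c (int p)) (prime_factorization (nat d)))"

text \<open>Shimura's extended symbol (c/d) for odd d: (c/d) = (c/|d|), times -1 if c<0 and d<0;
  in particular (0/\<plusminus>1) = 1.\<close>
definition shimura_symbol :: "int \<Rightarrow> int \<Rightarrow> int" where
  "shimura_symbol c d = (if c < 0 \<and> d < 0 then - Jacobi c \<bar>d\<bar> else Jacobi c \<bar>d\<bar>)"

definition eps_odd :: "int \<Rightarrow> complex" where
  "eps_odd d = (if [d = 1] (mod 4) then 1 else \<i>)"

definition theta_j :: "mat2 \<Rightarrow> complex \<Rightarrow> complex" where
  "theta_j g z = (case g of (a,b,c,d) \<Rightarrow>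
     of_int (shimura_symbol c d) * inverse (eps_odd d) * csqrt (of_int c * z + of_int d))"

definition dirichlet_char :: "nat \<Rightarrow> (int \<Rightarrow> complex) \<Rightarrow> bool" where
  "dirichlet_char N chi \<longleftrightarrow> N > 0 \<and> (\<forall>a b. chi (a*b) = chi a * chi b) \<and>
     (\<forall>a. chi (a + int N) = chi a) \<and> (\<forall>a. chi a = 0 \<longleftrightarrow> \<not> coprime a (int N))"

text \<open>Holomorphic cusp form of weight k+1/2 for the group G with character chi:
  holomorphic on the upper half plane, f(gz) = chi(d) j(g,z)^(2k+1) f(z) for g in G,
  and vanishing at every cusp: |cz+d|^(-(k+1/2)) |f(alpha z)| \<rightarrow> 0 as Im z \<rightarrow> \<infinity>
  (uniformly in Re z) for every alpha in SL2(Z).\<close>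
definition half_int_cusp_form :: "int \<Rightarrow> mat2 set \<Rightarrow> (int \<Rightarrow> complex) \<Rightarrow> (complex \<Rightarrow> complex) \<Rightarrow> bool" where
  "half_int_cusp_form k G chi f \<longleftrightarrow>
     f holomorphic_on upper_half_plane \<and>
     (\<forall>g\<in>G. \<forall>z\<in>upper_half_plane. case g of (a,b,c,d) \<Rightarrow>
         f (moebius_act g z) = chi d * (theta_j g z) powi (2*k+1) * f z) \<and>
     (\<forall>g\<in>SL2Z. case g of (a,b,c,d) \<Rightarrow>
         ((\<lambda>z. cmod (of_int c * z + of_int d) powr (- (of_int k + 1/2)) * cmod (f (moebius_act g z)))
            \<longlongrightarrow> 0) (filtercomap Im at_top))"

definition cusp_form_Gamma0 :: "int \<Rightarrow> nat \<Rightarrow> (int \<Rightarrow> complex) \<Rightarrow> (complex \<Rightarrow> complex) \<Rightarrow> bool" where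
  "cusp_form_Gamma0 k N chi f \<longleftrightarrow> N > 0 \<and> 4 dvd N \<and> dirichlet_char N chi \<and> half_int_cusp_form k (Gamma0 N) chi f"

definition cusp_form_Gamma1 :: "int \<Rightarrow> nat \<Rightarrow> (complex \<Rightarrow> complex) \<Rightarrow> bool" where
  "cusp_form_Gamma1 k N f \<longleftrightarrow> N > 0 \<and> 4 dvd N \<and> half_int_cusp_form k (Gamma1 N) (\<lambda>_. 1) f"

definition has_q_expansion :: "(complex \<Rightarrow> complex) \<Rightarrow> (nat \<Rightarrow> complex) \<Rightarrow> bool" where
  "has_q_expansion f a \<longleftrightarrow>
     (\<forall>z\<in>upper_half_plane. (\<lambda>n. a n * exp (2 * of_real pi * \<i> * of_nat n * z)) sums f z)"

end

theory Submission
 imports Defs "HOL-Complex_Analysis.Complex_Analysis" "HOL-Real_Asymp.Real_Asymp"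
begin

text \<open>Let O(w; q) be the rank generating function of overpartitions. Its Lambert series
expresses O(w; q), for a root of unity w = ee (j / t), through an Appell function B0 / th0, and O(1; q) = 1 / th0.
Summing B0 over the shifts z + 16 v / l with weights selecting (-n/l) = -1 cancels the non-elliptic
terms of its quasi-periodicity, because these only carry exponents minus a square. The sieved function
F is then determined by its poles and residues (Liouville), so a matrix with l^2 | c
carries it to a multiple of F or of its analogue for th1; at torsion points this gives weight 1/2 forms.
Multiplying by a large power of X8^L / X8(L z), with X8 = (th0 th1 th2)^8 and L = l^(2 m + 2), which is
1 modulo l^u, forces decay at the cusps with L not dividing c; at the other
cusps the sieve removes the leading exponent.\<close>

text \<open>Orthogonality of the t-th roots of unity writes t Nbar as the number of all
  overpartitions plus the contributions of ee (j / t) with 0 < j < t. After the sieve the two pieces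
  have different weights, -1/2 and 1/2, and different groups: only the second one depends on torsion
  points, which a matrix moves by its entry d modulo t. This is why two cusp forms occur, on Gamma0
  and Gamma1. The number 16 is forced by th1, whose exponents have denominator 16; being a square
  prime to l, it does not disturb the selection of residue classes. The condition l^2 | c makes the
  conjugate of a matrix by translations with denominator l integral again, and torsion of order t
  adds a factor t^2, whence L = (t l)^2. The power K of the discriminant quotient has to serve two
  purposes at once: the modulus l^u, and decay at the bad cusps. The latter needs a growth bound exp
  (C Im z) that is uniform over all of SL2(Z). Transformation laws are never obtained from
  generators for the Appell functions; each is a Liouville argument in the elliptic variable for a
  single matrix.\<close>

notation tendsto (infixr "--->" 55)
abbreviation "mob == moebius_act"
abbreviation "aut c d z == of_int c * z + (of_int d :: complex)"


section \<open>Legendre and Jacobi symbols, quadratic reciprocity\<close>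

lemma Legendre_values: "Legendre a p \<in> {-1, 0, 1}"
 by (auto simp: Legendre_def)

lemma Legendre_cong: "[a = b] (mod p) ==> Legendre a p = Legendre b p"
 by (simp add: Legendre_def QuadRes_def cong_def)

text \<open>Euler's criterion determines a Legendre symbol only modulo p. Two values in {-1, 0, 1}
  differ by at most 2 < p, so the congruence is an equality.\<close>

lemma cong_small_values:
 fixes x y p :: int
 assumes "x \<in> {-1,0,1}" "y \<in> {-1,0,1}" "p > 2" "[x = y] (mod p)"
 shows "x = y"
proof -
 have d: "p dvd (x - y)" using assms(4) by (simp add: cong_iff_dvd_diff)
 have b: "(abs (x - y)) < p" using assms(1-3) by auto
 show ?thesis using d b zdvd_imp_le[of p "(abs (x - y))"] by (cases "x = y") auto
qed

lemma Legendre_mult: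
 fixes p :: nat
 assumes "prime p" "p > 2"
 shows "Legendre (a * b) (int p) = Legendre a (int p) * Legendre b (int p)"
proof (rule cong_small_values)
 have "[Legendre (a*b) p = (a*b) ^ ((p-1) div 2)] (mod p)" by (rule euler_criterion[OF assms])
 also have "(a*b) ^ ((p-1) div 2) = a ^ ((p-1) div 2) * b ^ ((p-1) div 2)"
  by (simp add: power_mult_distrib)
 also have "[... = Legendre a p * Legendre b p] (mod p)"
  by (intro cong_mult cong_sym[OF euler_criterion[OF assms]])
 finally show "[Legendre (a*b) p = Legendre a p * Legendre b p] (mod p)" .
qed (use Legendre_values[of a p] Legendre_values[of b p] Legendre_values[of "a*b" p] assms(2) in auto)

lemma Legendre_square_right:
 fixes p :: nat
 assumes "prime p" "p > 2" "~ int p dvd b"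
 shows "Legendre (a * b^2) (int p) = Legendre a (int p)"
proof -
 have "Legendre b (int p) ~= 0" using assms(3) by (auto simp: Legendre_def cong_0_iff)
 hence "Legendre b (int p) * Legendre b (int p) = 1" using Legendre_values[of b p] by auto
 thus ?thesis using assms(1,2) by (simp add: Legendre_mult power2_eq_square)
qed

text \<open>Since \<open>Jacobi\<close> is a product over prime factors, multiplying by one odd
  prime at a time reduces every Jacobi identity to a Legendre identity.\<close>

lemma odd_nat_mult_induct [consumes 1, case_names one factor]:
 fixes n :: nat
 assumes "odd n" and one: "P 1"
  and factor: "!!p n. prime p ==> p > 2 ==> odd n ==> P n ==> P (p * n)"
 shows "P n"
proof -
 have "odd n --> P n"
 proof (induction n rule: prime_divisors_induct)
  case (factor p x)
  show ?case
  proof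
   assume o: "odd (p * x)"
   hence "p ~= 2" "odd x" by auto
   moreover have "p >= 2" using factor(1) prime_ge_2_nat by blast
   ultimately show "P (p * x)" using factor assms(3)[of p x] by simp
  qed
 qed (use one in auto)
 thus ?thesis using assms(1) by blast
qed

lemma Jacobi_1_right [simp]: "Jacobi c 1 = 1"
 by (simp add: Jacobi_def)

lemma Jacobi_prime: "prime p ==> Jacobi c (int p) = Legendre c (int p)"
 by (simp add: Jacobi_def prime_factorization_prime)

lemma Jacobi_mult_right:
 assumes "m > 0" "n > 0"
 shows "Jacobi c (int (m * n)) = Jacobi c (int m) * Jacobi c (int n)"
 using assms by (simp add: Jacobi_def prime_factorization_mult nat_mult_distrib)

lemma Jacobi_prime_mult:
 assumes "prime p" "n > 0"
 shows "Jacobi c (int (p * n)) = Legendre c (int p) * Jacobi c (int n)"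
 using assms Jacobi_mult_right[of p n c] by (simp add: Jacobi_prime prime_gt_0_nat)

lemma Jacobi_prime_mult_odd:
 assumes "prime p" "odd n"
 shows "Jacobi c (int p * int n) = Legendre c (int p) * Jacobi c (int n)"
 using Jacobi_prime_mult[OF assms(1), of n c] assms(2) odd_pos[of n] by simp

lemma Jacobi_mult_left:
 assumes "odd n"
 shows "Jacobi (a * b) (int n) = Jacobi a (int n) * Jacobi b (int n)"
 using assms
proof (induction n rule: odd_nat_mult_induct)
 case (factor p n)
 then show ?case by (simp add: Jacobi_prime_mult_odd Legendre_mult)
qed simp

lemma Jacobi_cong:
 assumes "odd n" "[a = b] (mod int n)"
 shows "Jacobi a (int n) = Jacobi b (int n)"
 using assms
proof (induction n rule: odd_nat_mult_induct)
 case (factor p n)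
 have "[a = b] (mod int p)" "[a = b] (mod int n)"
  using factor.prems unfolding of_nat_mult by (metis cong_modulus_mult, metis cong_modulus_mult mult.commute)
 with factor show ?case using Legendre_cong[of a b "int p"] by (simp add: Jacobi_prime_mult_odd)
qed simp

lemma Jacobi_nonzero:
 assumes "odd n" "coprime a (int n)"
 shows "Jacobi a (int n) = 1 | Jacobi a (int n) = -1"
 using assms
proof (induction n rule: odd_nat_mult_induct)
 case (factor p n)
 have 1: "coprime a (int p)" "coprime a (int n)" using factor.prems by auto
 have "~ int p dvd a"
 proof
  assume "int p dvd a"
  with 1(1) have "is_unit (int p)" by (meson coprime_common_divisor dvd_refl)
  thus False using factor(2) by auto
 qed
 hence "Legendre a (int p) = 1 | Legendre a (int p) = -1"
  by (auto simp: Legendre_def cong_0_iff)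
 with factor 1 show ?case by (auto simp: Jacobi_prime_mult_odd)
qed simp

lemma Jacobi_square:
 assumes "odd n" "coprime a (int n)"
 shows "Jacobi (a^2) (int n) = 1"
 using Jacobi_nonzero[OF assms] Jacobi_mult_left[OF assms(1), of a a]
 by (auto simp: power2_eq_square)

lemma Jacobi_1_left [simp]: "odd n ==> Jacobi 1 (int n) = 1"
 using Jacobi_square[of n 1] by simp

text \<open>On odd arguments \<open>sgn4\<close> is the character (-1/d) and \<open>rec4\<close> the
  sign of the reciprocity law. Residues modulo 4 replace the usual exponents so that negative
  arguments are covered as well.\<close>

definition sgn4 :: "int => int" where "sgn4 d = (if d mod 4 = 3 then -1 else 1)"
definition rec4 :: "int => int => int" where "rec4 c d = (if c mod 4 = 3 & d mod 4 = 3 then -1 else 1)"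

lemma odd_mod4: "odd (d::int) ==> d mod 4 = 1 | d mod 4 = 3" by presburger

lemma mult_mod4:
 fixes a b :: int
 assumes "odd a" "odd b"
 shows "(a * b) mod 4 = 3 \<longleftrightarrow> (a mod 4 = 3) ~= (b mod 4 = 3)"
proof -
 have "(a * b) mod 4 = ((a mod 4) * (b mod 4)) mod 4" by (simp add: mod_mult_eq)
 thus ?thesis using odd_mod4[OF assms(1)] odd_mod4[OF assms(2)] by (elim disjE) simp_all
qed

lemma sgn4_mult: "odd a ==> odd b ==> sgn4 (a * b) = sgn4 a * sgn4 b"
 by (auto simp: sgn4_def mult_mod4)

lemma rec4_mult: "odd a ==> odd b ==> rec4 (a * b) d = rec4 a d * rec4 b d"
 by (auto simp: rec4_def mult_mod4)

lemma rec4_sym: "rec4 a b = rec4 b a" by (auto simp: rec4_def)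

lemma Jacobi_minus1:
 assumes "odd n" shows "Jacobi (-1) (int n) = sgn4 (int n)"
 using assms
proof (induction n rule: odd_nat_mult_induct)
 case (factor p n)
 have op: "odd p" using factor by (metis prime_odd_nat)
 have "Legendre (-1) p = sgn4 (int p)"
 proof (rule cong_small_values)
  have "[Legendre (-1) p = (-1) ^ ((p-1) div 2)] (mod p)" by (rule euler_criterion) (use factor in auto)
  also have "(-1) ^ ((p-1) div 2) = sgn4 (int p)"
  proof -
   have "even ((p-1) div 2) \<longleftrightarrow> int p mod 4 ~= 3" using op by presburger
   thus ?thesis by (auto simp: sgn4_def)
  qed
  finally show "[Legendre (-1) p = sgn4 (int p)] (mod p)" .
 qed (use factor Legendre_values[of "-1" p] in \<open>auto simp: sgn4_def\<close>)
 with factor op show ?case by (simp add: Jacobi_prime_mult_odd sgn4_mult)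
qed (simp add: sgn4_def)

text \<open>Reciprocity is built up by two inductions: here the upper entry is prime and the lower
  one grows, afterwards the upper one grows.\<close>

lemma Legendre_Jacobi_reciprocity:
 assumes "prime p" "p > 2" "odd n" "coprime (int p) (int n)"
 shows "Jacobi (int p) (int n) = Legendre (int n) (int p) * rec4 (int p) (int n)"
 using assms(3,4)
proof (induction n rule: odd_nat_mult_induct)
 case one
 have "Legendre 1 (int p) = 1" using Jacobi_1_left[of p] assms Jacobi_prime[of p 1] by (metis prime_odd_nat)
 thus ?case by (simp add: rec4_def)
next
 case (factor q n)
 have c: "coprime (int p) (int n)" "p ~= q" using factor.prems factor(1) assms
  by (auto simp: coprime_mult_right_iff)
 have oq: "odd p" "odd q" using factor assms by (metis prime_odd_nat)+
 have nz: "Legendre q p = 1 | Legendre q p = -1"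
 proof -
  have "~ int p dvd int q" using c(2) assms(1) factor(1) primes_dvd_imp_eq int_dvd_int_iff by blast
  thus ?thesis by (auto simp: Legendre_def cong_0_iff)
 qed
 have "Legendre p q * Legendre q p = (-1::int) ^ ((p - 1) div 2 * ((q - 1) div 2))"
  using Quadratic_Reciprocity[of p q] assms factor c by auto
 also have "... = rec4 p q"
 proof -
  have "even ((p-1) div 2) \<longleftrightarrow> int p mod 4 ~= 3" "even ((q-1) div 2) \<longleftrightarrow> int q mod 4 ~= 3"
   using oq by presburger+
  hence "even ((p - 1) div 2 * ((q - 1) div 2)) \<longleftrightarrow> ~ (int p mod 4 = 3 & int q mod 4 = 3)" by simp
  thus ?thesis by (simp add: rec4_def uminus_power_if)
 qed
 finally have 1: "Legendre p q = Legendre q p * rec4 p q" using nz by auto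
 have "Jacobi (int p) (int (q*n)) = Legendre q p * rec4 p q * (Legendre n p * rec4 p n)"
  using factor c 1 by (simp add: Jacobi_prime_mult_odd)
 also have "... = Legendre (int (q * n)) p * rec4 p (int (q * n))"
  using assms oq factor(3) rec4_mult[of "int q" "int n" "int p"] by (simp add: Legendre_mult rec4_sym[of "int p"])
 finally show ?case .
qed

lemma Jacobi_reciprocity:
 assumes "odd m" "odd n" "coprime (int m) (int n)"
 shows "Jacobi (int m) (int n) = Jacobi (int n) (int m) * rec4 (int m) (int n)"
 using assms(1,3)
proof (induction m rule: odd_nat_mult_induct)
 case one
 then show ?case using assms by (simp add: rec4_def)
next
 case (factor p m)
 have c: "coprime (int m) (int n)" "coprime (int p) (int n)" using factor.prems by auto
 have op: "odd p" using factor by (metis prime_odd_nat)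
 have "Jacobi (int (p * m)) (int n) = Jacobi (int p) (int n) * Jacobi (int m) (int n)"
  using assms(2) Jacobi_mult_left by simp
 also have "... = Legendre (int n) p * rec4 p n * (Jacobi n m * rec4 m n)"
  using factor c Legendre_Jacobi_reciprocity[OF factor(1,2) assms(2) c(2)] by simp
 also have "... = Jacobi n (int (p * m)) * rec4 (int (p * m)) n"
  using factor op rec4_mult[of "int p" "int m" "int n"] by (simp add: Jacobi_prime_mult_odd)
 finally show ?case .
qed

text \<open>The supplementary law follows from reciprocity: with n = m + 2, the number 2 is -m
  modulo n, and n is 2 modulo m, so the symbol at n reduces to the symbol at m. The reciprocity sign
  is trivial because m and m + 2 are not both 3 modulo 4.\<close>

lemma Jacobi_2:
 assumes "odd n"
 shows "Jacobi 2 (int n) = (if n mod 8 = 1 | n mod 8 = 7 then 1 else -1)"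
 using assms
proof (induction n rule: less_induct)
 case (less n)
 show ?case
 proof (cases "n = 1")
  case False
  define m where "m = n - 2"
  have nm: "n = m + 2" "odd m" using False less.prems by (auto simp: m_def) presburger+
  have cop: "coprime (int m) (int n)"
  proof -
   have "coprime (int m) 2" using nm(2) by simp
   thus ?thesis unfolding nm(1) using gcd_add1[of 2 "int m"]
    by (simp add: coprime_iff_gcd_eq_1 gcd.commute)
  qed
  have "Jacobi 2 (int n) = Jacobi (- int m) (int n)"
   by (rule Jacobi_cong[OF less.prems]) (simp add: nm(1) cong_iff_dvd_diff)
  also have "... = Jacobi (-1) (int n) * Jacobi (int m) (int n)"
   using Jacobi_mult_left[OF less.prems, of "-1" "int m"] by simp
  also have "Jacobi (int m) (int n) = Jacobi (int n) (int m) * rec4 (int m) (int n)"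
   by (rule Jacobi_reciprocity[OF nm(2) less.prems cop])
  also have "Jacobi (int n) (int m) = Jacobi 2 (int m)"
   by (rule Jacobi_cong[OF nm(2)]) (simp add: nm(1) cong_iff_dvd_diff)
  also have "... = (if m mod 8 = 1 | m mod 8 = 7 then 1 else -1)"
   using less.IH[of m] nm by simp
  finally have *: "Jacobi 2 (int n) = sgn4 (int n) * ((if m mod 8 = 1 | m mod 8 = 7 then 1 else -1) * rec4 (int m) (int n))"
   by (simp add: Jacobi_minus1[OF less.prems])
  have r: "rec4 (int m) (int n) = 1" using nm unfolding rec4_def by presburger
  have "sgn4 (int n) = (if n mod 8 = 3 | n mod 8 = 7 then -1 else 1)"
   unfolding sgn4_def by presburger
  moreover have "m mod 8 = 1 | m mod 8 = 3 | m mod 8 = 5 | m mod 8 = 7" using nm(2) by presburger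
  moreover have "n mod 8 = (m mod 8 + 2) mod 8" unfolding nm(1) by presburger
  ultimately show ?thesis using * r by auto
 qed simp
qed

section \<open>Shimura's symbol as a function of d\<close>

lemma shimura_symbol_odd_part:
 fixes c' d :: int
 assumes "odd d" "odd c'" "c' > 0" "coprime c' d"
 shows "Jacobi c' (abs d) = Jacobi d c' * rec4 c' d"
proof -
 obtain m n where mn: "c' = int m" "(abs d) = int n"
  using assms by (metis abs_ge_zero zero_le_imp_eq_int order_less_imp_le)
 have o: "odd m" "odd n" using assms mn by (auto, metis even_of_nat mn(2) even_abs_add_iff dvd_abs_iff)
 have cop: "coprime (int m) (int n)" using assms(4) mn by (metis coprime_abs_right_iff)
 have 1: "Jacobi c' (abs d) = Jacobi (abs d) c' * rec4 c' (abs d)"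
  unfolding mn by (rule Jacobi_reciprocity[OF o cop])
 show ?thesis
 proof (cases "d >= 0")
  case False
  have "Jacobi (abs d) c' = sgn4 c' * Jacobi d c'"
   using Jacobi_mult_left[OF o(1), of "-1" d] False by (simp add: Jacobi_minus1[OF o(1)] mn(1))
  moreover have "sgn4 c' * rec4 c' (abs d) = rec4 c' d"
   using False assms(1) unfolding rec4_def sgn4_def by (simp split: if_splits) presburger
  ultimately show ?thesis using 1 by (simp add: mult_ac)
 qed (use 1 in simp)
qed

lemma exists_odd_part:
 fixes c :: int assumes "c ~= 0"
 shows "EX e c'. (abs c) = 2 ^ e * c' & odd c' & c' > 0"
proof -
 have "~ is_unit (2::int)" by simp
 then obtain c' where "(abs c) = 2 ^ multiplicity 2 (abs c) * c'" "~ 2 dvd c'"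
  using multiplicity_decompose'[of "(abs c)" 2] assms by auto
 moreover from this(1) have "c' > 0" using assms
  by (metis abs_ge_zero abs_eq_0 mult_eq_0_iff order_less_le zero_le_mult_iff zero_less_numeral zero_less_power not_less)
 ultimately show ?thesis by blast
qed

text \<open>After flipping the odd part c' of c, everything depends on d only modulo 8 and modulo
  c'. This makes the periodicity in d visible, including the change of sign of d.\<close>

lemma shimura_symbol_formula:
 fixes c d :: int
 assumes "c ~= 0" "(abs c) = 2 ^ e * c'" "odd c'" "c' > 0" "odd d" "coprime c d"
 shows "shimura_symbol c d = (if c < 0 then sgn4 d else 1) *
  (if even e | d mod 8 = 1 | d mod 8 = 7 then 1 else -1) * (Jacobi d c' * rec4 c' d)"
proof -
 obtain n where n: "(abs d) = int n" by (metis abs_ge_zero zero_le_imp_eq_int)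
 have "odd (int n)" using assms(5) by (simp flip: n)
 hence o: "odd n" by simp
 have c2: "coprime c' d" using assms(2,6)
  by (metis coprime_abs_left_iff coprime_mult_left_iff)
 have J2: "Jacobi (2^e) (int n) = (if even e | d mod 8 = 1 | d mod 8 = 7 then 1 else -1)"
 proof -
  have "Jacobi (2^e) (int n) = Jacobi 2 (int n) ^ e"
   by (induction e) (use o in \<open>auto simp: Jacobi_mult_left\<close>)
  moreover have "(n mod 8 = 1 | n mod 8 = 7) \<longleftrightarrow> (d mod 8 = 1 | d mod 8 = 7)"
  proof -
   have 1: "n mod 8 = 1 \<longleftrightarrow> (abs d) mod 8 = 1" "n mod 8 = 7 \<longleftrightarrow> (abs d) mod 8 = 7"
    unfolding n by presburger+
   have 2: "(- d) mod 8 = 1 \<longleftrightarrow> d mod 8 = 7" "(- d) mod 8 = 7 \<longleftrightarrow> d mod 8 = 1"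
    by (auto simp: zmod_zminus1_eq_if)
   show ?thesis by (cases "d >= 0") (use 1 2 in auto)
  qed
  ultimately show ?thesis by (auto simp: Jacobi_2[OF o] uminus_power_if)
 qed
 have a: "Jacobi (abs c) (int n) = Jacobi (2^e) (int n) * (Jacobi d c' * rec4 c' d)"
  using assms(2) Jacobi_mult_left[OF o, of "2^e" c'] shimura_symbol_odd_part[OF assms(5,3,4) c2] n by simp
 show ?thesis
 proof (cases "c < 0")
  case False
  thus ?thesis using a J2 n by (simp add: shimura_symbol_def)
 next
  case True
  hence 1: "Jacobi c (int n) = sgn4 (int n) * Jacobi (abs c) (int n)"
   using Jacobi_mult_left[OF o, of "-1" "(abs c)"] by (simp add: Jacobi_minus1[OF o])
  have 2: "(if d < 0 then - sgn4 (int n) else sgn4 (int n)) = sgn4 d"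
  proof -
   have 1: "(- d) mod 4 = 3 \<longleftrightarrow> d mod 4 = 1" by presburger
   show ?thesis unfolding n[symmetric] sgn4_def using 1 odd_mod4[OF assms(5)]
    by (cases "d < 0") auto
  qed
  have "shimura_symbol c d = (if d < 0 then - sgn4 (int n) else sgn4 (int n)) * Jacobi (abs c) (int n)"
   using True 1 by (simp add: shimura_symbol_def n)
  thus ?thesis unfolding 2 a J2 using True by simp
 qed
qed

lemma shimura_symbol_periodic:
 fixes c d d' :: int
 assumes "4 dvd c" "odd d" "coprime c d" "c dvd (d' - d)"
 shows "shimura_symbol c d' = shimura_symbol c d"
proof (cases "c = 0")
 case False
 obtain e c' where e: "(abs c) = 2 ^ e * c'" "odd c'" "c' > 0" using exists_odd_part[OF False] by blast
 have 4: "4 dvd d' - d" using assms by (meson dvd_trans)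
 have od: "odd d'" using 4 assms(2) by presburger
 obtain k where k: "d' = d + c * k" using assms(4) by (metis dvd_def add.commute diff_add_cancel)
 have cop: "coprime c d'" using assms(3) k
  by (metis add.commute coprime_iff_gcd_eq_1 gcd_add_mult mult.commute)
 have s: "sgn4 d' = sgn4 d" "rec4 c' d' = rec4 c' d"
 proof -
  have "d' mod 4 = d mod 4" using 4 by presburger
  thus "sgn4 d' = sgn4 d" "rec4 c' d' = rec4 c' d" by (simp_all add: sgn4_def rec4_def)
 qed
 have J: "Jacobi d' c' = Jacobi d c'"
 proof -
  obtain m where m: "c' = int m" using e(3) by (metis zero_le_imp_eq_int order_less_imp_le)
  have "c' dvd d' - d" using e(1) assms(4) by (metis abs_dvd_iff dvd_mult_right)
  thus ?thesis unfolding m by (intro Jacobi_cong) (use e m in \<open>auto simp: cong_iff_dvd_diff\<close>)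
 qed
 \<comment> \<open>For even e the factor (2/d) does not occur. For odd e the hypothesis 4 | c
   excludes e = 1, so 8 divides c and d is known modulo 8.\<close>
 have m8: "even e | d' mod 8 = d mod 8"
 proof (cases "even e")
  case False
  have "e ~= 1"
  proof
   assume "e = 1"
   hence "4 dvd 2 * c'" using e(1) assms(1) by (metis dvd_abs_iff power_one_right)
   thus False using e(2) by presburger
  qed
  hence "3 <= e" using False by presburger
  hence "(2::int)^3 dvd 2^e" by (rule le_imp_power_dvd)
  hence "8 dvd d' - d" using e(1) assms(4) by simp (metis abs_dvd_iff dvd_mult_left dvd_trans)
  thus ?thesis by presburger
 qed simp
 show ?thesis
  unfolding shimura_symbol_formula[OF False e assms(2,3)] shimura_symbol_formula[OF False e od cop]
  using s J m8 by auto
next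
 case True
 with assms show ?thesis by simp
qed

lemma shimura_symbol_mult_square:
 fixes c d m :: int
 assumes "odd d" "coprime m d" "m ~= 0"
 shows "shimura_symbol (c * m^2) d = shimura_symbol c d"
proof -
 obtain n where n: "(abs d) = int n" by (metis abs_ge_zero zero_le_imp_eq_int)
 have "odd (int n)" using assms by (simp flip: n)
 hence o: "odd n" by simp
 have cop: "coprime m (int n)" using assms(2) by (simp flip: n)
 have J: "Jacobi (c * m^2) (int n) = Jacobi c (int n)"
  by (simp add: Jacobi_mult_left[OF o] Jacobi_square[OF o cop])
 have "c * m^2 < 0 \<longleftrightarrow> c < 0" using assms(3) by (simp add: mult_less_0_iff)
 thus ?thesis by (simp add: shimura_symbol_def n J)
qed

lemma shimura_symbol_coprime_sq:
 assumes "odd d" "coprime c d"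
 shows "(shimura_symbol c d)\<^sup>2 = 1"
proof -
 obtain n where n: "(abs d) = int n" by (metis abs_ge_zero zero_le_imp_eq_int)
 have "odd (int n)" using assms by (simp flip: n)
 hence o: "odd n" by simp
 have "coprime c (int n)" using assms(2) by (simp flip: n)
 from Jacobi_nonzero[OF o this] show ?thesis using n by (auto simp: shimura_symbol_def)
qed

lemma Jacobi_abs_cong:
 fixes c c' d :: int
 assumes "odd d" "d dvd c' - c"
 shows "Jacobi c' (abs d) = Jacobi c (abs d)"
proof -
 obtain n where n: "(abs d) = int n" by (metis abs_ge_zero zero_le_imp_eq_int)
 have "odd (int n)" using assms(1) by (simp flip: n)
 hence o: "odd n" by simp
 have "int n dvd c' - c" using assms(2) by (simp flip: n)
 hence "[c' = c] (mod int n)" by (simp add: cong_iff_dvd_diff)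
 thus ?thesis unfolding n by (rule Jacobi_cong[OF o])
qed

section \<open>The normalised exponential\<close>

definition ee :: "complex => complex" where "ee z = exp (2 * of_real pi * \<i> * z)"

lemma ee_add: "ee (a + b) = ee a * ee b" by (simp add: ee_def ring_distribs exp_add)
lemma ee_diff: "ee (a - b) = ee a / ee b" by (simp add: ee_def ring_distribs exp_diff)
lemma ee_minus: "ee (- a) = inverse (ee a)" by (simp add: ee_def exp_minus)
lemma ee_0 [simp]: "ee 0 = 1" by (simp add: ee_def)
lemma ee_nonzero [simp]: "ee z ~= 0" by (simp add: ee_def)
lemma norm_ee: "norm (ee z) = exp (- 2 * pi * Im z)" by (simp add: ee_def norm_exp_eq_Re)
lemma ee_power: "ee z ^ n = ee (of_nat n * z)" by (simp add: ee_def exp_of_nat_mult[symmetric] mult_ac)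

lemma ee_eq_1_iff: "ee z = 1 \<longleftrightarrow> (EX n. z = of_int n)"
proof -
 have "ee z = 1 \<longleftrightarrow> (EX n. 2 * of_real pi * \<i> * z = of_real (of_int n * (2 * pi)) * \<i>)"
  unfolding ee_def exp_eq_1 by (auto simp: complex_eq_iff algebra_simps)
 also have "... \<longleftrightarrow> (EX n. z = of_int n)"
  by (intro ex_cong1) (auto simp: field_simps)
 finally show ?thesis .
qed

lemma ee_of_int [simp]: "ee (of_int n) = 1" using ee_eq_1_iff by blast
lemma ee_of_nat [simp]: "ee (of_nat n) = 1" using ee_of_int[of "int n"] by simp
lemma ee_1 [simp]: "ee 1 = 1" using ee_of_int[of 1] by simp
lemma ee_half: "ee (1/2) = -1" by (simp add: ee_def)
lemma ee_add_of_int [simp]: "ee (z + of_int n) = ee z" by (simp add: ee_add)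
lemma ee_add_1 [simp]: "ee (z + 1) = ee z" by (simp add: ee_add)

lemma ee_eq_iff: "ee a = ee b \<longleftrightarrow> (EX n. a - b = of_int n)"
proof -
 have "ee a = ee b \<longleftrightarrow> ee (a - b) = 1" by (simp add: ee_diff)
 thus ?thesis by (simp add: ee_eq_1_iff)
qed

lemma ee_eqI: "a - b = of_int n ==> ee a = ee b"
 using ee_eq_iff by blast

lemma has_field_derivative_ee [derivative_intros]:
 "(f has_field_derivative f') (at x within A) ==>
 ((%x. ee (f x)) has_field_derivative (ee (f x) * (2 * of_real pi * \<i> * f'))) (at x within A)"
 unfolding ee_def by (auto intro!: derivative_eq_intros)

lemma holomorphic_on_ee [holomorphic_intros]:
 "f holomorphic_on A ==> (%x. ee (f x)) holomorphic_on A"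
 unfolding ee_def by (intro holomorphic_intros)

lemma continuous_on_ee [continuous_intros]:
 "continuous_on A f ==> continuous_on A (%x. ee (f x))"
 unfolding ee_def by (intro continuous_intros)

lemma isCont_ee [simp]: "isCont ee z"
 unfolding ee_def by (intro continuous_intros)

lemma tendsto_ee [tendsto_intros]: "(f ---> l) F ==> ((%x. ee (f x)) ---> ee l) F"
 using isCont_tendsto_compose[OF isCont_ee] .

section \<open>Sums over the integers and holomorphy of infinite sums\<close>

lemma summable_int_geometric:
 fixes r :: real assumes "0 <= r" "r < 1"
 shows "(%n::int. r ^ nat (abs n)) summable_on UNIV"
proof -
 have s: "(%n::nat. r ^ n) summable_on UNIV" "(%n::nat. r ^ Suc n) summable_on UNIV"
  using assms by (auto intro!: norm_summable_imp_summable_on summable_geometric summable_mult simp: )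
 have "(%n::int. r ^ nat (abs n)) summable_on (range int)"
  using s(1) by (subst summable_on_reindex) (auto simp: o_def)
 moreover have "(%n::int. r ^ nat (abs n)) summable_on (range (%n. - int (Suc n)))"
  using s(2) by (subst summable_on_reindex) (auto simp: o_def inj_on_def nat_add_distrib)
 moreover have "range int \<inter> range (%n. - int (Suc n)) = {}" by auto
 ultimately have "(%n::int. r ^ nat (abs n)) summable_on (range int \<union> range (%n. - int (Suc n)))"
  by (rule summable_on_Un_disjoint)
 also have "range int \<union> range (%n. - int (Suc n)) = UNIV"
 proof (intro equalityI subsetI UNIV_I)
  fix n :: int show "n \<in> range int \<union> range (%n. - int (Suc n))"
   by (cases n rule: int_cases) auto
 qed
 finally show ?thesis .
qed

text \<open>Completing the square bounds - a x^2 + b x by a constant minus x, which leaves a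
  geometric series.\<close>

lemma summable_int_gaussian:
 fixes a b :: real assumes "a > 0"
 shows "(%n::int. exp (- a * (of_int n)^2 + b * (abs (of_int n)))) summable_on UNIV"
proof -
 define C where "C = exp ((b + 1)^2 / (4 * a))"
 have "(%n::int. C * exp (-1) ^ nat (abs n)) summable_on UNIV"
  by (intro summable_on_cmult_right summable_int_geometric) auto
 moreover have "norm (exp (- a * (of_int n)^2 + b * (abs (of_int n)))) <= C * exp (-1) ^ nat (abs n)" for n :: int
 proof -
  define x :: real where "x = (abs (of_int n))"
  have "0 <= (2 * a * x - (b + 1))^2 / (4 * a)" using assms by simp
  also have "... = a * x^2 - (b + 1) * x + (b + 1)^2 / (4 * a)"
   using assms by (simp add: field_simps power2_eq_square)
  finally have "- a * x^2 + b * x <= (b + 1)^2 / (4 * a) + (- x)" by (simp add: algebra_simps)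
  hence "exp (- a * x^2 + b * x) <= C * exp (- x)" unfolding C_def by (simp flip: exp_add)
  moreover have "exp (- x) = exp (-1) ^ nat (abs n)"
   by (simp add: x_def flip: exp_of_nat_mult)
  ultimately show ?thesis by (simp add: x_def)
 qed
 ultimately have "(%n::int. norm (exp (- a * (of_int n)^2 + b * (abs (of_int n))))) summable_on UNIV"
  by (rule Infinite_Sum.abs_summable_on_comparison_test')
 thus ?thesis by simp
qed

lemma summable_on_norm_bound:
 fixes f :: "'i => 'b :: banach" and M :: "'i => real"
 assumes "M summable_on A" "!!n. n \<in> A ==> norm (f n) <= M n"
 shows "f summable_on A" "f abs_summable_on A"
proof -
 show "f abs_summable_on A" using assms by (rule Infinite_Sum.abs_summable_on_comparison_test')
 thus "f summable_on A" by (rule abs_summable_summable)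
qed

lemma infsum_norm_bound:
 fixes f :: "'i => 'b :: banach" and M :: "'i => real"
 assumes "M summable_on A" "!!n. n \<in> A ==> norm (f n) <= M n"
 shows "norm (infsum f A) <= infsum M A"
proof -
 have "norm (infsum f A) <= infsum (%n. norm (f n)) A"
  by (rule norm_infsum_bound) (rule summable_on_norm_bound[OF assms])
 also have "... <= infsum M A"
  by (rule infsum_mono) (use assms summable_on_norm_bound(2)[OF assms] in auto)
 finally show ?thesis .
qed

text \<open>Local domination gives locally uniform convergence of the net of finite partial sums, so
  Weierstrass' theorem yields holomorphy and termwise differentiation at once.\<close>

lemma
 fixes f :: "'i => complex => complex"
 assumes S: "open S" and hol: "!!n. n \<in> I ==> f n holomorphic_on S"
  and M: "!!z. z \<in> S ==> EX r>0. EX M. cball z r <= S & M summable_on I & (ALL n:I. ALL w:cball z r. norm (f n w) <= (M n :: real))"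
 shows holomorphic_infsum: "(%z. infsum (%n. f n z) I) holomorphic_on S"
  and has_sum_deriv: "z \<in> S ==> ((%n. deriv (f n) z) has_sum deriv (%z. infsum (%n. f n z) I) z) I"
proof -
 let ?g = "%z. infsum (%n. f n z) I"
 have main: "EX g'. (?g has_field_derivative g') (at z) & ((%n. deriv (f n) z) has_sum g') I" if z: "z \<in> S" for z
 proof -
  obtain r M where r: "r > 0" "cball z r <= S" "M summable_on I" "!!n w. n \<in> I ==> w \<in> cball z r ==> norm (f n w) <= M n"
   using M[OF z] by blast
  have ul: "uniform_limit (cball z r) (%X y. \<Sum>n\<in>X. f n y) ?g (finite_subsets_at_top I)"
   by (rule Weierstrass_m_test_general[OF r(4,3)]) auto
  have cont: "\<forall>\<^sub>F X in finite_subsets_at_top I. continuous_on (cball z r) (%y. \<Sum>n\<in>X. f n y) &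
   (ALL w:ball z r. ((%y. \<Sum>n\<in>X. f n y) has_field_derivative (\<Sum>n\<in>X. deriv (f n) w)) (at w))"
   unfolding eventually_finite_subsets_at_top
  proof (intro exI[of _ "{}"] conjI allI impI ballI; (simp; fail)?)
   fix Y assume Y: "finite Y & {} <= Y & Y <= I"
   show "continuous_on (cball z r) (%y. \<Sum>n\<in>Y. f n y)"
    using Y hol r(2) by (intro continuous_on_sum holomorphic_on_imp_continuous_on) (blast intro: holomorphic_on_subset)
   fix w assume w: "w \<in> ball z r"
   hence "w \<in> S" using r(2) by auto
   show "((%y. \<Sum>n\<in>Y. f n y) has_field_derivative (\<Sum>n\<in>Y. deriv (f n) w)) (at w)"
   proof (rule DERIV_sum)
    fix n assume "n \<in> Y"
    hence "f n holomorphic_on S" using Y hol by auto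
    thus "(f n has_field_derivative deriv (f n) w) (at w)"
     using holomorphic_derivI[OF _ S \<open>w \<in> S\<close>] by blast
   qed
  qed
  obtain g' where g': "!!w. w \<in> ball z r ==> (?g has_field_derivative g' w) (at w) &
    ((%X. \<Sum>n\<in>X. deriv (f n) w) ---> g' w) (finite_subsets_at_top I)"
   using has_complex_derivative_uniform_limit[OF cont ul _ r(1)] by auto
  thus ?thesis using r(1) unfolding has_sum_def by (intro exI[of _ "g' z"]) auto
 qed
 show "?g holomorphic_on S"
  unfolding holomorphic_on_open[OF S] using main by blast
 show "z \<in> S ==> ((%n. deriv (f n) z) has_sum deriv ?g z) I"
  using main[of z] DERIV_imp_deriv by blast
qed

section \<open>A Liouville theorem for quasi-periodic functions\<close>

text \<open>The weight exp (a (Im u)^2) makes the norm of f doubly periodic, hence bounded by its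
  maximum over one cell; f itself is then bounded and Liouville applies. For a > 0 the bound C exp
  (- a (Im u)^2) even tends to 0 along the imaginary axis, so that only the zero function remains.
  Working with norms makes factors of modulus 1 harmless.\<close>

lemma quasi_periodic_constant:
 fixes f :: "complex => complex" and \<omega> :: complex and a :: real
 assumes hol: "f holomorphic_on -P"
  and disc: "!!z. EX r>0. ALL p:P. p ~= z --> r <= dist p z"
  and res: "!!p. p \<in> P ==> ((%u. (u - p) * f u) ---> 0) (at p)"
  and P: "!!u. u + 1 \<in> P \<longleftrightarrow> u \<in> P" "!!u. u + \<omega> \<in> P \<longleftrightarrow> u \<in> P"
  and inv1: "!!u. u ~: P ==> norm (f (u + 1)) = norm (f u)"
  and inv2: "!!u. u ~: P ==> norm (f (u + \<omega>)) * exp (a * (Im (u + \<omega>))^2) = norm (f u) * exp (a * (Im u)^2)"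
  and \<omega>: "Im \<omega> > 0" and a: "a >= 0"
 shows "EX c. (ALL u. u ~: P --> f u = c) & (a > 0 --> c = 0)"
proof -
 have ext: "EX r>0. EX g. ball z r \<inter> P <= {z} & g holomorphic_on ball z r & (ALL u:ball z r - {z}. g u = f u)
  & (z ~: P --> g z = f z)" for z
 proof -
  obtain r where r: "r > 0" "!!p. p \<in> P ==> p ~= z ==> r <= dist p z" using disc by blast
  have sub: "ball z r \<inter> P <= {z}" using r(2) by (force simp: dist_commute)
  show ?thesis
  proof (cases "z \<in> P")
   case False
   hence "f holomorphic_on ball z r" using sub by (intro holomorphic_on_subset[OF hol]) auto
   thus ?thesis using r(1) sub by blast
  next
   case True
   have 1: "f holomorphic_on ball z r - {z}" using sub by (intro holomorphic_on_subset[OF hol]) auto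
   have 2: "z \<in> interior (ball z r)" using r(1) by simp
   have "EX g. g holomorphic_on ball z r & (ALL u:ball z r - {z}. g u = f u)"
    using holomorphic_on_extend_lim[OF 1 2] res[OF True] by simp
   thus ?thesis using r(1) sub True by blast
  qed
 qed
 \<comment> \<open>Filling the singularities by limits gives a single entire candidate; around each
   point it agrees with the locally defined removable extension.\<close>
 define g where "g = (%z. if z \<in> P then Lim (at z) f else f z)"
 have gball: "EX r>0. g holomorphic_on ball z r" for z
 proof -
  obtain r h where r: "r > 0" "ball z r \<inter> P <= {z}" "h holomorphic_on ball z r"
   "!!u. u \<in> ball z r - {z} ==> h u = f u" "z ~: P ==> h z = f z"
   using ext[of z] by blast
  have "h u = g u" if u: "u \<in> ball z r" for u
  proof (cases "u = z")
   case False
   thus ?thesis using r u by (auto simp: g_def)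
  next
   case True
   show ?thesis
   proof (cases "z \<in> P")
    case True
    have "isCont h z" using r(1,3) by (meson analytic_at analytic_at_imp_isCont centre_in_ball open_ball)
    hence "(h ---> h z) (at z)" by (simp add: isCont_def)
    hence "(f ---> h z) (at z)"
     by (rule Lim_transform_within_open[OF _ open_ball[of z r]]) (use r in auto)
    hence "Lim (at z) f = h z" by (intro tendsto_Lim) auto
    thus ?thesis using True \<open>u = z\<close> by (simp add: g_def)
   qed (use r \<open>u = z\<close> in \<open>auto simp: g_def\<close>)
  qed
  hence "g holomorphic_on ball z r" using r(3) holomorphic_cong by metis
  thus ?thesis using r(1) by blast
 qed
 have ghol: "g holomorphic_on UNIV"
 proof -
  have "g field_differentiable at z" for z
  proof -
   obtain r where "r > 0" "g holomorphic_on ball z r" using gball by blast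
   thus ?thesis by (meson centre_in_ball holomorphic_on_imp_differentiable_at open_ball)
  qed
  thus ?thesis by (simp add: holomorphic_on_def)
 qed
 hence gcont: "continuous_on A g" for A
  using holomorphic_on_imp_continuous_on continuous_on_subset by blast
 define h where "h = (%u. norm (g u) * exp (a * (Im u)^2))"
 \<comment> \<open>A rectangle serves as cell although \<omega> may be slanted: the height is
   reduced by multiples of \<omega>, and only then the real part by integers.\<close>
 define K where "K = cbox 0 (Complex 1 (Im \<omega>))"
 have "compact (h ` K)" unfolding h_def K_def
  by (intro compact_continuous_image continuous_intros gcont) auto
 then obtain C where C: "!!u. u \<in> K ==> norm (h u) <= C"
  using compact_imp_bounded bounded_iff by (metis imageI)
 have Pm: "u + of_int m \<in> P \<longleftrightarrow> u \<in> P" for u m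
 proof (induction m rule: int_induct[of _ 0])
  case (step1 i) thus ?case using P(1)[of "u + of_int i"] by (simp add: add_ac)
 next
  case (step2 i) thus ?case using P(1)[of "u + of_int (i - 1)"] by (simp add: add_ac)
 qed simp
 have Pw: "u + of_int m * \<omega> \<in> P \<longleftrightarrow> u \<in> P" for u m
 proof (induction m rule: int_induct[of _ 0])
  case (step1 i) thus ?case using P(2)[of "u + of_int i * \<omega>"] by (simp add: algebra_simps)
 next
  case (step2 i) thus ?case using P(2)[of "u + of_int (i - 1) * \<omega>"] by (simp add: algebra_simps)
 qed simp
 have h1: "h (u + of_int m) = h u" if "u ~: P" for u m
 proof (induction m rule: int_induct[of _ 0])
  case (step1 i) thus ?case using inv1[of "u + of_int i"] Pm[of u i] Pm[of u "i + 1"] that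
   by (simp add: h_def g_def add_ac)
 next
  case (step2 i) thus ?case using inv1[of "u + of_int (i - 1)"] Pm[of u i] Pm[of u "i - 1"] that
   by (simp add: h_def g_def add_ac)
 qed simp
 have h2: "h (u + of_int m * \<omega>) = h u" if "u ~: P" for u m
 proof (induction m rule: int_induct[of _ 0])
  case (step1 i)
  have "h ((u + of_int i * \<omega>) + \<omega>) = h (u + of_int i * \<omega>)"
   using inv2[of "u + of_int i * \<omega>"] Pw[of u i] P(2)[of "u + of_int i * \<omega>"] that
   by (simp add: h_def g_def)
  thus ?case using step1 by (simp add: algebra_simps)
 next
  case (step2 i)
  have "h ((u + of_int (i - 1) * \<omega>) + \<omega>) = h (u + of_int (i - 1) * \<omega>)"
   using inv2[of "u + of_int (i - 1) * \<omega>"] Pw[of u "i - 1"] P(2)[of "u + of_int (i - 1) * \<omega>"] that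
   by (simp add: h_def g_def)
  thus ?case using step2 by (simp add: algebra_simps)
 qed simp
 have hC: "h u <= C" if u: "u ~: P" for u
 proof -
  define n where "n = \<lfloor>Im u / Im \<omega>\<rfloor>"
  define v where "v = u + of_int (- n) * \<omega>"
  define m where "m = \<lfloor>Re v\<rfloor>"
  define w where "w = v + of_int (- m)"
  have "of_int n * Im \<omega> <= Im u" "Im u <= (of_int n + 1) * Im \<omega>"
   using \<omega> unfolding n_def by (simp_all add: floor_divide_lower floor_divide_upper less_imp_le)
  hence "Im v >= 0" "Im v <= Im \<omega>" by (auto simp: v_def algebra_simps)
  moreover have "Re w >= 0" "Re w <= 1" unfolding w_def m_def by (simp_all) linarith+
  ultimately have "w \<in> K" by (auto simp: K_def in_cbox_complex_iff w_def)
  hence "h w <= C" using C[of w] by (simp add: h_def)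
  moreover have "v ~: P" unfolding v_def using Pw u by blast
  hence "h w = h v" unfolding w_def by (rule h1)
  moreover have "h v = h u" unfolding v_def by (rule h2[OF u])
  ultimately show ?thesis by simp
 qed
 have gC: "norm (g u) <= C * exp (- a * (Im u)^2)" for u
 proof (cases "u \<in> P")
  case False
  thus ?thesis using hC[OF False] by (simp add: h_def exp_minus field_simps)
 next
  case True
  obtain r where r: "r > 0" "!!p. p \<in> P ==> p ~= u ==> r <= dist p u" using disc by blast
  have "continuous_on UNIV h" unfolding h_def by (intro continuous_intros gcont)
  hence "isCont h u" by (simp add: continuous_on_eq_continuous_at)
  hence "(h ---> h u) (at u)" by (simp add: isCont_def)
  moreover have "eventually (%v. h v <= C) (at u)"
   unfolding eventually_at using r hC by (intro exI[of _ r]) (metis not_le)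
  ultimately have "h u <= C" by (rule tendsto_upperbound) auto
  thus ?thesis by (simp add: h_def exp_minus field_simps)
 qed
 have "C >= 0"
 proof -
  have "0 \<in> K" using \<omega> by (auto simp: K_def in_cbox_complex_iff)
  thus ?thesis using C[of 0] norm_ge_zero order_trans by blast
 qed
 hence "norm (g u) <= C" for u
  using gC[of u] a by (smt (verit) exp_le_one_iff mult_left_le mult_minus_left mult_nonneg_nonneg zero_le_power2)
 hence "bounded (range g)" by (auto simp: bounded_iff)
 hence "g constant_on UNIV" using Liouville_theorem[OF ghol] by simp
 then obtain c where c: "!!u. g u = c" by (auto simp: constant_on_def)
 have "c = 0" if "a > 0"
 proof -
  have "((%y::real. C * exp (- a * y^2)) ---> 0) at_top" using that by real_asymp
  moreover have "norm c <= C * exp (- a * y^2)" for y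
   using gC[of "Complex 0 y"] c by simp
  ultimately have "norm c <= 0"
   by (intro tendsto_lowerbound[of _ 0 at_top]) auto
  thus ?thesis by simp
 qed
 thus ?thesis using c by (metis g_def)
qed

section \<open>Bilateral Lambert series and their poles\<close>

text \<open>Used in two roles: with the coefficients \<open>theta_coeff\<close> it is the partial
  fraction expansion of a reciprocal theta function, with the Gaussian coefficients
  \<open>app0\<close> and \<open>appc\<close> it is the numerator of an Appell function.\<close>

definition lambert :: "(int => complex) => complex => complex => complex" where
 "lambert a z w = (\<Sum>\<^sub>\<infinity>n. a n / (1 - w * ee (of_int n * z)))"

text \<open>On a fixed annulus the modulus of w ee (n z) is below 1/2 for large n and above 2 for
  very negative n, so only finitely many denominators can be small.\<close>

lemma lambert_denominator_bound:
 assumes z: "Im z > 0" and r: "0 < r" "r < R"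
 shows "EX F. finite F & (ALL n w. n ~: F --> r < norm w --> norm w < R --> 1/2 <= norm (1 - w * ee (of_int n * z)))"
proof -
 define y where "y = 2 * pi * Im z"
 have y: "y > 0" using z by (simp add: y_def)
 define N where "N = nat \<lceil>max (ln (2 * R)) (ln (2 / r)) / y\<rceil>"
 have "max (ln (2 * R)) (ln (2 / r)) <= real N * y"
  using y unfolding N_def by (metis of_nat_ceiling pos_divide_le_eq)
 hence N: "ln (2 * R) <= real N * y" "ln (2 / r) <= real N * y" by simp_all
 have "1/2 <= norm (1 - w * ee (of_int n * z))"
  if n: "n ~: {- int N..int N}" and w: "r < norm w" "norm w < R" for n w
 proof -
  have nm: "norm (ee (of_int n * z)) = exp (- (of_int n * y))" by (simp add: norm_ee y_def mult_ac)
  have tri: "1 - norm (w * ee (of_int n * z)) <= norm (1 - w * ee (of_int n * z))"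
   "norm (w * ee (of_int n * z)) - 1 <= norm (1 - w * ee (of_int n * z))"
   using norm_triangle_ineq2[of 1 "w * ee (of_int n * z)"]
    norm_triangle_ineq2[of "w * ee (of_int n * z)" 1] by (simp_all add: norm_minus_commute)
  consider "n > int N" | "n < - int N" using n by fastforce
  thus ?thesis
  proof cases
   case 1
   have "real N * y <= of_int n * y" using 1 y by (intro mult_right_mono) linarith+
   hence "- (of_int n * y) <= - ln (2 * R)" using N(1) by linarith
   hence "exp (- (of_int n * y)) <= exp (- ln (2 * R))" by (simp only: exp_le_cancel_iff)
   also have "... = 1 / (2 * R)" using r by (simp add: exp_minus field_simps)
   finally have "norm w * exp (- (of_int n * y)) <= R * (1 / (2 * R))"
    using w r by (intro mult_mono) auto
   hence "norm (w * ee (of_int n * z)) <= 1/2" using r by (simp add: norm_mult nm)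
   thus ?thesis using tri(1) by linarith
  next
   case 2
   have "real N * y <= of_int (- n) * y" using 2 y by (intro mult_right_mono) linarith+
   hence "ln (2 / r) <= - (of_int n * y)" using N(2) by simp
   hence "exp (ln (2 / r)) <= exp (- (of_int n * y))" by (simp only: exp_le_cancel_iff)
   hence "2 / r <= exp (- (of_int n * y))" using r by simp
   hence "r * (2 / r) <= norm w * exp (- (of_int n * y))" using w r by (intro mult_mono) auto
   hence "2 <= norm (w * ee (of_int n * z))" using r by (simp add: norm_mult nm)
   thus ?thesis using tri(2) by linarith
  qed
 qed
 thus ?thesis by (intro exI[of _ "{- int N..int N}"]) auto
qed

text \<open>Locally the series is a finite sum of simple fractions plus a holomorphic remainder;
  summability, holomorphy and residues are all read off from this.\<close>

lemma lambert_split: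
 assumes z: "Im z > 0" and a: "(%n. norm (a n)) summable_on UNIV" and r: "0 < r" "r < R"
 obtains F g where "finite F"
  "!!n w. n ~: F ==> r < norm w ==> norm w < R ==> 1/2 <= norm (1 - w * ee (of_int n * z))"
  "g holomorphic_on {w. r < norm w & norm w < R}"
  "!!w. r < norm w ==> norm w < R ==> (%n. a n / (1 - w * ee (of_int n * z))) summable_on UNIV"
  "!!w. r < norm w ==> norm w < R ==> lambert a z w = (\<Sum>n\<in>F. a n / (1 - w * ee (of_int n * z))) + g w"
proof -
 obtain F where F: "finite F" "!!n w. n ~: F ==> r < norm w ==> norm w < R ==> 1/2 <= norm (1 - w * ee (of_int n * z))"
  using lambert_denominator_bound[OF z r] by blast
 let ?S = "{w :: complex. r < norm w & norm w < R}"
 let ?t = "%n w. a n / (1 - w * ee (of_int n * z))"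
 have op: "open ?S" by (intro open_Collect_conj open_Collect_less continuous_intros)
 have bd: "norm (?t n w) <= 2 * norm (a n)" if "n \<in> -F" "w \<in> ?S" for n w
 proof -
  have "1/2 <= norm (1 - w * ee (of_int n * z))" using F(2) that by auto
  hence "norm (a n) / norm (1 - w * ee (of_int n * z)) <= norm (a n) / (1/2)"
   by (intro divide_left_mono) auto
  thus ?thesis by (simp add: norm_divide)
 qed
 have sm: "(%n. 2 * norm (a n)) summable_on -F"
  by (intro summable_on_cmult_right summable_on_subset_banach[OF a]) auto
 have s1: "(%n. ?t n w) summable_on -F" if "w \<in> ?S" for w
  by (rule summable_on_norm_bound[OF sm]) (use bd that in auto)
 have hol: "(%w. \<Sum>\<^sub>\<infinity>n\<in>-F. ?t n w) holomorphic_on ?S"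
 proof (rule holomorphic_infsum[OF op])
  fix n assume n: "n \<in> -F"
  show "?t n holomorphic_on ?S"
  proof (intro holomorphic_intros)
   fix w assume "w \<in> ?S"
   hence "1/2 <= norm (1 - w * ee (of_int n * z))" using F(2) n by auto
   thus "1 - w * ee (of_int n * z) ~= 0" by auto
  qed
 next
  fix x assume "x \<in> ?S"
  then obtain e where "e > 0" "cball x e <= ?S" using op open_contains_cball by metis
  thus "EX r'>0. EX M. cball x r' <= ?S & M summable_on -F & (ALL n:-F. ALL w:cball x r'. norm (?t n w) <= M n)"
   using sm bd by (intro exI[of _ e] exI[of _ "%n. 2 * norm (a n)"] conjI) auto
 qed
 have s2: "(%n. ?t n w) summable_on UNIV" "lambert a z w = (\<Sum>n\<in>F. ?t n w) + (\<Sum>\<^sub>\<infinity>n\<in>-F. ?t n w)" if "w \<in> ?S" for w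
 proof -
  have "((%n. ?t n w) has_sum ((\<Sum>n\<in>F. ?t n w) + (\<Sum>\<^sub>\<infinity>n\<in>-F. ?t n w))) (F \<union> -F)"
   by (rule has_sum_Un_disjoint) (use F(1) s1[OF that] in auto)
  hence "((%n. ?t n w) has_sum ((\<Sum>n\<in>F. ?t n w) + (\<Sum>\<^sub>\<infinity>n\<in>-F. ?t n w))) UNIV" by simp
  thus "(%n. ?t n w) summable_on UNIV" "lambert a z w = (\<Sum>n\<in>F. ?t n w) + (\<Sum>\<^sub>\<infinity>n\<in>-F. ?t n w)"
   unfolding lambert_def by (auto simp: summable_on_def infsumI)
 qed
 show thesis
  by (rule that[OF F(1) F(2) hol]) (use s2 in auto)
qed

lemma lambert_summable:
 assumes z: "Im z > 0" and a: "(%n. norm (a n)) summable_on UNIV" and w: "w ~= 0"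
 shows "(%n. a n / (1 - w * ee (of_int n * z))) summable_on UNIV"
proof -
 have "norm w > 0" using w by simp
 hence r: "0 < norm w / 2" "norm w / 2 < norm w + 1" "norm w / 2 < norm w" by linarith+
 show ?thesis by (rule lambert_split[OF z a r(1,2)]) (use r in auto)
qed

lemma lambert_holomorphic:
 assumes z: "Im z > 0" and a: "(%n. norm (a n)) summable_on UNIV"
 shows "lambert a z holomorphic_on {w. w ~= 0 & (ALL n. w * ee (of_int n * z) ~= 1)}"
 unfolding holomorphic_on_def
proof
 fix w assume w: "w \<in> {w. w ~= 0 & (ALL n. w * ee (of_int n * z) ~= 1)}"
 have "norm w > 0" using w by simp
 hence r: "0 < norm w / 2" "norm w / 2 < norm w + 1" "norm w / 2 < norm w" by linarith+
 obtain F g where F: "finite F"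
  "!!n v. n ~: F ==> norm w / 2 < norm v ==> norm v < norm w + 1 ==> 1/2 <= norm (1 - v * ee (of_int n * z))"
  "g holomorphic_on {v. norm w / 2 < norm v & norm v < norm w + 1}"
  "!!v. norm w / 2 < norm v ==> norm v < norm w + 1 ==> (%n. a n / (1 - v * ee (of_int n * z))) summable_on UNIV"
  "!!v. norm w / 2 < norm v ==> norm v < norm w + 1 ==> lambert a z v = (\<Sum>n\<in>F. a n / (1 - v * ee (of_int n * z))) + g v"
  by (rule lambert_split[OF z a r(1,2)]) (rule that; assumption)
 let ?A = "{v :: complex. norm w / 2 < norm v & norm v < norm w + 1}"
 let ?S = "?A - (%n. inverse (ee (of_int n * z))) ` F"
 have S: "open ?S"
  by (intro open_Diff finite_imp_closed finite_imageI F(1) open_Collect_conj open_Collect_less continuous_intros)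
 have "(%v. (\<Sum>n\<in>F. a n / (1 - v * ee (of_int n * z))) + g v) holomorphic_on ?S"
 proof (intro holomorphic_intros)
  show "g holomorphic_on ?S" by (rule holomorphic_on_subset[OF F(3)]) auto
  fix v n assume "v \<in> ?S" "n \<in> F"
  hence "v ~= inverse (ee (of_int n * z))" by blast
  thus "1 - v * ee (of_int n * z) ~= 0" by (simp add: field_simps)
 qed
 hence "lambert a z holomorphic_on ?S"
  by (rule holomorphic_transform) (use F(5) in auto)
 moreover have "w \<in> ?S" using w r by (auto simp: field_simps)
 ultimately have "lambert a z field_differentiable at w"
  using S holomorphic_on_imp_differentiable_at by blast
 thus "lambert a z field_differentiable at w within {w. w ~= 0 & (ALL n. w * ee (of_int n * z) ~= 1)}"
  by (rule field_differentiable_at_within)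
qed

lemma ee_int_mult_eq_1:
 assumes "Im z > 0" "ee (of_int n * z) = 1" shows "n = 0"
proof -
 have "norm (ee (of_int n * z)) = 1" using assms(2) by simp
 hence "of_int n * Im z = 0" by (simp add: norm_ee)
 thus ?thesis using assms(1) by simp
qed

lemma lambert_residue:
 assumes z: "Im z > 0" and a: "(%n. norm (a n)) summable_on UNIV"
 shows "((%w. (1 - w * ee (of_int n * z)) * lambert a z w) ---> a n) (at (ee (- (of_int n * z))))"
proof -
 let ?p = "ee (- (of_int n * z))"
 have p: "?p * ee (of_int n * z) = 1" by (simp flip: ee_add)
 have "norm ?p > 0" by simp
 hence r: "0 < norm ?p / 2" "norm ?p / 2 < norm ?p + 1" "norm ?p / 2 < norm ?p" by linarith+
 let ?A = "{v :: complex. norm ?p / 2 < norm v & norm v < norm ?p + 1}"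
 obtain F g where F: "finite F"
  "!!n v. n ~: F ==> norm ?p / 2 < norm v ==> norm v < norm ?p + 1 ==> 1/2 <= norm (1 - v * ee (of_int n * z))"
  "g holomorphic_on {v. norm ?p / 2 < norm v & norm v < norm ?p + 1}"
  "!!v. norm ?p / 2 < norm v ==> norm v < norm ?p + 1 ==> (%n. a n / (1 - v * ee (of_int n * z))) summable_on UNIV"
  "!!v. norm ?p / 2 < norm v ==> norm v < norm ?p + 1 ==> lambert a z v = (\<Sum>n\<in>F. a n / (1 - v * ee (of_int n * z))) + g v"
  by (rule lambert_split[OF z a r(1,2)]) (rule that; assumption)
 have op: "open ?A" by (intro open_Collect_conj open_Collect_less continuous_intros)
 have pA: "?p \<in> ?A" using r by simp
 have nF: "n \<in> F" using F(2)[of n ?p] p pA by fastforce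
 let ?h = "%w. a n + (1 - w * ee (of_int n * z)) * ((\<Sum>k\<in>F - {n}. a k / (1 - w * ee (of_int k * z))) + g w)"
 have "((%w. ?h w) ---> a n + (1 - ?p * ee (of_int n * z)) * ((\<Sum>k\<in>F - {n}. a k / (1 - ?p * ee (of_int k * z))) + g ?p)) (at ?p)"
 proof (intro tendsto_intros)
  show "(g ---> g ?p) (at ?p)"
   using F(3) op pA by (meson analytic_at analytic_at_imp_isCont isCont_def)
  fix k assume k: "k \<in> F - {n}"
  have "?p * ee (of_int k * z) = ee (of_int (k - n) * z)" by (simp add: algebra_simps flip: ee_add)
  thus "1 - ?p * ee (of_int k * z) ~= 0" using ee_int_mult_eq_1[OF z, of "k - n"] k by auto
 qed
 hence "(?h ---> a n) (at ?p)" using p by simp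
 thus ?thesis
 proof (rule Lim_transform_within_open[OF _ op pA])
  fix w assume w: "w \<in> ?A" "w ~= ?p"
  have "1 - w * ee (of_int n * z) ~= 0"
   using w(2) p by (metis ee_nonzero eq_iff_diff_eq_0 mult_right_cancel)
  moreover have "lambert a z w = a n / (1 - w * ee (of_int n * z)) + ((\<Sum>k\<in>F - {n}. a k / (1 - w * ee (of_int k * z))) + g w)"
   using F(5)[of w] w(1) sum.remove[OF F(1) nF, of "%k. a k / (1 - w * ee (of_int k * z))"] by simp
  ultimately show "?h w = (1 - w * ee (of_int n * z)) * lambert a z w"
   by (simp add: distrib_left)
 qed
qed

lemma ee_pole_factor: "((%u. (u - p) / (1 - ee (u - p))) ---> - 1 / (2 * of_real pi * \<i>)) (at p)"
proof -
 have "((%u. ee (u - p)) has_field_derivative 2 * of_real pi * \<i>) (at p)"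
  by (auto intro!: derivative_eq_intros)
 hence "((%u. (ee (u - p) - 1) / (u - p)) ---> 2 * of_real pi * \<i>) (at p)"
  by (simp add: has_field_derivative_iff)
 hence "((%u. - inverse ((ee (u - p) - 1) / (u - p))) ---> - inverse (2 * of_real pi * \<i>)) (at p)"
  by (intro tendsto_intros) auto
 moreover have "- inverse ((ee (u - p) - 1) / (u - p)) = (u - p) / (1 - ee (u - p))" for u
  by (simp add: divide_simps) (simp add: algebra_simps)
 ultimately show ?thesis by (simp add: inverse_eq_divide)
qed

text \<open>Passing from w to u with w = ee u multiplies the residue by the limit in
  \<open>ee_pole_factor\<close>. The values of ee near p differ from ee p because two solutions of
  ee u = ee p differ by an integer.\<close>

lemma lambert_ee_residue:
 assumes z: "Im z > 0" and a: "(%n. norm (a n)) summable_on UNIV" and p: "p = of_int m * z + of_int j"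
 shows "((%u. (u - p) * lambert a z (ee u)) ---> - a (- m) / (2 * of_real pi * \<i>)) (at p)"
proof -
 have ep: "ee p = ee (- (of_int (- m) * z))" by (simp add: p)
 have ev: "eventually (%u. ee u ~= ee p) (at p)"
  unfolding eventually_at
 proof (intro exI[of _ 1] conjI ballI impI; (simp; fail)?)
  fix u assume u: "u ~= p & dist u p < 1"
  show "ee u ~= ee p"
  proof
   assume "ee u = ee p"
   then obtain n where n: "u - p = of_int n" using ee_eq_iff by blast
   hence "(abs (real_of_int n)) < 1" using u by (simp add: dist_norm)
   hence "n = 0" by linarith
   thus False using n u by simp
  qed
 qed
 have "filterlim ee (at (ee p)) (at p)"
  unfolding filterlim_at using ev isCont_ee[of p] by (auto simp: isCont_def)
 from filterlim_compose[OF lambert_residue[OF z a, of "-m", folded ep] this]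
 have 1: "((%u. (1 - ee u * ee (of_int (- m) * z)) * lambert a z (ee u)) ---> a (- m)) (at p)" .
 have 2: "ee u * ee (of_int (- m) * z) = ee (u - p)" for u
 proof -
  have "ee u * ee (of_int (- m) * z) = ee (u + of_int (- m) * z)" by (simp only: ee_add)
  also have "... = ee (u - p)" by (rule ee_eqI[of _ _ j]) (simp add: p)
  finally show ?thesis .
 qed
 have "((%u. ((u - p) / (1 - ee (u - p))) * ((1 - ee (u - p)) * lambert a z (ee u))) ---> - 1 / (2 * of_real pi * \<i>) * a (- m)) (at p)"
  using tendsto_mult[OF ee_pole_factor 1[unfolded 2]] .
 moreover have "eventually (%u. ((u - p) / (1 - ee (u - p))) * ((1 - ee (u - p)) * lambert a z (ee u)) = (u - p) * lambert a z (ee u)) (at p)"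
  using ev
 proof eventually_elim
  case (elim u)
  hence "1 - ee (u - p) ~= 0" by (simp add: ee_diff)
  thus ?case by simp
 qed
 ultimately show ?thesis by (simp add: tendsto_cong)
qed

text \<open>The denominator N covers all pole sets that occur: N = 1 for theta functions and single
  Appell functions, N = l for the sieved ones. Discreteness holds because a unit ball confines both
  coordinates m and j.\<close>

lemma lattice_discrete:
 fixes z c :: complex and N :: nat
 assumes z: "Im z > 0" and N: "N > 0"
 shows "EX r>0. ALL p:{p. EX m j :: int. p = c + of_int m * z + of_int j / of_nat N}. p ~= x --> r <= dist p x"
proof -
 let ?P = "{p. EX m j :: int. p = c + of_int m * z + of_int j / of_nat N}"
 define M where "M = nat \<lceil>(1 + (abs (Im x - Im c))) / Im z\<rceil>"
 define J where "J = nat \<lceil>real N * (1 + (abs (Re x - Re c)) + real M * (abs (Re z)))\<rceil>"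
 have "?P \<inter> ball x 1 <= (%(m, j). c + of_int m * z + of_int j / of_nat N) ` ({- int M..int M} \<times> {- int J..int J})"
 proof
  fix p assume "p \<in> ?P \<inter> ball x 1"
  then obtain m j where p: "p = c + of_int m * z + of_int j / of_nat N" "dist x p < 1" by auto
  have d: "(abs (Im p - Im x)) < 1" "(abs (Re p - Re x)) < 1"
   using p(2) abs_Im_le_cmod[of "p - x"] abs_Re_le_cmod[of "p - x"] by (auto simp: dist_norm norm_minus_commute)
  have im: "Im p = Im c + of_int m * Im z" by (simp add: p(1))
  have re: "Re p = Re c + of_int m * Re z + of_int j / real N" by (simp add: p(1))
  have "(abs (of_int m * Im z)) <= 1 + (abs (Im x - Im c))" using d(1) im by linarith
  hence "(abs (of_int m)) * Im z <= 1 + (abs (Im x - Im c))" using z by (simp add: abs_mult)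
  hence "(abs (real_of_int m)) <= (1 + (abs (Im x - Im c))) / Im z" using z by (simp add: field_simps)
  also have "... <= real M" unfolding M_def by linarith
  finally have m: "(abs (real_of_int m)) <= real M" .
  have "(abs (of_int m * Re z)) <= real M * (abs (Re z))"
   unfolding abs_mult by (intro mult_right_mono m) auto
  hence "(abs (of_int j / real N)) <= 1 + (abs (Re x - Re c)) + real M * (abs (Re z))"
   using d(2) re by linarith
  hence "(abs (real_of_int j)) <= real N * (1 + (abs (Re x - Re c)) + real M * (abs (Re z)))"
   using N by (simp add: field_simps)
  also have "... <= real J" unfolding J_def by linarith
  finally have "(abs (real_of_int j)) <= real J" .
  hence "m \<in> {- int M..int M}" "j \<in> {- int J..int J}" using m by (auto simp: abs_le_iff)
  thus "p \<in> (%(m, j). c + of_int m * z + of_int j / of_nat N) ` ({- int M..int M} \<times> {- int J..int J})"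
   using p(1) by (intro image_eqI[of _ _ "(m, j)"]) auto
 qed
 hence "finite (?P \<inter> ball x 1)" by (rule finite_subset) auto
 then obtain d where d: "d > 0" "!!p. p \<in> ?P \<inter> ball x 1 ==> p ~= x ==> d <= dist x p"
  using finite_set_avoid[of "?P \<inter> ball x 1" x] by blast
 show ?thesis
 proof (intro exI[of _ "min 1 d"] conjI ballI impI)
  fix p assume "p \<in> ?P" "p ~= x"
  thus "min 1 d <= dist p x" using d(2)[of p] by (cases "dist x p < 1") (auto simp: dist_commute)
 qed (use d in auto)
qed

section \<open>Tail estimates and families of theta series\<close>

definition int_tail :: real where "int_tail = (\<Sum>\<^sub>\<infinity>n::int. (1/2) ^ nat (abs n))"

text \<open>One factor r is split off before the remaining power is compared with a power of 1/2;
  the error of keeping only the term n = 0 is thus proportional to r itself.\<close>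

lemma infsum_tail_bound:
 fixes f :: "int => complex"
 assumes f: "!!n. n ~= 0 ==> norm (f n) <= c * r ^ nat (abs n)" and r: "0 <= r" "r <= 1/2" and c: "c >= 0"
 shows "f summable_on UNIV" "norm (infsum f UNIV - f 0) <= 2 * c * r * int_tail"
proof -
 let ?M = "%n::int. 2 * c * r * (1/2) ^ nat (abs n)"
 have sM: "?M summable_on UNIV" by (intro summable_on_cmult_right summable_int_geometric) auto
 have b: "norm (f n) <= ?M n" if n0: "n ~= 0" for n
 proof -
  obtain k where k: "nat (abs n) = Suc k" using n0 by (cases "nat (abs n)") auto
  have "norm (f n) <= c * r ^ nat (abs n)" by (rule f[OF n0])
  also have "... = c * r * r ^ k" by (simp add: k)
  also have "... <= c * r * (1/2) ^ k" using r c by (intro mult_left_mono power_mono) auto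
  also have "... = ?M n" by (simp add: k)
  finally show ?thesis .
 qed
 have sM': "?M summable_on (UNIV - {0})" by (rule summable_on_subset_banach[OF sM]) auto
 have s: "f summable_on (UNIV - {0})"
  by (rule summable_on_norm_bound(1)[OF sM']) (use b in auto)
 have hs: "(f has_sum (f 0 + infsum f (UNIV - {0}))) ({0} \<union> (UNIV - {0}))"
  by (rule has_sum_Un_disjoint) (use s in \<open>auto intro: has_sum_finiteI\<close>)
 thus "f summable_on UNIV" by (auto simp: summable_on_def)
 have "infsum f UNIV - f 0 = infsum f (UNIV - {0})" using infsumI[OF hs] by simp
 also have "norm ... <= infsum ?M (UNIV - {0})" by (rule infsum_norm_bound[OF sM']) (use b in auto)
 also have "... <= infsum ?M UNIV" by (rule infsum_mono2[OF sM' sM]) (use r c in auto)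
 also have "... = 2 * c * r * int_tail" unfolding int_tail_def by (rule infsum_cmult_right) (intro summable_int_geometric, auto)
 finally show "norm (infsum f UNIV - f 0) <= 2 * c * r * int_tail" .
qed

lemma has_sum_higher_deriv:
 fixes f :: "'i => complex => complex"
 assumes S: "open S" and hol: "!!n. n \<in> I ==> f n holomorphic_on S" and z: "z \<in> S"
  and M: "!!n w. n \<in> I ==> w \<in> S ==> norm (f n w) <= (M n :: real)" "M summable_on I"
 shows "((%n. (deriv ^^ k) (f n) z) has_sum (deriv ^^ k) (%z. infsum (%n. f n z) I) z) I"
proof -
 have fin: "(%y. \<Sum>n\<in>X. f n y) holomorphic_on S & (deriv ^^ k) (%y. \<Sum>n\<in>X. f n y) z = (\<Sum>n\<in>X. (deriv ^^ k) (f n) z)"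
  if "finite X" "X <= I" for X
  using that
 proof (induction X rule: finite_induct)
  case empty
  show ?case by (cases k) (auto simp del: funpow.simps simp: higher_deriv_const)
 next
  case (insert x F)
  have 1: "f x holomorphic_on S" using hol insert by auto
  have 2: "(%y. \<Sum>n\<in>F. f n y) holomorphic_on S" "(deriv ^^ k) (%y. \<Sum>n\<in>F. f n y) z = (\<Sum>n\<in>F. (deriv ^^ k) (f n) z)"
   using insert by auto
  show ?case using insert(1,2) 1 2 higher_deriv_add[OF 1 2(1) S z, of k]
   by (auto intro!: holomorphic_intros)
 qed
 have ul: "uniform_limit S (%X y. \<Sum>n\<in>X. f n y) (%z. infsum (%n. f n z) I) (finite_subsets_at_top I)"
  by (rule Weierstrass_m_test_general[OF M]) auto
 have "((%X. (deriv ^^ k) (%y. \<Sum>n\<in>X. f n y) z) ---> (deriv ^^ k) (%z. infsum (%n. f n z) I) z) (finite_subsets_at_top I)"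
  by (rule higher_deriv_complex_uniform_limit[OF ul _ _ S z])
   (use fin in \<open>auto simp: eventually_finite_subsets_at_top intro!: exI[of _ "{}"]\<close>)
 moreover have "eventually (%X. (deriv ^^ k) (%y. \<Sum>n\<in>X. f n y) z = (\<Sum>n\<in>X. (deriv ^^ k) (f n) z)) (finite_subsets_at_top I)"
  using fin by (auto simp: eventually_finite_subsets_at_top intro!: exI[of _ "{}"])
 ultimately show ?thesis unfolding has_sum_def by (simp add: tendsto_cong)
qed

lemma theta_dominated:
 fixes P Q R :: "complex => complex"
 assumes K: "compact K" and c: "continuous_on K P" "continuous_on K Q" "continuous_on K R"
  and P: "!!z. z \<in> K ==> Im (P z) > 0"
 shows "EX M. M summable_on (UNIV :: int set) &
  (ALL n. ALL z:K. norm (ee ((of_int n)^2 * P z + of_int n * Q z + R z)) <= (M n :: real))"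
proof (cases "K = {}")
 case False
 have c': "continuous_on K (%z. Im (P z))" "continuous_on K (%z. (abs (Im (Q z))))" "continuous_on K (%z. (abs (Im (R z))))"
  by (intro continuous_intros c)+
 obtain z0 where z0: "z0 \<in> K" "!!z. z \<in> K ==> Im (P z0) <= Im (P z)"
  using continuous_attains_inf[OF K False c'(1)] by blast
 obtain z1 where z1: "z1 \<in> K" "!!z. z \<in> K ==> (abs (Im (Q z))) <= (abs (Im (Q z1)))"
  using continuous_attains_sup[OF K False c'(2)] by blast
 obtain z2 where z2: "z2 \<in> K" "!!z. z \<in> K ==> (abs (Im (R z))) <= (abs (Im (R z2)))"
  using continuous_attains_sup[OF K False c'(3)] by blast
 define a where "a = 2 * pi * Im (P z0)"
 define b where "b = 2 * pi * (abs (Im (Q z1)))"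
 define d where "d = 2 * pi * (abs (Im (R z2)))"
 have a: "a > 0" using P[OF z0(1)] by (simp add: a_def)
 let ?M = "%n::int. exp d * exp (- a * (of_int n)^2 + b * (abs (of_int n)))"
 have "?M summable_on UNIV" by (intro summable_on_cmult_right summable_int_gaussian a)
 moreover have "norm (ee ((of_int n)^2 * P z + of_int n * Q z + R z)) <= ?M n" if z: "z \<in> K" for n z
 proof -
  have 1: "(of_int n)\<^sup>2 * Im (P z) >= (of_int n)^2 * Im (P z0)" using z0(2)[OF z] by (intro mult_left_mono) auto
  have "(abs (of_int n * Im (Q z))) <= (abs (of_int n)) * (abs (Im (Q z1)))" unfolding abs_mult
   using z1(2)[OF z] by (intro mult_left_mono) auto
  hence 2: "of_int n * Im (Q z) >= - ((abs (of_int n)) * (abs (Im (Q z1))))" by linarith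
  have 3: "Im (R z) >= - (abs (Im (R z2)))" using z2(2)[OF z] by linarith
  have "Im ((of_int n)^2 * P z + of_int n * Q z + R z) = (of_int n)^2 * Im (P z) + of_int n * Im (Q z) + Im (R z)"
   by (simp add: power2_eq_square)
  also have "... >= (of_int n)^2 * Im (P z0) - ((abs (of_int n)) * (abs (Im (Q z1)))) - (abs (Im (R z2)))"
   using 1 2 3 by linarith
  finally have "2 * pi * ((of_int n)^2 * Im (P z0) - ((abs (of_int n)) * (abs (Im (Q z1)))) - (abs (Im (R z2))))
   <= 2 * pi * Im ((of_int n)^2 * P z + of_int n * Q z + R z)" by (intro mult_left_mono) auto
  hence "- 2 * pi * Im ((of_int n)^2 * P z + of_int n * Q z + R z) <= d + (- a * (of_int n)^2 + b * (abs (of_int n)))"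
   unfolding a_def b_def d_def by (simp add: algebra_simps)
  thus ?thesis unfolding norm_ee by (simp only: exp_add[symmetric] exp_le_cancel_iff)
 qed
 ultimately show ?thesis by blast
qed (auto intro: exI[of _ "%_. 0"])

text \<open>One statement for all theta series in use: P, Q and R may vary with the elliptic
  variable, with the modulus, or with both, as for B = z / 2 + b.\<close>

lemma
 fixes P Q R :: "complex => complex"
 assumes S: "open S" and h: "P holomorphic_on S" "Q holomorphic_on S" "R holomorphic_on S"
  and P: "!!z. z \<in> S ==> Im (P z) > 0"
 defines "T \<equiv> %(n::int) z. ee ((of_int n)^2 * P z + of_int n * Q z + R z)"
 shows theta_family_holomorphic: "(%z. \<Sum>\<^sub>\<infinity>n. T n z) holomorphic_on S"
  and theta_family_deriv: "z \<in> S ==> ((%n. (deriv ^^ k) (T n) z) has_sum (deriv ^^ k) (%z. \<Sum>\<^sub>\<infinity>n. T n z) z) UNIV"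
  and theta_family_summable: "z \<in> S ==> (%n. norm (T n z)) summable_on UNIV"
proof -
 have dom: "EX r>0. EX M. cball z r <= S & M summable_on UNIV & (ALL n:UNIV. ALL w:cball z r. norm (T n w) <= M n)" if z: "z \<in> S" for z
 proof -
  obtain r where r: "r > 0" "cball z r <= S" using S z open_contains_cball by metis
  have "continuous_on (cball z r) P" "continuous_on (cball z r) Q" "continuous_on (cball z r) R"
   using h r(2) by (meson holomorphic_on_imp_continuous_on holomorphic_on_subset)+
  moreover have "!!w. w \<in> cball z r ==> Im (P w) > 0" using P r(2) by auto
  ultimately show ?thesis using theta_dominated[OF compact_cball, of z r P Q R] r unfolding T_def by (intro exI[of _ r]) simp
 qed
 have hol: "T n holomorphic_on S" for n unfolding T_def by (intro holomorphic_intros h)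
 show "(%z. \<Sum>\<^sub>\<infinity>n. T n z) holomorphic_on S"
  by (rule holomorphic_infsum[OF S hol dom])
 show "((%n. (deriv ^^ k) (T n) z) has_sum (deriv ^^ k) (%z. \<Sum>\<^sub>\<infinity>n. T n z) z) UNIV" if z: "z \<in> S"
 proof -
  obtain r M where "r > 0" "cball z r <= S" "M summable_on UNIV" "ALL n:UNIV. ALL w:cball z r. norm (T n w) <= M n"
   using dom[OF z] by blast
  moreover from this have "T n holomorphic_on ball z r" for n
   by (intro holomorphic_on_subset[OF hol]) (meson ball_subset_cball order_trans)
  ultimately show ?thesis
   by (intro has_sum_higher_deriv[of "ball z r" UNIV T z M]) auto
 qed
 show "(%n. norm (T n z)) summable_on UNIV" if z: "z \<in> S"
 proof -
  obtain r M where "r > 0" "M summable_on UNIV" "ALL n:UNIV. ALL w:cball z r. norm (T n w) <= M n"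
   using dom[OF z] by blast
  thus ?thesis by (intro summable_on_norm_bound(2)[of M]) auto
 qed
qed

section \<open>The Jacobi theta function\<close>

text \<open>Jacobi's theta function of modulus 2 A. Keeping the quadratic and the linear coefficient
  as two free variables gives the heat equation in its simplest form and makes shifts of A by 1/2 or
  1 transparent.\<close>

definition gtheta :: "complex => complex => complex" where
 "gtheta A B = (\<Sum>\<^sub>\<infinity>n::int. ee ((of_int n)^2 * A + of_int n * B))"

lemma gtheta_summable:
 assumes "Im A > 0"
 shows "(%n::int. norm (ee ((of_int n)^2 * A + of_int n * B))) summable_on UNIV"
  "(%n::int. ee ((of_int n)^2 * A + of_int n * B)) summable_on UNIV"
proof -
 show 1: "(%n::int. norm (ee ((of_int n)^2 * A + of_int n * B))) summable_on UNIV"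
  using theta_family_summable[of UNIV "%_. A" "%_. B" "%_. 0" 0] assms by simp
 show "(%n::int. ee ((of_int n)^2 * A + of_int n * B)) summable_on UNIV"
  by (rule abs_summable_summable[OF 1])
qed

lemma gtheta_holomorphic_snd:
 assumes "Im A > 0" shows "gtheta A holomorphic_on UNIV"
proof -
 have "(%B. \<Sum>\<^sub>\<infinity>n::int. ee ((of_int n)^2 * A + of_int n * B + 0)) holomorphic_on UNIV"
  by (rule theta_family_holomorphic[of UNIV "%_. A" "%B. B" "%_. 0"]) (use assms in \<open>auto intro: holomorphic_intros\<close>)
 thus ?thesis unfolding gtheta_def[abs_def] add_0_right .
qed

lemma gtheta_holomorphic_fst: "(%A. gtheta A B) holomorphic_on {A. Im A > 0}"
proof -
 have "(%A. \<Sum>\<^sub>\<infinity>n::int. ee ((of_int n)^2 * A + of_int n * B + 0)) holomorphic_on {A. Im A > 0}"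
  by (rule theta_family_holomorphic[of _ "%A. A" "%_. B" "%_. 0"])
   (auto intro: holomorphic_intros simp: open_halfspace_Im_gt)
 thus ?thesis unfolding gtheta_def[abs_def] add_0_right .
qed

lemma bij_int_shift: "bij (%n::int. n + k)"
 by (rule bij_betwI[where g = "%n. n - k"]) simp_all

lemma bij_int_reflect: "bij (%n::int. k - n)"
 by (rule bij_betwI[where g = "%n. k - n"]) simp_all

lemma infsum_int_shift: "(\<Sum>\<^sub>\<infinity>n::int. f (n + k)) = (\<Sum>\<^sub>\<infinity>n. f n)"
 by (rule infsum_reindex_bij_betw[OF bij_int_shift])

lemma infsum_int_reflect: "(\<Sum>\<^sub>\<infinity>n::int. f (k - n)) = (\<Sum>\<^sub>\<infinity>n. f n)"
 by (rule infsum_reindex_bij_betw[OF bij_int_reflect])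

lemma gtheta_add_1: "gtheta A (B + 1) = gtheta A B"
 unfolding gtheta_def
proof (intro infsum_cong)
 fix n :: int
 show "ee ((of_int n)^2 * A + of_int n * (B + 1)) = ee ((of_int n)^2 * A + of_int n * B)"
  by (rule ee_eqI[of _ _ n]) (simp add: algebra_simps)
qed

lemma gtheta_minus: "gtheta A (- B) = gtheta A B"
proof -
 have "gtheta A (- B) = (\<Sum>\<^sub>\<infinity>n::int. ee ((of_int (0 - n))^2 * A + of_int (0 - n) * B))"
  unfolding gtheta_def by (intro infsum_cong) simp
 also have "... = gtheta A B"
  unfolding gtheta_def by (rule infsum_int_reflect[where k = 0 and f = "%n. ee ((of_int n)^2 * A + of_int n * B)"])
 finally show ?thesis .
qed

lemma gtheta_quasi_period: "gtheta A (B + 2 * A) = ee (- A - B) * gtheta A B"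
proof -
 have "gtheta A (B + 2 * A) = (\<Sum>\<^sub>\<infinity>n::int. ee (- A - B) * ee ((of_int (n + 1))^2 * A + of_int (n + 1) * B))"
  unfolding gtheta_def
  by (intro infsum_cong, subst ee_add[symmetric]) (simp add: algebra_simps power2_eq_square)
 also have "... = ee (- A - B) * (\<Sum>\<^sub>\<infinity>n::int. ee ((of_int (n + 1))^2 * A + of_int (n + 1) * B))"
  by (rule infsum_cmult_right')
 also have "... = ee (- A - B) * gtheta A B"
  unfolding gtheta_def by (subst infsum_int_shift[where f = "%n. ee ((of_int n)^2 * A + of_int n * B)" and k = 1]) simp
 finally show ?thesis .
qed

lemma gtheta_fst_add_1: "gtheta (A + 1) B = gtheta A B"
proof -
 have "ee ((of_int n)^2 * (A + 1) + of_int n * B) = ee ((of_int n)^2 * A + of_int n * B)" for n :: int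
  by (rule ee_eqI[of _ _ "n\<^sup>2"]) (simp add: algebra_simps)
 thus ?thesis by (simp add: gtheta_def)
qed

lemma gtheta_fst_add_half: "gtheta (A + 1/2) B = gtheta A (B + 1/2)"
proof -
 have "ee ((of_int n)^2 * (A + 1/2) + of_int n * B) = ee ((of_int n)^2 * A + of_int n * (B + 1/2))" for n :: int
 proof -
  have "even (n * (n - 1))" by auto
  then obtain k where k: "n * (n - 1) = 2 * k" by (blast elim: evenE)
  hence k': "(of_int n :: complex) * (of_int n - 1) = 2 * of_int k"
   by (metis of_int_1 of_int_diff of_int_mult of_int_numeral)
  show ?thesis by (rule ee_eqI[of _ _ k]) (use k' in \<open>simp add: field_simps power2_eq_square\<close>)
 qed
 thus ?thesis by (simp add: gtheta_def)
qed

text \<open>The reflection of n to -1 - n changes the sign of every term.\<close>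

lemma gtheta_zero: "gtheta A (A + 1/2) = 0"
proof -
 have "ee ((of_int (- 1 - n))^2 * A + of_int (- 1 - n) * (A + 1/2)) = - ee ((of_int n)^2 * A + of_int n * (A + 1/2))" for n :: int
 proof -
  have "- ee ((of_int n)^2 * A + of_int n * (A + 1/2)) = ee ((of_int n)^2 * A + of_int n * (A + 1/2) + 1/2)"
   by (simp add: ee_add ee_half del: One_nat_def)
  also have "... = ee ((of_int (- 1 - n))^2 * A + of_int (- 1 - n) * (A + 1/2))"
   by (rule ee_eqI[of _ _ "n + 1"]) (simp add: field_simps power2_eq_square)
  finally show ?thesis by simp
 qed
 hence "gtheta A (A + 1/2) = (\<Sum>\<^sub>\<infinity>n::int. - ee ((of_int n)^2 * A + of_int n * (A + 1/2)))"
  unfolding gtheta_def by (subst infsum_int_reflect[where k = "-1", symmetric]) simp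
 also have "... = - gtheta A (A + 1/2)" unfolding gtheta_def by (rule infsum_uminus)
 finally show ?thesis by simp
qed

lemma has_sum_int_parity:
 fixes f :: "int => complex"
 assumes "f summable_on UNIV"
 shows "(\<Sum>\<^sub>\<infinity>n. f n) = (\<Sum>\<^sub>\<infinity>n. f (2 * n)) + (\<Sum>\<^sub>\<infinity>n. f (2 * n + 1))"
proof -
 have i: "inj (%n::int. 2 * n)" "inj (%n::int. 2 * n + 1)" by (auto simp: inj_def)
 have s: "f summable_on range (%n. 2 * n)" "f summable_on range (%n. 2 * n + 1)"
  using summable_on_subset_banach[OF assms] by auto
 have "range (%n::int. 2 * n) \<inter> range (%n. 2 * n + 1) = {}" by (auto, presburger)
 hence "infsum f (range (%n. 2 * n) \<union> range (%n. 2 * n + 1)) = infsum f (range (%n. 2 * n)) + infsum f (range (%n. 2 * n + 1))"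
  by (rule infsum_Un_disjoint[OF s])
 also have "range (%n::int. 2 * n) \<union> range (%n. 2 * n + 1) = UNIV"
 proof (intro equalityI subsetI UNIV_I)
  fix n :: int show "n \<in> range (%n::int. 2 * n) \<union> range (%n. 2 * n + 1)"
   by (cases "even n") (auto elim!: evenE oddE)
 qed
 finally show ?thesis by (simp add: infsum_reindex[OF i(1)] infsum_reindex[OF i(2)] o_def)
qed

text \<open>Needed in two places: for quadrupling A in the proof that theta does not vanish
  identically, and for returning from modulus z / 4 to z after an inversion.\<close>

lemma gtheta_parity:
 assumes "Im A > 0"
 shows "gtheta A B = gtheta (4 * A) (2 * B) + ee (A + B) * gtheta (4 * A) (2 * B + 4 * A)"
proof -
 have "gtheta A B = (\<Sum>\<^sub>\<infinity>n::int. ee ((of_int (2 * n))^2 * A + of_int (2 * n) * B))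
  + (\<Sum>\<^sub>\<infinity>n::int. ee ((of_int (2 * n + 1))^2 * A + of_int (2 * n + 1) * B))"
  unfolding gtheta_def by (rule has_sum_int_parity[OF gtheta_summable(2)[OF assms]])
 also have "(\<Sum>\<^sub>\<infinity>n::int. ee ((of_int (2 * n))^2 * A + of_int (2 * n) * B)) = gtheta (4 * A) (2 * B)"
  unfolding gtheta_def by (intro infsum_cong) (simp add: algebra_simps power2_eq_square)
 also have "(\<Sum>\<^sub>\<infinity>n::int. ee ((of_int (2 * n + 1))^2 * A + of_int (2 * n + 1) * B))
  = (\<Sum>\<^sub>\<infinity>n::int. ee (A + B) * ee ((of_int n)^2 * (4 * A) + of_int n * (2 * B + 4 * A)))"
  by (intro infsum_cong, subst ee_add[symmetric]) (simp add: algebra_simps power2_eq_square)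
 also have "... = ee (A + B) * gtheta (4 * A) (2 * B + 4 * A)"
  unfolding gtheta_def by (rule infsum_cmult_right')
 finally show ?thesis .
qed

lemma gtheta_near_1:
 assumes "2 * pi * Im A >= ln 2"
 shows "norm (gtheta A 0 - 1) <= 2 * exp (- 2 * pi * Im A) * int_tail"
proof -
 define r where "r = exp (- 2 * pi * Im A)"
 have r: "0 <= r" "r <= 1/2"
 proof -
  have "r <= exp (- ln 2)" unfolding r_def using assms by (simp only: exp_le_cancel_iff)
  thus "r <= 1/2" by (simp add: exp_minus)
 qed (simp add: r_def)
 have "norm (ee ((of_int n)^2 * A + of_int n * 0)) <= 1 * r ^ nat (abs n)" for n :: int
 proof -
  have "norm (ee ((of_int n)^2 * A + of_int n * 0)) = exp (of_nat (nat (n^2)) * (- 2 * pi * Im A))"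
   by (simp add: norm_ee power2_eq_square mult_ac)
  also have "... = r ^ nat (n^2)" unfolding r_def exp_of_nat_mult ..
  also have "... <= r ^ nat (abs n)"
  proof (rule power_decreasing)
   have "(abs n) * 1 <= (abs n) * (abs n)" using mult_left_mono[of 1 "(abs n)" "(abs n)"] by (cases "n = 0") auto
   thus "nat (abs n) <= nat (n^2)" by (simp add: power2_eq_square)
  qed (use r in auto)
  finally show ?thesis by simp
 qed
 from infsum_tail_bound(2)[OF this r] show ?thesis unfolding gtheta_def r_def by simp
qed

text \<open>Adding the values at two points that differ by 1/2 keeps only the even terms, so
  identical vanishing passes from A to 4 A. After enough quadruplings this contradicts
  \<open>gtheta_near_1\<close>.\<close>

lemma gtheta_not_identically_zero:
 assumes "Im A > 0" shows "EX B. gtheta A B ~= 0"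
proof (rule ccontr)
 assume "~ ?thesis"
 hence z: "gtheta A B = 0" for B by blast
 have step: "ALL B. gtheta (4 * C) B = 0" if C: "Im C > 0" "ALL B. gtheta C B = 0" for C
 proof
  fix B
  have "ee (C + (B / 2 + 1/2)) = - ee (C + B / 2)" by (simp add: ee_add ee_half)
  moreover have "gtheta (4 * C) (2 * (B/2 + 1/2)) = gtheta (4 * C) B"
   using gtheta_add_1[of "4 * C" B] by (simp add: algebra_simps)
  moreover have "gtheta (4 * C) (2 * (B/2 + 1/2) + 4 * C) = gtheta (4 * C) (B + 4 * C)"
   using gtheta_add_1[of "4 * C" "B + 4 * C"] by (simp add: algebra_simps)
  ultimately have "gtheta C (B/2) + gtheta C (B/2 + 1/2) = 2 * gtheta (4 * C) B"
   by (simp add: gtheta_parity[OF C(1)])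
  thus "gtheta (4 * C) B = 0" using C(2) by simp
 qed
 have imk: "Im (4 ^ k * A) = 4 ^ k * Im A" for k
  by (induction k) (simp_all add: mult.assoc)
 have all: "ALL B. gtheta (4 ^ k * A) B = 0" for k
 proof (induction k)
  case (Suc k)
  have "Im (4 ^ k * A) > 0" using assms by (simp add: imk)
  from step[OF this Suc] show ?case by (simp add: mult.assoc)
 qed (use z in simp)
 \<comment> \<open>Once 4 ^ k exceeds y, the distance of the theta value from 1 is at most 2
   \<open>int_tail\<close> / (2 \<open>int_tail\<close> + 1), which is less than 1.\<close>
 define y where "y = (ln 2 + ln (2 * int_tail + 1)) / (2 * pi * Im A)"
 obtain k where k: "y < 4 ^ k" using real_arch_pow[of 4 y] by auto
 have it: "int_tail >= 0" unfolding int_tail_def by (intro infsum_nonneg) auto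
 have b: "ln 2 + ln (2 * int_tail + 1) < 2 * pi * Im (4 ^ k * A)"
  using k assms by (simp add: y_def imk field_simps)
 have "ln (2 * int_tail + 1) >= 0" using it by simp
 hence "norm (gtheta (4 ^ k * A) 0 - 1) <= 2 * exp (- 2 * pi * Im (4 ^ k * A)) * int_tail"
  using b by (intro gtheta_near_1) linarith
 also have "exp (- 2 * pi * Im (4 ^ k * A)) <= exp (- ln (2 * int_tail + 1))"
  using b ln_gt_zero[of "2::real"] by (simp only: exp_le_cancel_iff) linarith
 also have "... = 1 / (2 * int_tail + 1)" using it by (simp add: exp_minus inverse_eq_divide)
 finally have "norm (gtheta (4 ^ k * A) 0 - 1) <= 2 * int_tail / (2 * int_tail + 1)"
  using it by (simp add: mult_right_mono)
 also have "... < 1" using it by (simp add: field_simps)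
 finally show False using all by simp
qed

section \<open>Zeros and uniqueness of the theta function\<close>

definition theta_coeff :: "complex => int => complex" where
 "theta_coeff A n = ee ((of_int n)^2 * A + of_int n * (A + 1/2))"

text \<open>Up to a constant, the partial fraction expansion of 1 / \<open>gtheta\<close>. Its poles
  are known by construction, so it locates the zeros of theta without contour integrals or product
  formulas, and it turns functions with the theta law into elliptic ones.\<close>

definition theta_recip :: "complex => complex => complex" where
 "theta_recip A B = lambert (theta_coeff A) (2 * A) (ee (B + (A + 1/2)))"

definition theta_zeros :: "complex => complex set" where
 "theta_zeros A = {p. EX m j :: int. p = A + 1/2 + of_int m * (2 * A) + of_int j / of_nat 1}"

lemma theta_coeff_summable: "Im A > 0 ==> (%n. norm (theta_coeff A n)) summable_on UNIV"
 unfolding theta_coeff_def by (rule gtheta_summable)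

lemma theta_coeff_pred: "theta_coeff A (n - 1) = - theta_coeff A n * ee (- (of_int n * (2 * A)))"
proof -
 have "- theta_coeff A n * ee (- (of_int n * (2 * A))) = ee ((of_int n)^2 * A + of_int n * (A + 1/2)) * ee (- (of_int n * (2 * A))) * ee (1/2)"
  by (simp add: theta_coeff_def ee_half)
 also have "... = ee ((of_int n)^2 * A + of_int n * (A + 1/2) + (- (of_int n * (2 * A))) + 1/2)"
  by (simp only: ee_add)
 also have "... = theta_coeff A (n - 1)" unfolding theta_coeff_def
  by (rule ee_eqI[of _ _ 1]) (simp add: field_simps power2_eq_square)
 finally show ?thesis ..
qed

text \<open>Shifting the index reproduces the series times -w, up to the sum of all coefficients;
  that sum is the theta value at its zero A + 1/2.\<close>

lemma lambert_theta_coeff_quasi_period: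
 assumes A: "Im A > 0" and w: "w ~= 0" "!!n. w * ee (of_int n * (2 * A)) ~= 1"
 shows "lambert (theta_coeff A) (2 * A) (w * ee (2 * A)) = - w * lambert (theta_coeff A) (2 * A) w"
proof -
 let ?a = "theta_coeff A" and ?z = "2 * A"
 have z: "Im ?z > 0" using A by simp
 have s1: "(%n. ?a n / (1 - w * ee (of_int n * ?z))) summable_on UNIV"
  by (rule lambert_summable[OF z theta_coeff_summable[OF A] w(1)])
 have s2: "(%n. ?a (n + (-1))) summable_on UNIV"
  using summable_on_reindex_bij_betw[OF bij_int_shift, of ?a "-1"] abs_summable_summable[OF theta_coeff_summable[OF A]] by blast
 have "lambert ?a ?z (w * ee ?z) = (\<Sum>\<^sub>\<infinity>n. ?a ((n + 1) - 1) / (1 - w * ee (of_int (n + 1) * ?z)))"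
  unfolding lambert_def by (intro infsum_cong) (simp add: ring_distribs ee_add mult_ac)
 also have "... = (\<Sum>\<^sub>\<infinity>n. ?a (n - 1) / (1 - w * ee (of_int n * ?z)))"
  by (rule infsum_int_shift[of "%n. ?a (n - 1) / (1 - w * ee (of_int n * ?z))" 1])
 also have "... = (\<Sum>\<^sub>\<infinity>n. (- w) * (?a n / (1 - w * ee (of_int n * ?z))) + ?a (n + (-1)))"
 proof (intro infsum_cong)
  fix n
  define e where "e = ee (of_int n * ?z)"
  have e: "e ~= 0" "w * e ~= 1" using w(2)[of n] by (auto simp: e_def)
  have p: "?a n = - e * ?a (n - 1)" using theta_coeff_pred[of A n] by (simp add: e_def ee_minus)
  show "?a (n - 1) / (1 - w * ee (of_int n * ?z)) = (- w) * (?a n / (1 - w * ee (of_int n * ?z))) + ?a (n + (-1))"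
   unfolding e_def[symmetric] p using e by (simp add: field_simps)
 qed
 also have "... = (\<Sum>\<^sub>\<infinity>n. (- w) * (?a n / (1 - w * ee (of_int n * ?z)))) + (\<Sum>\<^sub>\<infinity>n. ?a (n + (-1)))"
  by (rule infsum_add[OF summable_on_cmult_right[OF s1] s2])
 also have "(\<Sum>\<^sub>\<infinity>n. (- w) * (?a n / (1 - w * ee (of_int n * ?z)))) = (- w) * lambert ?a ?z w"
  unfolding lambert_def by (rule infsum_cmult_right')
 also have "(\<Sum>\<^sub>\<infinity>n. ?a (n + (-1))) = gtheta A (A + 1/2)"
  by (subst infsum_int_shift) (simp add: gtheta_def theta_coeff_def[abs_def])
 finally show ?thesis by (simp add: gtheta_zero)
qed

lemma theta_zeros_iff: "B \<in> theta_zeros A \<longleftrightarrow> (EX n. ee (B + (A + 1/2)) * ee (of_int n * (2 * A)) = 1)"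
proof
 assume "B \<in> theta_zeros A"
 then obtain m j :: int where "B = A + 1/2 + of_int m * (2 * A) + of_int j" by (auto simp: theta_zeros_def)
 hence "ee (B + (A + 1/2) + of_int (- m - 1) * (2 * A)) = 1"
  unfolding ee_eq_1_iff by (intro exI[of _ "j + 1"]) (simp add: algebra_simps)
 thus "EX n. ee (B + (A + 1/2)) * ee (of_int n * (2 * A)) = 1" unfolding ee_add[symmetric] by blast
next
 assume "EX n. ee (B + (A + 1/2)) * ee (of_int n * (2 * A)) = 1"
 then obtain n where "ee (B + (A + 1/2) + of_int n * (2 * A)) = 1" unfolding ee_add[symmetric] by blast
 then obtain j where j: "B + (A + 1/2) + of_int n * (2 * A) = of_int j" using ee_eq_1_iff by blast
 show "B \<in> theta_zeros A" unfolding theta_zeros_def mem_Collect_eq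
  by (intro exI[of _ "- n - 1"] exI[of _ "j - 1"]) (use j in \<open>simp add: algebra_simps\<close>)
qed

lemma theta_zeros_shift: "B + 1 \<in> theta_zeros A \<longleftrightarrow> B \<in> theta_zeros A"
 "B + 2 * A \<in> theta_zeros A \<longleftrightarrow> B \<in> theta_zeros A"
proof -
 have "ee (B + 1 + (A + 1/2)) = ee (B + (A + 1/2))" by (rule ee_eqI[of _ _ 1]) simp
 thus "B + 1 \<in> theta_zeros A \<longleftrightarrow> B \<in> theta_zeros A" unfolding theta_zeros_iff by simp
 have e: "ee (B + 2 * A + (A + 1/2)) * ee (of_int n * (2 * A)) = ee (B + (A + 1/2)) * ee (of_int (n + 1) * (2 * A))" for n
  unfolding ee_add[symmetric] by (rule arg_cong[of _ _ ee]) (simp add: algebra_simps)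
 show "B + 2 * A \<in> theta_zeros A \<longleftrightarrow> B \<in> theta_zeros A"
  unfolding theta_zeros_iff e by (metis diff_add_cancel)
qed

lemma theta_recip_laws:
 assumes A: "Im A > 0"
 shows "theta_recip A (B + 1) = theta_recip A B"
  and "B ~: theta_zeros A ==> theta_recip A (B + 2 * A) = ee (A + B) * theta_recip A B"
  and "theta_recip A holomorphic_on - theta_zeros A"
  and "p \<in> theta_zeros A ==> EX L. L ~= 0 & ((%B. (B - p) * theta_recip A B) ---> L) (at p)"
proof -
 have "ee (B + 1 + (A + 1/2)) = ee (B + (A + 1/2))" by (rule ee_eqI[of _ _ 1]) simp
 thus "theta_recip A (B + 1) = theta_recip A B" unfolding theta_recip_def by simp
next
 assume B: "B ~: theta_zeros A"
 have 1: "ee (B + 2 * A + (A + 1/2)) = ee (B + (A + 1/2)) * ee (2 * A)"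
  unfolding ee_add[symmetric] by (rule arg_cong[of _ _ ee]) simp
 have 2: "ee (A + B) = - ee (B + (A + 1/2))" unfolding ee_add by (simp add: ee_half)
 show "theta_recip A (B + 2 * A) = ee (A + B) * theta_recip A B"
  unfolding theta_recip_def 1 2
  by (rule lambert_theta_coeff_quasi_period[OF A]) (use B theta_zeros_iff in auto)
next
 have "Im (2 * A) > 0" using A by simp
 hence "lambert (theta_coeff A) (2 * A) \<circ> (%B. ee (B + (A + 1/2))) holomorphic_on - theta_zeros A"
  by (intro holomorphic_on_compose_gen[OF _ lambert_holomorphic[OF _ theta_coeff_summable[OF A]]] holomorphic_intros)
   (auto simp: theta_zeros_iff)
 thus "theta_recip A holomorphic_on - theta_zeros A" by (simp add: o_def theta_recip_def[abs_def])
next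
 assume "p \<in> theta_zeros A"
 then obtain m j :: int where p: "p = A + 1/2 + of_int m * (2 * A) + of_int j" by (auto simp: theta_zeros_def)
 have p': "p + (A + 1/2) = of_int (m + 1) * (2 * A) + of_int (j + 1)" by (simp add: p algebra_simps)
 have "Im (2 * A) > 0" using A by simp
 from lambert_ee_residue[OF this theta_coeff_summable[OF A] p']
 have "((%B. (B - p) * theta_recip A B) ---> - theta_coeff A (- (m + 1)) / (2 * of_real pi * \<i>)) (at (p + (A + 1/2) - (A + 1/2)))"
  by (drule_tac LIM_offset[where k = "A + 1/2"]) (simp add: theta_recip_def add_ac)
 hence "((%B. (B - p) * theta_recip A B) ---> - theta_coeff A (- (m + 1)) / (2 * of_real pi * \<i>)) (at p)"
  by simp
 moreover have "- theta_coeff A (- (m + 1)) / (2 * of_real pi * \<i>) ~= 0" by (simp add: theta_coeff_def)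
 ultimately show "EX L. L ~= 0 & ((%B. (B - p) * theta_recip A B) ---> L) (at p)" by blast
qed

lemma theta_zeros_discrete:
 "Im A > 0 ==> EX r>0. ALL p:theta_zeros A. p ~= z --> r <= dist p z"
 unfolding theta_zeros_def by (rule lattice_discrete) auto

text \<open>The quasi-period laws carry the zero at A + 1/2 to the whole lattice. There it cancels
  the simple poles of \<open>theta_recip\<close>, and since the two quasi-period factors are inverse
  to each other, the product is constant by the case a = 0 of the Liouville principle.\<close>

lemma
 assumes A: "Im A > 0" and f: "f holomorphic_on UNIV"
  and f1: "!!B. f (B + 1) = f B" and f2: "!!B. f (B + 2 * A) = ee (- A - B) * f B" and f0: "f (A + 1/2) = 0"
 shows theta_law_zeros: "p \<in> theta_zeros A ==> f p = 0"
  and theta_recip_product: "EX K. ALL B. B ~: theta_zeros A --> f B * theta_recip A B = K"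
proof -
 have z: "f p = 0" if p: "p \<in> theta_zeros A" for p
 proof -
  obtain m j :: int where p: "p = A + 1/2 + of_int m * (2 * A) + of_int j" using p by (auto simp: theta_zeros_def)
  have 1: "f (A + 1/2 + of_int m * (2 * A)) = 0" for m :: int
  proof (induction m rule: int_induct[of _ 0])
   case (step1 i)
   thus ?case using f2[of "A + 1/2 + of_int i * (2 * A)"] by (simp add: algebra_simps)
  next
   case (step2 i)
   thus ?case using f2[of "A + 1/2 + of_int (i - 1) * (2 * A)"] by (simp add: algebra_simps)
  qed (simp add: f0)
  have "f (A + 1/2 + of_int m * (2 * A) + of_int j) = 0" for j :: int
  proof (induction j rule: int_induct[of _ 0])
   case (step1 i)
   thus ?case using f1[of "A + 1/2 + of_int m * (2 * A) + of_int i"] by (simp add: add_ac)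
  next
   case (step2 i)
   thus ?case using f1[of "A + 1/2 + of_int m * (2 * A) + of_int (i - 1)"] by (simp add: add_ac)
  qed (use 1[of m] in simp)
  thus ?thesis by (simp add: p)
 qed
 show "p \<in> theta_zeros A ==> f p = 0" by (rule z)
 have "EX c. (ALL u. u ~: theta_zeros A --> f u * theta_recip A u = c) & (0 < (0::real) --> c = 0)"
 proof (rule quasi_periodic_constant[where \<omega> = "2 * A" and a = 0])
  show "(%u. f u * theta_recip A u) holomorphic_on - theta_zeros A"
   by (intro holomorphic_intros theta_recip_laws A holomorphic_on_subset[OF f]) auto
  fix p assume p: "p \<in> theta_zeros A"
  obtain L where L: "((%B. (B - p) * theta_recip A B) ---> L) (at p)" using theta_recip_laws(4)[OF A p] by blast
  have "isCont f p"
   using holomorphic_on_imp_continuous_on[OF f] by (simp add: continuous_on_eq_continuous_at)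
  hence "(f ---> 0) (at p)" using z[OF p] by (simp add: isCont_def)
  from tendsto_mult[OF this L] show "((%u. (u - p) * (f u * theta_recip A u)) ---> 0) (at p)"
   by (simp add: mult_ac)
 next
  fix u
  show "u + 1 \<in> theta_zeros A \<longleftrightarrow> u \<in> theta_zeros A" "u + 2 * A \<in> theta_zeros A \<longleftrightarrow> u \<in> theta_zeros A"
   by (rule theta_zeros_shift)+
  show "norm (f (u + 1) * theta_recip A (u + 1)) = norm (f u * theta_recip A u)"
   by (simp add: f1 theta_recip_laws A)
  assume u: "u ~: theta_zeros A"
  have "f (u + 2 * A) * theta_recip A (u + 2 * A) = (ee (- A - u) * ee (A + u)) * (f u * theta_recip A u)"
   by (simp only: f2 theta_recip_laws(2)[OF A u]) (simp add: mult_ac)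
  also have "ee (- A - u) * ee (A + u) = 1" by (simp flip: ee_add)
  finally show "norm (f (u + 2 * A) * theta_recip A (u + 2 * A)) * exp (0 * (Im (u + 2 * A))^2) =
   norm (f u * theta_recip A u) * exp (0 * (Im u)^2)" by simp
 qed (use A theta_zeros_discrete[OF A] in auto)
 thus "EX K. ALL B. B ~: theta_zeros A --> f B * theta_recip A B = K" by blast
qed

lemma gtheta_laws:
 assumes "Im A > 0"
 shows "gtheta A holomorphic_on UNIV" "gtheta A (B + 1) = gtheta A B"
  "gtheta A (B + 2 * A) = ee (- A - B) * gtheta A B" "gtheta A (A + 1/2) = 0"
 using assms by (simp_all add: gtheta_holomorphic_snd gtheta_add_1 gtheta_quasi_period gtheta_zero)

text \<open>A non-zero constant means that theta vanishes nowhere off the lattice.\<close>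

lemma gtheta_recip_const:
 assumes A: "Im A > 0"
 shows "EX K. K ~= 0 & (ALL B. B ~: theta_zeros A --> gtheta A B * theta_recip A B = K)"
proof -
 obtain K where K: "!!B. B ~: theta_zeros A ==> gtheta A B * theta_recip A B = K"
  using theta_recip_product[OF A gtheta_laws[OF A]] by blast
 \<comment> \<open>Close to the zero A + 1/2 the reciprocal is non-zero because its residue is, and
   theta is non-zero because it does not vanish identically.\<close>
 have "K ~= 0"
 proof -
  have p: "A + 1/2 \<in> theta_zeros A" (is "?p \<in> _") unfolding theta_zeros_def by (auto intro!: exI[of _ 0])
  obtain L where L: "L ~= 0" "((%B. (B - ?p) * theta_recip A B) ---> L) (at ?p)" using theta_recip_laws(4)[OF A p] by blast
  have e1: "eventually (%B. (B - ?p) * theta_recip A B ~= 0) (at ?p)"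
   using tendsto_imp_eventually_ne[OF L(2,1)] .
  obtain B0 where "gtheta A B0 ~= 0" using gtheta_not_identically_zero[OF A] by blast
  hence e2: "eventually (%B. gtheta A B ~= 0 & B \<in> UNIV) (at ?p)"
   by (intro non_zero_neighbour_alt[OF gtheta_holomorphic_snd[OF A]]) auto
  obtain r where r: "r > 0" "ALL p:theta_zeros A. p ~= ?p --> r <= dist p ?p" using theta_zeros_discrete[OF A] by blast
  have e3: "eventually (%B. B ~: theta_zeros A) (at ?p)"
   unfolding eventually_at using r by (intro exI[of _ r]) force
  have "eventually (%B. K ~= 0) (at ?p)"
   using e1 e2 e3 by eventually_elim (use K in force)
  thus ?thesis by simp
 qed
 thus ?thesis using K by blast
qed

lemma gtheta_nonzero:
 assumes A: "Im A > 0" and B: "B ~: theta_zeros A"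
 shows "gtheta A B ~= 0"
 using gtheta_recip_const[OF A] B by force

lemma theta_unique:
 assumes A: "Im A > 0" and f: "f holomorphic_on UNIV"
  and f1: "!!B. f (B + 1) = f B" and f2: "!!B. f (B + 2 * A) = ee (- A - B) * f B" and f0: "f (A + 1/2) = 0"
 shows "EX k. ALL B. f B = k * gtheta A B"
proof -
 obtain K where K: "K ~= 0" "!!B. B ~: theta_zeros A ==> gtheta A B * theta_recip A B = K"
  using gtheta_recip_const[OF A] by blast
 obtain K2 where K2: "!!B. B ~: theta_zeros A ==> f B * theta_recip A B = K2"
  using theta_recip_product[OF A f f1 f2 f0] by blast
 have "f B = K2 / K * gtheta A B" for B
 proof (cases "B \<in> theta_zeros A")
  case True
  thus ?thesis using theta_law_zeros[OF A f f1 f2 f0 True] theta_law_zeros[OF A gtheta_laws[OF A] True] by simp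
 next
  case False
  from K(2)[OF False] K2[OF False] K(1) show ?thesis by (auto simp: field_simps)
 qed
 thus ?thesis by blast
qed

section \<open>The inversion formula\<close>

lemma Im_inversion:
 assumes "Im A > 0"
 shows "Im (- 1 / (4 * A)) > 0" "Im (1 / (4 * A)) < 0"
proof -
 have "- 1 / (4 * A) = - inverse A / 4" by (simp add: field_simps)
 moreover have "(Re A)\<^sup>2 * 4 + (Im A)^2 * 4 > 0"
  using assms by (intro add_nonneg_pos) auto
 hence "Im (- inverse A / 4) > 0" using assms by (auto intro!: divide_pos_pos)
 ultimately show "Im (- 1 / (4 * A)) > 0" by metis
 thus "Im (1 / (4 * A)) < 0" by simp
qed

lemma deriv_2: "(deriv ^^ 2) f x = deriv (deriv f) x"
 by (simp add: numeral_2_eq_2)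

text \<open>The dual series known from Poisson summation. It is identified with a multiple of
  \<open>gtheta\<close> by uniqueness in B, and the multiple is found from the heat
  equation.\<close>

definition theta_dual :: "complex => complex => complex" where
 "theta_dual A B = (\<Sum>\<^sub>\<infinity>n::int. ee (- ((B - of_int n)^2) / (4 * A)))"

lemma theta_dual_term:
 assumes "A ~= (0 :: complex)"
 shows "- ((B - of_int n)^2) / (4 * A) = (of_int n)^2 * (- 1 / (4 * A)) + of_int n * (B / (2 * A)) + (- (B^2) / (4 * A))"
 using assms by (simp add: field_simps power2_eq_square)

lemma theta_dual_gtheta:
 assumes "A ~= 0"
 shows "theta_dual A B = ee (- (B^2) / (4 * A)) * gtheta (- 1 / (4 * A)) (B / (2 * A))"
 unfolding theta_dual_def gtheta_def theta_dual_term[OF assms] ee_add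
 by (simp add: infsum_cmult_right'[symmetric] mult_ac)

lemma theta_dual_laws:
 assumes A: "Im A > 0"
 shows "theta_dual A holomorphic_on UNIV"
  and "theta_dual A (B + 1) = theta_dual A B"
  and "theta_dual A (B + 2 * A) = ee (- A - B) * theta_dual A B"
  and "theta_dual A (A + 1/2) = 0"
proof -
 have nz: "A ~= 0" using A by auto
 have "(%B. \<Sum>\<^sub>\<infinity>n::int. ee ((of_int n)^2 * (- 1 / (4 * A)) + of_int n * (B / (2 * A)) + (- (B^2) / (4 * A)))) holomorphic_on UNIV"
  by (rule theta_family_holomorphic[of UNIV "%_. - 1 / (4 * A)" "%B. B / (2 * A)" "%B. - (B^2) / (4 * A)"])
   (use nz Im_inversion[OF A] in \<open>auto intro!: holomorphic_intros\<close>)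
 thus "theta_dual A holomorphic_on UNIV"
  unfolding theta_dual_def[abs_def] theta_dual_term[OF nz] .
 have "theta_dual A (B + 1) = (\<Sum>\<^sub>\<infinity>n::int. ee (- ((B + 1 - of_int (n + 1))^2) / (4 * A)))"
  unfolding theta_dual_def by (rule infsum_int_shift[symmetric])
 thus "theta_dual A (B + 1) = theta_dual A B" by (simp add: theta_dual_def)
 have "ee (- ((B + 2 * A - of_int n)^2) / (4 * A)) = ee (- A - B) * ee (- ((B - of_int n)^2) / (4 * A))" for n
  unfolding ee_add[symmetric] by (rule ee_eqI[of _ _ n]) (use nz in \<open>simp add: field_simps power2_eq_square\<close>)
 thus "theta_dual A (B + 2 * A) = ee (- A - B) * theta_dual A B"
  unfolding theta_dual_def by (simp add: infsum_cmult_right')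
 have "theta_dual A (A + 1/2) = (\<Sum>\<^sub>\<infinity>n::int. ee (- ((A + 1/2 - of_int (1 - n))^2) / (4 * A)))"
  unfolding theta_dual_def by (rule infsum_int_reflect[symmetric])
 also have "... = (\<Sum>\<^sub>\<infinity>n::int. - ee (- ((A + 1/2 - of_int n)^2) / (4 * A)))"
 proof (intro infsum_cong)
  fix n :: int
  have "- ee (- ((A + 1/2 - of_int n)^2) / (4 * A)) = ee (- ((A + 1/2 - of_int n)^2) / (4 * A) + 1/2)"
   unfolding ee_add ee_half by simp
  also have "... = ee (- ((A + 1/2 - of_int (1 - n))^2) / (4 * A))"
   by (rule ee_eqI[of _ _ n]) (use nz in \<open>simp add: field_simps power2_eq_square\<close>)
  finally show "ee (- ((A + 1/2 - of_int (1 - n))^2) / (4 * A)) = - ee (- ((A + 1/2 - of_int n)^2) / (4 * A))" ..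
 qed
 also have "... = - theta_dual A (A + 1/2)" unfolding theta_dual_def by (rule infsum_uminus)
 finally show "theta_dual A (A + 1/2) = 0" by simp
qed

text \<open>Each term satisfies the equation, since (2 pi i n)^2 = 2 pi i (2 pi i n^2); the theta
  families may be differentiated termwise.\<close>

lemma gtheta_heat:
 assumes A: "Im A > 0"
 shows "(deriv ^^ 2) (gtheta A) B = 2 * of_real pi * \<i> * deriv (%A. gtheta A B) A"
proof -
 let ?c = "2 * of_real pi * \<i> :: complex"
 have S: "open {A. Im A > 0}" by (simp add: open_halfspace_Im_gt)
 have 1: "((%n. (deriv ^^ 2) (%B. ee ((of_int n)^2 * A + of_int n * B + 0)) B) has_sum
   (deriv ^^ 2) (%B. \<Sum>\<^sub>\<infinity>n::int. ee ((of_int n)^2 * A + of_int n * B + 0)) B) UNIV"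
  by (rule theta_family_deriv[of UNIV "%_. A" "%B. B" "%_. 0"]) (use A in \<open>auto intro: holomorphic_intros\<close>)
 have 2: "((%n. (deriv ^^ 1) (%A. ee ((of_int n)^2 * A + of_int n * B + 0)) A) has_sum
   (deriv ^^ 1) (%A. \<Sum>\<^sub>\<infinity>n::int. ee ((of_int n)^2 * A + of_int n * B + 0)) A) UNIV"
  by (rule theta_family_deriv[OF S]) (use A in \<open>auto intro: holomorphic_intros\<close>)
 have d1: "deriv (%B. ee ((of_int n)^2 * A + of_int n * B + 0)) = (%B. ee ((of_int n)^2 * A + of_int n * B + 0) * (?c * of_int n))" for n :: int
  by (intro ext DERIV_imp_deriv) (auto intro!: derivative_eq_intros)
 have d2: "(deriv ^^ 2) (%B. ee ((of_int n)^2 * A + of_int n * B + 0)) B = ee ((of_int n)^2 * A + of_int n * B + 0) * (?c * of_int n)^2" for n :: int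
  unfolding deriv_2 d1
  by (intro DERIV_imp_deriv) (auto intro!: derivative_eq_intros simp: power2_eq_square)
 have d3: "deriv (%A. ee ((of_int n)^2 * A + of_int n * B + 0)) A = ee ((of_int n)^2 * A + of_int n * B + 0) * (?c * (of_int n)^2)" for n :: int
  by (intro DERIV_imp_deriv) (auto intro!: derivative_eq_intros)
 have "((%n. (deriv ^^ 2) (%B. ee ((of_int n)^2 * A + of_int n * B + 0)) B) has_sum
   ?c * deriv (%A. \<Sum>\<^sub>\<infinity>n::int. ee ((of_int n)^2 * A + of_int n * B + 0)) A) UNIV"
  using has_sum_cmult_right[OF 2, of ?c] by (simp only: d2 d3 funpow.simps o_def id_def One_nat_def) (simp add: power2_eq_square mult_ac)
 from has_sum_unique[OF 1 this] show ?thesis unfolding add_0_right gtheta_def[abs_def] .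
qed

text \<open>The additional term - pi i / A reflects that the Gaussians appear without the factor
  A^(-1/2) of the heat kernel.\<close>

lemma theta_dual_heat:
 assumes A: "Im A > 0"
 shows "(deriv ^^ 2) (theta_dual A) B = - (of_real pi * \<i> / A) * theta_dual A B + 2 * of_real pi * \<i> * deriv (%A. theta_dual A B) A"
  and "(%A. theta_dual A B) holomorphic_on {A. Im A > 0}"
proof -
 let ?c = "2 * of_real pi * \<i> :: complex"
 have nz: "A ~= 0" using A by auto
 let ?S = "{A. Im A > 0}"
 have S: "open ?S" by (simp add: open_halfspace_Im_gt)
 let ?T = "%n A B. ee ((of_int n)^2 * (- 1 / (4 * A)) + of_int n * (B / (2 * A)) + (- (B^2) / (4 * A)))"
 have nz': "A \<in> ?S ==> A ~= 0" for A by auto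
 have Teq: "A \<in> ?S ==> (\<Sum>\<^sub>\<infinity>n::int. ?T n A B) = theta_dual A B" for A B
  unfolding theta_dual_def using theta_dual_term[OF nz'] by simp
 have hol: "(%A. \<Sum>\<^sub>\<infinity>n::int. ?T n A B) holomorphic_on ?S"
  by (rule theta_family_holomorphic[OF S]) (auto intro!: holomorphic_intros Im_inversion)
 show "(%A. theta_dual A B) holomorphic_on ?S"
  by (rule holomorphic_transform[OF hol Teq])
 have 1: "((%n. (deriv ^^ 2) (%B. ?T n A B) B) has_sum (deriv ^^ 2) (%B. \<Sum>\<^sub>\<infinity>n::int. ?T n A B) B) UNIV"
  by (rule theta_family_deriv[of UNIV "%_. - 1 / (4 * A)" "%B. B / (2 * A)" "%B. - (B^2) / (4 * A)"])
   (use nz Im_inversion[OF A] in \<open>auto intro!: holomorphic_intros\<close>)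
 have 2: "((%n. (deriv ^^ 1) (%A. ?T n A B) A) has_sum (deriv ^^ 1) (%A. \<Sum>\<^sub>\<infinity>n::int. ?T n A B) A) UNIV"
  by (rule theta_family_deriv[OF S]) (use A in \<open>auto intro!: holomorphic_intros Im_inversion\<close>)
 have 3: "((%n. ?T n A B) has_sum (\<Sum>\<^sub>\<infinity>n::int. ?T n A B)) UNIV"
  by (rule has_sum_infsum, rule abs_summable_summable,
    rule theta_family_summable[OF S]) (use A in \<open>auto intro!: holomorphic_intros Im_inversion\<close>)
 have d1: "deriv (%B. ?T n A B) = (%B. ?T n A B * (?c * ((of_int n - B) / (2 * A))))" for n :: int
  by (intro ext DERIV_imp_deriv) (use nz in \<open>auto intro!: derivative_eq_intros simp: field_simps\<close>)
 have d2: "(deriv ^^ 2) (%B. ?T n A B) B = ?T n A B * ((?c * ((of_int n - B) / (2 * A)))^2 - ?c / (2 * A))" for n :: int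
  unfolding deriv_2 d1
  by (intro DERIV_imp_deriv) (use nz in \<open>auto intro!: derivative_eq_intros simp: field_simps power2_eq_square\<close>)
 have "((%A. (of_int n)\<^sup>2 * (- 1 / (4 * A)) + of_int n * (B / (2 * A)) + (- (B^2) / (4 * A))) has_field_derivative ((of_int n - B) / (2 * A))\<^sup>2) (at A)" for n :: int
  using nz by (auto intro!: derivative_eq_intros simp: field_simps power2_eq_square)
 hence d3: "deriv (%A. ?T n A B) A = ?T n A B * (?c * ((of_int n - B) / (2 * A))^2)" for n :: int
  using DERIV_imp_deriv has_field_derivative_ee by blast
 have e: "(deriv ^^ 2) (%B. ?T n A B) B = - (of_real pi * \<i> / A) * ?T n A B + ?c * deriv (%A. ?T n A B) A" for n :: int
  unfolding d2 d3 using nz by (simp add: field_simps power2_eq_square)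
 have "((%n. (deriv ^^ 2) (%B. ?T n A B) B) has_sum
   (- (of_real pi * \<i> / A) * (\<Sum>\<^sub>\<infinity>n::int. ?T n A B) + ?c * deriv (%A. \<Sum>\<^sub>\<infinity>n::int. ?T n A B) A)) UNIV"
  unfolding e using 2 by (intro has_sum_add has_sum_cmult_right 3) simp
 from has_sum_unique[OF 1 this]
 have "(deriv ^^ 2) (%B. \<Sum>\<^sub>\<infinity>n::int. ?T n A B) B = - (of_real pi * \<i> / A) * (\<Sum>\<^sub>\<infinity>n::int. ?T n A B) + ?c * deriv (%A. \<Sum>\<^sub>\<infinity>n::int. ?T n A B) A" .
 moreover have "(%B. \<Sum>\<^sub>\<infinity>n::int. ?T n A B) = theta_dual A" using Teq A by auto
 moreover have "deriv (%A. \<Sum>\<^sub>\<infinity>n::int. ?T n A B) A = deriv (%A. theta_dual A B) A"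
  by (rule deriv_cong_ev) (use A Teq eventually_nhds_in_open[OF S, of A] in \<open>auto elim!: eventually_mono\<close>)
 moreover have "(\<Sum>\<^sub>\<infinity>n::int. ?T n A B) = theta_dual A B" using Teq A by auto
 ultimately show "(deriv ^^ 2) (theta_dual A) B = - (of_real pi * \<i> / A) * theta_dual A B + 2 * of_real pi * \<i> * deriv (%A. theta_dual A B) A"
  by simp
qed

lemma gtheta_i_half_nonzero: "gtheta (\<i> / 2) 0 ~= 0"
proof -
 let ?f = "%n::int. ee ((of_int n)^2 * (\<i> / 2) + of_int n * 0)"
 have f: "?f n = of_real (exp (- pi * (of_int n)^2))" for n
  by (simp add: ee_def algebra_simps flip: exp_of_real)
 have s: "?f summable_on UNIV" by (rule gtheta_summable) simp
 hence h1: "((%n. Re (?f n)) has_sum Re (gtheta (\<i> / 2) 0)) UNIV"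
  unfolding gtheta_def by (intro has_sum_Re has_sum_infsum)
 have h2: "((%n. Re (?f n)) has_sum Re (?f 0)) {0}" by (intro has_sum_finiteI) auto
 have "Re (?f 0) <= Re (gtheta (\<i> / 2) 0)"
 proof (rule has_sum_mono2[OF h2 h1])
  fix n show "Re (?f n) >= 0" unfolding f by simp
 qed simp
 thus ?thesis by auto
qed

lemma minus_2i_not_nonpos: "Im A > 0 ==> - 2 * \<i> * A ~: \<real>\<^sub>\<le>\<^sub>0"
 by (auto simp: complex_nonpos_Reals_iff)

text \<open>Uniqueness gives a factor k(A) independent of B, and comparing the two heat equations
  gives k' = k / (2 A). Hence k divided by csqrt (- 2 i A) is constant on the half-plane; it equals
  1 at A = i / 2, the fixed point of A -> -1 / (4 A), where both series agree and do not
  vanish.\<close>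

theorem gtheta_dual_eq:
 assumes A: "Im A > 0"
 shows "theta_dual A B = csqrt (- 2 * \<i> * A) * gtheta A B"
proof -
 let ?S = "{A. Im A > 0}"
 have S: "open ?S" by (simp add: open_halfspace_Im_gt)
 define k where "k = (%A. SOME k. ALL B. theta_dual A B = k * gtheta A B)"
 have k: "theta_dual A B = k A * gtheta A B" if "A \<in> ?S" for A B
 proof -
  have "EX k. ALL B. theta_dual A B = k * gtheta A B"
   by (rule theta_unique) (use that theta_dual_laws in auto)
  from someI_ex[OF this] show ?thesis unfolding k_def by blast
 qed
 have kd: "(k has_field_derivative k A / (2 * A)) (at A)" if A: "A \<in> ?S" for A
 proof -
  have nz: "A ~= 0" using A by auto
  obtain B where B: "gtheta A B ~= 0" using gtheta_not_identically_zero A by auto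
  define F' where "F' = deriv (%A. theta_dual A B) A"
  define G' where "G' = deriv (%A. gtheta A B) A"
  have dF: "((%A. theta_dual A B) has_field_derivative F') (at A)"
   unfolding F'_def using theta_dual_heat(2) A S by (intro holomorphic_derivI) auto
  have dG: "((%A. gtheta A B) has_field_derivative G') (at A)"
   unfolding G'_def using gtheta_holomorphic_fst A S by (intro holomorphic_derivI) auto
  have dq: "((%A. theta_dual A B / gtheta A B) has_field_derivative
    (F' * gtheta A B - theta_dual A B * G') / (gtheta A B * gtheta A B)) (at A)"
   by (rule DERIV_divide[OF dF dG B])
  have "eventually (%C. gtheta C B ~= 0) (nhds A)"
   using B DERIV_isCont[OF dG] tendsto_imp_eventually_ne[of "%C. gtheta C B" "gtheta A B" "at A" 0]
   unfolding eventually_nhds_conv_at isCont_def by blast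
  moreover have "eventually (%C. C \<in> ?S) (nhds A)" using S A by (rule eventually_nhds_in_open)
  ultimately have "eventually (%C. theta_dual C B / gtheta C B = k C) (nhds A)"
   by eventually_elim (use k in auto)
  hence "(k has_field_derivative (F' * gtheta A B - theta_dual A B * G') / (gtheta A B * gtheta A B)) (at A)"
   using dq by (simp add: DERIV_cong_ev)
  moreover have "(F' * gtheta A B - theta_dual A B * G') / (gtheta A B * gtheta A B) = k A / (2 * A)"
  proof -
   have "theta_dual A = (%B. k A * gtheta A B)" using k[OF A] by blast
   hence "(deriv ^^ 2) (theta_dual A) B = k A * (deriv ^^ 2) (gtheta A) B"
    using higher_deriv_cmult[OF gtheta_holomorphic_snd, of A B 2 "k A"] A by simp
   hence "- (of_real pi * \<i> / A) * (k A * gtheta A B) + 2 * of_real pi * \<i> * F' = k A * (2 * of_real pi * \<i> * G')"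
    using theta_dual_heat(1)[of A B] gtheta_heat[of A B] A k[OF A, of B] by (simp add: F'_def G'_def)
   hence "2 * of_real pi * \<i> * F' = k A * (2 * of_real pi * \<i> * G') + (of_real pi * \<i> / A) * (k A * gtheta A B)"
    by (simp add: algebra_simps)
   also have "... = 2 * of_real pi * \<i> * (k A * G' + k A * gtheta A B / (2 * A))"
    using nz by (simp add: field_simps)
   finally have "2 * of_real pi * \<i> * F' = 2 * of_real pi * \<i> * (k A * G' + k A * gtheta A B / (2 * A))" .
   hence F': "F' = k A * G' + k A * gtheta A B / (2 * A)" by simp
   show ?thesis unfolding F' k[OF A, of B] using B nz by (simp add: field_simps)
  qed
  ultimately show ?thesis by simp
 qed
 define h where "h = (%A. k A / csqrt (- 2 * \<i> * A))"
 have "EX c. ALL A:?S. h A = c"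
 proof (rule has_field_derivative_zero_constant)
  show "convex ?S" by (rule convex_halfspace_Im_gt)
  fix A assume A: "A \<in> ?S"
  have nz: "A ~= 0" using A by auto
  have np: "- 2 * \<i> * A ~: \<real>\<^sub>\<le>\<^sub>0" using A minus_2i_not_nonpos by auto
  define s where "s = csqrt (- 2 * \<i> * A)"
  have s: "s ~= 0" "s * s = - 2 * \<i> * A"
   using nz power2_csqrt[of "- 2 * \<i> * A"] by (auto simp: s_def power2_eq_square)
  have ds: "((%A. csqrt (- 2 * \<i> * A)) has_field_derivative inverse (2 * s) * (- 2 * \<i>)) (at A)"
   unfolding s_def
   by (rule DERIV_chain2[of csqrt _ "%A. - 2 * \<i> * A"], rule has_field_derivative_csqrt[OF np]) (auto intro!: derivative_eq_intros)
  have "(h has_field_derivative (k A / (2 * A) * s - k A * (inverse (2 * s) * (- 2 * \<i>))) / (s * s)) (at A)"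
   unfolding h_def using DERIV_divide[OF kd[OF A] ds] s(1) unfolding s_def by simp
  moreover have "k A / (2 * A) * s - k A * (inverse (2 * s) * (- 2 * \<i>)) = k A * (s * s + 2 * \<i> * A) / (2 * A * s)"
   using nz s(1) by (simp add: field_simps)
  ultimately have "(h has_field_derivative 0) (at A)" using s(2) by simp
  thus "(h has_field_derivative 0) (at A within ?S)" by (rule has_field_derivative_at_within)
 qed
 then obtain c where c: "!!A. A \<in> ?S ==> h A = c" by blast
 have "k (\<i> / 2) = 1"
 proof -
  have "theta_dual (\<i> / 2) 0 = gtheta (\<i> / 2) 0"
  proof -
   have "- 1 / (4 * (\<i> / 2)) = \<i> / 2" by (simp add: complex_eq_iff Re_divide Im_divide)
   thus ?thesis by (simp add: theta_dual_gtheta)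
  qed
  thus ?thesis using k[of "\<i> / 2" 0] gtheta_i_half_nonzero by simp
 qed
 hence "h (\<i> / 2) = 1" by (simp add: h_def)
 hence "c = 1" using c[of "\<i> / 2"] by simp
 hence "h A = 1" using c A by simp
 hence "k A = csqrt (- 2 * \<i> * A)" using A by (auto simp: h_def divide_eq_1_iff)
 thus ?thesis using k[of A B] A by simp
qed

corollary gtheta_inversion:
 assumes A: "Im A > 0"
 shows "gtheta (- 1 / (4 * A)) (B / (2 * A)) = csqrt (- 2 * \<i> * A) * ee (B^2 / (4 * A)) * gtheta A B"
proof -
 have nz: "A ~= 0" using A by auto
 have e: "ee (B^2 / (4 * A)) * ee (- (B^2) / (4 * A)) = 1" by (simp flip: ee_add)
 have "gtheta (- 1 / (4 * A)) (B / (2 * A)) = ee (B^2 / (4 * A)) * theta_dual A B"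
  unfolding theta_dual_gtheta[OF nz, of B] mult.assoc[symmetric] e by simp
 thus ?thesis by (simp only: gtheta_dual_eq[OF A, of B]) (simp only: mult_ac)
qed

section \<open>Branches of the square root\<close>

declare csqrt.simps [simp del]

lemma csqrt_Re_pos:
 assumes "Im z ~= 0 | Re z > 0" shows "Re (csqrt z) > 0"
proof (rule ccontr)
 assume "~ ?thesis"
 hence "Re (csqrt z) = 0" using csqrt_principal[of z] by auto
 moreover have "z = (csqrt z)^2" by simp
 ultimately have "Re z = - (Im (csqrt z))\<^sup>2" "Im z = 0"
  by (metis Re_power2 diff_0 zero_power2, metis Im_power2 mult_eq_0_iff)
 thus False using assms zero_le_power2[of "Im (csqrt z)"] by linarith
qed

lemma csqrt_Im_sign:
 "Im z > 0 ==> Im (csqrt z) > 0" "Im z < 0 ==> Im (csqrt z) < 0"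
proof -
 have e: "Im z = 2 * Re (csqrt z) * Im (csqrt z)" by (metis Im_power2 power2_csqrt)
 {
  assume i: "Im z > 0"
  have "Re (csqrt z) > 0" by (rule csqrt_Re_pos) (use i in simp)
  moreover have "2 * Re (csqrt z) * Im (csqrt z) > 0" using e i by linarith
  ultimately show "Im (csqrt z) > 0" by (simp add: zero_less_mult_iff)
 }
 {
  assume i: "Im z < 0"
  have "Re (csqrt z) > 0" by (rule csqrt_Re_pos) (use i in simp)
  moreover have "2 * Re (csqrt z) * Im (csqrt z) < 0" using e i by linarith
  ultimately show "Im (csqrt z) < 0" by (simp add: mult_less_0_iff)
 }
qed

lemma csqrt_divide_eq:
 assumes "Re (csqrt x / csqrt y) > 0"
 shows "csqrt (x / y) = csqrt x / csqrt y"
 by (rule csqrt_unique) (use assms in \<open>simp_all add: power_divide\<close>)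

lemma Re_divide_pos_iff: "y ~= 0 ==> Re (x / y) > 0 \<longleftrightarrow> Re x * Re y + Im x * Im y > 0"
 "y ~= 0 ==> Im (x / y) > 0 \<longleftrightarrow> Im x * Re y - Re x * Im y > 0"
 "y ~= 0 ==> Im (x / y) < 0 \<longleftrightarrow> Im x * Re y - Re x * Im y < 0"
proof -
 assume "y ~= 0"
 hence p: "(Re y)\<^sup>2 + (Im y)^2 > 0" by (metis complex_neq_0)
 show "Re (x / y) > 0 \<longleftrightarrow> Re x * Re y + Im x * Im y > 0"
  "Im (x / y) > 0 \<longleftrightarrow> Im x * Re y - Re x * Im y > 0"
  "Im (x / y) < 0 \<longleftrightarrow> Im x * Re y - Re x * Im y < 0"
  using p by (simp_all add: Re_divide Im_divide zero_less_divide_iff divide_less_0_iff)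
qed

text \<open>Both roots lie in the same open quadrant, so their quotient stays in the right
  half-plane.\<close>

lemma csqrt_divide_same_half:
 assumes "(Im x > 0 & Im y > 0) | (Im x < 0 & Im y < 0)"
 shows "csqrt (x / y) = csqrt x / csqrt y"
proof (rule csqrt_divide_eq)
 have p: "Re (csqrt x) > 0" "Re (csqrt y) > 0" using assms by (auto intro!: csqrt_Re_pos)
 have "Im (csqrt x) * Im (csqrt y) > 0"
  using assms csqrt_Im_sign[of x] csqrt_Im_sign[of y] by (auto intro: mult_pos_pos mult_neg_neg)
 moreover have "Re (csqrt x) * Re (csqrt y) > 0" using p by simp
 moreover have "csqrt y ~= 0" using p by auto
 ultimately show "Re (csqrt x / csqrt y) > 0" using Re_divide_pos_iff(1) by simp
qed

text \<open>Both roots have arguments below pi / 4 in absolute value.\<close>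

lemma csqrt_divide_Re_pos:
 assumes "Re x > 0" "Re y > 0"
 shows "csqrt (x / y) = csqrt x / csqrt y"
proof (rule csqrt_divide_eq)
 have p: "Re (csqrt x) > 0" "Re (csqrt y) > 0" using assms by (auto intro!: csqrt_Re_pos)
 have "(abs (Im (csqrt x))) < Re (csqrt x)"
  using assms(1) p(1) power2_less_imp_less[of "(abs (Im (csqrt x)))" "Re (csqrt x)"]
  by (metis Re_power2 abs_ge_zero diff_gt_0_iff_gt less_eq_real_def power2_abs power2_csqrt)
 moreover have "(abs (Im (csqrt y))) < Re (csqrt y)"
  using assms(2) p(2) power2_less_imp_less[of "(abs (Im (csqrt y)))" "Re (csqrt y)"]
  by (metis Re_power2 abs_ge_zero diff_gt_0_iff_gt less_eq_real_def power2_abs power2_csqrt)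
 ultimately have "(abs (Im (csqrt x))) * (abs (Im (csqrt y))) < Re (csqrt x) * Re (csqrt y)"
  by (intro mult_strict_mono') auto
 hence "Re (csqrt x) * Re (csqrt y) + Im (csqrt x) * Im (csqrt y) > 0"
  unfolding abs_mult[symmetric] by linarith
 moreover have "csqrt y ~= 0" using p by auto
 ultimately show "Re (csqrt x / csqrt y) > 0" using Re_divide_pos_iff(1) by simp
qed

lemma csqrt_inverse_eq:
 assumes "Im z ~= 0 | Re z > 0" shows "csqrt (1 / z) = 1 / csqrt z"
proof -
 have p: "Re (csqrt z) > 0" by (rule csqrt_Re_pos[OF assms])
 hence "csqrt z ~= 0" by auto
 hence "Re (1 / csqrt z) > 0" using Re_divide_pos_iff(1)[of "csqrt z" 1] p by simp
 thus ?thesis using csqrt_divide_eq[of 1 z] by simp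
qed

section \<open>Theta constants under translation and inversion\<close>

text \<open>In terms of the eta function, th0, th1 and th2 are eta(z)^2 / eta(2 z), eta(z)^2 / eta(z
  / 2) and, up to a root of unity, eta(z)^2 / eta((z + 1) / 2); the full modular group permutes them
  up to automorphy factors. \<open>th3\<close> is the theta series that defines the half-integral
  weight multiplier, and th0 is its translate by 1/2.\<close>

definition th0 :: "complex => complex" where "th0 z = gtheta z (1/2)"
definition th1 :: "complex => complex" where "th1 z = ee (z / 16) * gtheta z (z / 2)"
definition th2 :: "complex => complex" where "th2 z = ee ((z + 1) / 16) * gtheta z (z / 2 + 1/2)"
definition th3 :: "complex => complex" where "th3 z = gtheta z 0"

lemma th0_T: "th0 (z + 1) = th0 z" by (simp add: th0_def gtheta_fst_add_1)
lemma th1_T: "th1 (z + 1) = th2 z" by (simp add: th1_def th2_def gtheta_fst_add_1 add_divide_distrib)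
lemma th2_T: "th2 (z + 1) = ee (1/8) * th1 z"
proof -
 have "th2 (z + 1) = ee ((z + 1 + 1) / 16) * gtheta z (z / 2 + 1)"
 proof -
  have "(z + 1) / 2 + 1/2 = z / 2 + 1" by (simp add: field_simps)
  thus ?thesis unfolding th2_def gtheta_fst_add_1 by simp
 qed
 also have "(z + 1 + 1) / 16 = 1/8 + z / 16" by (simp add: field_simps)
 finally show ?thesis by (simp only: gtheta_add_1 ee_add th1_def mult_ac)
qed
lemma th3_T: "th3 (z + 1) = th3 z" by (simp add: th3_def gtheta_fst_add_1)
lemma th3_half: "th3 (z + 1/2) = th0 z" unfolding th3_def th0_def gtheta_fst_add_half by simp

lemma th3_T_int: "th3 (z + of_int k) = th3 z"
proof (induction k rule: int_induct[of _ 0])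
 case (step1 i) thus ?case using th3_T[of "z + of_int i"] by (simp add: add_ac)
next
 case (step2 i) thus ?case using th3_T[of "z + of_int (i - 1)"] by (simp add: add_ac)
qed simp

text \<open>Inversion leads to a theta series with z / 4; its even and odd halves coincide, which
  produces the factor 2 and returns to z.\<close>

lemma th0_S:
 assumes "Im z > 0"
 shows "th0 (- 1 / z) = 2 * csqrt (- \<i> * z / 2) * th1 z"
proof -
 have nz: "z ~= 0" using assms by auto
 have A: "Im (z / 4) > 0" using assms by simp
 have "th0 (- 1 / z) = gtheta (- 1 / (4 * (z / 4))) ((z / 4) / (2 * (z / 4)))"
  using nz by (simp add: th0_def)
 also have "... = csqrt (- 2 * \<i> * (z / 4)) * ee ((z / 4)^2 / (4 * (z / 4))) * gtheta (z / 4) (z / 4)"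
  by (rule gtheta_inversion[OF A])
 also have "(z / 4)\<^sup>2 / (4 * (z / 4)) = z / 16" using nz by (simp add: power2_eq_square field_simps)
 also have "- 2 * \<i> * (z / 4) = - \<i> * z / 2" by simp
 also have "gtheta (z / 4) (z / 4) = gtheta z (z / 2) + ee (z / 2) * gtheta z (- (z / 2) + 2 * z)"
  using gtheta_parity[OF A, of "z / 4"] by (simp add: field_simps)
 also have "gtheta z (- (z / 2) + 2 * z) = ee (- z - (- (z / 2))) * gtheta z (z / 2)"
  unfolding gtheta_quasi_period gtheta_minus ..
 also have "ee (z / 2) * (ee (- z - (- (z / 2))) * gtheta z (z / 2)) = gtheta z (z / 2)"
  by (simp add: mult.assoc[symmetric] flip: ee_add)
 finally show ?thesis by (simp add: th1_def)
qed

lemma csqrt_S_product: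
 assumes "Im z > 0"
 shows "2 * csqrt (- \<i> * (- 1 / z) / 2) * csqrt (- \<i> * z / 2) = 1"
proof -
 have nz: "z ~= 0" using assms by auto
 let ?x = "- 2 * \<i> * z"
 have "- \<i> * (- 1 / z) / 2 = 1 / ?x" using nz by (simp add: field_simps)
 moreover have "csqrt (1 / ?x) = 1 / csqrt ?x" by (rule csqrt_inverse_eq) (use assms in simp)
 moreover have "csqrt ?x = 2 * csqrt (- \<i> * z / 2)"
 proof -
  have "csqrt (- \<i> * z / 2 * of_real 4) = csqrt (- \<i> * z / 2) * of_real (sqrt 4)"
   by (rule csqrt_unique) (use csqrt_Re_pos[of "- \<i> * z / 2"] assms in \<open>auto simp: power_mult_distrib\<close>)
  thus ?thesis by (simp add: mult_ac)
 qed
 moreover have "csqrt ?x ~= 0" using nz by simp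
 ultimately show ?thesis by simp
qed

lemma th1_S:
 assumes "Im z > 0"
 shows "th1 (- 1 / z) = csqrt (- \<i> * z / 2) * th0 z"
proof -
 have nz: "z ~= 0" using assms by auto
 have "Im (- 1 / z) > 0" using Im_inversion(1)[of "z / 4"] assms by simp
 from th0_S[OF this] have "th0 z = 2 * csqrt (- \<i> * (- 1 / z) / 2) * th1 (- 1 / z)" using nz by simp
 hence "csqrt (- \<i> * z / 2) * th0 z = (2 * csqrt (- \<i> * (- 1 / z) / 2) * csqrt (- \<i> * z / 2)) * th1 (- 1 / z)"
  by (simp only: mult_ac)
 thus ?thesis unfolding csqrt_S_product[OF assms] by simp
qed

lemma ee_minus_quarter: "ee (- (1/4)) = - \<i>"
proof -
 have "ee (- (1/4)) = cis (- pi / 2)" by (simp add: ee_def cis_conv_exp algebra_simps)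
 also have "... = - \<i>" by (simp add: cis.ctr complex_eq_iff)
 finally show ?thesis .
qed

text \<open>As for th0, but now the odd half is i times the even one, whence 1 + i; its eighth power
  disappears in the discriminant together with ee (- (1/8)).\<close>

lemma th2_S:
 assumes "Im z > 0"
 shows "th2 (- 1 / z) = ((1 + \<i>) * ee (- (1/8))) * csqrt (- \<i> * z / 2) * th2 z"
proof -
 have nz: "z ~= 0" using assms by auto
 have A: "Im (z / 4) > 0" using assms by simp
 let ?B = "z / 4 - 1/4"
 have "th2 (- 1 / z) = ee ((- 1 / z + 1) / 16) * gtheta (- 1 / (4 * (z / 4))) (?B / (2 * (z / 4)))"
 proof -
  have "?B / (2 * (z / 4)) = (- 1 / z) / 2 + 1/2" "- 1 / (4 * (z / 4)) = - 1 / z"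
   using nz by (simp_all add: field_simps)
  thus ?thesis by (simp only: th2_def)
 qed
 also have "gtheta (- 1 / (4 * (z / 4))) (?B / (2 * (z / 4))) =
   csqrt (- 2 * \<i> * (z / 4)) * ee (?B\<^sup>2 / (4 * (z / 4))) * gtheta (z / 4) ?B"
  by (rule gtheta_inversion[OF A])
 also have "- 2 * \<i> * (z / 4) = - \<i> * z / 2" by simp
 also have "gtheta (z / 4) ?B = gtheta z (z / 2 - 1/2) + ee (z / 2 + - (1/4)) * gtheta z (- (z / 2 + 1/2) + 2 * z)"
 proof -
  have "4 * (z / 4) = z" "2 * ?B = z / 2 - 1/2" "z / 4 + ?B = z / 2 + - (1/4)"
   "2 * ?B + z = - (z / 2 + 1/2) + 2 * z" by (simp_all add: field_simps)
  thus ?thesis using gtheta_parity[OF A, of ?B] by (simp only:)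
 qed
 also have "gtheta z (- (z / 2 + 1/2) + 2 * z) = ee (- z - (- (z / 2 + 1/2))) * gtheta z (z / 2 + 1/2)"
  unfolding gtheta_quasi_period gtheta_minus ..
 also have "gtheta z (z / 2 - 1/2) = gtheta z (z / 2 + 1/2)"
  using gtheta_add_1[of z "z / 2 - 1/2"] by (simp add: algebra_simps)
 also have "ee (z / 2 + - (1/4)) * (ee (- z - (- (z / 2 + 1/2))) * gtheta z (z / 2 + 1/2)) = \<i> * gtheta z (z / 2 + 1/2)"
 proof -
  have "ee (z / 2 + - (1/4)) * ee (- z - (- (z / 2 + 1/2))) = ee (- (1/4) + 1/2)"
   unfolding ee_add[symmetric] by (rule arg_cong[of _ _ ee]) (simp add: field_simps)
  also have "... = \<i>" by (simp only: ee_add ee_minus_quarter ee_half) simp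
  finally show ?thesis by (simp only: mult.assoc[symmetric])
 qed
 finally have "th2 (- 1 / z) = csqrt (- \<i> * z / 2) * (1 + \<i>) * (ee ((- 1 / z + 1) / 16) * ee (?B\<^sup>2 / (4 * (z / 4)))) * gtheta z (z / 2 + 1/2)"
  by (simp add: algebra_simps)
 also have "ee ((- 1 / z + 1) / 16) * ee (?B\<^sup>2 / (4 * (z / 4))) = ee (- (1/8)) * ee ((z + 1) / 16)"
  unfolding ee_add[symmetric] by (rule arg_cong[of _ _ ee]) (use nz in \<open>simp add: field_simps power2_eq_square\<close>)
 finally show ?thesis by (simp add: th2_def mult_ac)
qed

lemma th3_S:
 assumes "Im z > 0"
 shows "th3 (- 1 / (4 * z)) = csqrt (- 2 * \<i> * z) * th3 z"
 using gtheta_inversion[OF assms, of 0] by (simp add: th3_def)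

section \<open>The modular action and the theta multiplier on Gamma0(4)\<close>

lemma Im_moebius:
 assumes "a * d - b * c = (1 :: int)" "Im z > 0"
 shows "Im (mob (a,b,c,d) z) = Im z / (norm (aut c d z))^2"
  and "of_int c * z + of_int d ~= (0 :: complex)"
  and "Im (mob (a,b,c,d) z) > 0"
proof -
 have r: "real_of_int a * real_of_int d - real_of_int b * real_of_int c = 1"
  using assms(1) by (metis of_int_1 of_int_diff of_int_mult)
 show nz: "of_int c * z + of_int d ~= (0 :: complex)"
 proof
  assume x: "of_int c * z + of_int d = (0 :: complex)"
  have "Im (aut c d z) = of_int c * Im z" by simp
  hence c: "c = 0" using x assms(2) by simp
  hence "d = 0" using x by simp
  thus False using c assms(1) by simp
 qed
 show 1: "Im (mob (a,b,c,d) z) = Im z / (norm (aut c d z))^2"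
 proof -
  have "Im (mob (a,b,c,d) z) = ((of_int a * of_int d - of_int b * of_int c) * Im z) / (norm (aut c d z))^2"
   unfolding moebius_act_def by (simp add: Im_divide cmod_power2 algebra_simps)
  thus ?thesis using r by simp
 qed
 show "Im (mob (a,b,c,d) z) > 0" unfolding 1 using nz assms(2) by simp
qed

definition mmul :: "mat2 => mat2 => mat2" where
 "mmul g h = (case g of (a,b,c,d) => case h of (a',b',c',d') =>
  (a * a' + b * c', a * b' + b * d', c * a' + d * c', c * b' + d * d'))"

lemma moebius_mmul:
 assumes "of_int c' * z + of_int d' ~= (0 :: complex)"
 shows "mob (mmul (a,b,c,d) (a',b',c',d')) z = mob (a,b,c,d) (mob (a',b',c',d') z)"
  and "of_int (c * a' + d * c') * z + of_int (c * b' + d * d') =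
    (of_int c * mob (a',b',c',d') z + of_int d) * (of_int c' * z + of_int d')"
proof -
 define J where "J = of_int c' * z + of_int d'"
 define N where "N = of_int a' * z + of_int b'"
 have J: "J ~= 0" using assms by (simp add: J_def)
 have e: "of_int x * (N / J) + of_int y = (of_int x * N + of_int y * J) / J" for x y :: int
  using J by (simp add: field_simps)
 have m: "mob (a',b',c',d') z = N / J" by (simp add: moebius_act_def N_def J_def)
 have "mob (a,b,c,d) (mob (a',b',c',d') z) = (of_int a * (N / J) + of_int b) / (of_int c * (N / J) + of_int d)"
  unfolding m by (simp add: moebius_act_def)
 also have "... = (of_int a * N + of_int b * J) / (of_int c * N + of_int d * J)"
  unfolding e using J by simp
 also have "... = mob (mmul (a,b,c,d) (a',b',c',d')) z"
  by (simp add: moebius_act_def mmul_def N_def J_def algebra_simps)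
 finally show "mob (mmul (a,b,c,d) (a',b',c',d')) z = mob (a,b,c,d) (mob (a',b',c',d') z)" ..
 show "of_int (c * a' + d * c') * z + of_int (c * b' + d * d') =
    (of_int c * mob (a',b',c',d') z + of_int d) * (of_int c' * z + of_int d')"
 proof -
  have "(of_int c * (N / J) + of_int d) * J = of_int c * N + of_int d * J" unfolding e using J by simp
  thus ?thesis unfolding m J_def[symmetric] by (simp add: N_def J_def algebra_simps)
 qed
qed

text \<open>The matrix (1, 0; 4, 1) is a translation conjugated by z -> -1 / (4 z). Principal roots
  divide correctly because - 2 i z has positive real part on the half-plane; the case s = -1 is the
  case s = 1 solved for the other side.\<close>

lemma th3_U:
 assumes z: "Im z > 0" and s: "s = 1 | s = (-1 :: int)"
 shows "th3 (z / (4 * of_int s * z + 1)) = csqrt (4 * of_int s * z + 1) * th3 z"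
proof -
 have main: "th3 (z / (4 * z + 1)) = csqrt (4 * z + 1) * th3 z" if z: "Im z > 0" for z
 proof -
  have nz: "z ~= 0" using z by auto
  have nz2: "4 * z + 1 ~= 0" using z by (auto simp: complex_eq_iff)
  define S where "S = z / (4 * z + 1)"
  have S: "Im S > 0" using Im_moebius(3)[of 1 1 0 4 z] z by (simp add: moebius_act_def S_def)
  have nz3: "S ~= 0" using S by auto
  have "- 1 / (4 * S) = - 1 / (4 * z) + of_int (- 1)"
   using nz nz2 by (simp add: S_def field_simps)
  hence 1: "csqrt (- 2 * \<i> * S) * th3 S = csqrt (- 2 * \<i> * z) * th3 z"
   by (metis th3_S[OF S] th3_S[OF z] th3_T_int)
  have 2: "csqrt (- 2 * \<i> * z / (- 2 * \<i> * S)) = csqrt (- 2 * \<i> * z) / csqrt (- 2 * \<i> * S)"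
   by (rule csqrt_divide_Re_pos) (use z S in auto)
  have 3: "- 2 * \<i> * z / (- 2 * \<i> * S) = 4 * z + 1"
   using nz nz2 by (simp add: S_def field_simps)
  have "csqrt (- 2 * \<i> * S) ~= 0" using nz3 by simp
  hence "th3 S = csqrt (- 2 * \<i> * z) / csqrt (- 2 * \<i> * S) * th3 z"
   using 1 by (metis eq_divide_imp mult.commute times_divide_eq_left)
  also have "csqrt (- 2 * \<i> * z) / csqrt (- 2 * \<i> * S) = csqrt (4 * z + 1)"
   unfolding 2[symmetric] 3 ..
  finally show ?thesis unfolding S_def .
 qed
 show ?thesis
 proof (cases "s = 1")
  case True
  thus ?thesis using main[OF z] by simp
 next
  case False
  hence s': "s = -1" using s by auto
  have nz2: "1 - 4 * z ~= 0" using z by (auto simp: complex_eq_iff)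
  define S where "S = z / (1 - 4 * z)"
  have S: "Im S > 0" using Im_moebius(3)[of 1 1 0 "-4" z] z by (simp add: moebius_act_def S_def)
  have f: "4 * S + 1 = 1 / (1 - 4 * z)" using nz2 by (simp add: S_def field_simps)
  have "S / (4 * S + 1) = z" unfolding f using nz2 by (simp add: S_def)
  hence "th3 z = csqrt (1 / (1 - 4 * z)) * th3 S" using main[OF S] f by simp
  also have "csqrt (1 / (1 - 4 * z)) = 1 / csqrt (1 - 4 * z)"
   by (rule csqrt_inverse_eq) (use z in auto)
  finally have "th3 S = csqrt (1 - 4 * z) * th3 z" using nz2 by simp
  thus ?thesis by (simp add: s' S_def)
 qed
qed

text \<open>In one step of the descent csqrt P csqrt Q may differ in sign from csqrt (P Q). The
  extra sign of Shimura's symbol for two negative entries compensates exactly this. The condition on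
  c1 d s says that X and Q lie in the same half-plane precisely for d > 0.\<close>

lemma csqrt_cocycle_sign:
 fixes P Q X :: complex and c1 c2 d s :: int and y :: real
 assumes s: "s = 1 | s = -1" "c1 * d * s < 0" and PQ: "P * Q = X" and y: "y > 0" "y' > 0"
  and Im: "Im X = of_int c1 * y" "Im Q = - 4 * of_int s * y" "Im P = of_int c2 * y'"
 shows "(if c2 < 0 & d < 0 then - 1 else 1) * (csqrt P * csqrt Q) = (if c1 < 0 & d < 0 then - 1 else 1) * csqrt X"
proof -
 have sg: "(s = 1 & c1 * d < 0) | (s = -1 & c1 * d > 0)" using s by auto
 \<comment> \<open>R is a square root of P, so csqrt P is R or - R; the half-planes of X and Q fix
   the half-plane of R, and the sign of c2 decides between the two.\<close>
 define R where "R = csqrt X / csqrt Q"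
 have Q: "Im Q ~= 0" using Im(2) s(1) y by auto
 hence Qnz: "csqrt Q ~= 0" "Q ~= 0" by auto
 have c1: "c1 ~= 0" "d ~= 0" using s(2) by auto
 hence X: "Im X ~= 0" using Im(1) y by simp
 have Rp: "Re (csqrt X) > 0" "Re (csqrt Q) > 0" using X Q by (auto intro: csqrt_Re_pos)
 have R2: "R\<^sup>2 = P" using PQ Qnz by (simp add: R_def power_divide field_simps)
 have RQ: "R * csqrt Q = csqrt X" using Qnz by (simp add: R_def)
 have PX: "P = X / Q" using PQ Qnz by (simp add: field_simps)
 show ?thesis
 proof (cases "d > 0")
  case True
  have "(Im X > 0 & Im Q > 0) | (Im X < 0 & Im Q < 0)"
   using sg True y unfolding Im by (auto simp: zero_less_mult_iff mult_less_0_iff)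
  hence "csqrt P = R" unfolding R_def PX by (rule csqrt_divide_same_half)
  thus ?thesis using True RQ by simp
 next
  case False
  hence d: "d < 0" using c1 by simp
  have ImP: "Im P = 2 * Re R * Im R" using R2 by (metis Im_power2)
  show ?thesis
  proof (cases "c1 > 0")
   case True
   have "Im X > 0" "Im Q < 0" using sg True d y unfolding Im by (auto simp: zero_less_mult_iff mult_less_0_iff)
   hence "Im (csqrt X) > 0" "Im (csqrt Q) < 0" using csqrt_Im_sign by auto
   hence "Im (csqrt X) * Re (csqrt Q) > 0" "Re (csqrt X) * Im (csqrt Q) < 0"
    using Rp by (auto intro: mult_pos_pos mult_pos_neg)
   hence IR: "Im R > 0" unfolding R_def using Re_divide_pos_iff(2)[OF Qnz(1)] by simp
   show ?thesis
   proof (cases "c2 < 0")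
    case c2: True
    hence "Im P < 0" using Im(3) y by (simp add: mult_neg_pos)
    hence "Re R < 0" using ImP IR by (simp add: mult_less_0_iff)
    hence "csqrt P = - R" by (intro csqrt_unique) (use R2 in auto)
    thus ?thesis using True c2 d RQ by simp
   next
    case c2: False
    hence "Im P >= 0" using Im(3) y by simp
    hence "Re R >= 0" using ImP IR by (simp add: zero_le_mult_iff)
    hence "csqrt P = R" by (intro csqrt_unique) (use R2 IR in auto)
    thus ?thesis using True c2 RQ by simp
   qed
  next
   case False
   hence c1': "c1 < 0" using c1 by simp
   have "Im X < 0" "Im Q > 0" using sg c1' d y unfolding Im by (auto simp: zero_less_mult_iff mult_less_0_iff)
   hence "Im (csqrt X) < 0" "Im (csqrt Q) > 0" using csqrt_Im_sign by auto
   hence "Im (csqrt X) * Re (csqrt Q) < 0" "Re (csqrt X) * Im (csqrt Q) > 0"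
    using Rp by (auto intro: mult_pos_pos mult_neg_pos)
   hence IR: "Im R < 0" unfolding R_def using Re_divide_pos_iff(3)[OF Qnz(1)] by simp
   show ?thesis
   proof (cases "c2 < 0")
    case c2: True
    hence "Im P < 0" using Im(3) y by (simp add: mult_neg_pos)
    hence "Re R > 0" using ImP IR by (simp add: mult_less_0_iff)
    hence "csqrt P = R" by (intro csqrt_unique) (use R2 in auto)
    thus ?thesis using c1' c2 d RQ by simp
   next
    case c2: False
    hence "Im P >= 0" using Im(3) y by simp
    hence "Re R <= 0" using ImP IR by (simp add: zero_le_mult_iff)
    hence "csqrt P = - R" by (intro csqrt_unique) (use R2 IR in auto)
    thus ?thesis using c1' c2 d RQ by simp
   qed
  qed
 qed
qed

lemma SL2_coprime: "a * d - b * c = (1 :: int) ==> coprime c d"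
proof (rule coprimeI)
 fix k assume "a * d - b * c = 1" "k dvd c" "k dvd d"
 hence "k dvd a * d - b * c" by (intro dvd_diff dvd_mult)
 thus "is_unit k" using \<open>a * d - b * c = 1\<close> by simp
qed

lemma balanced_remainder:
 fixes c d :: int
 assumes "c ~= 0" shows "EX k. 2 * (abs (d + k * c)) <= (abs c)"
proof -
 define r where "r = d mod (abs c)"
 have r: "0 <= r" "r < (abs c)" using assms by (auto simp: r_def)
 have 1: "d = (abs c) * (d div (abs c)) + r" by (simp add: r_def)
 have 2: "(abs c) = sgn c * c" by (simp add: abs_sgn mult.commute)
 show ?thesis
 proof (cases "2 * r <= (abs c)")
  case True
  have "d + (- sgn c * (d div (abs c))) * c = r" using 1 2 by (simp add: algebra_simps)
  thus ?thesis using True r by (metis abs_of_nonneg)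
 next
  case False
  have "d + (- sgn c * (d div (abs c)) - sgn c) * c = r - (abs c)" using 1 2 by (simp add: algebra_simps)
  moreover have "2 * (abs (r - C)) <= C" if "0 <= r" "r < C" "~ 2 * r <= C" for C
   using that by (simp add: abs_if)
  hence "2 * (abs (r - (abs c))) <= (abs c)" using False r by blast
  ultimately show ?thesis by metis
 qed
qed

text \<open>Euclidean descent on |c|: a translation makes 2 |d| < |c|, then splitting off a lower
  triangular factor replaces c by c + 4 s d, which is smaller. The symbol survives the translation
  by its periodicity in d, and the second move because c changes by a multiple of d; the roots are
  handled by \<open>csqrt_cocycle_sign\<close>.\<close>

theorem th3_transform:
 assumes "a * d - b * c = 1" "4 dvd c" "Im z > 0"
 shows "th3 (mob (a,b,c,d) z) = theta_j (a,b,c,d) z * th3 z"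
 using assms
proof (induction "nat (abs c)" arbitrary: a b c d z rule: less_induct)
 case less
 note det = less.prems(1) and c4 = less.prems(2) and z = less.prems(3)
 show ?case
 proof (cases "c = 0")
  case True
  hence ad: "a * d = 1" using det by simp
  hence "(a = 1 & d = 1) | (a = -1 & d = -1)" using zmult_eq_1_iff by blast
  thus ?thesis
  proof
   assume ad: "a = 1 & d = 1"
   have "theta_j (a,b,c,d) z = 1" using ad True
    by (simp add: theta_j_def shimura_symbol_def eps_odd_def)
   moreover have "mob (a,b,c,d) z = z + of_int b" using ad True by (simp add: moebius_act_def)
   ultimately show ?thesis by (simp add: th3_T_int)
  next
   assume ad: "a = -1 & d = -1"
   have "~ [-1 = 1] (mod (4::int))" by (simp add: cong_def)
   hence "theta_j (a,b,c,d) z = 1" using ad True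
    by (simp add: theta_j_def shimura_symbol_def eps_odd_def csqrt_of_real_nonpos[of "-1", simplified])
   moreover have "mob (a,b,c,d) z = z + of_int (- b)" using ad True by (simp add: moebius_act_def)
   ultimately show ?thesis by (simp only: th3_T_int mult_1)
  qed
 next
  case c0: False
  obtain k where k: "2 * (abs (d + k * c)) <= (abs c)" using balanced_remainder[OF c0] by blast
  define d1 where "d1 = d + k * c"
  define b1 where "b1 = b + k * a"
  have det1: "a * d1 - b1 * c = 1" using det by (simp add: d1_def b1_def algebra_simps)
  have "even c" using c4 by presburger
  hence "even (b1 * c)" by simp
  moreover have "a * d1 = b1 * c + 1" using det1 by simp
  ultimately have "odd (a * d1)" by simp
  hence od1: "odd d1" by simp
  \<comment> \<open>Equality is excluded since d1 is odd and 4 divides c. The strict inequality is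
    what makes |c| decrease.\<close>
  have ned: "2 * (abs d1) ~= (abs c)"
  proof
   assume "2 * (abs d1) = (abs c)"
   hence "4 dvd 2 * d1" using c4 by (metis abs_mult abs_numeral dvd_abs_iff)
   thus False using od1 by presburger
  qed
  have lt: "2 * (abs d1) < (abs c)" using k ned by (simp add: d1_def)
  have d10: "d1 ~= 0" using od1 by auto
  \<comment> \<open>The sign is opposite to that of c d1, so that adding 4 s d1 moves c towards
    0.\<close>
  define s :: int where "s = (if c * d1 > 0 then -1 else 1)"
  have cd: "c * d1 ~= 0" using c0 d10 by simp
  have s: "s = 1 | s = -1" "c * d1 * s < 0" using cd by (auto simp: s_def not_less order_less_le)
  define c2 where "c2 = c + 4 * s * d1"
  define a2 where "a2 = a + 4 * s * b1"
  have det2: "a2 * d1 - b1 * c2 = 1" using det1 by (simp add: a2_def c2_def algebra_simps)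
  have c24: "4 dvd c2" using c4 by (simp add: c2_def)
  have small: "nat (abs c2) < nat (abs c)"
  proof -
   consider "c > 0" "d1 > 0" | "c > 0" "d1 < 0" | "c < 0" "d1 > 0" | "c < 0" "d1 < 0"
    using c0 d10 by linarith
   hence "(abs c2) < (abs c)"
   proof cases
    case 1
    hence "s = -1" by (simp add: s_def)
    thus ?thesis using lt 1 unfolding c2_def by simp
   next
    case 2
    hence "c * d1 < 0" by (rule mult_pos_neg)
    hence "s = 1" by (simp add: s_def)
    thus ?thesis using lt 2 unfolding c2_def by simp
   next
    case 3
    hence "c * d1 < 0" by (rule mult_neg_pos)
    hence "s = 1" by (simp add: s_def)
    thus ?thesis using lt 3 unfolding c2_def by simp
   next
    case 4
    hence "c * d1 > 0" by (rule mult_neg_neg)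
    hence "s = -1" by (simp add: s_def)
    thus ?thesis using lt 4 unfolding c2_def by simp
   qed
   thus ?thesis by simp
  qed
  have step1: "mob (a,b,c,d) (S + of_int k) = mob (a,b1,c,d1) S" for S
   by (simp add: moebius_act_def b1_def d1_def algebra_simps)
  define y where "y = z - of_int k"
  have y: "Im y > 0" "z = y + of_int k" using z by (auto simp: y_def)
  have tj1: "theta_j (a,b,c,d) z = theta_j (a,b1,c,d1) y"
  proof -
   have od: "odd d" using od1 c4 by (auto simp: d1_def)
   have "shimura_symbol c d1 = shimura_symbol c d"
    by (rule shimura_symbol_periodic[OF c4 od SL2_coprime[OF det]]) (simp add: d1_def)
   moreover have "eps_odd d1 = eps_odd d"
   proof -
    have "[d1 = d] (mod 4)" using c4 by (simp add: d1_def cong_iff_dvd_diff)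
    thus ?thesis unfolding eps_odd_def by (metis cong_sym cong_trans)
   qed
   moreover have "of_int c * z + of_int d = of_int c * y + (of_int d1 :: complex)"
    by (simp add: y(2) d1_def algebra_simps)
   ultimately show ?thesis by (simp add: theta_j_def)
  qed
  define Q where "Q = 4 * of_int (- s) * y + 1"
  define r where "r = y / Q"
  have Qnz: "Q ~= 0" using Im_moebius(2)[of 1 1 0 "4 * - s" y] y by (simp add: Q_def)
  have r: "Im r > 0" using Im_moebius(3)[of 1 1 0 "4 * - s" y] y by (simp add: moebius_act_def Q_def r_def)
  have mob: "mob (a,b1,c,d1) y = mob (a2,b1,c2,d1) r"
  proof -
   have "mmul (a2,b1,c2,d1) (1, 0, 4 * - s, 1) = (a,b1,c,d1)"
    by (simp add: mmul_def a2_def c2_def)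
   moreover have "mob (1, 0, 4 * - s, 1) y = r" by (simp add: moebius_act_def r_def Q_def)
   ultimately show ?thesis using moebius_mmul(1)[of "4 * - s" y 1 a2 b1 c2 d1 1 0] Qnz by (simp add: Q_def)
  qed
  have "th3 (mob (a,b,c,d) z) = th3 (mob (a2,b1,c2,d1) r)"
   using step1[of y] mob y(2) by simp
  also have "... = theta_j (a2,b1,c2,d1) r * th3 r"
   by (rule less.hyps[OF small det2 c24 r])
  also have "th3 r = csqrt Q * th3 y"
   unfolding r_def Q_def by (rule th3_U) (use y s in auto)
  also have "th3 y = th3 z" unfolding y(2) th3_T_int ..
  also have "theta_j (a2,b1,c2,d1) r * (csqrt Q * th3 z) = theta_j (a,b,c,d) z * th3 z"
  proof -
   have J: "Jacobi c2 (abs d1) = Jacobi c (abs d1)"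
    by (rule Jacobi_abs_cong[OF od1]) (simp add: c2_def)
   let ?X = "of_int c * y + of_int d1" and ?P = "of_int c2 * r + of_int d1"
   have PQ: "?P * Q = ?X" using Qnz by (simp add: r_def field_simps) (simp add: Q_def c2_def algebra_simps)
   have "(if c2 < 0 & d1 < 0 then - 1 else 1) * (csqrt ?P * csqrt Q) = (if c < 0 & d1 < 0 then - 1 else 1) * csqrt ?X"
    by (rule csqrt_cocycle_sign[OF s PQ y(1) r]) (simp_all add: Q_def)
   moreover have "of_int (shimura_symbol x d1) = (if x < 0 & d1 < 0 then - 1 else 1) * (of_int (Jacobi x (abs d1)) :: complex)" for x
    by (simp add: shimura_symbol_def)
   ultimately have "theta_j (a2,b1,c2,d1) r * csqrt Q = theta_j (a,b1,c,d1) y"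
    unfolding theta_j_def prod.case J by (simp add: mult_ac J)
   thus ?thesis using tj1 by (simp add: mult.assoc[symmetric])
  qed
  finally show ?thesis .
 qed
qed

section \<open>Functional equations of Lambert series with Gaussian coefficients\<close>

lemma ee_surj: "w ~= 0 ==> EX u. ee u = w"
 by (rule exI[of _ "Ln w / (2 * of_real pi * \<i>)"]) (simp add: ee_def)

lemma isCont_holomorphic:
 fixes f :: "complex => complex"
 assumes "f holomorphic_on S" "open S" "z \<in> S"
 shows "isCont f z"
 using holomorphic_on_imp_continuous_on[OF assms(1)] assms(2,3) by (simp add: continuous_on_eq_continuous_at)

lemma norm_ee_lt_1: "Im z > 0 ==> norm (ee z) < 1"
 by (simp add: norm_ee)

lemma ee_nat_mult: "ee (of_int (int k) * z) = ee z ^ k"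
 by (simp add: ee_power)

text \<open>Put q = ee z. The index shift brings in a factor q^(-2n), and q^(-2n) / (1 - w q^n) =
  w^2 / (1 - w q^n) + w q^(-n) + q^(-2n). The last two terms sum to theta values.\<close>

lemma lambert_gauss_quasi_period:
 fixes z B w :: complex
 defines "a \<equiv> %n::int. ee ((of_int n)^2 * z + of_int n * B)"
 assumes z: "Im z > 0" and w: "w ~= 0" "!!n. w * ee (of_int n * z) ~= 1"
 shows "lambert a z (w * ee z) = ee (z - B) * (w^2 * lambert a z w + w * gtheta z (B - z)) + gtheta z B"
proof -
 let ?e = "%n. ee (of_int n * z)"
 have sa: "(%n. norm (a n)) summable_on UNIV" unfolding a_def by (rule gtheta_summable[OF z])
 have s1: "(%n. a n / (1 - w * ?e n)) summable_on UNIV" by (rule lambert_summable[OF z sa w(1)])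
 define b where "b = (%n::int. ee ((of_int n)^2 * z + of_int n * (B - z)))"
 have s2: "b summable_on UNIV" unfolding b_def by (rule gtheta_summable(2)[OF z])
 have s3: "(%n. a (n + (-1))) summable_on UNIV"
  using summable_on_reindex_bij_betw[OF bij_int_shift, of a "-1"] abs_summable_summable[OF sa] by blast
 have ba: "b n * ?e n = a n" for n
  unfolding b_def a_def ee_add[symmetric] by (rule arg_cong[of _ _ ee]) (simp add: algebra_simps)
 have pa: "a (n - 1) * (?e n)^2 = ee (z - B) * a n" for n
  unfolding a_def power2_eq_square ee_add[symmetric]
  by (rule arg_cong[of _ _ ee]) (simp add: algebra_simps power2_eq_square)
 have "lambert a z (w * ee z) = (\<Sum>\<^sub>\<infinity>n. a ((n + 1) - 1) / (1 - w * ?e (n + 1)))"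
  unfolding lambert_def by (intro infsum_cong) (simp add: ring_distribs ee_add mult_ac)
 also have "... = (\<Sum>\<^sub>\<infinity>n. a (n - 1) / (1 - w * ?e n))"
  by (rule infsum_int_shift[of "%n. a (n - 1) / (1 - w * ?e n)" 1])
 also have "... = (\<Sum>\<^sub>\<infinity>n. (ee (z - B) * w^2) * (a n / (1 - w * ?e n)) + ((ee (z - B) * w) * b n + a (n + (-1))))"
 proof (intro infsum_cong)
  fix n
  define e where "e = ?e n"
  define c where "c = ee (z - B)"
  have e: "e ~= 0" "w * e ~= 1" "c ~= 0" using w(2)[of n] by (auto simp: e_def c_def)
  have 1: "a n = a (n - 1) * e^2 / c" using pa[of n] e by (simp add: e_def c_def field_simps)
  have "b n * e = a n" using ba[of n] by (simp add: e_def)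
  hence 2: "b n = a (n - 1) * e / c" using 1 e by (simp add: field_simps power2_eq_square)
  have "1 - w * e ~= 0" using e by simp
  thus "a (n - 1) / (1 - w * ?e n) = (ee (z - B) * w^2) * (a n / (1 - w * ?e n)) + ((ee (z - B) * w) * b n + a (n + (-1)))"
   unfolding e_def[symmetric] c_def[symmetric] 1 2 using e(1,3)
   by (simp add: divide_simps) (simp add: algebra_simps power2_eq_square)
 qed
 also have "... = (\<Sum>\<^sub>\<infinity>n. (ee (z - B) * w^2) * (a n / (1 - w * ?e n))) + ((\<Sum>\<^sub>\<infinity>n. (ee (z - B) * w) * b n) + (\<Sum>\<^sub>\<infinity>n. a (n + (-1))))"
  using infsum_add[OF summable_on_cmult_right[OF s1] summable_on_add[OF summable_on_cmult_right[OF s2] s3]]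
   infsum_add[OF summable_on_cmult_right[OF s2] s3] by metis
 also have "(\<Sum>\<^sub>\<infinity>n. (ee (z - B) * w^2) * (a n / (1 - w * ?e n))) = (ee (z - B) * w^2) * lambert a z w"
  unfolding lambert_def by (rule infsum_cmult_right')
 also have "(\<Sum>\<^sub>\<infinity>n. (ee (z - B) * w) * b n) = (ee (z - B) * w) * gtheta z (B - z)"
  unfolding gtheta_def b_def by (rule infsum_cmult_right')
 also have "(\<Sum>\<^sub>\<infinity>n. a (n + (-1))) = gtheta z B"
  by (subst infsum_int_shift) (simp add: gtheta_def a_def)
 finally show ?thesis by (simp add: algebra_simps)
qed

definition app0 :: "complex => int => complex" where
 "app0 z n = ee ((of_int n)^2 * z + of_int n * (1/2))"

lemma app0_summable: "Im z > 0 ==> (%n. norm (app0 z n)) summable_on UNIV"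
 unfolding app0_def by (rule gtheta_summable)

text \<open>For B = 1/2 the middle theta value sits at a zero of theta, so only the constant defect
  th0 is left.\<close>

lemma lambert_app0_quasi_period:
 assumes z: "Im z > 0" and w: "w ~= 0" "!!n. w * ee (of_int n * z) ~= 1"
 shows "lambert (app0 z) z (w * ee z) = - ee z * w^2 * lambert (app0 z) z w + th0 z"
proof -
 have "gtheta z (1/2 - z) = gtheta z (- (z - 1/2))" by simp
 also have "... = gtheta z (z - 1/2 + 1)" unfolding gtheta_minus gtheta_add_1 ..
 also have "... = 0" using gtheta_zero[of z] by (simp add: add.commute)
 finally have x: "gtheta z (1/2 - z) = 0" .
 have "ee (z - 1/2) = - ee z" unfolding ee_diff ee_half by simp
 thus ?thesis using lambert_gauss_quasi_period[OF z w, of "1/2"] x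
  by (simp add: app0_def[abs_def] th0_def)
qed

section \<open>The rank series inside the unit disc\<close>

text \<open>Generates overpartitions with all parts at most N, with x marking the number of
  parts.\<close>

definition aprod :: "'a => 'a => nat => 'a :: field" where
 "aprod q x N = (\<Prod>k=1..N. (1 + x * q ^ k) / (1 - x * q ^ k))"

lemma aprod_0 [simp]: "aprod q x 0 = 1" by (simp add: aprod_def)
lemma aprod_Suc: "aprod q x (Suc N) = aprod q x N * ((1 + x * q ^ Suc N) / (1 - x * q ^ Suc N))"
 by (simp add: aprod_def)

lemma aprod_add: "aprod q x (K + j) = aprod q x K * aprod q (x * q ^ K) j"
 by (induction j) (simp_all add: aprod_Suc power_add mult_ac)

lemma aprod_real_bound:
 fixes r R :: real
 assumes r: "0 <= r" "r < 1" and R: "0 <= R" "R * r < 1"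
 shows "0 <= aprod r R N" "aprod r R N <= exp (2 * R / ((1 - R * r) * (1 - r)))"
proof -
 have t: "0 <= R * r ^ k" "R * r ^ k <= R * r" if k: "k >= 1" for k
 proof -
  show "0 <= R * r ^ k" using r R by simp
  have "r ^ k <= r ^ 1" using r k by (intro power_decreasing) auto
  thus "R * r ^ k <= R * r" using R by (intro mult_left_mono) auto
 qed
 have f: "0 <= (1 + R * r ^ k) / (1 - R * r ^ k)" "(1 + R * r ^ k) / (1 - R * r ^ k) <= exp (2 * R / (1 - R * r) * r ^ k)" if k: "k >= 1" for k
 proof -
  have p: "1 - R * r ^ k > 0" "1 - R * r > 0" using t[OF k] R by linarith+
  show "0 <= (1 + R * r ^ k) / (1 - R * r ^ k)" using p t[OF k] by simp
  have "(1 + R * r ^ k) / (1 - R * r ^ k) = 1 + 2 * (R * r ^ k) / (1 - R * r ^ k)" using p by (simp add: field_simps)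
  also have "2 * (R * r ^ k) / (1 - R * r ^ k) <= 2 * (R * r ^ k) / (1 - R * r)"
   using t[OF k] p by (intro divide_left_mono) auto
  also have "1 + 2 * (R * r ^ k) / (1 - R * r) <= exp (2 * (R * r ^ k) / (1 - R * r))" by (rule exp_ge_add_one_self)
  finally show "(1 + R * r ^ k) / (1 - R * r ^ k) <= exp (2 * R / (1 - R * r) * r ^ k)" by (simp add: mult_ac)
 qed
 show "0 <= aprod r R N" unfolding aprod_def by (intro prod_nonneg) (use f in auto)
 have "aprod r R N <= (\<Prod>k=1..N. exp (2 * R / (1 - R * r) * r ^ k))"
  unfolding aprod_def by (intro prod_mono) (use f in auto)
 also have "... = exp (\<Sum>k=1..N. 2 * R / (1 - R * r) * r ^ k)" by (simp add: exp_sum)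
 also have "(\<Sum>k=1..N. 2 * R / (1 - R * r) * r ^ k) <= 2 * R / (1 - R * r) * (1 / (1 - r))"
  unfolding sum_distrib_left[symmetric]
 proof (rule mult_left_mono)
  have "(\<Sum>k=1..N. r ^ k) <= (\<Sum>k<Suc N. r ^ k)" using r by (intro sum_mono2) auto
  also have "... = (1 - r ^ Suc N) / (1 - r)" using r by (subst sum_gp_strict) auto
  also have "... <= 1 / (1 - r)" using r by (intro divide_right_mono) auto
  finally show "(\<Sum>k=1..N. r ^ k) <= 1 / (1 - r)" .
 qed (use R in auto)
 finally show "aprod r R N <= exp (2 * R / ((1 - R * r) * (1 - r)))" by simp
qed

lemma aprod_norm_bound:
 fixes q x :: complex
 assumes q: "norm q < 1" and x: "norm x <= r" "r * norm q < 1"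
 shows "norm (aprod q x N) <= aprod (norm q) r N"
  and "norm (aprod q x N) <= exp (2 * r / ((1 - r * norm q) * (1 - norm q)))"
proof -
 have r: "r >= 0" using x(1) norm_ge_zero order_trans by blast
 show 1: "norm (aprod q x N) <= aprod (norm q) r N"
  unfolding aprod_def prod_norm[symmetric]
 proof (intro prod_mono conjI)
  fix k assume k: "k \<in> {1..N}"
  have "norm q ^ k <= norm q ^ 1" using q k by (intro power_decreasing) auto
  hence 2: "r * norm q ^ k <= r * norm q" using r by (intro mult_left_mono) auto
  have 3: "norm (x * q ^ k) <= r * norm q ^ k" unfolding norm_mult norm_power using x by (intro mult_right_mono) auto
  have "norm (1 + x * q ^ k) <= 1 + r * norm q ^ k" using norm_triangle_ineq[of 1 "x * q ^ k"] 3 by simp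
  moreover have "1 - r * norm q ^ k <= norm (1 - x * q ^ k)" using norm_triangle_ineq2[of 1 "x * q ^ k"] 3 by simp
  ultimately show "norm ((1 + x * q ^ k) / (1 - x * q ^ k)) <= (1 + r * norm q ^ k) / (1 - r * norm q ^ k)"
   unfolding norm_divide using 2 x(2) r by (intro frac_le) auto
 qed auto
 also have "... <= exp (2 * r / ((1 - r * norm q) * (1 - norm q)))"
  by (rule aprod_real_bound) (use q x r in auto)
 finally show "norm (aprod q x N) <= exp (2 * r / ((1 - r * norm q) * (1 - norm q)))" .
qed

text \<open>The local version of the gluing in the Liouville argument, for functions whose
  singularities may accumulate at the boundary of S; the powers of q do so at 0.\<close>

lemma removable_extension:
 fixes f :: "complex => complex"
 assumes S: "open S" and hol: "f holomorphic_on S - P"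
  and disc: "!!z. z \<in> S ==> EX r>0. ALL p:P. p ~= z --> r <= dist p z"
  and res: "!!p. p \<in> P ==> p \<in> S ==> ((%u. (u - p) * f u) ---> 0) (at p)"
 shows "EX g. g holomorphic_on S & (ALL u:S - P. g u = f u)"
proof -
 define g where "g = (%z. if z \<in> P then Lim (at z) f else f z)"
 have "g field_differentiable at z" if z: "z \<in> S" for z
 proof -
  obtain r1 where r1: "r1 > 0" "!!p. p \<in> P ==> p ~= z ==> r1 <= dist p z" using disc[OF z] by blast
  obtain r2 where r2: "r2 > 0" "ball z r2 <= S" using S z open_contains_ball by blast
  define r where "r = min r1 r2"
  have r: "r > 0" "ball z r \<inter> P <= {z}" "ball z r <= S"
   using r1 r2 by (force simp: r_def dist_commute)+
  have "EX h. h holomorphic_on ball z r & (ALL u:ball z r. h u = g u)"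
  proof (cases "z \<in> P")
   case False
   hence "ball z r \<inter> P = {}" using r(2) by auto
   hence "f holomorphic_on ball z r" "ALL u:ball z r. f u = g u"
    using r(3) by (auto intro: holomorphic_on_subset[OF hol] simp: g_def)
   thus ?thesis by blast
  next
   case True
   have 1: "f holomorphic_on ball z r - {z}" using r by (intro holomorphic_on_subset[OF hol]) auto
   have 2: "z \<in> interior (ball z r)" using r(1) by simp
   obtain h where h: "h holomorphic_on ball z r" "!!u. u \<in> ball z r - {z} ==> h u = f u"
    using holomorphic_on_extend_lim[OF 1 2] res[OF True z] by auto
   have "isCont h z" by (rule isCont_holomorphic[OF h(1)]) (use r(1) in auto)
   hence "(h ---> h z) (at z)" by (simp add: isCont_def)
   hence "(f ---> h z) (at z)"
    by (rule Lim_transform_within_open[OF _ open_ball[of z r]]) (use r h in auto)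
   hence "Lim (at z) f = h z" by (intro tendsto_Lim) auto
   hence "h u = g u" if "u \<in> ball z r" for u using h(2)[of u] that True r(2) by (cases "u = z") (auto simp: g_def)
   thus ?thesis using h(1) by blast
  qed
  then obtain h where h: "h holomorphic_on ball z r" "!!u. u \<in> ball z r ==> h u = g u" by blast
  hence "g holomorphic_on ball z r" using holomorphic_transform by blast
  thus ?thesis using r(1) by (meson centre_in_ball holomorphic_on_imp_differentiable_at open_ball)
 qed
 hence "g holomorphic_on S" by (auto simp: holomorphic_on_def intro: field_differentiable_at_within)
 thus ?thesis by (intro exI[of _ g]) (auto simp: g_def)
qed

text \<open>For s = w this is the rank series before Abel summation. The second parameter is there
  because replacing w by q w leads through the series with s = q w.\<close>

definition vgen :: "complex => complex => complex => complex" where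
 "vgen q s w = (\<Sum>\<^sub>\<infinity>N. s ^ N * aprod q (1 / w) N)"

lemma aprod_eventually_bounded:
 fixes q x :: complex
 assumes q: "norm q < 1"
 shows "EX C. ALL N. norm (aprod q x N) <= C"
proof -
 have "((%K. norm x * norm q ^ K) ---> norm x * 0) sequentially"
  using q by (intro tendsto_intros LIMSEQ_power_zero) auto
 hence "eventually (%K. norm x * norm q ^ K < 1) sequentially" by (intro order_tendstoD(2)) auto
 then obtain K where K: "norm x * norm q ^ K < 1" by (auto simp: eventually_sequentially)
 define r where "r = norm (x * q ^ K)"
 have r: "r * norm q < 1" "r >= 0"
 proof -
  have "r * norm q <= r * 1" using q by (intro mult_left_mono) (auto simp: r_def)
  thus "r * norm q < 1" "r >= 0" using K by (auto simp: r_def norm_mult norm_power)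
 qed
 define C where "C = norm (aprod q x K) * exp (2 * r / ((1 - r * norm q) * (1 - norm q)))"
 have b: "norm (aprod q x N) <= C" if N: "N >= K" for N
 proof -
  obtain j where j: "N = K + j" using N le_Suc_ex by blast
  have "norm (aprod q (x * q ^ K) j) <= exp (2 * r / ((1 - r * norm q) * (1 - norm q)))"
   by (rule aprod_norm_bound(2)[OF q _ r(1)]) (simp add: r_def)
  thus ?thesis unfolding j aprod_add norm_mult C_def by (intro mult_left_mono) auto
 qed
 define D where "D = Max (insert C ((%N. norm (aprod q x N)) ` {..<K}))"
 have "norm (aprod q x N) <= D" for N
 proof (cases "N < K")
  case True
  thus ?thesis unfolding D_def by (intro Max_ge) auto
 next
  case False
  have "C <= D" unfolding D_def by (intro Max_ge) auto
  thus ?thesis using b[of N] False by linarith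
 qed
 thus ?thesis by blast
qed

lemma vgen_summable:
 fixes q s w :: complex
 assumes q: "norm q < 1" and s: "norm s < 1"
 shows "(%N. s ^ N * aprod q (1 / w) N) summable_on UNIV"
proof -
 obtain C where C: "!!N. norm (aprod q (1 / w) N) <= C" using aprod_eventually_bounded[OF q] by blast
 have "(%N. norm s ^ N * C) summable_on (UNIV :: nat set)"
  using s by (intro summable_on_cmult_left norm_summable_imp_summable_on) (auto intro: summable_geometric)
 thus ?thesis
  by (rule summable_on_norm_bound(1)) (use C in \<open>auto simp: norm_mult norm_power intro: mult_left_mono\<close>)
qed

lemma infsum_nat_split:
 fixes f :: "nat => complex"
 assumes "f summable_on UNIV"
 shows "infsum f UNIV = f 0 + (\<Sum>\<^sub>\<infinity>n. f (Suc n))" "(%n. f (Suc n)) summable_on UNIV"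
proof -
 have s: "f summable_on range Suc" by (rule summable_on_subset_banach[OF assms]) auto
 thus 1: "(%n. f (Suc n)) summable_on UNIV" by (simp add: summable_on_reindex o_def)
 have "infsum f ({0} \<union> range Suc) = infsum f {0} + infsum f (range Suc)"
  by (rule infsum_Un_disjoint) (use s in auto)
 also have "{0} \<union> range Suc = UNIV" using not0_implies_Suc by auto
 finally show "infsum f UNIV = f 0 + (\<Sum>\<^sub>\<infinity>n. f (Suc n))" by (simp add: infsum_reindex o_def)
qed

text \<open>The two contiguity relations below eliminate the auxiliary series with s = q w.\<close>

lemma vgen_functional_equation:
 assumes q: "norm q < 1" "q ~= 0" and w: "0 < norm w" "norm w < 1" "!!k. k >= 1 ==> w ~= q ^ k"
 shows "(1 + q * w) * vgen q (q * w) (q * w) = 1 - q * w^2 - q * w^2 * ((1 + w) * vgen q w w)"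
proof -
 have w0: "w ~= 0" using w by auto
 have qw: "norm (q * w) < 1"
 proof -
  have "norm q * norm w < 1 * 1" using q w by (intro mult_strict_mono) auto
  thus ?thesis by (simp add: norm_mult)
 qed
 have w1: "w ~= 1" using w by auto
 have qw1: "1 + q * w ~= 0"
 proof
  assume "1 + q * w = 0"
  hence "q * w = -1" by (simp add: add_eq_0_iff)
  thus False using qw by simp
 qed
 define A where "A = aprod q (1 / w)"
 have As: "A (Suc N) * (w - q ^ Suc N) = A N * (w + q ^ Suc N)" for N
 proof -
  have "w - q ^ Suc N ~= 0" using w(3)[of "Suc N"] by simp
  thus ?thesis using w0 by (simp add: A_def aprod_Suc field_simps del: power_Suc)
 qed
 define V where "V = vgen q w w"
 define W where "W = vgen q (q * w) w"
 have sV: "(%N. w ^ N * A N) summable_on UNIV" and sW: "(%N. (q * w) ^ N * A N) summable_on UNIV"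
  unfolding A_def using vgen_summable[OF q(1) w(2)] vgen_summable[OF q(1) qw] by auto
 have Vs: "V = 1 + (\<Sum>\<^sub>\<infinity>N. w ^ Suc N * A (Suc N))" and sV': "(%N. w ^ Suc N * A (Suc N)) summable_on UNIV"
  using infsum_nat_split[OF sV] by (simp_all add: V_def vgen_def A_def)
 have Ws: "W = 1 + (\<Sum>\<^sub>\<infinity>N. (q * w) ^ Suc N * A (Suc N))" and sW': "(%N. (q * w) ^ Suc N * A (Suc N)) summable_on UNIV"
  using infsum_nat_split[OF sW] by (simp_all add: W_def vgen_def A_def)
 have "w * (V - 1) - (W - 1) = w * (w * V) + q * w * W"
 proof -
  have "w * (V - 1) - (W - 1) = (\<Sum>\<^sub>\<infinity>N. w * (w ^ Suc N * A (Suc N))) - (\<Sum>\<^sub>\<infinity>N. (q * w) ^ Suc N * A (Suc N))"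
   unfolding Vs Ws by (simp only: infsum_cmult_right' add_diff_cancel_left')
  also have "... = (\<Sum>\<^sub>\<infinity>N. w * (w ^ Suc N * A (Suc N)) - (q * w) ^ Suc N * A (Suc N))"
   using infsum_add[OF summable_on_cmult_right[OF sV', of w] summable_on_uminus[THEN iffD2, OF sW']]
   by (simp only: infsum_uminus diff_conv_add_uminus)
  also have "... = (\<Sum>\<^sub>\<infinity>N. w * w * (w ^ N * A N) + q * w * ((q * w) ^ N * A N))"
  proof (intro infsum_cong)
   fix N
   have "w * (w ^ Suc N * A (Suc N)) - (q * w) ^ Suc N * A (Suc N) = w ^ Suc N * (A (Suc N) * (w - q ^ Suc N))"
    by (simp add: power_mult_distrib algebra_simps)
   also have "... = w * w * (w ^ N * A N) + q * w * ((q * w) ^ N * A N)"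
    unfolding As by (simp add: power_mult_distrib algebra_simps)
   finally show "w * (w ^ Suc N * A (Suc N)) - (q * w) ^ Suc N * A (Suc N) = w * w * (w ^ N * A N) + q * w * ((q * w) ^ N * A N)" .
  qed
  also have "... = w * w * V + q * w * W"
   unfolding V_def W_def vgen_def A_def[symmetric]
   using infsum_add[OF summable_on_cmult_right[OF sV] summable_on_cmult_right[OF sW]] by (simp only: infsum_cmult_right')
  finally show ?thesis by (simp add: mult.assoc)
 qed
 moreover have "W * (1 + q * w) - (1 - w) * (w * V + 1) = (w * (w * V) + q * w * W) - (w * (V - 1) - (W - 1))"
  by (simp add: algebra_simps)
 ultimately have W: "W * (1 + q * w) = (1 - w) * (w * V + 1)" by simp
 \<comment> \<open>The second relation: splitting off the first factor of the product at 1 / (q w)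
   leaves the product at 1 / w, so the new series is again the auxiliary one.\<close>
 have "vgen q (q * w) (q * w) = 1 + (\<Sum>\<^sub>\<infinity>N. (q * w) ^ Suc N * aprod q (1 / (q * w)) (Suc N))"
  using infsum_nat_split(1)[OF vgen_summable[OF q(1) qw, of "q * w"]] by (simp add: vgen_def)
 also have "(\<Sum>\<^sub>\<infinity>N. (q * w) ^ Suc N * aprod q (1 / (q * w)) (Suc N)) = (\<Sum>\<^sub>\<infinity>N. (q * w * (w + 1) / (w - 1)) * ((q * w) ^ N * A N))"
 proof (intro infsum_cong)
  fix N
  have "aprod q (1 / (q * w)) (Suc N) = aprod q (1 / (q * w)) 1 * aprod q (1 / (q * w) * q ^ 1) N"
   using aprod_add[of q "1 / (q * w)" 1 N] by simp
  also have "1 / (q * w) * q ^ 1 = 1 / w" using q w0 by simp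
  also have "aprod q (1 / (q * w)) 1 = (w + 1) / (w - 1)"
   using q(2) w0 w1 by (simp add: aprod_def field_simps)
  finally show "(q * w) ^ Suc N * aprod q (1 / (q * w)) (Suc N) = (q * w * (w + 1) / (w - 1)) * ((q * w) ^ N * A N)"
   by (simp add: A_def)
 qed
 also have "... = (q * w * (w + 1) / (w - 1)) * W" unfolding W_def vgen_def A_def by (rule infsum_cmult_right')
 finally have "(1 + q * w) * vgen q (q * w) (q * w) = (1 + q * w) + (q * w * (w + 1) / (w - 1)) * (W * (1 + q * w))"
  by (simp add: algebra_simps)
 also have "... = (1 + q * w) - q * w * (w + 1) * (w * V + 1)"
  unfolding W using w1 by (simp add: field_simps)
 also have "... = 1 - q * w^2 - q * w^2 * ((1 + w) * V)" by (simp add: algebra_simps power2_eq_square)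
 finally show ?thesis by (simp add: V_def)
qed

text \<open>Beyond an index K with |q|^K < r the factors have no poles in r < |w| < 1, so all
  singularities sit in finitely many explicit products and the tail T is holomorphic.\<close>

lemma vgen_local_structure:
 assumes q: "norm q < 1" "q ~= 0" and r: "0 < r" "r < 1"
 shows "EX K T. T holomorphic_on {w. r < norm w & norm w < 1} & (ALL m>K. norm q ^ m < r) &
  (ALL w. r < norm w --> norm w < 1 -->
    vgen q w w = (\<Sum>N<K. w ^ N * aprod q (1 / w) N) + w ^ K * aprod q (1 / w) K * T w)"
proof -
 let ?S = "{w :: complex. r < norm w & norm w < 1}"
 have op: "open ?S" by (intro open_Collect_conj open_Collect_less continuous_intros)
 have "((%K. norm q ^ K) ---> 0) sequentially" using q by (intro LIMSEQ_power_zero) auto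
 hence "eventually (%K. norm q ^ K < r) sequentially" by (rule order_tendstoD(2)) (use r in auto)
 then obtain K where K: "norm q ^ K < r" by (auto simp: eventually_sequentially)
 have Km: "norm q ^ m < r" if "m > K" for m
 proof -
  have "norm q ^ m <= norm q ^ K" using that q by (intro power_decreasing) auto
  thus ?thesis using K by linarith
 qed
 define R where "R = norm q ^ K / r"
 have R: "R >= 0" "R * norm q < 1"
 proof -
  show "R >= 0" using r by (simp add: R_def)
  have "R < 1" using K r by (simp add: R_def)
  hence "R * norm q <= 1 * norm q" by (intro mult_right_mono) auto
  thus "R * norm q < 1" using q(1) by linarith
 qed
 define C where "C = exp (2 * R / ((1 - R * norm q) * (1 - norm q)))"
 let ?t = "%j w. w ^ j * aprod q (1 / w * q ^ K) j"
 have nx: "norm (1 / w * q ^ K) <= R" if "w \<in> ?S" for w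
 proof -
  have "0 < norm w" "r <= norm w" using that r by auto
  thus ?thesis using r by (auto simp: norm_mult norm_divide norm_power R_def intro!: divide_left_mono mult_pos_pos)
 qed
 have bd: "norm (?t j w) <= norm w ^ j * C" if "w \<in> ?S" for j w
  unfolding norm_mult norm_power C_def
  by (intro mult_left_mono aprod_norm_bound(2)[OF q(1) nx[OF that] R(2)]) auto
 have den: "1 - 1 / w * q ^ K * q ^ k ~= 0" if w: "w \<in> ?S" and k: "k >= 1" for w k
 proof -
  have "norm q ^ k <= norm q ^ 1" using q k by (intro power_decreasing) auto
  hence "norm (1 / w * q ^ K * q ^ k) <= R * norm q"
   unfolding norm_mult[of _ "q ^ k"] norm_power[of q k] using nx[OF w] R(1) by (intro mult_mono) auto
  hence "norm (1 / w * q ^ K * q ^ k) < 1" using R(2) by linarith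
  thus ?thesis by auto
 qed
 have hol: "(%w. \<Sum>\<^sub>\<infinity>j. ?t j w) holomorphic_on ?S"
 proof (rule holomorphic_infsum[OF op])
  fix j
  show "?t j holomorphic_on ?S" unfolding aprod_def
   by (intro holomorphic_intros) (use den r in auto)
 next
  fix z assume z: "z \<in> ?S"
  define s where "s = (norm z + 1) / 2"
  have s: "norm z < s" "s < 1" using z by (auto simp: s_def)
  have "open (?S \<inter> ball 0 s)" by (intro open_Int op open_ball)
  moreover have "z \<in> ?S \<inter> ball 0 s" using z s by auto
  ultimately obtain e where e: "e > 0" "cball z e <= ?S \<inter> ball 0 s" using open_contains_cball by metis
  have "s > 0" unfolding s_def by (intro divide_pos_pos add_nonneg_pos) auto
  hence "summable (%j. norm (s ^ j))" using s by (simp add: norm_power summable_geometric)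
  hence "(%j. s ^ j * C) summable_on (UNIV :: nat set)"
   by (intro summable_on_cmult_left norm_summable_imp_summable_on)
  moreover have "norm (?t j w) <= s ^ j * C" if w: "w \<in> cball z e" for j w
  proof -
   have w': "w \<in> ?S" "norm w < s" using e(2) w by auto
   have "norm w ^ j * C <= s ^ j * C" using w' by (intro mult_right_mono power_mono) (auto simp: C_def)
   thus ?thesis using bd[OF w'(1), of j] by linarith
  qed
  ultimately show "EX r'>0. EX M. cball z r' <= ?S & M summable_on UNIV & (ALL n:UNIV. ALL w:cball z r'. norm (?t n w) <= M n)"
   using e by (intro exI[of _ e] exI[of _ "%j. s ^ j * C"]) auto
 qed
 have eq: "vgen q w w = (\<Sum>N<K. w ^ N * aprod q (1 / w) N) + w ^ K * aprod q (1 / w) K * (\<Sum>\<^sub>\<infinity>j. ?t j w)"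
  if w: "w \<in> ?S" for w
 proof -
  let ?f = "%N. w ^ N * aprod q (1 / w) N"
  have s: "?f summable_on UNIV" using vgen_summable[OF q(1)] w by auto
  have i: "inj (%j. K + j)" by simp
  have sK: "?f summable_on range (%j. K + j)" by (rule summable_on_subset_banach[OF s]) auto
  have "infsum ?f ({..<K} \<union> range (%j. K + j)) = infsum ?f {..<K} + infsum ?f (range (%j. K + j))"
   by (rule infsum_Un_disjoint) (use sK in auto)
  also have "{..<K} \<union> range (%j. K + j) = UNIV"
  proof (intro equalityI subsetI UNIV_I)
   fix n :: nat show "n \<in> {..<K} \<union> range (%j. K + j)"
    using le_Suc_ex[of K n] by (cases "n < K") auto
  qed
  also have "infsum ?f (range (%j. K + j)) = (\<Sum>\<^sub>\<infinity>j. (w ^ K * aprod q (1 / w) K) * ?t j w)"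
   unfolding infsum_reindex[OF i] by (intro infsum_cong) (simp add: aprod_add power_add mult_ac)
  also have "... = w ^ K * aprod q (1 / w) K * (\<Sum>\<^sub>\<infinity>j. ?t j w)" by (rule infsum_cmult_right')
  finally show ?thesis by (simp add: vgen_def)
 qed
 show ?thesis using hol Km eq by (intro exI[of _ K] exI[of _ "%w. \<Sum>\<^sub>\<infinity>j. ?t j w"]) auto
qed

lemma norm_powers_distinct:
 assumes "norm (q :: complex) < 1" "q ~= 0" "q ^ k = q ^ m" shows "k = m"
proof (rule ccontr)
 assume "k ~= m"
 hence "norm q ^ k ~= norm q ^ m" using assms(1,2) power_inject_exp'[of "norm q" k m] by auto
 thus False using assms(3) by (metis norm_power)
qed

lemma aprod_pole_limit:
 fixes q :: complex
 assumes q: "norm q < 1" "q ~= 0"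
 shows "EX L. ((%w. (w - q ^ m) * aprod q (1 / w) N) ---> L) (at (q ^ m))"
proof -
 let ?p = "q ^ m"
 let ?f = "%k w. (1 + 1 / w * q ^ k) / (1 - 1 / w * q ^ k)"
 have p0: "?p ~= 0" using q by simp
 have lim: "(?f k ---> ?f k ?p) (at ?p)" if "k ~= m" for k
 proof (intro tendsto_intros p0)
  have "q ^ k ~= ?p" using norm_powers_distinct[OF q] that by blast
  thus "1 - 1 / ?p * q ^ k ~= 0" using p0 by (simp add: field_simps)
 qed
 show ?thesis
 proof (cases "m \<in> {1..N}")
  case False
  have "((%w. (w - ?p) * (\<Prod>k=1..N. ?f k w)) ---> (?p - ?p) * (\<Prod>k=1..N. ?f k ?p)) (at ?p)"
   by (intro tendsto_intros lim) (use False in auto)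
  thus ?thesis unfolding aprod_def by blast
 next
  case True
  have "((%w. (w + ?p) * (\<Prod>k\<in>{1..N} - {m}. ?f k w)) ---> (?p + ?p) * (\<Prod>k\<in>{1..N} - {m}. ?f k ?p)) (at ?p)"
   by (intro tendsto_intros lim) auto
  hence "((%w. (w - ?p) * aprod q (1 / w) N) ---> (?p + ?p) * (\<Prod>k\<in>{1..N} - {m}. ?f k ?p)) (at ?p)"
  proof (rule Lim_transform_within_open[where s = "- {0}"])
   fix w assume w: "w \<in> - {0 :: complex}" "w ~= ?p"
   have e1: "aprod q (1 / w) N = ?f m w * (\<Prod>k\<in>{1..N} - {m}. ?f k w)"
    unfolding aprod_def by (rule prod.remove) (use True in auto)
   have e2: "(w - ?p) * ?f m w = w + ?p" using w by (simp add: field_simps)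
   show "(w + ?p) * (\<Prod>k\<in>{1..N} - {m}. ?f k w) = (w - ?p) * aprod q (1 / w) N"
    by (simp only: e1 mult.assoc[symmetric] e2)
  qed (use p0 in auto)
  thus ?thesis by blast
 qed
qed

lemma
 assumes q: "norm q < 1" "q ~= 0"
 shows vgen_holomorphic: "(%w. vgen q w w) holomorphic_on {w. 0 < norm w & norm w < 1} - {q ^ k | k. k >= 1}"
  and vgen_pole_limit: "m >= 1 ==> EX L. ((%w. (w - q ^ m) * vgen q w w) ---> L) (at (q ^ m))"
proof -
 let ?D = "{w. 0 < norm w & norm w < 1} - {q ^ k | k. k >= 1}"
 have "(%w. vgen q w w) field_differentiable at w" if w: "w \<in> ?D" for w
 proof -
  have r: "0 < norm w / 2" "norm w / 2 < 1" "norm w / 2 < norm w" using w by auto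
  obtain K T where KT: "T holomorphic_on {v. norm w / 2 < norm v & norm v < 1}" "ALL m>K. norm q ^ m < norm w / 2"
   "!!v. norm w / 2 < norm v ==> norm v < 1 ==>
    vgen q v v = (\<Sum>N<K. v ^ N * aprod q (1 / v) N) + v ^ K * aprod q (1 / v) K * T v"
   using vgen_local_structure[OF q r(1,2)] by blast
  let ?S = "{v :: complex. norm w / 2 < norm v & norm v < 1} - (%k. q ^ k) ` {1..K}"
  have S: "open ?S" by (intro open_Diff finite_imp_closed finite_imageI open_Collect_conj open_Collect_less continuous_intros) auto
  have ap: "(%v. aprod q (1 / v) N) holomorphic_on ?S" if "N <= K" for N
   unfolding aprod_def
  proof (intro holomorphic_intros)
   fix v k assume v: "v \<in> ?S" and k: "k \<in> {1..N}"
   show "v ~= 0" using v r by auto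
   have "v ~= q ^ k" using v k that by auto
   thus "1 - 1 / v * q ^ k ~= 0" using \<open>v ~= 0\<close> by (simp add: field_simps)
  qed (use r in auto)
  have T: "T holomorphic_on ?S" by (rule holomorphic_on_subset[OF KT(1)]) auto
  have "(%v. (\<Sum>N<K. v ^ N * aprod q (1 / v) N) + v ^ K * aprod q (1 / v) K * T v) holomorphic_on ?S"
   by (intro holomorphic_intros ap T) auto
  hence "(%v. vgen q v v) holomorphic_on ?S"
   by (rule holomorphic_transform) (use KT(3) in auto)
  moreover have "w \<in> ?S" using w r by auto
  ultimately show ?thesis using S holomorphic_on_imp_differentiable_at by blast
 qed
 thus "(%w. vgen q w w) holomorphic_on ?D"
  unfolding holomorphic_on_def by (blast intro: field_differentiable_at_within)
 show "EX L. ((%w. (w - q ^ m) * vgen q w w) ---> L) (at (q ^ m))" if m: "m >= 1"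
 proof -
  let ?p = "q ^ m"
  have np: "0 < norm ?p" "norm ?p < 1"
   using q m power_less_one_iff[of "norm q" m] by (auto simp: norm_power)
  hence r: "0 < norm ?p / 2" "norm ?p / 2 < 1" "norm ?p / 2 < norm ?p" by auto
  obtain K T where KT: "T holomorphic_on {v. norm ?p / 2 < norm v & norm v < 1}"
   "!!v. norm ?p / 2 < norm v ==> norm v < 1 ==>
    vgen q v v = (\<Sum>N<K. v ^ N * aprod q (1 / v) N) + v ^ K * aprod q (1 / v) K * T v"
   using vgen_local_structure[OF q r(1,2)] by blast
  let ?S = "{v :: complex. norm ?p / 2 < norm v & norm v < 1}"
  have S: "open ?S" by (intro open_Collect_conj open_Collect_less continuous_intros)
  have pS: "?p \<in> ?S" using np r by auto
  have "ALL N. EX L. ((%w. (w - ?p) * aprod q (1 / w) N) ---> L) (at ?p)" using aprod_pole_limit[OF q] by blast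
  then obtain L where L: "!!N. ((%w. (w - ?p) * aprod q (1 / w) N) ---> L N) (at ?p)" by metis
  have T: "(T ---> T ?p) (at ?p)"
   using KT(1) S pS by (meson analytic_at analytic_at_imp_isCont isCont_def)
  have "((%w. (\<Sum>N<K. w ^ N * ((w - ?p) * aprod q (1 / w) N)) + w ^ K * ((w - ?p) * aprod q (1 / w) K) * T w) \<longlongrightarrow>
    (\<Sum>N<K. ?p ^ N * L N) + ?p ^ K * L K * T ?p) (at ?p)"
   by (intro tendsto_intros L T)
  hence "((%w. (w - ?p) * vgen q w w) ---> (\<Sum>N<K. ?p ^ N * L N) + ?p ^ K * L K * T ?p) (at ?p)"
   by (rule Lim_transform_within_open[OF _ S pS])
    (use KT(2) in \<open>auto simp: distrib_left sum_distrib_left mult_ac\<close>)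
  thus ?thesis by blast
 qed
qed

text \<open>A theta function in the multiplicative variable, vanishing exactly at the integral
  powers of ee z. It clears the poles of both sides of the identity between \<open>vgen\<close> and
  the Lambert series.\<close>

definition thw :: "complex => complex => complex" where
 "thw z w = (\<Sum>\<^sub>\<infinity>n::int. ee ((of_int n)^2 * (z / 2) + of_int n * (1/2 - z / 2)) * w powi n)"

lemma ee_powi: "ee u powi n = ee (of_int n * u)"
proof (cases "n >= 0")
 case True
 then obtain k where "n = int k" using zero_le_imp_eq_int by blast
 thus ?thesis by (simp add: ee_power)
next
 case False
 then obtain k where "n = - int k" by (metis zero_le_imp_eq_int minus_minus neg_0_le_iff_le linear)
 thus ?thesis by (simp add: ee_power ee_minus power_int_minus)
qed

lemma thw_ee: "thw z (ee u) = gtheta (z / 2) (u - z / 2 + 1/2)"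
 unfolding thw_def gtheta_def ee_powi ee_add[symmetric]
 by (intro infsum_cong arg_cong[of _ _ ee]) (simp add: algebra_simps)

lemma thw_holomorphic:
 assumes z: "Im z > 0"
 shows "thw z holomorphic_on - {0}"
proof -
 let ?c = "%n::int. ee ((of_int n)^2 * (z / 2) + of_int n * (1/2 - z / 2))"
 have "(%w. \<Sum>\<^sub>\<infinity>n. ?c n * w powi n) holomorphic_on - {0}"
 proof (rule holomorphic_infsum)
  fix n show "(%w. ?c n * w powi n) holomorphic_on - {0}"
   by (intro holomorphic_intros) auto
 next
  fix x :: complex assume x: "x \<in> - {0}"
  define r where "r = norm x / 2"
  have r: "r > 0" using x by (simp add: r_def)
  define b where "b = max (ln (3 * r)) (- ln r)"
  have pw: "norm (w powi n) <= exp (b * (abs (of_int n)))" if w: "w \<in> cball x r" for w n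
  proof -
   have "norm x - norm w <= r" "norm w - norm x <= r"
    using w norm_triangle_ineq2[of x w] norm_triangle_ineq2[of w x] by (auto simp: dist_norm norm_minus_commute)
   hence wb: "r <= norm w" "norm w <= 3 * r" by (auto simp: r_def)
   hence w0: "norm w > 0" using r by linarith
   have l: "ln (norm w) <= ln (3 * r)" "ln r <= ln (norm w)" using wb w0 r by simp_all
   have "norm (w powi n) = exp (of_int n * ln (norm w))"
    using w0 by (simp add: norm_power_int powr_real_of_int'[symmetric] powr_def)
   also have "of_int n * ln (norm w) <= b * (abs (of_int n))"
   proof (cases "n >= 0")
    case True
    have "of_int n * ln (norm w) <= of_int n * b" using l True by (intro mult_left_mono) (auto simp: b_def)
    thus ?thesis using True by (simp add: mult.commute)
   next
    case False
    have "of_int (- n) * (- ln (norm w)) <= of_int (- n) * b" using l False by (intro mult_left_mono) (auto simp: b_def)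
    thus ?thesis using False by (simp add: mult.commute)
   qed
   finally show ?thesis by simp
  qed
  define M where "M = (%n::int. exp (- (pi * Im z) * (of_int n)^2 + (pi * Im z + b) * (abs (of_int n))))"
  have sM: "M summable_on UNIV" unfolding M_def by (rule summable_int_gaussian) (use z in simp)
  have "norm (?c n * w powi n) <= M n" if w: "w \<in> cball x r" for n w
  proof -
   have "norm (?c n) = exp (- (pi * Im z) * (of_int n)^2 + pi * Im z * of_int n)"
    by (simp add: norm_ee power2_eq_square algebra_simps)
   also have "... <= exp (- (pi * Im z) * (of_int n)^2 + pi * Im z * (abs (of_int n)))"
    using z by (simp add: mult_left_mono)
   finally have "norm (?c n * w powi n) <= exp (- (pi * Im z) * (of_int n)^2 + pi * Im z * (abs (of_int n))) * exp (b * (abs (of_int n)))"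
    unfolding norm_mult using pw[OF w] by (intro mult_mono) auto
   thus ?thesis by (simp add: M_def algebra_simps flip: exp_add)
  qed
  moreover have "cball x r <= - {0}" using r by (auto simp: r_def dist_norm)
  ultimately show "EX r>0. EX M. cball x r <= - {0} & M summable_on UNIV &
    (ALL n:UNIV. ALL w:cball x r. norm (?c n * w powi n) <= M n)"
   using r sM by blast
 qed auto
 thus ?thesis by (simp add: thw_def[abs_def])
qed

lemma thw_quasi_period:
 assumes "w ~= 0" shows "thw z (w * ee z) * w = - thw z w"
proof -
 obtain u where u: "ee u = w" using ee_surj[OF assms] by blast
 have "w * ee z = ee (u + z)" by (simp add: ee_add u)
 hence "thw z (w * ee z) = gtheta (z / 2) (u + z - z / 2 + 1/2)" by (simp only: thw_ee)
 also have "u + z - z / 2 + 1/2 = (u - z / 2 + 1/2) + 2 * (z / 2)" by simp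
 also have "gtheta (z / 2) ... = ee (- (z / 2) - (u - z / 2 + 1/2)) * thw z (ee u)"
  unfolding gtheta_quasi_period thw_ee ..
 also have "- (z / 2) - (u - z / 2 + 1/2) = - u - 1/2" by simp
 also have "ee (- u - 1/2) = - inverse w" by (simp add: ee_diff ee_minus ee_half u)
 finally show ?thesis using assms u by simp
qed

lemma thw_eq_0_iff:
 assumes z: "Im z > 0" and w: "w ~= 0"
 shows "thw z w = 0 \<longleftrightarrow> (EX n. w * ee (of_int n * z) = 1)"
proof -
 obtain u where u: "ee u = w" using ee_surj[OF w] by blast
 have A: "Im (z / 2) > 0" using z by simp
 let ?B = "u - z / 2 + 1/2"
 have "thw z w = 0 \<longleftrightarrow> ?B \<in> theta_zeros (z / 2)"
  using gtheta_nonzero[OF A, of ?B] theta_law_zeros[OF A gtheta_laws[OF A], of ?B] thw_ee[of z u] u by metis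
 also have "... \<longleftrightarrow> (EX n. w * ee (of_int n * z) = 1)"
 proof -
  have "ee (?B + (z / 2 + 1/2)) = w" unfolding u[symmetric] by (rule ee_eqI[of _ _ 1]) simp
  thus ?thesis unfolding theta_zeros_iff by simp
 qed
 finally show ?thesis .
qed

lemma power_set_discrete:
 assumes q: "norm (q :: complex) < 1" "q ~= 0" and z: "z ~= 0"
 shows "EX r>0. ALL p:{q ^ k | k. k >= 1}. p ~= z --> r <= dist p z"
proof -
 have "((%K. norm q ^ K) ---> 0) sequentially" using q by (intro LIMSEQ_power_zero) auto
 hence "eventually (%K. norm q ^ K < norm z / 2) sequentially" by (rule order_tendstoD(2)) (use z in auto)
 then obtain K where K: "!!k. k >= K ==> norm q ^ k < norm z / 2" by (auto simp: eventually_sequentially)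
 obtain d where d: "d > 0" "!!p. p \<in> (%k. q ^ k) ` {..<K} ==> p ~= z ==> d <= dist z p"
  using finite_set_avoid[of "(%k. q ^ k) ` {..<K}" z] by blast
 show ?thesis
 proof (intro exI[of _ "min d (norm z / 2)"] conjI ballI impI)
  fix p assume p: "p \<in> {q ^ k | k. k >= 1}" "p ~= z"
  then obtain k where k: "p = q ^ k" by blast
  show "min d (norm z / 2) <= dist p z"
  proof (cases "k < K")
   case True
   thus ?thesis using d(2)[of p] k p by (auto simp: dist_commute)
  next
   case False
   hence "norm p < norm z / 2" using K[of k] by (simp add: k norm_power)
   moreover have "norm z - norm p <= dist p z" using norm_triangle_ineq2[of z p] by (simp add: dist_norm norm_minus_commute)
   ultimately show ?thesis by linarith
  qed
 qed (use d z in auto)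
qed

text \<open>The law keeps g bounded near 0, so g extends to 0 and vanishes there. A zero of finite
  order n, with cofactor H, would give q^n H 0 = 0 after cancelling the powers of v.\<close>

lemma superexponential_zero:
 fixes g :: "complex => complex"
 assumes q: "norm q < 1" "q ~= 0" and g: "g holomorphic_on {w. 0 < norm w & norm w < 1}"
  and law: "!!w. 0 < norm w ==> norm w < 1 ==> g (q * w) = q * w * g w"
  and w: "0 < norm w" "norm w < 1"
 shows "g w = 0"
proof -
 let ?D = "{w. 0 < norm w & norm w < (1 :: real)} :: complex set"
 define s :: real where "s = 1/2"
 have D: "?D = ball 0 1 - {0}" by auto
 define K where "K = cball 0 s - ball (0 :: complex) (norm q * s)"
 have "compact K" unfolding K_def by (intro compact_diff compact_cball open_ball)
 moreover have KD: "K <= ?D" using q by (auto simp: K_def s_def dist_norm)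
 moreover have "continuous_on K g"
  using holomorphic_on_imp_continuous_on[OF g] KD continuous_on_subset by blast
 ultimately have "compact (g ` K)" by (intro compact_continuous_image)
 then obtain C where C: "!!w. w \<in> K ==> norm (g w) <= C"
  using compact_imp_bounded bounded_iff by (metis imageI)
 have step: "norm (g (q ^ k * v)) <= norm (g v)" if v: "0 < norm v" "norm v < 1" for k v
 proof (induction k)
  case (Suc k)
  have nk: "norm q ^ k <= 1" using q by (intro power_le_one) auto
  have "norm q ^ k * norm v <= 1 * norm v" by (rule mult_right_mono[OF nk]) auto
  hence n: "0 < norm (q ^ k * v)" "norm (q ^ k * v) < 1"
   using v q by (simp_all only: norm_mult norm_power) auto
  have "g (q ^ Suc k * v) = q * (q ^ k * v) * g (q ^ k * v)" using law[OF n] by (simp add: mult.assoc)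
  hence "norm (g (q ^ Suc k * v)) = norm q * norm (q ^ k * v) * norm (g (q ^ k * v))" by (simp add: norm_mult)
  also have "... <= 1 * norm (g (q ^ k * v))"
   using q n by (intro mult_right_mono) (auto simp: mult_le_one less_imp_le)
  finally show ?case using Suc by simp
 qed simp
 have bdd: "norm (g v) <= C" if v: "0 < norm v" "norm v <= s" for v
 proof -
  have "((%k. norm q ^ k * s) ---> 0 * s) sequentially" using q by (intro tendsto_intros LIMSEQ_power_zero) auto
  hence "eventually (%k. norm q ^ k * s < norm v) sequentially" by (rule order_tendstoD(2)) (use v in auto)
  then obtain k0 where k0: "norm q ^ k0 * s < norm v" by (auto simp: eventually_sequentially)
  \<comment> \<open>k is the first index at which the circle of radius |q|^k s lies inside |v|;
    dividing v by q^(k-1) then lands in the compact annulus K.\<close>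
  define k where "k = (LEAST k. norm q ^ k * s < norm v)"
  have k: "norm q ^ k * s < norm v" unfolding k_def by (rule LeastI[of "%k. norm q ^ k * s < norm v", OF k0])
  have "k ~= 0" using k v(2) by (intro notI) auto
  then obtain j where j: "k = Suc j" using not0_implies_Suc by blast
  have j2: "norm v <= norm q ^ j * s" using not_less_Least[of j "%k. norm q ^ k * s < norm v"] j k_def by simp
  define w0 where "w0 = v / q ^ j"
  have n: "norm w0 = norm v / norm q ^ j" by (simp add: w0_def norm_divide norm_power)
  have "norm w0 <= s" "norm q * s <= norm w0" using j2 k q by (auto simp: n j field_simps)
  hence "w0 \<in> K" by (auto simp: K_def)
  hence "norm (g w0) <= C" "w0 \<in> ?D" using C KD by auto
  moreover have "v = q ^ j * w0" using q by (simp add: w0_def)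
  ultimately show ?thesis using step[of w0 j] by auto
 qed
 have "EX G. G holomorphic_on ball 0 1 & (ALL v:ball 0 1 - {0}. G v = g v)"
 proof (rule iffD2[OF holomorphic_on_extend_bounded])
  show "g holomorphic_on ball 0 1 - {0}" using g unfolding D .
  show "EX B. \<forall>\<^sub>F v in at 0. norm (g v) <= B"
   unfolding eventually_at using bdd by (intro exI[of _ C] exI[of _ s]) (auto simp: s_def dist_norm)
 qed simp
 then obtain G where G: "G holomorphic_on ball 0 1" "!!v. v \<in> ball 0 1 - {0} ==> G v = g v" by blast
 have lawG: "G (q * v) = q * v * G v" if "v \<in> ball 0 1 - {0}" for v
 proof -
  have "norm (q * v) < 1 * 1" unfolding norm_mult using that q by (intro mult_strict_mono) auto
  hence "q * v \<in> ball 0 1 - {0}" using that q by auto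
  thus ?thesis using G(2)[of "q * v"] G(2)[OF that] law[of v] that by auto
 qed
 have cont: "isCont G v" if "v \<in> ball 0 1" for v
  using G(1) that by (meson analytic_at analytic_at_imp_isCont open_ball)
 have limq: "((%v. q * v) ---> q * 0) (at 0)" by (intro tendsto_intros)
 have Gq: "((%v. H (q * v)) ---> H 0) (at 0)" if "isCont H 0" for H :: "complex => complex"
  using isCont_tendsto_compose[of "q * 0" H, OF _ limq] that by simp
 have G0: "G 0 = 0"
 proof -
  have "((%v. q * v * G v) ---> q * 0 * G 0) (at 0)"
   using cont[of 0] by (intro tendsto_intros) (auto simp: isCont_def)
  hence "((%v. G (q * v)) ---> q * 0 * G 0) (at 0)"
   by (rule Lim_transform_within_open[OF _ open_ball[of 0 1]]) (use lawG in auto)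
  from tendsto_unique[OF _ Gq[OF cont] this] show ?thesis by simp
 qed
 have "G constant_on ball 0 1"
 proof (rule ccontr)
  assume nc: "~ G constant_on ball 0 1"
  have z0: "0 \<in> ball (0 :: complex) 1" by simp
  obtain H r n where H: "0 < n" "0 < r" "ball 0 r <= ball (0 :: complex) 1" "H holomorphic_on ball 0 r"
   "!!v. v \<in> ball 0 r ==> G v = (v - 0) ^ n * H v" "!!v. v \<in> ball 0 r ==> H v ~= 0"
   by (rule holomorphic_factor_zero_nonconstant[OF G(1) open_ball connected_ball z0 G0 nc]) (rule that; assumption)
  have cH: "isCont H 0" using H(2,4) by (intro isCont_holomorphic[OF H(4)]) auto
  have e: "q ^ n * H (q * v) = q * v * H v" if v: "v \<in> ball 0 r" "v ~= 0" for v
  proof -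
   have "norm (q * v) <= 1 * norm v" unfolding norm_mult using q by (intro mult_right_mono) auto
   hence qv: "q * v \<in> ball 0 r" using v by auto
   have "(q * v) ^ n * H (q * v) = q * v * (v ^ n * H v)"
    using H(5)[OF qv] H(5)[OF v(1)] lawG[of v] v H(3) by auto
   thus ?thesis using v by (simp add: power_mult_distrib field_simps)
  qed
  have "((%v. q * v * H v) ---> q * 0 * H 0) (at 0)" using cH by (intro tendsto_intros) (auto simp: isCont_def)
  hence "((%v. q ^ n * H (q * v)) ---> q * 0 * H 0) (at 0)"
   by (rule Lim_transform_within_open[OF _ open_ball[of 0 r]]) (use e H(2) in auto)
  moreover have "((%v. q ^ n * H (q * v)) ---> q ^ n * H 0) (at 0)" by (intro tendsto_intros Gq cH)
  ultimately have "q ^ n * H 0 = 0" using tendsto_unique by (metis mult_zero_left mult_zero_right trivial_limit_at)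
  thus False using q H(6)[of 0] H(2) by auto
 qed
 hence "G w = G 0" using w by (auto simp: constant_on_def)
 thus ?thesis using G0 G(2)[of w] w by auto
qed

lemma lambert_pole_in_disc:
 assumes z: "Im z > 0" and w: "0 < norm w" "norm w < 1"
 shows "(EX n. w * ee (of_int n * z) = 1) \<longleftrightarrow> w \<in> {ee z ^ k | k. k >= 1}"
proof
 assume "EX n. w * ee (of_int n * z) = 1"
 then obtain n where n: "w * ee (of_int n * z) = 1" by blast
 have 1: "w = ee (of_int (- n) * z)"
 proof -
  have "w = w * ee (of_int n * z) * ee (of_int (- n) * z)" by (simp add: mult.assoc flip: ee_add)
  thus ?thesis by (simp add: n)
 qed
 have "n < 0"
 proof (rule ccontr)
  assume "~ n < 0"
  hence "norm w >= 1" unfolding 1 norm_ee using z by simp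
  thus False using w by simp
 qed
 then obtain k where k: "- n = int k" "k >= 1" by (metis neg_0_less_iff_less zero_less_imp_eq_int Suc_leI One_nat_def)
 thus "w \<in> {ee z ^ k | k. k >= 1}" using 1 ee_nat_mult[of k z] by auto
next
 assume "w \<in> {ee z ^ k | k. k >= 1}"
 then obtain k where "w = ee z ^ k" by blast
 hence "w = ee (of_int (int k) * z)" using ee_nat_mult[of k z] by simp
 hence "w * ee (of_int (- int k) * z) = 1" by (simp flip: ee_add)
 thus "EX n. w * ee (of_int n * z) = 1" by blast
qed

text \<open>The difference D of the two sides satisfies D(q w) = - q w^2 D(w), the inhomogeneous
  terms being equal. Multiplication by \<open>thw\<close> removes the simple poles at the powers of
  q and turns this into the law of \<open>superexponential_zero\<close>.\<close>

lemma vgen_lambert: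
 assumes z: "Im z > 0" and w: "0 < norm w" "norm w < 1" "w ~: {ee z ^ k | k. k >= 1}"
 shows "th0 z * ((1 + w) * vgen (ee z) w w) = 2 * lambert (app0 z) z w - th0 z"
proof -
 let ?q = "ee z" and ?L = "lambert (app0 z) z"
 let ?Q = "{?q ^ k | k. k >= 1}" and ?S = "{w. 0 < norm w & norm w < (1 :: real)} :: complex set"
 have q: "norm ?q < 1" "?q ~= 0" using norm_ee_lt_1[OF z] by auto
 have S: "open ?S" by (intro open_Collect_conj open_Collect_less continuous_intros)
 define D where "D = (%w. th0 z * ((1 + w) * vgen ?q w w) - (2 * ?L w - th0 z))"
 define M where "M = (%w. thw z w * D w)"
 have sub: "?S - ?Q <= {w. w ~= 0 & (ALL n. w * ee (of_int n * z) ~= 1)}"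
  using lambert_pole_in_disc[OF z] by auto
 have hol: "M holomorphic_on ?S - ?Q"
  unfolding M_def D_def
  by (intro holomorphic_intros vgen_holomorphic[OF q] holomorphic_on_subset[OF lambert_holomorphic[OF z app0_summable[OF z]] sub]
    holomorphic_on_subset[OF thw_holomorphic[OF z]]) auto
 have res: "((%v. (v - p) * M v) ---> 0) (at p)" if p: "p \<in> ?Q" "p \<in> ?S" for p
 proof -
  obtain m where m: "p = ?q ^ m" "m >= 1" using p by blast
  obtain L1 where L1: "((%v. (v - p) * vgen ?q v v) ---> L1) (at p)"
   using vgen_pole_limit[OF q m(2)] m(1) by blast
  have p': "p = ee (- (of_int (- int m) * z))" using ee_nat_mult[of m z] by (simp add: m(1))
  let ?e = "ee (of_int (- int m) * z)"
  have pe: "p * ?e = 1" unfolding p' by (simp flip: ee_add)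
  have gen: "x * (y * ((1 + v) * ((v - p) * s)) - (2 * ((v - p) * w) - (v - p) * y)) = (v - p) * (x * (y * ((1 + v) * s) - (2 * w - y)))"
   for x y s w v :: complex by (simp add: algebra_simps)
  have "((%v. - p * ((1 - v * ?e) * ?L v)) ---> - p * app0 z (- int m)) (at p)"
   using lambert_residue[OF z app0_summable[OF z], of "- int m", folded p'] by (rule tendsto_mult_left)
  moreover have "- p * ((1 - v * ?e) * ?L v) = (v - p) * ?L v" for v
  proof -
   have "- p * (1 - v * ?e) = v * (p * ?e) - p" by (simp add: algebra_simps)
   thus ?thesis by (simp only: mult.assoc[symmetric] pe mult_1_right)
  qed
  ultimately have L2: "((%v. (v - p) * ?L v) ---> - p * app0 z (- int m)) (at p)" by simp
  have "isCont (thw z) p"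
   by (rule isCont_holomorphic[OF thw_holomorphic[OF z]]) (use p(2) in auto)
  moreover have "EX n. p * ee (of_int n * z) = 1" using pe by blast
  hence "thw z p = 0" using thw_eq_0_iff[OF z, of p] p(2) by simp
  ultimately have T: "(thw z ---> 0) (at p)" by (simp add: isCont_def)
  have "((%v. thw z v * (th0 z * ((1 + v) * ((v - p) * vgen ?q v v)) - (2 * ((v - p) * ?L v) - (v - p) * th0 z))) \<longlongrightarrow>
    0 * (th0 z * ((1 + p) * L1) - (2 * (- p * app0 z (- int m)) - (p - p) * th0 z))) (at p)"
   by (intro tendsto_intros T L1 L2)
  moreover have "thw z v * (th0 z * ((1 + v) * ((v - p) * vgen ?q v v)) - (2 * ((v - p) * ?L v) - (v - p) * th0 z)) = (v - p) * M v" for v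
   unfolding M_def D_def by (rule gen)
  ultimately show ?thesis by simp
 qed
 obtain g where g: "g holomorphic_on ?S" "!!u. u \<in> ?S - ?Q ==> g u = M u"
  using removable_extension[OF S hol power_set_discrete[OF q] res] by auto
 have qS: "?q * v \<in> ?S" if "v \<in> ?S" for v
 proof -
  have "norm ?q * norm v < 1 * 1" using that q by (intro mult_strict_mono) auto
  thus ?thesis using that q by (auto simp: norm_mult)
 qed
 have law1: "g (?q * v) = ?q * v * g v" if v: "v \<in> ?S - ?Q" for v
 proof -
  have vk: "!!k. k >= 1 ==> v ~= ?q ^ k" using v by blast
  have v0: "v ~= 0" "v ~= 1" using v by auto
  have qv: "?q * v ~: ?Q"
  proof
   assume "?q * v \<in> ?Q"
   then obtain k where k: "?q * v = ?q ^ k" "k >= 1" by blast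
   then obtain j where j: "k = Suc j" by (cases k) auto
   hence "v = ?q ^ j" using k q by simp
   thus False using vk[of j] v0 by (cases j) auto
  qed
  have nn: "!!n. v * ee (of_int n * z) ~= 1" using sub v by blast
  have V: "(1 + ?q * v) * vgen ?q (?q * v) (?q * v) = 1 - ?q * v^2 - ?q * v^2 * ((1 + v) * vgen ?q v v)"
   by (rule vgen_functional_equation[OF q]) (use v vk in auto)
  have L: "?L (?q * v) = - ?q * v^2 * ?L v + th0 z"
   using lambert_app0_quasi_period[OF z v0(1) nn] by (simp add: mult.commute)
  have "D (?q * v) = - ?q * v^2 * D v" unfolding D_def V L by (simp add: algebra_simps)
  moreover have "thw z (?q * v) * v = - thw z v" using thw_quasi_period[OF v0(1), of z] by (simp add: mult.commute)
  moreover have gen: "T * (- x * v^2 * d) = x * v * (t * d)" if "T * v = - t" for T t x d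
  proof -
   have "T * (- x * v^2 * d) = - x * v * (T * v) * d" by (simp add: power2_eq_square)
   thus ?thesis unfolding that by simp
  qed
  ultimately have "M (?q * v) = ?q * v * M v"
   unfolding M_def by (metis gen)
  thus ?thesis using g(2)[OF v] g(2)[of "?q * v"] qS v qv by auto
 qed
 have law: "g (?q * v) = ?q * v * g v" if v: "v \<in> ?S" for v
 proof (cases "v \<in> ?Q")
  case True
  have c: "isCont g x" if "x \<in> ?S" for x using g(1) S that by (auto intro: isCont_holomorphic)
  obtain r where r: "r > 0" "!!p. p \<in> ?Q ==> p ~= v ==> r <= dist p v" using power_set_discrete[OF q, of v] v by auto
  have l0: "((%x. ?q * x) ---> ?q * v) (at v)" by (intro tendsto_intros)
  have l1: "((%x. g (?q * x)) ---> g (?q * v)) (at v)" using isCont_tendsto_compose[OF c[OF qS[OF v]] l0] .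
  have "((%x. ?q * x * g x) ---> ?q * v * g v) (at v)" using c[OF v] by (intro tendsto_intros) (auto simp: isCont_def)
  hence l2: "((%x. g (?q * x)) ---> ?q * v * g v) (at v)"
  proof (rule Lim_transform_within_open)
   show "open (?S \<inter> ball v r)" "v \<in> ?S \<inter> ball v r" using S v r(1) by auto
   fix x assume "x \<in> ?S \<inter> ball v r" "x ~= v"
   hence "x \<in> ?S - ?Q" using r(2)[of x] by (auto simp: dist_commute)
   thus "?q * x * g x = g (?q * x)" using law1 by simp
  qed
  from tendsto_unique[OF _ l1 l2] show ?thesis by simp
 qed (use v law1 in blast)
 have "g w = 0" by (rule superexponential_zero[OF q g(1)]) (use law w in auto)
 hence "M w = 0" using g(2)[of w] w by auto
 moreover have "thw z w ~= 0" using thw_eq_0_iff[OF z, of w] lambert_pole_in_disc[OF z w(1,2)] w by auto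
 ultimately have "D w = 0" by (simp add: M_def)
 thus ?thesis by (simp add: D_def)
qed

section \<open>The rank series on the unit circle\<close>

text \<open>Abel summation of \<open>vgen\<close>, grouping by the largest part N + 1. Unlike
  \<open>vgen\<close> it still converges for |w| = 1, because the differences decay like
  q^N.\<close>

definition ogen :: "complex => complex => complex" where
 "ogen q w = 1 + (\<Sum>\<^sub>\<infinity>N. w ^ Suc N * (aprod q (1 / w) (Suc N) - aprod q (1 / w) N))"

lemma ogen_vgen:
 assumes q: "norm q < 1" and w: "norm w < 1"
 shows "ogen q w = (1 - w) * vgen q w w"
proof -
 let ?a = "aprod q (1 / w)"
 have s: "(%N. w ^ N * ?a N) summable_on UNIV" by (rule vgen_summable[OF q w])
 note s' = infsum_nat_split[OF s]
 have "(\<Sum>\<^sub>\<infinity>N. w ^ Suc N * (?a (Suc N) - ?a N)) = (\<Sum>\<^sub>\<infinity>N. w ^ Suc N * ?a (Suc N) + (- w) * (w ^ N * ?a N))"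
  by (intro infsum_cong) (simp add: algebra_simps)
 also have "... = (\<Sum>\<^sub>\<infinity>N. w ^ Suc N * ?a (Suc N)) + (- w) * vgen q w w"
  unfolding vgen_def using infsum_add[OF s'(2) summable_on_cmult_right[OF s, of "- w"]] by (simp only: infsum_cmult_right')
 also have "(\<Sum>\<^sub>\<infinity>N. w ^ Suc N * ?a (Suc N)) = vgen q w w - 1" using s'(1) by (simp add: vgen_def)
 finally show ?thesis by (simp add: ogen_def algebra_simps)
qed

lemma ogen_term_bound:
 fixes q x :: complex
 assumes q: "norm q < 1" and x: "norm x <= r" "r * norm q < 1"
 shows "norm (aprod q x (Suc N) - aprod q x N) \<le>
  exp (2 * r / ((1 - r * norm q) * (1 - norm q))) * (2 * r * norm q ^ Suc N / (1 - r * norm q))"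
proof -
 have r: "r >= 0" using x(1) norm_ge_zero order_trans by blast
 have "norm q ^ Suc N <= norm q ^ 1" using q by (intro power_decreasing) auto
 hence 2: "r * norm q ^ Suc N <= r * norm q" using r by (intro mult_left_mono) auto
 have 3: "norm (x * q ^ Suc N) <= r * norm q ^ Suc N" unfolding norm_mult[of x] norm_power using x by (intro mult_right_mono) auto
 have d: "1 - r * norm q <= norm (1 - x * q ^ Suc N)" using norm_triangle_ineq2[of 1 "x * q ^ Suc N"] 2 3 by simp
 hence nz: "1 - x * q ^ Suc N ~= 0" using x(2) by auto
 have "aprod q x (Suc N) - aprod q x N = aprod q x N * ((1 + x * q ^ Suc N) / (1 - x * q ^ Suc N) - 1)"
  by (simp add: aprod_Suc algebra_simps)
 also have "(1 + x * q ^ Suc N) / (1 - x * q ^ Suc N) - 1 = 2 * (x * q ^ Suc N) / (1 - x * q ^ Suc N)"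
  using nz by (simp add: divide_simps)
 also have "norm (aprod q x N * (2 * (x * q ^ Suc N) / (1 - x * q ^ Suc N))) \<le>
  exp (2 * r / ((1 - r * norm q) * (1 - norm q))) * (2 * (r * norm q ^ Suc N) / (1 - r * norm q))"
  unfolding norm_mult[of "aprod q x N"] norm_divide
 proof (intro mult_mono aprod_norm_bound(2)[OF q x] frac_le)
  show "norm (2 * (x * q ^ Suc N)) <= 2 * (r * norm q ^ Suc N)" using 3 by (simp only: norm_mult[of 2]) simp
 qed (use d x r in auto)
 finally show ?thesis by (simp add: mult.assoc)
qed

lemma ogen_isCont:
 assumes q: "norm q < 1" "q ~= 0" and w: "norm w = 1"
 shows "isCont (ogen q) w"
proof -
 \<comment> \<open>The ring s < |w| < 1 / s contains the unit circle and no power q^k with k >= 1,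
   and on it the terms decay like s^N.\<close>
 define s where "s = sqrt (norm q)"
 have s: "0 < s" "s < 1" "s * s = norm q" using q by (auto simp: s_def)
 define S where "S = {w :: complex. s < norm w & norm w < 1 / s}"
 have S: "open S" unfolding S_def by (intro open_Collect_conj open_Collect_less continuous_intros)
 let ?t = "%N w. w ^ Suc N * (aprod q (1 / w) (Suc N) - aprod q (1 / w) N)"
 have r: "1 / s * norm q = s" using s by (simp add: field_simps)
 define C where "C = exp (2 * (1 / s) / ((1 - 1 / s * norm q) * (1 - norm q))) * (2 * (1 / s) / (1 - 1 / s * norm q))"
 have C: "C >= 0" unfolding C_def r using s by simp
 have nx: "norm (1 / w) <= 1 / s" if "w \<in> S" for w
  using that s by (auto simp: S_def norm_divide intro!: divide_left_mono mult_pos_pos)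
 have gen: "x * (E * (y * z / D)) = E * (y / D) * (x * z)" for x y z D E :: real by simp
 have bd: "norm (?t N w) <= C * s ^ Suc N" if w: "w \<in> S" for N w
 proof -
  have "norm (?t N w) <= (1 / s) ^ Suc N * (exp (2 * (1 / s) / ((1 - 1 / s * norm q) * (1 - norm q))) * (2 * (1 / s) * norm q ^ Suc N / (1 - 1 / s * norm q)))"
   unfolding norm_mult norm_power[of w]
   by (intro mult_mono power_mono ogen_term_bound[OF q(1) nx[OF w]]) (use w s r in \<open>auto simp: S_def\<close>)
  also have "... = C * ((1 / s) ^ Suc N * norm q ^ Suc N)" unfolding C_def by (rule gen)
  also have "(1 / s) ^ Suc N * norm q ^ Suc N = s ^ Suc N" unfolding power_mult_distrib[symmetric] r ..
  finally show ?thesis .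
 qed
 have den: "1 - 1 / w * q ^ k ~= 0" if w: "w \<in> S" and k: "k >= 1" for w k
 proof -
  have "norm q ^ k <= norm q ^ 1" using q k by (intro power_decreasing) auto
  hence "norm (1 / w * q ^ k) <= 1 / s * norm q"
   unfolding norm_mult norm_power using nx[OF w] s by (intro mult_mono) auto
  hence "norm (1 / w * q ^ k) < 1" using r s by linarith
  thus ?thesis by auto
 qed
 have "(%w. \<Sum>\<^sub>\<infinity>N. ?t N w) holomorphic_on S"
 proof (rule holomorphic_infsum[OF S])
  fix N
  show "?t N holomorphic_on S" unfolding aprod_def
   by (intro holomorphic_intros) (use den s in \<open>auto simp: S_def\<close>)
 next
  fix z assume z: "z \<in> S"
  then obtain e where e: "e > 0" "cball z e <= S" using S open_contains_cball by metis
  have "summable (%j. norm (s ^ Suc j))" using s by (simp add: norm_power norm_mult summable_geometric summable_mult)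
  hence "(%j. C * s ^ Suc j) summable_on (UNIV :: nat set)"
   by (intro summable_on_cmult_right norm_summable_imp_summable_on)
  thus "EX r'>0. EX M. cball z r' <= S & M summable_on UNIV & (ALL n:UNIV. ALL w:cball z r'. norm (?t n w) <= M n)"
   using e bd by (intro exI[of _ e] exI[of _ "%j. C * s ^ Suc j"]) blast
 qed
 hence "ogen q holomorphic_on S" unfolding ogen_def[abs_def] by (intro holomorphic_intros)
 moreover have "w \<in> S" using w s by (simp add: S_def)
 ultimately show ?thesis using S by (auto intro: isCont_holomorphic)
qed

text \<open>Radial limits from the disc. At w = 1 the factor 1 - w meets the simple pole of the
  Lambert series, and the limit of the product is the coefficient \<open>app0\<close> at n = 0,
  which is 1.\<close>

theorem ogen_lambert:
 assumes z: "Im z > 0" and w: "norm w = 1"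
 shows "w ~= 1 ==> th0 z * (1 + w) * ogen (ee z) w = (1 - w) * (2 * lambert (app0 z) z w - th0 z)"
  and "th0 z * ogen (ee z) 1 = 1"
proof -
 let ?q = "ee z" and ?L = "lambert (app0 z) z"
 have q: "norm ?q < 1" "?q ~= 0" using norm_ee_lt_1[OF z] by auto
 have inner: "th0 z * (1 + v) * ogen ?q v = (1 - v) * (2 * ?L v - th0 z)" if v: "norm ?q < norm v" "norm v < 1" for v
 proof -
  have "v ~: {?q ^ k | k. k >= 1}"
  proof
   assume "v \<in> {?q ^ k | k. k >= 1}"
   then obtain k where k: "v = ?q ^ k" "k >= 1" by blast
   have "norm ?q ^ k <= norm ?q ^ 1" using q k by (intro power_decreasing) auto
   thus False using v k by (simp add: norm_power)
  qed
  from vgen_lambert[OF z _ v(2) this] v ogen_vgen[OF q(1) v(2)] show ?thesis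
   by (simp add: mult_ac) (metis norm_ge_zero order_le_less_trans zero_less_norm_iff)
 qed
 have ev: "eventually (%r. th0 z * (1 + of_real r * x) * ogen ?q (of_real r * x) = (1 - of_real r * x) * (2 * ?L (of_real r * x) - th0 z)) (at_left (1 :: real))"
  if x: "norm x = 1" for x
 proof -
  have "eventually (%r::real. r \<in> {norm ?q<..<1}) (at_left 1)" using q by (intro eventually_at_left_real) auto
  thus ?thesis
  proof eventually_elim
   case (elim r)
   have "0 < r" using elim le_less_trans[OF norm_ge_zero, of ?q r] by auto
   hence "norm (of_real r * x) = r" using x by (simp add: norm_mult)
   thus ?case using elim by (intro inner) auto
  qed
 qed
 have lim: "((%r::real. of_real r * x) ---> x) (at_left 1)" for x :: complex
 proof -
  have "((%r::real. of_real r * x) ---> of_real 1 * x) (at_left 1)" by (intro tendsto_intros)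
  thus ?thesis by simp
 qed
 have limO: "((%r::real. ogen ?q (of_real r * x)) ---> ogen ?q x) (at_left 1)" if x: "norm x = 1" for x
  by (rule isCont_tendsto_compose[OF ogen_isCont[OF q x] lim])
 show "th0 z * (1 + w) * ogen ?q w = (1 - w) * (2 * ?L w - th0 z)" if w1: "w ~= 1"
 proof -
  have "isCont ?L w"
  proof -
   let ?H = "{v :: complex. norm ?q < norm v & norm v < 1 / norm ?q} - {1}"
   have H: "open ?H" by (intro open_Diff open_Collect_conj open_Collect_less continuous_intros) auto
   have "v * ee (of_int n * z) ~= 1" if v: "v \<in> ?H" for v n
   proof
    assume v1: "v * ee (of_int n * z) = 1"
    define y where "y = 2 * pi * Im z"
    have y: "y > 0" using z by (simp add: y_def)
    have nq: "norm ?q = exp (- y)" by (simp add: norm_ee y_def)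
    have "norm (ee (of_int n * z)) = exp (- (of_int n * y))" by (simp add: norm_ee y_def mult_ac)
    hence "norm v * exp (- (of_int n * y)) = 1" using v1 by (metis norm_mult norm_one)
    hence nv: "norm v = exp (of_int n * y)" by (simp add: exp_minus field_simps)
    have "exp (- y) < exp (of_int n * y)" using v nq nv by simp
    hence 1: "- 1 * y < of_int n * y" by simp
    have "exp (of_int n * y) < exp y" using v nq nv by (simp add: exp_minus field_simps)
    hence 2: "of_int n * y < 1 * y" by simp
    have "(-1 :: real) < of_int n" "of_int n < (1 :: real)" using 1 2 y mult_less_cancel_right_pos[OF y] by blast+
    hence "n = 0" by linarith
    thus False using v1 v by simp
   qed
   hence "?H <= {v. v ~= 0 & (ALL n. v * ee (of_int n * z) ~= 1)}" using q by auto
   hence "?L holomorphic_on ?H"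
    by (rule holomorphic_on_subset[OF lambert_holomorphic[OF z app0_summable[OF z]]])
   moreover have "w \<in> ?H" using w w1 q by auto
   ultimately show ?thesis using H by (auto intro: isCont_holomorphic)
  qed
  hence 1: "((%r::real. ?L (of_real r * w)) ---> ?L w) (at_left 1)" by (rule isCont_tendsto_compose[OF _ lim])
  have 2: "((%r::real. th0 z * (1 + of_real r * w) * ogen ?q (of_real r * w)) ---> th0 z * (1 + w) * ogen ?q w) (at_left 1)"
   by (intro tendsto_intros lim limO[OF w])
  have "((%r::real. (1 - of_real r * w) * (2 * ?L (of_real r * w) - th0 z)) ---> (1 - w) * (2 * ?L w - th0 z)) (at_left 1)"
   by (intro tendsto_intros lim 1)
  hence 3: "((%r::real. th0 z * (1 + of_real r * w) * ogen ?q (of_real r * w)) ---> (1 - w) * (2 * ?L w - th0 z)) (at_left 1)"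
   using tendsto_cong[OF ev[OF w]] by blast
  show ?thesis by (rule tendsto_unique[OF _ 2 3]) simp
 qed
 show "th0 z * ogen ?q 1 = 1"
 proof -
  have n1: "norm (1 :: complex) = 1" by simp
  have 2: "((%r::real. th0 z * (1 + of_real r * 1) * ogen ?q (of_real r * 1)) ---> th0 z * (1 + 1) * ogen ?q 1) (at_left 1)"
   by (intro tendsto_intros lim limO[OF n1])
  have "((%v. (1 - v) * ?L v) ---> 1) (at 1)"
  proof -
   have "app0 z 0 = 1" by (simp add: app0_def)
   thus ?thesis using lambert_residue[OF z app0_summable[OF z], of 0] by simp
  qed
  moreover have "filterlim (%r::real. of_real r * 1 :: complex) (at 1) (at_left 1)"
  proof (rule filterlim_atI[OF lim])
   have "eventually (%r::real. r \<in> {0<..<1}) (at_left 1)" by (intro eventually_at_left_real) auto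
   thus "eventually (%r::real. of_real r * 1 ~= (1 :: complex)) (at_left 1)"
   proof eventually_elim
    case (elim r)
    hence "r ~= 1" by simp
    thus ?case by (simp only: mult_1_right of_real_eq_1_iff) simp
   qed
  qed
  ultimately have 1: "((%r::real. (1 - of_real r * 1) * ?L (of_real r * 1)) ---> 1) (at_left 1)"
   by (rule filterlim_compose)
  have "((%r::real. 2 * ((1 - of_real r * 1) * ?L (of_real r * 1)) - (1 - of_real r * 1) * th0 z) ---> 2 * 1 - (1 - 1) * th0 z) (at_left 1)"
   by (intro tendsto_intros lim 1)
  moreover have "2 * ((1 - v) * ?L v) - (1 - v) * th0 z = (1 - v) * (2 * ?L v - th0 z)" for v
   by (simp add: algebra_simps)
  ultimately have "((%r::real. (1 - of_real r * 1) * (2 * ?L (of_real r * 1) - th0 z)) ---> 2) (at_left 1)" by simp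
  hence 3: "((%r::real. th0 z * (1 + of_real r * 1) * ogen ?q (of_real r * 1)) ---> 2) (at_left 1)"
   using tendsto_cong[OF ev[OF n1]] by blast
  have "th0 z * (1 + 1) * ogen ?q 1 = 2" by (rule tendsto_unique[OF _ 2 3]) simp
  thus ?thesis by simp
 qed
qed

section \<open>Overpartitions counted by rank\<close>

lemma has_sum_product_complex:
 fixes f :: "'a => complex" and g :: "'b => complex"
 assumes f: "(f has_sum F) A" and g: "(g has_sum G) B"
 shows "((%(x, y). f x * g y) has_sum F * G) (A \<times> B)"
proof (rule has_sum_SigmaI)
 show "((%y. case (x, y) of (x, y) => f x * g y) has_sum f x * G) B" for x
  using has_sum_cmult_right[OF g] by simp
 show "((%x. f x * G) has_sum F * G) A" using has_sum_cmult_left[OF f] by simp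
 have "(%x. norm (f x)) summable_on A" "(%x. norm (g x)) summable_on B"
  using f g summable_on_def summable_on_iff_abs_summable_on_complex by blast+
 hence "(%p. norm (case p of (x, y) => f x * g y)) summable_on A \<times> B"
  unfolding Infinite_Sum.abs_summable_on_Sigma_iff
  by (auto simp: norm_mult infsum_cmult_right' abs_mult summable_on_cmult_right infsum_nonneg intro!: summable_on_cmult_left)
 thus "(%(x, y). f x * g y) summable_on A \<times> B" by (simp add: summable_on_iff_abs_summable_on_complex)
qed

definition overpartitions_le :: "nat => (nat multiset \<times> nat set) set" where
 "overpartitions_le N = {(P, Q). 0 ~:# P & Q <= set_mset P & (\<forall>p\<in>#P. p <= N)}"

lemma overpartitions_le_0: "overpartitions_le 0 = {({#}, {})}"
proof -
 have "P = {#}" if "0 ~:# P" "\<forall>p\<in>#P. p <= 0" for P :: "nat multiset"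
  using that by (metis le_zero_eq multiset_nonemptyE)
 thus ?thesis by (auto simp: overpartitions_le_def)
qed

definition opweight :: "complex => complex => nat multiset \<times> nat set => complex" where
 "opweight q x PO = x ^ size (fst PO) * q ^ sum_mset (fst PO)"

lemma norm_opweight: "of_real (norm (opweight q x PO)) = opweight (of_real (norm q)) (of_real (norm x)) PO"
 by (simp add: opweight_def norm_mult norm_power)

text \<open>The contribution of one part size: a multiplicity k and an overline mark, which requires
  k > 0.\<close>

lemma has_sum_marked_geometric:
 fixes y :: complex
 assumes "norm y < 1"
 shows "((%(k, b). y ^ k) has_sum (1 + y) / (1 - y)) {(k, b). b --> (k :: nat) > 0}"
proof -
 have y1: "y ~= 1" using assms by auto
 have g: "((%k. y ^ k) has_sum 1 / (1 - y)) UNIV"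
  by (rule norm_summable_imp_has_sum) (use assms in \<open>auto simp: norm_power summable_geometric intro: geometric_sums\<close>)
 have "((%(k, b). y ^ k) has_sum 1 / (1 - y)) ((%k::nat. (k, False)) ` UNIV)"
  by (subst has_sum_reindex) (use g in \<open>auto simp: o_def inj_on_def\<close>)
 moreover have "((%(k, b). y ^ k) has_sum y / (1 - y)) ((%k::nat. (Suc k, True)) ` UNIV)"
  by (subst has_sum_reindex) (use has_sum_cmult_right[OF g, of y] in \<open>auto simp: o_def inj_on_def\<close>)
 ultimately have "((%(k, b). y ^ k) has_sum 1 / (1 - y) + y / (1 - y)) ((%k::nat. (k, False)) ` UNIV \<union> (%k::nat. (Suc k, True)) ` UNIV)"
  by (rule has_sum_Un_disjoint) auto
 moreover have "(%k::nat. (k, False)) ` UNIV \<union> (%k::nat. (Suc k, True)) ` UNIV = {(k, b). b --> (k :: nat) > 0}"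
  by (auto simp: image_iff gr0_conv_Suc)
 ultimately show ?thesis by (simp add: add_divide_distrib)
qed

lemma overpartitions_le_has_sum:
 fixes q x :: complex
 assumes q: "norm q < 1" and x: "norm (x * q) < 1"
 shows "(opweight q x has_sum aprod q x N) (overpartitions_le N)"
proof (induction N)
 case 0
 have "sum (opweight q x) {({#}, {})} = 1" by (simp add: opweight_def)
 thus ?case using has_sum_finite[of "{({#}, {})}" "opweight q x"] by (simp add: overpartitions_le_0)
next
 case (Suc N)
 let ?n = "Suc N"
 define y where "y = x * q ^ ?n"
 have "norm y = norm (x * q) * norm q ^ N" by (simp add: y_def norm_mult norm_power)
 also have "... <= norm (x * q) * 1" using q by (intro mult_left_mono power_le_one) auto
 finally have y: "norm y < 1" using x by simp
 let ?K = "{(k, b). b --> (k :: nat) > 0}"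
 define j where "j = (%((P, Q), (k, b)). (P + replicate_mset k ?n, if b then insert ?n Q else Q))"
 define i where "i = (%(P, Q). ((filter_mset (%p. p ~= ?n) P, Q - {?n}), (count P ?n, ?n \<in> Q)))"
 have f0: "filter_mset (%p. p ~= ?n) P = P" if "\<forall>p\<in>#P. p <= N" for P
  using that by (auto simp: filter_mset_eq_conv)
 have c0: "count P ?n = 0" if "\<forall>p\<in>#P. p <= N" for P
  using that by (auto simp: not_in_iff[symmetric])
 have "((%(PO, (k, b)). opweight q x PO * y ^ k) has_sum aprod q x N * ((1 + y) / (1 - y))) (overpartitions_le N \<times> ?K)"
  using has_sum_product_complex[OF Suc has_sum_marked_geometric[OF y]] by (simp add: case_prod_unfold)
 moreover have "((%(PO, (k, b)). opweight q x PO * y ^ k) has_sum aprod q x N * ((1 + y) / (1 - y))) (overpartitions_le N \<times> ?K)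
   \<longleftrightarrow> (opweight q x has_sum aprod q x ?n) (overpartitions_le ?n)"
 proof (rule has_sum_reindex_bij_witness[of _ i j])
  fix a assume "a \<in> overpartitions_le N \<times> ?K"
  then obtain P Q k b where a: "a = ((P, Q), (k, b))" "(P, Q) \<in> overpartitions_le N" "b --> k > 0" by auto
  have P: "0 ~:# P" "Q <= set_mset P" "\<forall>p\<in>#P. p <= N" using a(2) by (auto simp: overpartitions_le_def)
  have Q: "?n ~: Q" using P(2,3) Suc_n_not_le_n by blast
  have "filter_mset (%p. p ~= ?n) (replicate_mset k ?n) = {#}" by (induction k) auto
  thus "i (j a) = a" using a(3) Q f0[OF P(3)] c0[OF P(3)] by (auto simp: a(1) i_def j_def)
  show "j a \<in> overpartitions_le ?n" using a(3) P
   by (auto simp: a(1) j_def overpartitions_le_def le_Suc_eq split: if_splits)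
  show "opweight q x (j a) = (case a of (PO, (k, b)) => opweight q x PO * y ^ k)"
   by (simp add: a(1) j_def opweight_def y_def power_add power_mult_distrib mult_ac flip: power_mult)
 next
  fix b assume "b \<in> overpartitions_le ?n"
  then obtain P Q where b: "b = (P, Q)" "0 ~:# P" "Q <= set_mset P" "\<forall>p\<in>#P. p <= ?n" by (auto simp: overpartitions_le_def)
  have "filter_mset (%p. p ~= ?n) P + replicate_mset (count P ?n) ?n = P"
   by (rule multiset_eqI) auto
  thus "j (i b) = b" by (auto simp: b(1) i_def j_def)
  show "i b \<in> overpartitions_le N \<times> ?K" using b(2-4) by (auto simp: b(1) i_def overpartitions_le_def le_Suc_eq)
 qed (simp add: aprod_Suc y_def)
 ultimately show ?case by simp
qed

definition overpartition :: "(nat multiset \<times> nat set) set" where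
 "overpartition = {(P, Q). 0 ~:# P & Q <= set_mset P}"

definition rankweight :: "complex => complex => nat multiset \<times> nat set => complex" where
 "rankweight q w PO = (if fst PO = {#} then 1 else w powi overpartition_rank PO * q ^ sum_mset (fst PO))"

text \<open>Absolute summability has to precede any regrouping. A finite family has a largest part,
  and the products \<open>aprod\<close> at x = 1 are bounded independently of it.\<close>

lemma overpartition_summable:
 assumes q: "norm q < 1"
 shows "(%PO. norm (opweight q 1 PO)) summable_on overpartition"
proof (rule nonneg_bdd_above_summable_on)
 define C where "C = exp (2 * 1 / ((1 - 1 * norm q) * (1 - norm q)))"
 show "bdd_above (sum (%PO. norm (opweight q 1 PO)) ` {F. F <= overpartition & finite F})"
 proof (rule bdd_aboveI2)
  fix F assume "F \<in> {F. F <= overpartition & finite F}"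
  hence F: "F <= overpartition" "finite F" by auto
  define N where "N = Max (insert 0 (\<Union>PO\<in>F. set_mset (fst PO)))"
  have "p <= N" if "PO \<in> F" "p \<in># fst PO" for PO p unfolding N_def by (rule Max_ge) (use F that in auto)
  hence sub: "F <= overpartitions_le N" using F(1) by (force simp: overpartition_def overpartitions_le_def)
  have "((%PO. of_real (norm (opweight q 1 PO)) :: complex) has_sum aprod (of_real (norm q)) (of_real (norm (1 :: complex))) N) (overpartitions_le N)"
   unfolding norm_opweight by (rule overpartitions_le_has_sum) (use q in auto)
  moreover have r: "aprod (of_real (norm q)) (of_real (norm (1 :: complex))) N = (of_real (aprod (norm q) 1 N) :: complex)"
   by (simp add: aprod_def)
  ultimately have s: "((%PO. norm (opweight q 1 PO)) has_sum aprod (norm q) 1 N) (overpartitions_le N)"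
   by (simp only: has_sum_of_real_iff r)
  have "(\<Sum>PO\<in>F. norm (opweight q 1 PO)) <= aprod (norm q) 1 N"
   by (rule has_sum_mono_neutral[OF has_sum_finite[OF F(2)] s]) (use sub in auto)
  also have "... <= C" unfolding C_def by (rule aprod_real_bound) (use q in auto)
  finally show "(\<Sum>PO\<in>F. norm (opweight q 1 PO)) <= C" .
 qed
qed auto

lemma norm_rankweight: "norm w = 1 ==> norm (rankweight q w PO) = norm (opweight q 1 PO)"
 by (auto simp: rankweight_def opweight_def norm_mult norm_power_int)

lemma finite_overpartitions: "finite {PO. is_overpartition n PO}"
proof (rule finite_subset)
 let ?X = "(mset ` {xs. set xs <= {..n} & length xs <= n}) \<times> Pow {..n}"
 show "finite ?X" by (intro finite_cartesian_product finite_imageI finite_lists_length_le) auto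
 have size: "size P <= sum_mset P" if "0 ~:# P" for P :: "nat multiset" using that
  by (induction P) (auto simp: Suc_le_eq intro: add_less_le_mono)
 show "{PO. is_overpartition n PO} <= ?X"
 proof
  fix PO assume "PO \<in> {PO. is_overpartition n PO}"
  then obtain P Q where PO: "PO = (P, Q)" "0 ~:# P" "sum_mset P = n" "Q <= set_mset P"
   by (cases PO) (auto simp: is_overpartition_def)
  obtain xs where xs: "mset xs = P" using ex_mset by blast
  have "p <= n" if "p \<in># P" for p using that PO(3) by (metis le_add1 multi_member_split sum_mset.add_mset)
  hence "set_mset P <= {..n}" by auto
  moreover have "length xs <= n" using size[OF PO(2)] PO(3) xs by auto
  ultimately show "PO \<in> ?X" using PO(1,4) xs by (auto simp flip: set_mset_mset)
 qed
qed

text \<open>In the class with largest part N + 1 the weight with x = 1 / w, multiplied by w^(N+1),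
  is w to the rank. The classes partition the non-empty overpartitions; the empty one accounts for
  the summand 1.\<close>

lemma ogen_has_sum:
 assumes q: "norm q < 1" "q ~= 0" and w: "norm w = 1"
 shows "(rankweight q w has_sum ogen q w) overpartition"
proof -
 have w0: "w ~= 0" using w by auto
 have sm: "rankweight q w summable_on overpartition"
  unfolding summable_on_iff_abs_summable_on_complex norm_rankweight[OF w] by (rule overpartition_summable[OF q(1)])
 define D where "D = (%N. overpartitions_le (Suc N) - overpartitions_le N)"
 have xq: "norm (1 / w * q) < 1" using q w by (simp add: norm_divide norm_mult)
 have mono: "overpartitions_le N <= overpartitions_le (Suc N)" for N by (auto simp: overpartitions_le_def)
 have Dsum: "(rankweight q w has_sum w ^ Suc N * (aprod q (1 / w) (Suc N) - aprod q (1 / w) N)) (D N)" for N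
 proof -
  have "(opweight q (1 / w) has_sum aprod q (1 / w) (Suc N) - aprod q (1 / w) N) (D N)"
   unfolding D_def by (intro has_sum_Diff overpartitions_le_has_sum q(1) xq mono)
  from has_sum_cmult_right[OF this, of "w ^ Suc N"]
  have "((%PO. w ^ Suc N * opweight q (1 / w) PO) has_sum w ^ Suc N * (aprod q (1 / w) (Suc N) - aprod q (1 / w) N)) (D N)" .
  moreover have "w ^ Suc N * opweight q (1 / w) PO = rankweight q w PO" if PO': "PO \<in> D N" for PO
  proof -
   obtain P Q where PO: "PO = (P, Q)" by (cases PO)
   from PO' have "0 ~:# P" "Q <= set_mset P" "\<forall>p\<in>#P. p <= Suc N" "~ (\<forall>p\<in>#P. p <= N)"
    by (auto simp: PO D_def overpartitions_le_def)
   hence "Suc N \<in># P" by (auto simp: le_Suc_eq)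
   hence "Max (set_mset P) = Suc N" "P ~= {#}" using \<open>\<forall>p\<in>#P. p <= Suc N\<close> by (auto intro!: Max_eqI)
   moreover have "w powi (int (Suc N) - int (size P)) = w ^ Suc N / w ^ size P"
    using w0 by (subst power_int_diff) (auto simp del: of_nat_Suc power_Suc)
   ultimately show ?thesis
    by (simp add: rankweight_def PO overpartition_rank_def opweight_def power_divide)
  qed
  ultimately show ?thesis using has_sum_cong[of "D N" "%PO. w ^ Suc N * opweight q (1 / w) PO" "rankweight q w"] by simp
 qed
 have bij: "bij_betw snd (Sigma UNIV D) (overpartition - {({#}, {})})"
 proof (rule bij_betwI')
  fix x y assume xy: "x \<in> Sigma UNIV D" "y \<in> Sigma UNIV D"
  have "fst x = fst y" if e: "snd x = snd y"
  proof (rule ccontr)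
   assume "fst x ~= fst y"
   have le: "overpartitions_le a <= overpartitions_le b" if "a <= b" for a b
    using that by (auto simp: overpartitions_le_def)
   have lt: False if "a < b" "p \<in> D a" "p \<in> D b" for a b p using that le[of "Suc a" b] by (auto simp: D_def)
   from \<open>fst x ~= fst y\<close> show False using lt xy e by (cases x; cases y) (auto simp: neq_iff)
  qed
  thus "(snd x = snd y) = (x = y)" by (auto simp: prod_eq_iff)
 next
  fix x assume "x \<in> Sigma UNIV D"
  thus "snd x \<in> overpartition - {({#}, {})}" by (auto simp: D_def overpartitions_le_def overpartition_def)
 next
  fix y assume "y \<in> overpartition - {({#}, {})}"
  then obtain P Q where y': "y = (P, Q)" "0 ~:# P" "Q <= set_mset P" "y ~= ({#}, {})"
   by (cases y) (auto simp: overpartition_def)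
  have "P ~= {#}" using y' by auto
  note y = y'(1-3) this
  define M where "M = Max (set_mset P)"
  have M: "M \<in># P" "\<forall>p\<in>#P. p <= M" using y(4) by (auto simp: M_def)
  have "M ~= 0" using M y(2) by metis
  then obtain N where N: "M = Suc N" using not0_implies_Suc by blast
  have "~ (\<forall>p\<in>#P. p <= N)" using M(1) Suc_n_not_le_n unfolding N by blast
  hence "y \<in> D N" using y M by (auto simp: D_def overpartitions_le_def N)
  thus "EX x:Sigma UNIV D. y = snd x" by (intro bexI[of _ "(N, y)"]) auto
 qed
 have "rankweight q w summable_on overpartition - {({#}, {})}" by (rule summable_on_subset_banach[OF sm]) auto
 then obtain T where T: "(rankweight q w has_sum T) (overpartition - {({#}, {})})" by (auto simp: summable_on_def)
 hence "((%x. rankweight q w (snd x)) has_sum T) (Sigma UNIV D)" unfolding has_sum_reindex_bij_betw[OF bij] .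
 hence "((%N. w ^ Suc N * (aprod q (1 / w) (Suc N) - aprod q (1 / w) N)) has_sum T) UNIV"
  by (rule has_sum_Sigma') (use Dsum in auto)
 hence "ogen q w = 1 + T" unfolding ogen_def by (simp add: infsumI)
 moreover have "(rankweight q w has_sum 1) {({#}, {})}"
  using has_sum_finite[of "{({#}, {})}" "rankweight q w"] by (simp add: rankweight_def)
 hence "(rankweight q w has_sum 1 + T) ({({#}, {})} \<union> (overpartition - {({#}, {})}))"
  by (rule has_sum_Un_disjoint[OF _ T]) auto
 moreover have "{({#}, {})} \<union> (overpartition - {({#}, {})}) = overpartition" by (auto simp: overpartition_def)
 ultimately show ?thesis by simp
qed

definition rankcoeff :: "complex => nat => complex" where
 "rankcoeff w n = (if n = 0 then 1 else \<Sum>PO | is_overpartition n PO. w powi overpartition_rank PO)"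

lemma rankcoeff_1: "n > 0 ==> rankcoeff 1 n = of_nat (card {PO. is_overpartition n PO})"
 by (simp add: rankcoeff_def)

lemma rankcoeff_has_sum:
 assumes q: "norm q < 1" "q ~= 0" and w: "norm w = 1"
 shows "((%n. rankcoeff w n * q ^ n) has_sum ogen q w) UNIV"
proof -
 let ?O = "%n. {PO. is_overpartition n PO}"
 have bij: "bij_betw snd (Sigma UNIV ?O) overpartition"
  by (rule bij_betwI') (auto simp: is_overpartition_def overpartition_def)
 have s: "((%x. rankweight q w (snd x)) has_sum ogen q w) (Sigma UNIV ?O)"
  unfolding has_sum_reindex_bij_betw[OF bij] by (rule ogen_has_sum[OF q w])
 have "((%PO. rankweight q w (snd (n, PO))) has_sum rankcoeff w n * q ^ n) (?O n)" for n
 proof -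
  have e: "(\<Sum>PO\<in>?O n. rankweight q w PO) = rankcoeff w n * q ^ n"
  proof (cases "n = 0")
   case True
   have "?O 0 = {({#}, {})}"
   proof -
    have "P = {#}" if "0 ~:# P" "\<forall>p\<in>#P. p = (0::nat)" for P using that by (metis multiset_nonemptyE)
    thus ?thesis by (auto simp: is_overpartition_def)
   qed
   thus ?thesis using True by (simp add: rankcoeff_def rankweight_def)
  next
   case False
   have "rankweight q w PO = w powi overpartition_rank PO * q ^ n" if "PO \<in> ?O n" for PO
    using that False by (auto simp: rankweight_def is_overpartition_def)
   thus ?thesis using False by (simp add: rankcoeff_def sum_distrib_right)
  qed
  show ?thesis using has_sum_finite[OF finite_overpartitions[of n], of "rankweight q w"] by (simp add: e)
 qed
 from has_sum_Sigma'[OF s this] show ?thesis .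
qed

section \<open>The theta constant th0 under the modular group\<close>

lemma upper_inverse_neg: "Im z > 0 ==> Im (- 1 / z) > 0" and upper_nonzero: "Im z > 0 ==> z ~= 0"
proof -
 show "Im z > 0 ==> Im (- 1 / z) > 0" using Im_moebius(3)[of 0 0 "-1" 1 z] by (simp add: moebius_act_def)
qed auto

lemma th0_nonzero: "Im z > 0 ==> th0 z ~= 0"
 using ogen_lambert(2)[of z 1] by (metis mult_zero_left norm_one zero_neq_one)

lemma th1_nonzero: "Im z > 0 ==> th1 z ~= 0"
 by (metis th0_S th0_nonzero upper_inverse_neg mult_zero_right)

lemma th2_nonzero: "Im z > 0 ==> th2 z ~= 0"
 using th1_nonzero[of "z + 1"] unfolding th1_T by simp

text \<open>As th0 is the translate of \<open>th3\<close> by 1/2, the matrix is conjugated by that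
  translation; 16 | c is more than enough to keep it integral, and it allows a factor 4 of c to be
  dropped from the symbol as a square, after which the change of d by c / 2 is a multiple of the
  period.\<close>

lemma th0_transform:
 assumes det: "a * d - b * c = 1" and c: "16 dvd c" and z: "Im z > 0"
 shows "th0 (mob (a,b,c,d) z) = theta_j (a,b,c,d) z * th0 z"
proof -
 obtain k where k: "c = 16 * k" using c by (elim dvdE)
 have "even (b * c)" by (simp add: k)
 moreover have "a * d = b * c + 1" using det by simp
 ultimately have "odd (a * d)" by simp
 hence od: "odd a" "odd d" by auto
 have "even (d - a)" using od by simp
 then obtain e where e: "d - a = 2 * e" by (elim dvdE)
 define a' where "a' = a + 8 * k"
 define b' where "b' = b + e - 4 * k"
 define d' where "d' = d - 8 * k"
 have det': "a' * d' - b' * c = 1"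
 proof -
  have "a' * d' - b' * c = (a * d - b * c) + 8 * k * (d - a - 2 * e)" by (simp add: a'_def b'_def d'_def k algebra_simps)
  thus ?thesis using det e by simp
 qed
 let ?s = "z + 1/2 :: complex"
 have s: "Im ?s > 0" using z by simp
 have J: "of_int c * ?s + of_int d' = of_int c * z + (of_int d :: complex)" by (simp add: k d'_def algebra_simps)
 have nz: "of_int c * z + (of_int d :: complex) ~= 0" using Im_moebius(2)[OF det z] .
 have mob: "mob (a',b',c,d') ?s = mob (a,b,c,d) z + 1/2"
 proof -
  have "d = a + 2 * e" using e by simp
  hence "of_int d = of_int a + 2 * (of_int e :: complex)" by simp
  hence "of_int a' * ?s + of_int b' = of_int a * z + of_int b + 1/2 * (aut c d z)"
   by (simp add: a'_def b'_def k algebra_simps)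
  moreover have "(N + 1/2 * D) / D = N / D + 1/2" if "D ~= 0" for N D :: complex
   using that by (simp add: field_simps)
  ultimately show ?thesis using nz unfolding moebius_act_def prod.case J by simp
 qed
 have "th0 (mob (a,b,c,d) z) = th3 (mob (a',b',c,d') ?s)" unfolding mob th3_half ..
 also have "... = theta_j (a',b',c,d') ?s * th3 ?s" by (rule th3_transform[OF det' _ s]) (simp add: k)
 also have "theta_j (a',b',c,d') ?s = theta_j (a,b,c,d) z"
 proof -
  have cop: "coprime c d" using SL2_coprime[OF det] .
  have "shimura_symbol c d' = shimura_symbol c d"
  proof -
   have od': "odd d'" using od by (simp add: d'_def)
   have cop': "coprime c d'" using SL2_coprime[OF det'] .
   have c4: "c = 4 * k * 2^2" by (simp add: k)
   have "shimura_symbol (4 * k * 2^2) d' = shimura_symbol (4 * k) d'"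
    by (rule shimura_symbol_mult_square[OF od']) (use od' in \<open>auto simp: coprime_left_2_iff_odd\<close>)
   also have "... = shimura_symbol (4 * k) d"
   proof (rule shimura_symbol_periodic[OF _ od(2)])
    show "coprime (4 * k) d" by (rule coprime_divisors[OF _ dvd_refl cop]) (simp add: k)
   qed (auto simp: d'_def)
   also have "... = shimura_symbol (4 * k * 2^2) d"
    by (rule shimura_symbol_mult_square[OF od(2), symmetric]) (use od in \<open>auto simp: coprime_left_2_iff_odd\<close>)
   finally show ?thesis by (simp add: c4)
  qed
  moreover have "eps_odd d' = eps_odd d"
  proof -
   have "[d' = d] (mod 4)" by (simp add: d'_def cong_iff_dvd_diff)
   thus ?thesis unfolding eps_odd_def by (metis cong_sym cong_trans)
  qed
  ultimately show ?thesis by (simp add: theta_j_def J)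
 qed
 finally show ?thesis unfolding th3_half .
qed

lemma shimura_symbol_1: "shimura_symbol c 1 = 1"
 by (simp add: shimura_symbol_def)

text \<open>Two matrices with the same entry c differ on the left by a matrix (A, B; C, D). Here C
  is 4 v' l times the square of 2 l c1, and D is 1 modulo both 4 v' l and 2 l c1, so the symbol is 1
  and no multiplier beyond the square roots is left. Without this the translates would acquire signs
  depending on the shift.\<close>

lemma theta_j_quotient:
 assumes z: "Im z > 0" and \<open>d - d' = 16 * (l * c1) * v'\<close> \<open>c = l^2 * c1\<close> and det: "a * d - b * c = 1" "a' * d' - b' * c = 1"
 shows "th0 (mob (a',b',c,d') z) * csqrt (aut c d z) =
  csqrt (of_int c * z + of_int d') * th0 (mob (a,b,c,d) z)"
proof -
 note dd = assms(2) and c = assms(3)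
 let ?J = "of_int c * z + of_int d :: complex" and ?J' = "of_int c * z + of_int d' :: complex"
 define w where "w = mob (a,b,c,d) z"
 have w: "Im w > 0" unfolding w_def by (rule Im_moebius(3)[OF det(1) z])
 have nz: "?J ~= 0" "?J' ~= 0" using Im_moebius(2)[OF det(1) z] Im_moebius(2)[OF det(2) z] by auto
 define A where "A = a' * d - b' * c"
 define B where "B = b' * a - a' * b"
 define C where "C = c * (d - d')"
 define D where "D = d' * a - c * b"
 have mm: "mmul (A,B,C,D) (a,b,c,d) = (a',b',c,d')"
 proof -
  have "A * a + B * c = a' * (a * d - b * c)" "A * b + B * d = b' * (a * d - b * c)"
   "C * a + D * c = c * (a * d - b * c)" "C * b + D * d = d' * (a * d - b * c)"
   by (simp_all add: A_def B_def C_def D_def algebra_simps)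
  thus ?thesis using det by (simp add: mmul_def)
 qed
 have detD: "A * D - B * C = 1"
 proof -
  have "A * D - B * C = (a * d - b * c) * (a' * d' - b' * c)" by (simp add: A_def B_def C_def D_def algebra_simps)
  thus ?thesis using det by simp
 qed
 have D1: "D = 1 - a * (d - d')" using det(1) by (simp add: D_def algebra_simps)
 have Cform: "C = 4 * v' * l * (2 * (l * c1))^2" unfolding C_def dd c by (simp add: power2_eq_square)
 have Dform: "D = 1 - 16 * a * l * c1 * v'" unfolding D1 dd by simp
 have odD: "odd D" by (simp add: Dform)
 have sym: "shimura_symbol C D = 1"
 proof (cases "l * c1 = 0")
  case True
  hence "D = 1" by (auto simp: Dform)
  thus ?thesis by (simp add: shimura_symbol_1)
 next
  case False
  have co: "coprime x D" if "x dvd 1 - D" for x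
  proof (rule coprimeI)
   fix y assume y: "y dvd x" "y dvd D"
   have "y dvd (1 - D) + D" by (rule dvd_add[OF dvd_trans[OF y(1) that] y(2)])
   thus "is_unit y" by simp
  qed
  have "shimura_symbol C D = shimura_symbol (4 * v' * l) D"
   unfolding Cform by (rule shimura_symbol_mult_square[OF odD co]) (use False in \<open>auto simp: Dform\<close>)
  also have "... = shimura_symbol (4 * v' * l) 1"
   by (rule shimura_symbol_periodic) (auto simp: Dform)
  finally show ?thesis by (simp add: shimura_symbol_1)
 qed
 have eps: "eps_odd D = 1" by (simp add: eps_odd_def Dform cong_iff_dvd_diff)
 have "th0 (mob (A,B,C,D) w) = theta_j (A,B,C,D) w * th0 w"
  by (rule th0_transform[OF detD _ w]) (simp add: C_def dd)
 moreover have "mob (A,B,C,D) w = mob (a',b',c,d') z"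
  unfolding w_def mm[symmetric] by (rule moebius_mmul(1)[symmetric]) (use nz in auto)
 moreover have "theta_j (A,B,C,D) w = csqrt (of_int C * w + of_int D)"
  by (simp add: theta_j_def sym eps)
 moreover have "of_int C * w + of_int D = ?J' / ?J"
 proof -
  have "(of_int C * w + of_int D) * ?J = of_int C * (w * ?J) + of_int D * ?J" by (simp add: algebra_simps)
  also have "w * ?J = of_int a * z + of_int b" using nz by (simp add: w_def moebius_act_def)
  also have "of_int C * (aut a b z) + of_int D * ?J = of_int (C * a + D * c) * z + of_int (C * b + D * d)"
   by (simp add: algebra_simps)
  also have "... = ?J'" using mm by (simp add: mmul_def)
  finally show ?thesis using nz by (simp add: field_simps)
 qed
 moreover have "csqrt (?J' / ?J) = csqrt ?J' / csqrt ?J"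
 proof -
  consider "c = 0" | "c > 0" | "c < 0" by linarith
  thus ?thesis
  proof cases
   case 1
   have "l * c1 = 0" using 1 c by auto
   hence "d = d'" using dd by auto
   thus ?thesis using nz by simp
  next
   case 2
   hence "Im ?J > 0" "Im ?J' > 0" using z by simp_all
   thus ?thesis using csqrt_divide_same_half[of ?J' ?J] by blast
  next
   case 3
   hence "Im ?J < 0" "Im ?J' < 0" using z by (simp_all add: mult_neg_pos)
   thus ?thesis using csqrt_divide_same_half[of ?J' ?J] by blast
  qed
 qed
 moreover have "csqrt ?J ~= 0" using nz by simp
 ultimately show ?thesis unfolding w_def by (simp add: field_simps)
qed

text \<open>Generation by translations and inversion, again by descent on |c|; the rules are right
  multiplications, which act on the argument z.\<close>

lemma SL2_induct [consumes 1, case_names id T T' S]: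
 assumes det: "a * d - b * c = (1 :: int)"
  and id: "P 1 0 0 1"
  and T: "!!a b c d. a * d - b * c = 1 ==> P a b c d ==> P a (b + a) c (d + c)"
  and T': "!!a b c d. a * d - b * c = 1 ==> P a b c d ==> P a (b - a) c (d - c)"
  and S: "!!a b c d. a * d - b * c = 1 ==> P a b c d ==> P b (- a) d (- c)"
 shows "P a b c d"
proof -
 have Tk: "P a (b + k * a) c (d + k * c)" if "a * d - b * c = 1" "P a b c d" for a b c d k
 proof (induction k rule: int_induct[where k = 0])
  case base
  show ?case using that by simp
 next
  case (step1 k)
  have "a * (d + k * c) - (b + k * a) * c = 1" using that(1) by (simp add: algebra_simps)
  from T[OF this step1(2)] show ?case by (simp add: algebra_simps)
 next
  case (step2 k)
  have "a * (d + k * c) - (b + k * a) * c = 1" using that(1) by (simp add: algebra_simps)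
  from T'[OF this step2(2)] show ?case by (simp add: algebra_simps)
 qed
 from det show ?thesis
 proof (induction "nat (abs c)" arbitrary: a b c d rule: less_induct)
  case less
  show ?case
  proof (cases "c = 0")
   case True
   hence "a * d = 1" using less.prems by simp
   hence "(a = 1 & d = 1) | (a = -1 & d = -1)" using zmult_eq_1_iff by blast
   thus ?thesis
   proof
    assume "a = 1 & d = 1"
    thus ?thesis using Tk[of 1 1 0 0 b] id True by simp
   next
    assume ad: "a = -1 & d = -1"
    have "P 0 (-1) 1 0" using S[OF _ id] by simp
    hence "P (-1) 0 0 (-1)" using S[of 0 0 "-1" 1] by simp
    thus ?thesis using Tk[of "-1" "-1" 0 0 "-b"] ad True by simp
   qed
  next
   case c0: False
   obtain k where k: "2 * (abs (d + k * c)) <= (abs c)" using balanced_remainder[OF c0] by blast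
   define d1 where "d1 = d + k * c"
   define b1 where "b1 = b + k * a"
   have det1: "a * d1 - b1 * c = 1" using less.prems by (simp add: d1_def b1_def algebra_simps)
   have "0 < (abs c)" using c0 by simp
   hence "(abs d1) < (abs c)" using k unfolding d1_def[symmetric] by linarith
   hence "nat \<bar>- d1\<bar> < nat (abs c)" by simp
   moreover have "- b1 * c - a * (- d1) = 1" using det1 by simp
   ultimately have "P (- b1) a (- d1) c" by (rule less.hyps)
   hence "P a b1 c d1" using S[of "- b1" c a "- d1"] det1 by simp
   from Tk[OF det1 this, of "- k"] show ?thesis by (simp add: d1_def b1_def)
  qed
 qed
qed

lemma moebius_T: "mob (a, b + a, c, d + c) z = mob (a, b, c, d) (z + 1)"
 and moebius_T': "mob (a, b - a, c, d - c) z = mob (a, b, c, d) (z - 1)"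
 by (simp_all add: moebius_act_def algebra_simps)

lemma moebius_S: "z ~= 0 ==> mob (b, - a, d, - c) z = mob (a, b, c, d) (- 1 / z)"
 using mult_divide_mult_cancel_right[of z "of_int b - of_int a / z" "of_int d - of_int c / z"]
 by (simp add: moebius_act_def algebra_simps)

text \<open>The bottom row modulo 2 decides which of the three theta constants th0 is carried
  to.\<close>

definition thr :: "int => int => complex => complex" where
 "thr c d = (if even c then th0 else if even d then th1 else th2)"

lemma thr_nonzero: "Im z > 0 ==> thr c d z ~= 0"
 by (simp add: thr_def th0_nonzero th1_nonzero th2_nonzero)

lemma thr_T: "EX C. C ~= 0 & (ALL z. (thr c d (z + 1))\<^sup>2 = C * (thr c (d + c) z)^2)"
proof -
 have "(thr c d (z + 1))\<^sup>2 = (if odd c & odd d then (ee (1/8))\<^sup>2 else 1) * (thr c (d + c) z)^2" for z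
  by (auto simp: thr_def th0_T th1_T th2_T power_mult_distrib)
 thus ?thesis by (intro exI[of _ "if odd c & odd d then (ee (1/8))\<^sup>2 else 1"]) auto
qed

lemma thr_S: "coprime c d ==> EX C. C ~= 0 & (ALL z. Im z > 0 --> (thr c d (- 1 / z))\<^sup>2 = C * z * (thr d (- c) z)^2)"
proof -
 assume cop: "coprime c d"
 have nb: "~ (even c & even d)" using cop by (metis coprime_common_divisor odd_one)
 define k where "k = (if even c then 2 else if even d then 1 else (1 + \<i>) * ee (- (1/8)))"
 have i1: "1 + \<i> ~= 0" by (simp add: complex_eq_iff)
 have "thr c d (- 1 / z) = k * csqrt (- \<i> * z / 2) * thr d (- c) z" if "Im z > 0" for z
  using nb th0_S[OF that] th1_S[OF that] th2_S[OF that] by (auto simp: thr_def k_def)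
 hence "(thr c d (- 1 / z))\<^sup>2 = (k^2 * (- \<i> / 2)) * z * (thr d (- c) z)^2" if "Im z > 0" for z
  using that by (simp add: power_mult_distrib)
 moreover have "k\<^sup>2 * (- \<i> / 2) ~= 0" using i1 by (simp add: k_def)
 ultimately show ?thesis by blast
qed

text \<open>For squares the automorphy factor is c z + d without a choice of root, so the factors
  multiply along the induction.\<close>

lemma th0_square_transform:
 assumes det: "a * d - b * c = 1"
 shows "EX K. K ~= 0 & (ALL z. Im z > 0 --> (th0 (mob (a,b,c,d) z))\<^sup>2 = K * (aut c d z) * (thr c d z)^2)"
 using det
proof (induction a b c d rule: SL2_induct)
 case id
 show ?case by (intro exI[of _ 1]) (simp add: moebius_act_def thr_def)
next
 case (T a b c d)
 obtain K where K: "K ~= 0" "!!z. Im z > 0 ==> (th0 (mob (a,b,c,d) z))\<^sup>2 = K * (aut c d z) * (thr c d z)^2"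
  using T(2) by blast
 obtain C where C: "C ~= 0" "!!z. (thr c d (z + 1))\<^sup>2 = C * (thr c (d + c) z)^2" using thr_T by blast
 show ?case
 proof (intro exI[of _ "K * C"] conjI allI impI)
  fix z assume "Im z > 0"
  thus "(th0 (mob (a,b+a,c,d+c) z))\<^sup>2 = K * C * (of_int c * z + of_int (d + c)) * (thr c (d + c) z)^2"
   unfolding moebius_T by (subst K(2)) (simp_all only: C(2), simp_all add: algebra_simps)
 qed (use K C in simp)
next
 case (T' a b c d)
 obtain K where K: "K ~= 0" "!!z. Im z > 0 ==> (th0 (mob (a,b,c,d) z))\<^sup>2 = K * (aut c d z) * (thr c d z)^2"
  using T'(2) by blast
 obtain C where C: "C ~= 0" "!!z. (thr c (d - c) (z + 1))\<^sup>2 = C * (thr c (d - c + c) z)^2" using thr_T by blast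
 have C': "(thr c d (z - 1))\<^sup>2 = (1 / C) * (thr c (d - c) z)^2" for z
  using C(2)[of "z - 1"] C(1) by simp
 show ?case
 proof (intro exI[of _ "K * (1 / C)"] conjI allI impI)
  fix z assume "Im z > 0"
  thus "(th0 (mob (a,b-a,c,d-c) z))\<^sup>2 = K * (1 / C) * (of_int c * z + of_int (d - c)) * (thr c (d - c) z)^2"
   unfolding moebius_T' by (subst K(2)) (simp_all only: C', simp_all add: field_simps)
 qed (use K C in simp)
next
 case (S a b c d)
 obtain K where K: "K ~= 0" "!!z. Im z > 0 ==> (th0 (mob (a,b,c,d) z))\<^sup>2 = K * (aut c d z) * (thr c d z)^2"
  using S(2) by blast
 obtain C where C: "C ~= 0" "!!z. Im z > 0 ==> (thr c d (- 1 / z))\<^sup>2 = C * z * (thr d (- c) z)^2"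
  using thr_S[OF SL2_coprime[OF S(1)]] by blast
 show ?case
 proof (intro exI[of _ "K * C"] conjI allI impI)
  fix z assume z: "Im z > 0"
  have nz: "z ~= 0" using z by auto
  have "(of_int c * (- 1 / z) + of_int d) * (C * z * (thr d (- c) z)^2) = C * ((of_int d * z + of_int (- c)) * (thr d (- c) z)^2)"
   using nz by (simp add: field_simps)
  thus "(th0 (mob (b,-a,d,-c) z))\<^sup>2 = K * C * (of_int d * z + of_int (- c)) * (thr d (- c) z)^2"
   unfolding moebius_S[OF nz] K(2)[OF upper_inverse_neg[OF z]] C(2)[OF z] by (simp only: mult.assoc)
 qed (use K C in simp)
qed

lemma th0_holomorphic: "th0 holomorphic_on {z. Im z > 0}"
 unfolding th0_def[abs_def] by (rule gtheta_holomorphic_fst)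

lemma gtheta_half_period_holomorphic:
 "(%z. gtheta z (z / 2 + b)) holomorphic_on {z. Im z > 0}"
proof -
 have "(%z. \<Sum>\<^sub>\<infinity>n::int. ee ((of_int n)^2 * z + of_int n * (z / 2 + b) + 0)) holomorphic_on {z. Im z > 0}"
  by (rule theta_family_holomorphic[of _ "%z. z" "%z. z / 2 + b" "%_. 0"])
   (auto intro!: holomorphic_intros simp: open_halfspace_Im_gt)
 thus ?thesis unfolding gtheta_def[abs_def] add_0_right .
qed

lemma th1_holomorphic: "th1 holomorphic_on {z. Im z > 0}"
 and th2_holomorphic: "th2 holomorphic_on {z. Im z > 0}"
proof -
 show "th1 holomorphic_on {z. Im z > 0}" unfolding th1_def[abs_def]
  using gtheta_half_period_holomorphic[of 0] by (intro holomorphic_intros holomorphic_on_ee) auto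
 show "th2 holomorphic_on {z. Im z > 0}" unfolding th2_def[abs_def]
  by (intro holomorphic_intros holomorphic_on_ee gtheta_half_period_holomorphic) auto
qed

lemma csqrt_linear_continuous: "continuous_on {z. Im z > 0} (%z. csqrt (aut c d z))"
proof (cases "c = 0")
 case False
 have "of_int c * z + of_int d ~: \<real>\<^sub>\<le>\<^sub>0" if "Im z > 0" for z
 proof -
  have "Im (aut c d z) ~= 0" using that False by simp
  thus ?thesis by (auto simp: complex_nonpos_Reals_iff)
 qed
 hence "continuous_on {z. Im z > 0} (csqrt \<circ> (%z. of_int c * z + of_int d))"
  by (intro continuous_on_compose continuous_intros continuous_on_subset[OF continuous_on_csqrt]) auto
 thus ?thesis by (simp add: o_def)
qed simp

text \<open>The quotient f is continuous on a connected set and has constant square, hence is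
  constant. The root is recovered without tracking any sign.\<close>

theorem th0_general_transform:
 assumes det: "a * d - b * c = 1"
 shows "EX k. k ~= 0 & (ALL z. Im z > 0 --> th0 (mob (a,b,c,d) z) = k * csqrt (aut c d z) * thr c d z)"
proof -
 obtain K where K: "K ~= 0" "!!z. Im z > 0 ==> (th0 (mob (a,b,c,d) z))\<^sup>2 = K * (aut c d z) * (thr c d z)^2"
  using th0_square_transform[OF det] by blast
 define f where "f = (%z. th0 (mob (a,b,c,d) z) / (csqrt (aut c d z) * thr c d z))"
 let ?H = "{z. Im z > 0}"
 have J: "of_int c * z + of_int d ~= (0 :: complex)" if "Im z > 0" for z by (rule Im_moebius(2)[OF det that])
 have f2: "(f z)\<^sup>2 = K" if "Im z > 0" for z
  using K(2)[OF that] J[OF that] thr_nonzero[OF that] by (simp add: f_def power_divide power_mult_distrib)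
 have cont: "continuous_on ?H f"
 proof -
  have m: "continuous_on ?H (mob (a,b,c,d))" unfolding moebius_act_def[abs_def] prod.case
   by (intro continuous_intros) (use J in auto)
  have "continuous_on ?H (%z. th0 (mob (a,b,c,d) z))"
   by (rule continuous_on_compose2[OF holomorphic_on_imp_continuous_on[OF th0_holomorphic] m])
    (use Im_moebius(3)[OF det] in auto)
  moreover have "continuous_on ?H (thr c d)"
   using th0_holomorphic th1_holomorphic th2_holomorphic by (auto simp: thr_def intro: holomorphic_on_imp_continuous_on)
  ultimately show ?thesis unfolding f_def
   by (intro continuous_intros csqrt_linear_continuous) (use J thr_nonzero in auto)
 qed
 have "f constant_on ?H"
 proof (rule continuous_finite_range_constant[OF _ cont])
  show "connected ?H" by (intro convex_connected convex_halfspace_Im_gt)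
  have "f ` ?H <= {csqrt K, - csqrt K}"
  proof
   fix y assume "y \<in> f ` ?H"
   then obtain z where "Im z > 0" "y = f z" by auto
   hence "y\<^sup>2 = (csqrt K)^2" using f2 by simp
   thus "y \<in> {csqrt K, - csqrt K}" by (simp only: power2_eq_iff) simp
  qed
  thus "finite (f ` ?H)" by (rule finite_subset) simp
 qed
 then obtain k where k: "!!z. Im z > 0 ==> f z = k" unfolding constant_on_def by auto
 have "k\<^sup>2 = K" using k[of \<i>] f2[of \<i>] by simp
 hence "k ~= 0" using K(1) by auto
 moreover have "th0 (mob (a,b,c,d) z) = k * csqrt (aut c d z) * thr c d z" if "Im z > 0" for z
  using k[OF that] J[OF that] thr_nonzero[OF that, of c d] by (auto simp: f_def field_simps)
 ultimately show ?thesis by blast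
qed

section \<open>The discriminant\<close>

text \<open>The product of the three theta constants is a constant times eta^3, so this is the
  modular discriminant up to sign: weight 12 for SL2(Z), no zero in the half-plane, a simple zero in
  ee z at infinity. The eighth power removes the roots of unity of the theta multipliers.\<close>

definition X8 :: "complex => complex" where "X8 z = (th0 z * th1 z * th2 z) ^ 8"

lemma X8_nonzero: "Im z > 0 ==> X8 z ~= 0"
 by (simp add: X8_def th0_nonzero th1_nonzero th2_nonzero)

lemma X8_T: "X8 (z + 1) = X8 z"
proof -
 have "(ee (1/8)) ^ 8 = 1" unfolding ee_power using ee_of_int[of 1] by simp
 thus ?thesis by (simp add: X8_def th0_T th1_T th2_T power_mult_distrib)
qed

lemma X8_S:
 assumes z: "Im z > 0"
 shows "X8 (- 1 / z) = z ^ 12 * X8 z"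
proof -
 define r where "r = csqrt (- \<i> * z / 2)"
 have "(r ^ 3) ^ 8 = (r^2) ^ 12" by (simp flip: power_mult)
 also have "r\<^sup>2 = - \<i> * z / 2" by (simp add: r_def)
 also have "(- \<i> * z / 2) ^ 12 = z ^ 12 / 2 ^ 12"
 proof -
  have "\<i> ^ 12 = (\<i> ^ 4) ^ 3" by (simp flip: power_mult)
  thus ?thesis by (simp add: power_mult_distrib power_divide)
 qed
 finally have r: "(r ^ 3) ^ 8 = z ^ 12 / 2 ^ 12" .
 have "(2 * 1 * ((1 + \<i>) * ee (- (1/8)))) ^ 8 = 2 ^ 8 * (((1 + \<i>) ^ 2) ^ 4 * ee (- 1))"
  unfolding power_mult_distrib ee_power by (simp flip: power_mult)
 also have "ee (- 1) = 1" using ee_of_int[of "-1"] by simp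
 also have "(1 + \<i>) ^ 2 = 2 * \<i>" by (simp add: power2_eq_square algebra_simps)
 also have "(2 * \<i>) ^ 4 = 2 ^ 4 * (\<i> ^ 4)" by (rule power_mult_distrib)
 finally have k: "(2 * 1 * ((1 + \<i>) * ee (- (1/8)))) ^ 8 = 2 ^ 12" by simp
 have "X8 (- 1 / z) = (2 * 1 * ((1 + \<i>) * ee (- (1/8))) * r ^ 3 * (th0 z * th1 z * th2 z)) ^ 8"
  unfolding X8_def th0_S[OF z] th1_S[OF z] th2_S[OF z] r_def[symmetric] by (simp add: power3_eq_cube mult_ac)
 also have "... = 2 ^ 12 * (z ^ 12 / 2 ^ 12) * X8 z" unfolding power_mult_distrib[of _ "th0 z * th1 z * th2 z"]
   power_mult_distrib[of _ "r ^ 3"] k r X8_def ..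
 finally show ?thesis by simp
qed

theorem X8_transform:
 assumes det: "a * d - b * c = 1" and "Im z > 0"
 shows "X8 (mob (a,b,c,d) z) = (aut c d z) ^ 12 * X8 z"
 using assms
proof (induction a b c d arbitrary: z rule: SL2_induct)
 case id
 show ?case by (simp add: moebius_act_def)
next
 case (T a b c d)
 have e: "of_int c * (z + 1) + of_int d = of_int c * z + (of_int (d + c) :: complex)" by (simp add: algebra_simps)
 have "X8 (mob (a,b,c,d) (z + 1)) = (of_int c * (z + 1) + of_int d) ^ 12 * X8 (z + 1)"
  by (rule T(2)) (use T(3) in simp)
 thus ?case unfolding moebius_T X8_T e .
next
 case (T' a b c d)
 have e: "of_int c * (z - 1) + of_int d = of_int c * z + (of_int (d - c) :: complex)" by (simp add: algebra_simps)
 have e': "X8 (z - 1) = X8 z" using X8_T[of "z - 1"] by simp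
 have "X8 (mob (a,b,c,d) (z - 1)) = (of_int c * (z - 1) + of_int d) ^ 12 * X8 (z - 1)"
  by (rule T'(2)) (use T'(3) in simp)
 thus ?case unfolding moebius_T' e' e .
next
 case (S a b c d)
 have nz: "z ~= 0" using S(3) by auto
 have "(of_int c * (- 1 / z) + of_int d) ^ 12 * (z ^ 12 * X8 z) = (of_int d * z + of_int (- c)) ^ 12 * X8 z"
 proof -
  have "(of_int c * (- 1 / z) + of_int d) * z = of_int d * z + (of_int (- c) :: complex)" using nz by (simp add: field_simps)
  thus ?thesis by (metis mult.assoc power_mult_distrib)
 qed
 thus ?case unfolding moebius_S[OF nz] using S(2)[OF upper_inverse_neg[OF S(3)]] X8_S[OF S(3)] by simp
qed

section \<open>Normalised Appell functions\<close>

text \<open>The flag records the parity of c: False belongs to even c, True to odd c with even d.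
  The third class, c and d both odd, is later reached through a translation.\<close>

definition thc :: "bool => complex => complex" where "thc e z = (if e then th1 z else th0 z)"

definition appc :: "bool => complex => int => complex" where
 "appc e z n = ee ((of_int n)^2 * z + of_int n * (if e then z / 2 else 1 / 2))"

text \<open>The factor ee (u / 2) gives the version for odd c the change of sign under u + 1 that
  the image of the other version has for odd c.\<close>

definition appell :: "bool => complex => complex => complex" where
 "appell e z u = (if e then ee (u / 2) else 1) * lambert (appc e z) z (ee u) / thc e z"

lemma thc_nonzero: "Im z > 0 ==> thc e z ~= 0"
 by (simp add: thc_def th0_nonzero th1_nonzero)

lemma appc_summable: "Im z > 0 ==> (%n. norm (appc e z n)) summable_on UNIV"
 unfolding appc_def by (rule gtheta_summable)

lemma appc_False: "appc False = app0"
 by (rule ext)+ (simp add: appc_def app0_def)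

abbreviation esgn :: "bool => complex" where "esgn e \<equiv> (if e then 1 else -1)"

lemma appell_quasi_period:
 assumes z: "Im z > 0" and u: "!!n. ee u * ee (of_int n * z) ~= 1"
 shows "appell e z (u + z) = esgn e * ee (z + 2 * u) * appell e z u +
  (if e then ee (15 * z / 16 + 3 * u / 2) + ee (7 * z / 16 + u / 2) else 1)"
proof (cases e)
 case False
 let ?L = "lambert (app0 z) z (ee u)"
 have "lambert (app0 z) z (ee u * ee z) = - ee z * (ee u)^2 * ?L + th0 z"
  using lambert_app0_quasi_period[OF z ee_nonzero u] by (simp add: mult.commute)
 hence "lambert (app0 z) z (ee (u + z)) = - ee (z + 2 * u) * ?L + th0 z"
  by (simp add: ee_add ee_power flip: mult.assoc)
 thus ?thesis using False th0_nonzero[OF z] by (simp add: appell_def thc_def appc_False field_simps)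
next
 case True
 let ?L = "lambert (appc True z) z (ee u)"
 define G where "G = gtheta z (z / 2)"
 have th1: "th1 z = ee (z / 16) * G" by (simp add: th1_def G_def)
 have G0: "G ~= 0" using th1_nonzero[OF z] th1 by auto
 have "gtheta z (z / 2 - z) = G" using gtheta_minus[of z "z / 2"] by (simp add: G_def)
 hence "lambert (appc True z) z (ee u * ee z) = ee (z - z / 2) * ((ee u)^2 * ?L + ee u * G) + G"
  using lambert_gauss_quasi_period[OF z ee_nonzero u, of "z / 2"] by (simp add: appc_def[abs_def] G_def)
 hence 1: "appell True z (u + z) = ee ((u + z) / 2) * (ee (z - z / 2) * ((ee u)^2 * ?L + ee u * G) + G) / (ee (z / 16) * G)"
  by (simp add: appell_def thc_def th1 ee_add)
 have gen: "A * (B * (W * L + w * G) + G) / (s * G) = (A * B * W) * L / (s * G) + (A * B * w + A) / s"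
  if "s ~= 0" for A B W L w s :: complex using that G0 by (simp add: field_simps)
 have E1: "ee ((u + z) / 2) * ee (z - z / 2) * (ee u)^2 = ee (z + 2 * u) * ee (u / 2)"
  unfolding ee_power ee_add[symmetric] by (rule arg_cong[where f = ee]) (simp add: field_simps)
 have E2: "ee ((u + z) / 2) * ee (z - z / 2) * ee u = ee (15 * z / 16 + 3 * u / 2) * ee (z / 16)"
  unfolding ee_add[symmetric] by (rule arg_cong[where f = ee]) (simp add: field_simps)
 have E3: "ee ((u + z) / 2) = ee (7 * z / 16 + u / 2) * ee (z / 16)"
  unfolding ee_add[symmetric] by (rule arg_cong[where f = ee]) (simp add: field_simps)
 have "appell True z (u + z) = ee (z + 2 * u) * ee (u / 2) * ?L / (ee (z / 16) * G) +
  (ee (15 * z / 16 + 3 * u / 2) * ee (z / 16) + ee (7 * z / 16 + u / 2) * ee (z / 16)) / ee (z / 16)"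
  unfolding 1 gen[OF ee_nonzero] E1 E2 unfolding E3 ..
 also have "... = ee (z + 2 * u) * appell True z u + (ee (15 * z / 16 + 3 * u / 2) + ee (7 * z / 16 + u / 2))"
  by (simp add: appell_def thc_def th1 add_divide_distrib)
 finally show ?thesis using True by simp
qed

text \<open>The defects of ellipticity, transported back to the argument u. As powers of ee z their
  exponents are -(i + 1/4)^2, -(i + 3/4)^2 or -(i + 1)^2; sixteen times each of these is minus the
  square of an integer.\<close>

definition apps :: "bool => nat => complex => complex => complex" where
 "apps e i z u = (if e then ee (- ((of_nat i + 1/4)^2 * z) - (2 * of_nat i + 1/2) * u) + ee (- ((of_nat i + 3/4)^2 * z) - (2 * of_nat i + 3/2) * u)
  else (-1) ^ Suc i * ee (- ((of_nat i + 1)^2 * z) - 2 * (of_nat i + 1) * u))"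

lemma appell_quasi_period_nat:
 assumes z: "Im z > 0" and u: "!!n. ee u * ee (of_int n * z) ~= 1"
 shows "appell e z (u + of_nat k * z) = esgn e ^ k * ee ((of_nat k)^2 * z + 2 * of_nat k * u) * (appell e z u + (\<Sum>i<k. apps e i z u))"
proof (induction k)
 case (Suc k)
 let ?u = "u + of_nat k * z"
 have np: "ee ?u * ee (of_int n * z) ~= 1" for n
 proof -
  have "ee ?u * ee (of_int n * z) = ee u * ee (of_int (n + int k) * z)"
   unfolding ee_add[symmetric] by (rule arg_cong[where f = ee]) (simp add: algebra_simps)
  thus ?thesis using u[of "n + int k"] by simp
 qed
 let ?E = "ee ((of_nat (Suc k))^2 * z + 2 * of_nat (Suc k) * u)"
 have E: "ee (z + 2 * ?u) * ee ((of_nat k)^2 * z + 2 * of_nat k * u) = ?E"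
  unfolding ee_add[symmetric] by (rule arg_cong[where f = ee]) (simp add: algebra_simps power2_eq_square)
 have R: "(if e then ee (15 * z / 16 + 3 * ?u / 2) + ee (7 * z / 16 + ?u / 2) else 1) = esgn e ^ Suc k * ?E * apps e k z u"
 proof (cases e)
  case True
  have "?E * ee (- ((of_nat k + 1/4)^2 * z) - (2 * of_nat k + 1/2) * u) = ee (15 * z / 16 + 3 * ?u / 2)"
   unfolding ee_add[symmetric] by (rule arg_cong[where f = ee]) (simp add: field_simps power2_eq_square)
  moreover have "?E * ee (- ((of_nat k + 3/4)^2 * z) - (2 * of_nat k + 3/2) * u) = ee (7 * z / 16 + ?u / 2)"
   unfolding ee_add[symmetric] by (rule arg_cong[where f = ee]) (simp add: field_simps power2_eq_square)
  ultimately show ?thesis using True by (simp only: apps_def if_True power_one mult_1 distrib_left)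
 next
  case False
  have "?E * ee (- ((of_nat k + 1)^2 * z) - 2 * (of_nat k + 1) * u) = ee 0"
   unfolding ee_add[symmetric] by (rule arg_cong[where f = ee]) (simp add: field_simps power2_eq_square)
  moreover have "(-1) ^ Suc k * (E :: complex) * ((-1) ^ Suc k * x) = E * x" for E x
   by (simp add: mult_ac flip: power_mult_distrib)
  ultimately show ?thesis using False by (simp only: apps_def if_False ee_0)
 qed
 have "appell e z (u + of_nat (Suc k) * z) = appell e z (?u + z)" by (simp add: algebra_simps)
 also have "... = esgn e ^ Suc k * (ee (z + 2 * ?u) * ee ((of_nat k)^2 * z + 2 * of_nat k * u)) * (appell e z u + (\<Sum>i<k. apps e i z u)) + esgn e ^ Suc k * ?E * apps e k z u"
  unfolding appell_quasi_period[OF z np] R Suc by (simp only: power_Suc mult_ac)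
 finally show ?case unfolding E by (simp only: sum.lessThan_Suc distrib_left add.assoc)
qed simp

lemma appell_add_1: "appell e z (u + 1) = (if e then -1 else 1) * appell e z u"
 by (simp add: appell_def add_divide_distrib ee_add ee_half)

lemma appell_add_int: "appell e z (u + of_int n) = (if e then (-1) powi n else 1) * appell e z u"
proof (induction n rule: int_induct[where k = 0])
 case (step1 i)
 thus ?case using appell_add_1[of e z "u + of_int i"] by (auto simp: add.assoc power_int_add)
next
 case (step2 i)
 thus ?case using appell_add_1[of e z "u + of_int (i - 1)"] by (auto simp: add.assoc power_int_diff)
qed simp

text \<open>The prefactor ee (z / 16) of th1 forces 16 as the translation that fixes both theta
  constants.\<close>

lemma thc_T16: "thc e (z + 16) = thc e z"
proof -
 have "th0 (z + 16) = th0 z"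
  unfolding th0_def gtheta_def by (intro infsum_cong, rule ee_eqI[where n = "16 * _^2"]) (simp add: algebra_simps)
 moreover have "th1 (z + 16) = th1 z"
 proof -
  have g: "gtheta (z + 16) ((z + 16) / 2) = gtheta z (z / 2)"
   unfolding gtheta_def by (intro infsum_cong, rule ee_eqI[where n = "16 * x^2 + 8 * x" for x]) (simp add: field_simps)
  have "ee ((z + 16) / 16) = ee (z / 16)" by (rule ee_eqI[where n = 1]) (simp add: add_divide_distrib)
  thus ?thesis using g by (simp add: th1_def)
 qed
 ultimately show ?thesis by (simp add: thc_def)
qed

lemma thc_T16_int: "thc e (z + 16 * of_int n) = thc e z"
proof (induction n rule: int_induct[where k = 0])
 case (step1 i)
 thus ?case using thc_T16[of e "z + 16 * of_int i"] by (simp add: algebra_simps)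
next
 case (step2 i)
 thus ?case using thc_T16[of e "z + 16 * of_int (i - 1)"] by (simp add: algebra_simps)
qed simp

lemma appell_T16: "appell e (z + 16) u = appell e z u"
proof -
 have a: "appc e (z + 16) n = appc e z n" for n
  unfolding appc_def by (rule ee_eqI[where n = "16 * n^2 + (if e then 8 * n else 0)"]) (simp add: field_simps)
 have l: "lambert (appc e z) (z + 16) w = lambert (appc e z) z w" for w
 proof -
  have "ee (of_int n * (z + 16)) = ee (of_int n * z)" for n
   by (rule ee_eqI[where n = "16 * n"]) (simp add: algebra_simps)
  thus ?thesis by (simp add: lambert_def)
 qed
 have "appc e (z + 16) = appc e z" using a by blast
 thus ?thesis by (simp add: appell_def l thc_T16)
qed

lemma appell_T16_int: "appell e (z + 16 * of_int n) u = appell e z u"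
proof (induction n rule: int_induct[where k = 0])
 case (step1 i)
 thus ?case using appell_T16[of e "z + 16 * of_int i" u] by (simp add: algebra_simps)
next
 case (step2 i)
 thus ?case using appell_T16[of e "z + 16 * of_int (i - 1)" u] by (simp add: algebra_simps)
qed simp

lemma lambert_pole_ee: "ee u * ee (of_int n * z) = 1 \<longleftrightarrow> (EX j. u = of_int (- n) * z + of_int j)"
 unfolding ee_add[symmetric] ee_eq_1_iff by (auto simp: algebra_simps)

lemma discrete_open:
 fixes P :: "complex set"
 assumes "!!z. EX r>0. ALL p:P. p ~= z --> r <= dist p z"
 shows "open (- P)"
proof (subst open_subopen, intro ballI)
 fix z assume z: "z \<in> - P"
 obtain r where r: "r > 0" "ALL p:P. p ~= z --> r <= dist p z" using assms by blast
 have "w ~: P" if "w \<in> ball z r" for w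
  using r(2) z that by (metis ComplD dist_commute mem_ball not_less)
 hence "ball z r <= - P" by blast
 thus "EX T. open T & z \<in> T & T <= - P" using r(1) by (meson centre_in_ball open_ball)
qed

lemma appell_field_differentiable:
 assumes z: "Im z > 0" and u: "\<nexists>m j :: int. u = of_int m * z + of_int j"
 shows "appell e z field_differentiable at u"
proof -
 let ?S = "{w. w ~= 0 & (ALL n. w * ee (of_int n * z) ~= 1)}"
 let ?U = "- {p. EX m j :: int. p = 0 + of_int m * z + of_int j / of_nat 1}"
 have op: "open ?U" by (rule discrete_open) (rule lattice_discrete[OF z], simp)
 have "ee w * ee (of_int n * z) ~= 1" if "w \<in> ?U" for w n
 proof
  assume "ee w * ee (of_int n * z) = 1"
  then obtain j where "w = of_int (- n) * z + of_int j" unfolding lambert_pole_ee by blast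
  hence "w = 0 + of_int (- n) * z + of_int j / of_nat 1" by simp
  thus False using that by blast
 qed
 hence "ee ` ?U <= ?S" by auto
 hence "(lambert (appc e z) z \<circ> ee) holomorphic_on ?U"
  by (intro holomorphic_on_compose_gen[OF holomorphic_on_ee lambert_holomorphic[OF z appc_summable[OF z]]]) (auto intro: holomorphic_intros)
 hence "appell e z holomorphic_on ?U" unfolding appell_def[abs_def] o_def
  by (cases e) (auto intro!: holomorphic_intros holomorphic_on_ee simp: thc_nonzero[OF z])
 thus ?thesis using op u by (auto simp: holomorphic_on_open field_differentiable_def)
qed

lemma appell_residue:
 assumes z: "Im z > 0" and p: "p = of_int m * z + of_int j"
 shows "((%u. (u - p) * appell e z u) ---> - ((-1) powi (if e then j else m) * ee ((of_int m)^2 * z)) / (2 * of_real pi * \<i> * thc e z)) (at p)"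
proof -
 have l: "((%u. (if e then ee (u / 2) else 1) * ((u - p) * lambert (appc e z) z (ee u)) / thc e z) \<longlongrightarrow>
  (if e then ee (p / 2) else 1) * (- appc e z (- m) / (2 * of_real pi * \<i>)) / thc e z) (at p)"
  by (intro tendsto_intros lambert_ee_residue[OF z appc_summable[OF z] p])
   (use thc_nonzero[OF z] in \<open>cases e, auto intro!: tendsto_intros tendsto_ee\<close>)
 have half: "ee (of_int n / 2) = (-1) powi n" for n
 proof (induction n rule: int_induct[where k = 0])
  case (step1 i)
  thus ?case by (simp add: add_divide_distrib ee_add ee_half power_int_add)
 next
  case (step2 i)
  thus ?case by (simp add: diff_divide_distrib ee_diff ee_half power_int_diff)
 qed simp
 have "(if e then ee (p / 2) else 1) * appc e z (- m) = (-1) powi (if e then j else m) * ee ((of_int m)^2 * z)"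
 proof (cases e)
  case True
  have "ee (p / 2) * appc True z (- m) = ee (of_int j / 2) * ee ((of_int m)^2 * z)"
   unfolding appc_def ee_add[symmetric] p by (rule arg_cong[where f = ee]) (simp add: field_simps)
  thus ?thesis using True half by simp
 next
  case False
  have "appc False z (- m) = ee (of_int (- m) / 2) * ee ((of_int m)^2 * z)"
   unfolding appc_def ee_add[symmetric] by (rule arg_cong[where f = ee]) (simp add: field_simps)
  moreover have "((-1) :: complex) powi (- m) = (-1) powi m"
   unfolding power_int_minus by (rule inverse_unique) (rule power_int_minus_one_mult_self)
  ultimately show ?thesis using False half[of "- m"] by simp
 qed
 hence "(if e then ee (p / 2) else 1) * (- appc e z (- m) / (2 * of_real pi * \<i>)) / thc e z =
  - ((-1) powi (if e then j else m) * ee ((of_int m)^2 * z)) / (2 * of_real pi * \<i> * thc e z)"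
  by (metis (no_types, lifting) divide_divide_eq_left minus_mult_right times_divide_eq_right)
 moreover have "(%u. (if e then ee (u / 2) else 1) * ((u - p) * lambert (appc e z) z (ee u)) / thc e z) = (%u. (u - p) * appell e z u)"
  by (simp add: appell_def mult_ac)
 ultimately show ?thesis using l by (simp only:)
qed

section \<open>The quadratic sieve\<close>

definition nonres :: "nat => int => bool" where "nonres l n \<longleftrightarrow> Legendre (- n) (int l) = -1"

lemma nonres_cong:
 assumes "[n = n'] (mod int l)" shows "nonres l n = nonres l n'"
proof -
 have "[- n = - n'] (mod int l)" using assms cong_minus_minus_iff by blast
 thus ?thesis unfolding nonres_def using Legendre_cong by metis
qed

lemma nonres_mult_square: "prime l ==> l > 2 ==> ~ int l dvd d ==> nonres l (n * d^2) = nonres l n"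
proof -
 assume "prime l" "l > 2" "~ int l dvd d"
 hence "Legendre (- n * d^2) (int l) = Legendre (- n) (int l)" by (rule Legendre_square_right)
 moreover have "- (n * d^2) = - n * d^2" by simp
 ultimately show ?thesis unfolding nonres_def by (simp only:)
qed

text \<open>Hence the exponents of the defect terms, and the exponent 0, are never selected.\<close>

lemma not_nonres_neg_square: "~ nonres l (- (x^2))"
proof -
 have "QuadRes (int l) (x^2)" unfolding QuadRes_def by (intro exI[of _ x]) simp
 thus ?thesis by (simp add: nonres_def Legendre_def)
qed

text \<open>The finite Fourier transform of the indicator of \<open>nonres\<close>, so that weighted
  translates extract the selected exponents by Fourier inversion.\<close>

definition sieve_coeff :: "nat => int => complex" where
 "sieve_coeff l v = (\<Sum>n\<in>{n\<in>{0..<int l}. nonres l n}. ee (- (of_int (n * v) / of_nat l))) / of_nat l"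

lemma sum_roots_of_unity:
 assumes l: "l > 0"
 shows "(\<Sum>v\<in>{0..<int l}. ee (of_int (v * k) / of_nat l)) = (if int l dvd k then of_nat l else 0)"
proof -
 let ?x = "ee (of_int k / of_nat l)"
 have "(\<Sum>v\<in>{0..<int l}. ee (of_int (v * k) / of_nat l)) = (\<Sum>v<l. ?x ^ v)"
  by (rule sum.reindex_bij_witness[of _ int nat]) (auto simp: ee_power)
 also have "... = (if int l dvd k then of_nat l else 0)"
 proof (cases "int l dvd k")
  case True
  then obtain j where "k = int l * j" by (elim dvdE)
  hence "?x = 1" using l by simp
  thus ?thesis using True by simp
 next
  case False
  have "?x ~= 1"
  proof
   assume "?x = 1"
   then obtain j where j: "of_int k / of_nat l = (of_int j :: complex)" by (auto simp: ee_eq_1_iff)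
   hence "of_int k = (of_int (j * int l) :: complex)" using l by (simp add: field_simps)
   hence "k = j * int l" by (simp only: of_int_eq_iff)
   thus False using False by simp
  qed
  moreover have "?x ^ l = 1" using l by (simp add: ee_power)
  ultimately show ?thesis using False by (simp add: geometric_sum)
 qed
 finally show ?thesis .
qed

lemma sieve_indicator:
 assumes l: "l > 0"
 shows "(\<Sum>v\<in>{0..<int l}. sieve_coeff l v * ee (of_int (v * k) / of_nat l)) = of_bool (nonres l k)"
proof -
 let ?S = "{n\<in>{0..<int l}. nonres l n}"
 have e: "ee (- (of_int (n * v) / of_nat l)) * ee (of_int (v * k) / of_nat l) = ee (of_int (v * (k - n)) / of_nat l)" for n v
  unfolding ee_add[symmetric] by (rule arg_cong[where f = ee]) (simp add: field_simps diff_divide_distrib)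
 have "(\<Sum>v\<in>{0..<int l}. sieve_coeff l v * ee (of_int (v * k) / of_nat l)) =
   (\<Sum>v\<in>{0..<int l}. \<Sum>n\<in>?S. ee (of_int (v * (k - n)) / of_nat l)) / of_nat l"
  unfolding sieve_coeff_def sum_divide_distrib[symmetric] times_divide_eq_left sum_distrib_right e ..
 also have "(\<Sum>v\<in>{0..<int l}. \<Sum>n\<in>?S. ee (of_int (v * (k - n)) / of_nat l)) = (\<Sum>n\<in>?S. if int l dvd k - n then of_nat l else 0)"
  by (subst sum.swap) (simp only: sum_roots_of_unity[OF l])
 also have "... = (\<Sum>n\<in>?S. if k mod int l = n then of_nat l else 0)"
 proof (rule sum.cong[OF refl])
  fix n assume "n \<in> ?S"
  hence "n mod int l = n" by simp
  hence "int l dvd k - n \<longleftrightarrow> k mod int l = n" by (metis mod_eq_dvd_iff)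
  thus "(if int l dvd k - n then of_nat l else 0 :: complex) = (if k mod int l = n then of_nat l else 0)" by simp
 qed
 also have "... = (if k mod int l \<in> ?S then of_nat l else 0)" by (rule sum.delta', rule finite_subset[of _ "{0..<int l}"]) auto
 also have "k mod int l \<in> ?S \<longleftrightarrow> nonres l k" using l nonres_cong[of "k mod int l" k l] by (simp add: cong_def)
 finally show ?thesis using l by simp
qed

lemma sieve_coeff_cong: "[v = v'] (mod int l) ==> sieve_coeff l v = sieve_coeff l v'"
proof (cases "l = 0")
 case False
 assume c: "[v = v'] (mod int l)"
 then obtain k where k: "v' = v + int l * k" by (metis cong_iff_lin)
 have "ee (- (of_int (n * v) / of_nat l)) = ee (- (of_int (n * v') / of_nat l))" for n
  by (rule ee_eqI[where n = "n * k"]) (use False in \<open>simp add: k field_simps\<close>)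
 thus ?thesis by (simp add: sieve_coeff_def)
qed (simp add: sieve_coeff_def)

lemma sum_sieve_coeff: "l > 0 ==> (\<Sum>v\<in>{0..<int l}. sieve_coeff l v) = 0"
proof -
 assume l: "l > 0"
 have "~ nonres l 0" using not_nonres_neg_square[of l 0] by (simp only: zero_power2 minus_zero) simp
 moreover have "(\<Sum>v\<in>{0..<int l}. sieve_coeff l v) = (\<Sum>v\<in>{0..<int l}. sieve_coeff l v * ee (of_int (v * 0) / of_nat l))"
  by (intro sum.cong refl) (simp only: mult_zero_right of_int_0 div_0 ee_0 mult_1_right)
 ultimately show ?thesis unfolding sieve_indicator[OF l] by (simp only: of_bool_eq)
qed

text \<open>\<open>nonres\<close> is invariant under squares prime to l, hence so are its Fourier
  coefficients. A matrix with lower right entry d turns the shift v into v d^2; this lemma undoes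
  the change.\<close>

lemma sieve_reindex:
 fixes f :: "int => complex"
 assumes l: "prime l" "l > 2" and d: "~ int l dvd d" and f: "!!v v'. [v = v'] (mod int l) ==> f v = f v'"
 shows "(\<Sum>v\<in>{0..<int l}. sieve_coeff l v * f (v * d^2)) = (\<Sum>v\<in>{0..<int l}. sieve_coeff l v * f v)"
proof -
 let ?Z = "{0..<int l}" and ?S = "{n\<in>{0..<int l}. nonres l n}"
 define p where "p = (%x. x * d^2 mod int l)"
 have cop: "coprime (int l) (d^2)" using l d by (simp add: prime_imp_coprime)
 have inj: "inj_on p ?Z"
 proof (rule inj_onI)
  fix x y assume xy: "x \<in> ?Z" "y \<in> ?Z" "p x = p y"
  hence "[x * d^2 = y * d^2] (mod int l)" by (simp add: p_def cong_def)
  hence "[x = y] (mod int l)" using cop by (simp add: cong_mult_rcancel coprime_commute)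
  thus "x = y" using xy by (simp add: cong_def)
 qed
 have Z: "p ` ?Z = ?Z" by (rule endo_inj_surj[OF _ _ inj]) (use l in \<open>auto simp: p_def\<close>)
 have cg: "[p x = x * d^2] (mod int l)" for x by (simp add: p_def)
 have injS: "inj_on p ?S" by (rule inj_on_subset[OF inj]) blast
 have nr: "nonres l (p x) = nonres l x" for x
  using nonres_cong[OF cg] nonres_mult_square[OF l d] by blast
 have "p ` ?S <= ?S"
 proof
  fix y assume "y \<in> p ` ?S"
  then obtain x where x: "x \<in> ?S" "y = p x" by blast
  have "p x \<in> ?Z" using Z x(1) by blast
  thus "y \<in> ?S" using nr x by blast
 qed
 moreover have "finite ?S" by (rule finite_subset[of _ ?Z]) auto
 ultimately have "p ` ?S = ?S" using endo_inj_surj injS by blast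
 hence bijS: "bij_betw p ?S ?S" using injS by (simp only: bij_betw_def)
 have bijZ: "bij_betw p ?Z ?Z" using inj Z by (simp only: bij_betw_def)
 have c: "sieve_coeff l (v * d^2) = sieve_coeff l v" for v
 proof -
  have "(\<Sum>n\<in>?S. ee (- (of_int (n * v) / of_nat l))) = (\<Sum>n\<in>?S. ee (- (of_int (p n * v) / of_nat l)))"
   by (rule sum.reindex_bij_betw[OF bijS, symmetric])
  also have "... = (\<Sum>n\<in>?S. ee (- (of_int (n * (v * d^2)) / of_nat l)))"
  proof (rule sum.cong[OF refl])
   fix n
   obtain k where k: "n * d^2 = p n + int l * k" using cg[of n] unfolding cong_iff_lin by blast
   have "n * (v * d^2) = (n * d^2) * v" by (simp add: mult_ac)
   also have "... = p n * v + int l * (k * v)" unfolding k by (simp add: algebra_simps)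
   finally have "n * (v * d^2) = p n * v + int l * (k * v)" .
   thus "ee (- (of_int (p n * v) / of_nat l)) = ee (- (of_int (n * (v * d^2)) / of_nat l))"
    using l by (intro ee_eqI[where n = "k * v"]) (simp add: field_simps)
  qed
  finally show ?thesis by (simp only: sieve_coeff_def)
 qed
 have "(\<Sum>v\<in>?Z. sieve_coeff l v * f v) = (\<Sum>v\<in>?Z. sieve_coeff l (p v) * f (p v))"
  by (rule sum.reindex_bij_betw[OF bijZ, symmetric])
 also have "... = (\<Sum>v\<in>?Z. sieve_coeff l v * f (v * d^2))"
 proof (rule sum.cong[OF refl])
  fix v
  have "f (p v) = f (v * d^2)" by (rule f[OF cg])
  moreover have "sieve_coeff l (p v) = sieve_coeff l v" using sieve_coeff_cong[OF cg, of v] c[of v] by simp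
  ultimately show "sieve_coeff l (p v) * f (p v) = sieve_coeff l v * f (v * d^2)" by simp
 qed
 finally show ?thesis ..
qed

section \<open>The sieved Appell function and its transformation law\<close>

text \<open>Exponents with denominator 16 become integers over l after multiplication by 16 v / l,
  and since translation by 16 fixes \<open>thc\<close> and \<open>appell\<close>, only v modulo l
  matters. As 16 is a square prime to l, the selection for integral exponents is the same as with
  steps 1 / l.\<close>

definition sshift :: "nat => complex => int => complex" where
 "sshift l z v = z + 16 * of_int v / of_nat l"

lemma Im_sshift [simp]: "Im (sshift l z v) = Im z"
proof -
 have "16 * of_int v / of_nat l = complex_of_real (16 * of_int v / real l)" by simp
 thus ?thesis unfolding sshift_def by (simp only: plus_complex.sel Im_complex_of_real add_0_right)
qed

definition sapp :: "nat => bool => complex => complex => complex" where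
 "sapp l e z u = (\<Sum>v\<in>{0..<int l}. sieve_coeff l v * appell e (sshift l z v) u)"

text \<open>The poles of all translates together. The set is invariant under 1 and l z because l
  times a shifted z is l z plus an integer; z itself is in general no period.\<close>

definition spoles :: "nat => complex => complex set" where
 "spoles l z = {p. EX m j v :: int. p = of_int m * sshift l z v + of_int j}"

lemma spoles_shift:
 assumes l: "l > 0"
 shows "u + of_int k * (of_nat l * z) + of_int n \<in> spoles l z \<longleftrightarrow> u \<in> spoles l z"
proof -
 have 1: "u + of_int k * (of_nat l * z) + of_int n \<in> spoles l z" if uu: "u \<in> spoles l z" for u k n
 proof -
  obtain m j v where "u = of_int m * sshift l z v + of_int j" using uu by (auto simp: spoles_def)
  hence "u + of_int k * (of_nat l * z) + of_int n = of_int (m + k * int l) * sshift l z v + of_int (j + n - 16 * k * v)"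
   using l by (simp add: sshift_def field_simps)
  thus ?thesis unfolding spoles_def by blast
 qed
 show ?thesis using 1[of u k n] 1[of "u + of_int k * (of_nat l * z) + of_int n" "- k" "- n"] by auto
qed

lemma pole_sshift_in_spoles: "p = of_int m * sshift l z v + of_int j ==> p \<in> spoles l z"
 unfolding spoles_def by blast

lemma spoles_discrete:
 assumes l: "l > 0" and z: "Im z > 0"
 shows "EX r>0. ALL p:spoles l z. p ~= x --> r <= dist p x"
proof -
 have "spoles l z <= {p. EX m j :: int. p = 0 + of_int m * z + of_int j / of_nat l}"
 proof
  fix p assume "p \<in> spoles l z"
  then obtain m j v where "p = of_int m * sshift l z v + of_int j" by (auto simp: spoles_def)
  hence "p = 0 + of_int m * z + of_int (16 * m * v + j * int l) / of_nat l"
   using l by (simp add: sshift_def field_simps)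
  thus "p \<in> {p. EX m j :: int. p = 0 + of_int m * z + of_int j / of_nat l}" by blast
 qed
 thus ?thesis using lattice_discrete[OF z l, of 0 x] by (meson subsetD)
qed

lemma sapp_field_differentiable:
 assumes z: "Im z > 0" and u: "u ~: spoles l z"
 shows "sapp l e z field_differentiable at u"
 unfolding sapp_def[abs_def]
proof (intro field_differentiable_sum field_differentiable_mult field_differentiable_const)
 fix v
 show "appell e (sshift l z v) field_differentiable at u"
  by (rule appell_field_differentiable) (use z u pole_sshift_in_spoles in auto)
qed

text \<open>The sieve sees sixteen times the exponents, minus the squares of 4 i + 1, 4 i + 3 or 4
  (i + 1).\<close>

lemma sieve_apps: "l > 0 ==> (\<Sum>v\<in>{0..<int l}. sieve_coeff l v * apps e i (sshift l z v) u) = 0"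
proof -
 assume l: "l > 0"
 have Z: "(\<Sum>v\<in>{0..<int l}. sieve_coeff l v * (ee (of_int (v * (- (k^2))) / of_nat l) * C)) = 0" for k C
  unfolding mult.assoc[symmetric] sum_distrib_right[symmetric] sieve_indicator[OF l] by (simp add: not_nonres_neg_square)
 show ?thesis
 proof (cases e)
  case True
  have 1: "ee (- ((of_nat i + 1/4)^2 * sshift l z v) - (2 * of_nat i + 1/2) * u) =
   ee (of_int (v * (- ((4 * int i + 1)^2))) / of_nat l) * ee (- ((of_nat i + 1/4)^2 * z) - (2 * of_nat i + 1/2) * u)" for v
   unfolding ee_add[symmetric] sshift_def using l by (intro arg_cong[where f = ee]) (simp add: field_simps power2_eq_square)
  have 2: "ee (- ((of_nat i + 3/4)^2 * sshift l z v) - (2 * of_nat i + 3/2) * u) =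
   ee (of_int (v * (- ((4 * int i + 3)^2))) / of_nat l) * ee (- ((of_nat i + 3/4)^2 * z) - (2 * of_nat i + 3/2) * u)" for v
   unfolding ee_add[symmetric] sshift_def using l by (intro arg_cong[where f = ee]) (simp add: field_simps power2_eq_square)
  show ?thesis unfolding apps_def if_P[OF True] 1 2 distrib_left sum.distrib Z by simp
 next
  case False
  have 1: "(-1) ^ Suc i * ee (- ((of_nat i + 1)^2 * sshift l z v) - 2 * (of_nat i + 1) * u) =
   ee (of_int (v * (- ((4 * (int i + 1))^2))) / of_nat l) * ((-1) ^ Suc i * ee (- ((of_nat i + 1)^2 * z) - 2 * (of_nat i + 1) * u))" for v
  proof -
   have "ee (- ((of_nat i + 1)^2 * sshift l z v) - 2 * (of_nat i + 1) * u) =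
    ee (of_int (v * (- ((4 * (int i + 1))^2))) / of_nat l) * ee (- ((of_nat i + 1)^2 * z) - 2 * (of_nat i + 1) * u)"
    unfolding ee_add[symmetric] sshift_def using l by (intro arg_cong[where f = ee]) (simp add: field_simps power2_eq_square)
   thus ?thesis by (simp only: mult_ac)
  qed
  show ?thesis unfolding apps_def if_not_P[OF False] 1 Z ..
 qed
qed

lemma not_spoles_ee:
 assumes u: "u ~: spoles l z" shows "ee u * ee (of_int n * sshift l z v) ~= 1"
proof
 assume "ee u * ee (of_int n * sshift l z v) = 1"
 then obtain j where "u = of_int (- n) * sshift l z v + of_int j" unfolding lambert_pole_ee by blast
 thus False using u pole_sshift_in_spoles by blast
qed

lemma sapp_add_int: "sapp l e z (u + of_int n) = (if e then (-1) powi n else 1) * sapp l e z u"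
proof -
 have "sieve_coeff l v * appell e (sshift l z v) (u + of_int n) = (if e then (-1) powi n else 1) * (sieve_coeff l v * appell e (sshift l z v) u)" for v
  unfolding appell_add_int by (rule mult.left_commute)
 thus ?thesis unfolding sapp_def sum_distrib_left by (rule sum.cong[OF refl])
qed

text \<open>The step l z is l times each shifted z up to the even integer 16 v, so the l-fold
  quasi-period of every summand applies. The multipliers agree for all v, and the defects cancel
  after weighting.\<close>

lemma sapp_add_period:
 assumes l: "odd l" and z: "Im z > 0" and u: "u ~: spoles l z"
 shows "sapp l e z (u + of_nat l * z) = esgn e * ee ((of_nat l)^2 * z + 2 * of_nat l * u) * sapp l e z u"
proof -
 have l0: "l > 0" using l by (cases l) auto
 let ?E = "ee ((of_nat l)^2 * z + 2 * of_nat l * u)"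
 have "appell e (sshift l z v) (u + of_nat l * z) = esgn e * ?E * (appell e (sshift l z v) u + (\<Sum>i<l. apps e i (sshift l z v) u))" for v
 proof -
  have "u + of_nat l * z = u + of_nat l * sshift l z v + of_int (- 16 * v)" using l0 by (simp add: sshift_def field_simps)
  moreover have "((-1) :: complex) powi (- 16 * v) = 1" using power_int_mult[of "-1 :: complex" "-16" v] by simp
  ultimately have "appell e (sshift l z v) (u + of_nat l * z) = appell e (sshift l z v) (u + of_nat l * sshift l z v)"
   by (simp only: appell_add_int if_cancel mult_1)
  also have "... = esgn e ^ l * ee ((of_nat l)^2 * sshift l z v + 2 * of_nat l * u) * (appell e (sshift l z v) u + (\<Sum>i<l. apps e i (sshift l z v) u))"
   by (rule appell_quasi_period_nat) (use z not_spoles_ee[OF u] in auto)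
  also have "ee ((of_nat l)^2 * sshift l z v + 2 * of_nat l * u) = ?E"
   by (rule ee_eqI[where n = "16 * v * int l"]) (use l0 in \<open>simp add: sshift_def field_simps power2_eq_square\<close>)
  finally show ?thesis using l by simp
 qed
 hence "sapp l e z (u + of_nat l * z) = esgn e * ?E * (sapp l e z u + (\<Sum>v\<in>{0..<int l}. \<Sum>i<l. sieve_coeff l v * apps e i (sshift l z v) u))"
  unfolding sapp_def sum_distrib_left[symmetric] sum.distrib[symmetric] distrib_left[symmetric]
  by (simp only: sum_distrib_left mult_ac)
 also have "(\<Sum>v\<in>{0..<int l}. \<Sum>i<l. sieve_coeff l v * apps e i (sshift l z v) u) = 0"
  by (subst sum.swap) (simp add: sieve_apps[OF l0])
 finally show ?thesis by simp
qed

lemma sapp_shift: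
 assumes l: "odd l" and z: "Im z > 0" and u: "u ~: spoles l z"
 shows "sapp l e z (u + of_int k * (of_nat l * z) + of_int n) =
  (if e then (-1) powi n else (-1) powi k) * ee ((of_int k * of_nat l)^2 * z + 2 * of_int k * of_nat l * u) * sapp l e z u"
proof -
 have l0: "l > 0" using l by (cases l) auto
 let ?E = "%k::int. ee ((of_int k * of_nat l)^2 * z + 2 * of_int k * of_nat l * u)"
 have np: "u + of_int k * (of_nat l * z) ~: spoles l z" for k
  using spoles_shift[OF l0, of u k z 0] u by simp
 have step: "sapp l e z (u + of_int (k + 1) * (of_nat l * z)) = esgn e * (ee ((of_nat l)^2 * z + 2 * of_nat l * (u + of_int k * (of_nat l * z))) * sapp l e z (u + of_int k * (of_nat l * z)))" for k
  using sapp_add_period[OF l z np[of k], of e] by (simp add: algebra_simps)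
 have E: "ee ((of_nat l)^2 * z + 2 * of_nat l * (u + of_int k * (of_nat l * z))) * ?E k = ?E (k + 1)" for k
  unfolding ee_add[symmetric] by (rule arg_cong[where f = ee]) (simp add: algebra_simps power2_eq_square)
 have "sapp l e z (u + of_int k * (of_nat l * z)) = (if e then 1 else (-1) powi k) * ?E k * sapp l e z u"
 proof (induction k rule: int_induct[where k = 0])
  case (step1 i)
  have "esgn e * (X * ((if e then 1 else (-1) powi i) * Y * Z)) = (if e then 1 else (-1) powi (i + 1)) * (X * Y) * Z" for X Y Z :: complex
   by (simp add: power_int_add)
  thus ?case unfolding step step1(2) E[symmetric] .
 next
  case (step2 i)
  let ?X = "ee ((of_nat l)^2 * z + 2 * of_nat l * (u + of_int (i - 1) * (of_nat l * z)))"
  have "esgn e * (?X * sapp l e z (u + of_int (i - 1) * (of_nat l * z))) = (if e then 1 else (-1) powi i) * (?X * ?E (i - 1)) * sapp l e z u"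
   using step[of "i - 1"] step2(2) E[of "i - 1"] by simp
  moreover have "(-1 :: complex) powi i = - ((-1) powi (i - 1))" by (simp add: power_int_diff)
  ultimately have "?X * sapp l e z (u + of_int (i - 1) * (of_nat l * z)) = ?X * ((if e then 1 else (-1) powi (i - 1)) * ?E (i - 1) * sapp l e z u)"
   by (cases e) (simp_all add: mult_ac)
  thus ?case by (simp only: mult_left_cancel[OF ee_nonzero])
 qed simp
 thus ?thesis unfolding sapp_add_int by (cases e) simp_all
qed

lemma minus_one_powi: "(-1 :: complex) powi n = (if even n then 1 else -1)"
proof (induction n rule: int_induct[where k = 0])
 case (step1 i)
 thus ?case by (simp add: power_int_add)
next
 case (step2 i)
 thus ?case by (simp add: power_int_diff)
qed simp

text \<open>Both sides have the same polar lattice and, by the transformation law of the theta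
 constant, the same residues.\<close>

lemma appell_pole_match:
 fixes a b c d :: int
 assumes det: "a * d - b * c = 1" and e: "e \<longleftrightarrow> odd c" "e ==> even d" and y: "Im y > 0"
  and k: "k ~= 0" and J: "J = of_int c * y + of_int d" and g: "g = mob (a,b,c,d) y"
  and th: "th0 g = k * csqrt J * thc e y"
 shows "((%u. (u - p) * (ee (of_int c * u^2 / J) * appell False g (u / J) - csqrt J / k * appell e y u)) ---> 0) (at p)"
proof -
 have J0: "J ~= 0" unfolding J by (rule Im_moebius(2)[OF det y])
 have gp: "Im g > 0" unfolding g by (rule Im_moebius(3)[OF det y])
 have gJ: "g * J = of_int a * y + of_int b" using J0 by (simp add: g J moebius_act_def)
 have det': "of_int a * of_int d - of_int b * of_int c = (1 :: complex)" using det by (metis of_int_1 of_int_diff of_int_mult)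
 have comp: "filterlim (%u. u / J) (at (p / J)) (at p)"
  by (rule filterlim_atI) (use J0 in \<open>auto intro!: tendsto_intros simp: eventually_at_filter\<close>)
 have q0: "((%u. ee (of_int c * u^2 / J)) ---> ee (of_int c * p^2 / J)) (at p)"
  by (intro tendsto_ee tendsto_intros) (use J0 in auto)
 show ?thesis
 proof (cases "EX m j :: int. p = of_int m * y + of_int j")
  case True
  then obtain m j :: int where p: "p = of_int m * y + of_int j" by blast
  \<comment> \<open>Coordinates of the pole p / J in the lattice of g, obtained from (m, j) by the
    inverse matrix.\<close>
  define m' where "m' = d * m - c * j"
  define j' where "j' = a * j - b * m"
  have pJ: "p / J = of_int m' * g + of_int j'"
  proof -
   have "(of_int m' * g + of_int j') * J = of_int m' * (g * J) + of_int j' * J" by (simp add: algebra_simps)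
   also have "... = (of_int a * of_int d - of_int b * of_int c) * p"
    unfolding gJ by (simp add: m'_def j'_def J p algebra_simps)
   finally show ?thesis using J0 by (simp add: det' field_simps)
  qed
  let ?s = "(-1 :: complex) powi (if e then j else m)"
  define R where "R = - (((-1) powi m') * ee ((of_int m')^2 * g)) / (2 * of_real pi * \<i> * th0 g)"
  have l1: "((%u. (u / J - p / J) * appell False g (u / J)) ---> R) (at p)"
   using filterlim_compose[OF appell_residue[OF gp pJ, of False] comp] by (simp add: R_def thc_def)
  have l2: "((%u. (u - p) * appell e y u) ---> - (?s * ee ((of_int m)^2 * y)) / (2 * of_real pi * \<i> * thc e y)) (at p)"
   by (rule appell_residue[OF y p])
  have key: "ee (of_int c * p^2 / J) * ((-1) powi m' * ee ((of_int m')^2 * g)) = ?s * ee ((of_int m)^2 * y)"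
  proof -
   \<comment> \<open>The two quadratic exponents differ by this integer, which is invisible to
     \<open>ee\<close>.\<close>
   define N where "N = b * d * m^2 - 2 * b * c * m * j + a * c * j^2"
   have "of_int c * p^2 + (of_int m')^2 * (g * J) - ((of_int m)^2 * y + of_int N) * J =
    (of_int a * of_int d - of_int b * of_int c - 1) * ((of_int d * (of_int m)^2 - 2 * of_int c * of_int m * of_int j) * y - of_int c * (of_int j)^2)"
    unfolding gJ by (simp add: p m'_def J N_def algebra_simps power2_eq_square)
   hence "of_int c * p^2 + (of_int m')^2 * g * J = ((of_int m)^2 * y + of_int N) * J" by (simp add: det' mult.assoc)
   hence "of_int c * p^2 / J + (of_int m')^2 * g = (of_int m)^2 * y + of_int N" using J0 by (simp add: field_simps)
   hence "ee (of_int c * p^2 / J) * ee ((of_int m')^2 * g) = ee ((of_int m)^2 * y)" unfolding ee_add[symmetric] by simp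
   moreover have "even m' = even (if e then j else m)"
   proof -
    have "odd (a * d - b * c)" using det by simp
    thus ?thesis using e by (auto simp: m'_def)
   qed
   hence "(-1 :: complex) powi m' = ?s" unfolding minus_one_powi by simp
   ultimately show ?thesis by (metis mult.left_commute)
  qed
  have "((%u. ee (of_int c * u^2 / J) * (J * ((u / J - p / J) * appell False g (u / J))) - csqrt J / k * ((u - p) * appell e y u)) \<longlongrightarrow>
    ee (of_int c * p^2 / J) * (J * R) - csqrt J / k * (- (?s * ee ((of_int m)^2 * y)) / (2 * of_real pi * \<i> * thc e y))) (at p)"
   by (intro tendsto_diff tendsto_mult q0 tendsto_const l1 l2)
  moreover have "ee (of_int c * p^2 / J) * (J * R) = csqrt J / k * (- (?s * ee ((of_int m)^2 * y)) / (2 * of_real pi * \<i> * thc e y))"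
  proof -
   have "ee (of_int c * p^2 / J) * (J * R) = - (ee (of_int c * p^2 / J) * ((-1) powi m' * ee ((of_int m')^2 * g))) * J / (2 * of_real pi * \<i> * th0 g)"
    by (simp add: R_def)
   moreover have "- S * x^2 / (2 * of_real pi * \<i> * (k * x * T)) = x / k * (- S / (2 * of_real pi * \<i> * T))"
    if "x ~= 0" "T ~= 0" for S x T :: complex using that k by (simp add: field_simps power2_eq_square)
   from this[of "csqrt J" "thc e y" "?s * ee ((of_int m)^2 * y)"]
   have "- (?s * ee ((of_int m)^2 * y)) * J / (2 * of_real pi * \<i> * th0 g) = csqrt J / k * (- (?s * ee ((of_int m)^2 * y)) / (2 * of_real pi * \<i> * thc e y))"
    using J0 thc_nonzero[OF y, of e] by (simp add: th)
   ultimately show ?thesis unfolding key by (simp only:)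
  qed
  moreover have "ee (of_int c * u^2 / J) * (J * ((u / J - p / J) * appell False g (u / J))) - csqrt J / k * ((u - p) * appell e y u)
    = (u - p) * (ee (of_int c * u^2 / J) * appell False g (u / J) - csqrt J / k * appell e y u)" for u
  proof -
   have "J * (u / J - p / J) = u - p" using J0 by (simp add: field_simps)
   hence "ee (of_int c * u^2 / J) * (J * ((u / J - p / J) * appell False g (u / J))) = (u - p) * (ee (of_int c * u^2 / J) * appell False g (u / J))"
    by (metis mult.assoc mult.left_commute)
   thus ?thesis by (simp only: right_diff_distrib mult.left_commute)
  qed
  ultimately show ?thesis by simp
 next
  case False
  have np: "\<nexists>m j :: int. p / J = of_int m * g + of_int j"
  proof
   assume "EX m j :: int. p / J = of_int m * g + of_int j"
   then obtain m j :: int where "p / J = of_int m * g + of_int j" by blast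
   hence "p = of_int m * (g * J) + of_int j * J" using J0 by (simp add: field_simps)
   hence "p = of_int (m * a + j * c) * y + of_int (m * b + j * d)" unfolding gJ by (simp add: J algebra_simps)
   thus False using False by blast
  qed
  have "isCont (appell False g) (p / J)"
   by (rule field_differentiable_imp_continuous_at[OF appell_field_differentiable[OF gp np]])
  hence l1: "((%u. appell False g (u / J)) ---> appell False g (p / J)) (at p)"
   by (rule isCont_tendsto_compose) (intro tendsto_intros, use J0 in auto)
  have "isCont (appell e y) p"
   by (rule field_differentiable_imp_continuous_at[OF appell_field_differentiable[OF y False]])
  hence l2: "(appell e y ---> appell e y p) (at p)" by (simp add: isCont_def)
  have "((%u. (u - p) * (ee (of_int c * u^2 / J) * appell False g (u / J) - csqrt J / k * appell e y u)) \<longlongrightarrow>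
   (p - p) * (ee (of_int c * p^2 / J) * appell False g (p / J) - csqrt J / k * appell e y p)) (at p)"
   by (intro tendsto_intros q0 l1 l2)
  thus ?thesis by simp
 qed
qed

text \<open>The new matrix is the given one multiplied by the translation 16 v / l on the left and
  by - 16 v d^2 / l on the right. The entries containing c / l or c / l^2 are integral by l^2 | c;
  the amount v d^2 makes the upper right entry integral, because there the remaining fraction has
  the factor 1 - a d = - b c.\<close>

lemma sshift_matrix:
 fixes a b c d c1 v :: int and l :: nat
 assumes l: "l > 0" and det: "a * d - b * c = 1" and c: "c = (int l)^2 * c1" and z: "Im z > 0"
 defines "a' \<equiv> a + 16 * v * int l * c1" and "b' \<equiv> b - 16 * v * d * b * int l * c1 - 256 * v^2 * d^2 * c1"
  and "d' \<equiv> d - 16 * (v * d^2) * int l * c1"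
 shows "a' * d' - b' * c = 1"
  and "of_int c * sshift l z (v * d^2) + of_int d' = of_int c * z + of_int d"
  and "mob (a',b',c,d') (sshift l z (v * d^2)) = sshift l (mob (a,b,c,d) z) v"
  and "th0 (sshift l (mob (a,b,c,d) z) v) * csqrt (of_int c * sshift l z (v * d^2) + of_int d) =
   csqrt (aut c d z) * th0 (mob (a,b,c,d) (sshift l z (v * d^2)))"
proof -
 let ?s = "sshift l z (v * d^2)" and ?J = "of_int c * z + of_int d :: complex"
 have "a' * d' - b' * c - 1 = (a * d - b * c - 1) * (1 - 16 * v * d * int l * c1)"
  unfolding a'_def b'_def d'_def c by (simp add: algebra_simps power2_eq_square)
 thus det': "a' * d' - b' * c = 1" using det by simp
 show J: "of_int c * ?s + of_int d' = ?J"
  using l by (simp add: sshift_def c d'_def field_simps power2_eq_square)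
 have J0: "?J ~= 0" by (rule Im_moebius(2)[OF det z])
 have det'': "of_int a * of_int d - of_int b * of_int c = (1 :: complex)" using det by (metis of_int_1 of_int_diff of_int_mult)
 have "(of_int a' * ?s + of_int b') * of_nat l - (aut a b z) * of_nat l - 16 * of_int v * ?J =
  16 * of_int v * of_int d * (of_int a * of_int d - of_int b * of_int c - 1)"
  using l by (simp add: sshift_def c a'_def b'_def field_simps power2_eq_square)
 hence "(of_int a' * ?s + of_int b') * of_nat l = (aut a b z) * of_nat l + 16 * of_int v * ?J"
  by (simp add: det'' algebra_simps)
 hence "of_int a' * ?s + of_int b' = (aut a b z) + 16 * of_int v / of_nat l * ?J"
  using l by (simp add: field_simps)
 thus mob: "mob (a',b',c,d') ?s = sshift l (mob (a,b,c,d) z) v"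
  unfolding moebius_act_def prod.case J using J0 by (simp add: sshift_def add_divide_distrib)
 have "th0 (mob (a',b',c,d') ?s) * csqrt (of_int c * ?s + of_int d) = csqrt (of_int c * ?s + of_int d') * th0 (mob (a,b,c,d) ?s)"
  by (rule theta_j_quotient[of _ d d' "int l" c1 "v * d^2"]) (use z det det' c in \<open>auto simp: d'_def\<close>)
 thus "th0 (sshift l (mob (a,b,c,d) z) v) * csqrt (of_int c * ?s + of_int d) =
   csqrt ?J * th0 (mob (a,b,c,d) ?s)" unfolding mob J .
qed

text \<open>The constant k and the root are the same for every v, so all theta denominators of the
  sieved sum transform uniformly.\<close>

lemma th0_sshift:
 fixes a b c d :: int and l :: nat
 assumes l: "l > 0" and det: "a * d - b * c = 1" and c: "(int l)\<^sup>2 dvd c" and z: "Im z > 0"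
  and th: "!!z. Im z > 0 ==> th0 (mob (a,b,c,d) z) = k * csqrt (aut c d z) * thc e z"
 shows "th0 (sshift l (mob (a,b,c,d) z) v) = k * csqrt (aut c d z) * thc e (sshift l z (v * d^2))"
proof -
 obtain c1 where c1: "c = (int l)^2 * c1" using c by (elim dvdE)
 have s: "Im (sshift l z (v * d^2)) > 0" using z by simp
 have nz: "csqrt (of_int c * sshift l z (v * d^2) + of_int d) ~= 0" using Im_moebius(2)[OF det s] by simp
 have "th0 (sshift l (mob (a,b,c,d) z) v) * csqrt (of_int c * sshift l z (v * d^2) + of_int d) =
  k * csqrt (aut c d z) * thc e (sshift l z (v * d^2)) * csqrt (of_int c * sshift l z (v * d^2) + of_int d)"
  unfolding sshift_matrix(4)[OF l det c1 z] th[OF s] by (simp only: mult_ac)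
 thus ?thesis using mult_right_cancel[OF nz] by blast
qed

text \<open>The difference G of the two sides has no poles, by \<open>appell_pole_match\<close>
  applied to each v with its own conjugated matrix. Its behaviour under 1 and l z is that of a
  function whose norm carries a Gaussian weight with positive exponent, which forces G = 0.\<close>

theorem sapp_transform:
 fixes a b c d :: int and l :: nat
 assumes l: "prime l" "l > 2" and det: "a * d - b * c = 1" and c: "(int l)\<^sup>2 dvd c" and z: "Im z > 0"
  and e: "e \<longleftrightarrow> odd c" "e ==> even d" and y: "y ~= 0"
  and th: "!!z. Im z > 0 ==> th0 (mob (a,b,c,d) z) = y * csqrt (aut c d z) * thc e z"
  and J: "J = of_int c * z + of_int d" and g: "g = mob (a,b,c,d) z" and u: "u ~: spoles l z"
 shows "ee (of_int c * u^2 / J) * sapp l False g (u / J) = csqrt J / y * sapp l e z u"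
proof -
 have l0: "l > 0" and lodd: "odd l" using l prime_odd_nat by auto
 obtain c1 where c1: "c = (int l)^2 * c1" using c by (elim dvdE)
 have J0: "J ~= 0" unfolding J by (rule Im_moebius(2)[OF det z])
 have gp: "Im g > 0" unfolding g by (rule Im_moebius(3)[OF det z])
 have gJ: "g * J = of_int a * z + of_int b" using J0 by (simp add: g J moebius_act_def)
 have det': "of_int a * of_int d - of_int b * of_int c = (1 :: complex)" using det by (metis of_int_1 of_int_diff of_int_mult)
 have ld: "~ int l dvd d"
 proof
  assume "int l dvd d"
  moreover have "int l dvd c" by (simp add: c1 power2_eq_square)
  ultimately have "int l dvd a * d - b * c" by simp
  thus False using det l by simp
 qed
 let ?D = "%v u. ee (of_int c * u^2 / J) * appell False (sshift l g v) (u / J) - csqrt J / y * appell e (sshift l z (v * d^2)) u"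
 define G where "G = (%u. ee (of_int c * u^2 / J) * sapp l False g (u / J) - csqrt J / y * sapp l e z u)"
 have reix: "sapp l e z u = (\<Sum>v\<in>{0..<int l}. sieve_coeff l v * appell e (sshift l z (v * d^2)) u)" for u
  unfolding sapp_def
 proof (rule sieve_reindex[OF l ld, symmetric])
  fix v v' assume "[v = v'] (mod int l)"
  then obtain k where k: "v' = v + int l * k" by (metis cong_iff_lin)
  have "sshift l z v' = sshift l z v + 16 * of_int k" using l0 by (simp add: k sshift_def field_simps)
  thus "appell e (sshift l z v) u = appell e (sshift l z v') u" by (simp add: appell_T16_int)
 qed
 have Gsum: "G u = (\<Sum>v\<in>{0..<int l}. sieve_coeff l v * ?D v u)" for u
  unfolding G_def reix by (simp add: sapp_def sum_distrib_left right_diff_distrib sum_subtractf mult.left_commute)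
 have matrix: "EX a' b' d'. a' * d' - b' * c = 1 & (e --> even d') & J = of_int c * sshift l z (v * d^2) + of_int d' &
   sshift l g v = mob (a',b',c,d') (sshift l z (v * d^2))" for v
  using sshift_matrix[OF l0 det c1 z, of v] e(2)
  by (intro exI[of _ "a + 16 * v * int l * c1"] exI[of _ "b - 16 * v * d * b * int l * c1 - 256 * v^2 * d^2 * c1"]
    exI[of _ "d - 16 * (v * d^2) * int l * c1"]) (simp add: J g)
 have res: "((%u. (u - p) * G u) ---> 0) (at p)" for p
 proof -
  have "((%u. \<Sum>v\<in>{0..<int l}. sieve_coeff l v * ((u - p) * ?D v u)) ---> (\<Sum>v\<in>{0..<int l}. sieve_coeff l v * 0)) (at p)"
  proof (intro tendsto_sum tendsto_mult tendsto_const)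
   fix v
   obtain a' b' d' where m: "a' * d' - b' * c = 1" "e --> even d'" "J = of_int c * sshift l z (v * d^2) + of_int d'"
    "sshift l g v = mob (a',b',c,d') (sshift l z (v * d^2))" using matrix by blast
   show "((%u. (u - p) * ?D v u) ---> 0) (at p)"
    by (rule appell_pole_match[OF m(1) e(1) _ _ y m(3,4)])
     (use m(2) z th0_sshift[OF l0 det c z th, of v] in \<open>auto simp: g J\<close>)
  qed
  thus ?thesis by (simp add: Gsum sum_distrib_left mult.left_commute)
 qed
 have poles: "u / J ~: spoles l g" if "u ~: spoles l z" for u
 proof
  assume "u / J \<in> spoles l g"
  then obtain m j v where uJ: "u / J = of_int m * sshift l g v + of_int j" by (auto simp: spoles_def)
  obtain a' b' d' where m: "a' * d' - b' * c = 1" "J = of_int c * sshift l z (v * d^2) + of_int d'"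
    "sshift l g v = mob (a',b',c,d') (sshift l z (v * d^2))" using matrix by blast
  have "sshift l g v * J = of_int a' * sshift l z (v * d^2) + of_int b'" using J0 unfolding m(3) by (simp add: m(2) moebius_act_def)
  moreover have "u = of_int m * (sshift l g v * J) + of_int j * J" using uJ J0 by (simp add: field_simps)
  ultimately have "u = of_int (m * a' + j * c) * sshift l z (v * d^2) + of_int (m * b' + j * d')"
   by (simp add: m(2) algebra_simps)
  thus False using that pole_sshift_in_spoles by blast
 qed
 have hol: "G holomorphic_on - spoles l z"
 proof -
  have op: "open (- spoles l z)" by (rule discrete_open[OF spoles_discrete[OF l0 z]])
  have "G field_differentiable at u" if u: "u ~: spoles l z" for u
  proof -
   have "(sapp l False g \<circ> (%u. u / J)) field_differentiable at u"
    by (rule field_differentiable_compose) (auto intro!: derivative_intros sapp_field_differentiable[OF gp poles[OF u]] J0)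
   moreover have "(%u. ee (of_int c * u^2 / J)) field_differentiable at u"
   proof -
    have "(%u. ee (of_int c * u^2 / J)) holomorphic_on UNIV"
     by (intro holomorphic_on_ee holomorphic_intros) (use J0 in auto)
    thus ?thesis by (simp add: holomorphic_on_def)
   qed
   ultimately show ?thesis unfolding G_def o_def
    by (intro field_differentiable_diff field_differentiable_mult field_differentiable_const sapp_field_differentiable[OF z u])
  qed
  thus ?thesis using op by (auto simp: holomorphic_on_def field_differentiable_at_within)
 qed
 have G1: "G (u + 1) = (if e then -1 else 1) * G u" if u: "u ~: spoles l z" for u
 proof -
  \<comment> \<open>Since 1 / J = a - c g, adding 1 to u moves u / J by a - c g. As c = l (l c1),
    this is an integer plus a multiple of the period l g.\<close>
  let ?k = "- (int l * c1)"
  have kl: "of_int ?k * of_nat l = - (of_int c :: complex)" by (simp add: c1 power2_eq_square)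
  have "(of_int a - of_int c * g) * J = of_int a * J - of_int c * (g * J)" by (simp add: algebra_simps)
  also have "... = of_int a * of_int d - of_int b * of_int c" unfolding gJ by (simp add: J algebra_simps)
  finally have inv: "1 / J = of_int a - of_int c * g" using J0 det' by (simp add: field_simps)
  have "(u + 1) / J = u / J + 1 / J" by (simp add: add_divide_distrib)
  also have "... = u / J + of_int ?k * (of_nat l * g) + of_int a" unfolding inv mult.assoc[symmetric] kl by simp
  finally have "sapp l False g ((u + 1) / J) = sapp l False g (u / J + of_int ?k * (of_nat l * g) + of_int a)" by (rule arg_cong)
  also have "... = (-1) powi ?k * ee ((of_int ?k * of_nat l)^2 * g + 2 * of_int ?k * of_nat l * (u / J)) * sapp l False g (u / J)"
   using sapp_shift[OF lodd gp poles[OF u], of False ?k a] by simp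
  also have "(of_int ?k * of_nat l)\<^sup>2 * g + 2 * of_int ?k * of_nat l * (u / J) = (of_int c)^2 * g - 2 * of_int c * (u / J)"
   using kl by (simp add: mult.assoc)
  finally have s: "sapp l False g ((u + 1) / J) = (-1) powi ?k * ee ((of_int c)^2 * g - 2 * of_int c * (u / J)) * sapp l False g (u / J)" .
  have "ee (of_int c * (u + 1)^2 / J) * ee ((of_int c)^2 * g - 2 * of_int c * (u / J)) = ee (of_int c * u^2 / J)"
   unfolding ee_add[symmetric]
  proof (rule ee_eqI[where n = "c * a"])
   have "of_int c * (u + 1)^2 / J = of_int c * u^2 / J + 2 * of_int c * (u / J) + of_int c * (1 / J)"
    using J0 by (simp add: field_simps power2_eq_square)
   thus "of_int c * (u + 1)^2 / J + ((of_int c)^2 * g - 2 * of_int c * (u / J)) - of_int c * u^2 / J = of_int (c * a)"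
    unfolding inv by (simp add: algebra_simps power2_eq_square)
  qed
  moreover have "(-1 :: complex) powi ?k = (if e then -1 else 1)" unfolding minus_one_powi using e(1) lodd by (simp add: c1)
  moreover have "sapp l e z (u + 1) = (if e then -1 else 1) * sapp l e z u" using sapp_add_int[of l e z u 1] by simp
  ultimately show ?thesis unfolding G_def s by (simp add: mult.assoc[symmetric] right_diff_distrib)
 qed
 have G2: "G (u + of_nat l * z) = esgn e * ee ((of_nat l)^2 * z + 2 * of_nat l * u) * G u" if u: "u ~: spoles l z" for u
 proof -
  \<comment> \<open>Similarly z / J = d g - b, so u + l z corresponds to u / J + d (l g) - l
    b.\<close>
  have "(of_int d * g - of_int b) * J = of_int d * (g * J) - of_int b * J" by (simp add: algebra_simps)
  also have "... = (of_int a * of_int d - of_int b * of_int c) * z" unfolding gJ by (simp add: J algebra_simps)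
  finally have tJ: "z / J = of_int d * g - of_int b" using J0 det' by (simp add: field_simps)
  have "(u + of_nat l * z) / J = u / J + of_nat l * (z / J)" by (simp add: add_divide_distrib)
  also have "... = u / J + of_int d * (of_nat l * g) + of_int (- (int l * b))" unfolding tJ by (simp add: algebra_simps)
  finally have "sapp l False g ((u + of_nat l * z) / J) = sapp l False g (u / J + of_int d * (of_nat l * g) + of_int (- (int l * b)))" by (rule arg_cong)
  also have "... = (-1) powi d * ee ((of_int d * of_nat l)^2 * g + 2 * of_int d * of_nat l * (u / J)) * sapp l False g (u / J)"
   using sapp_shift[OF lodd gp poles[OF u], of False d "- (int l * b)"] by simp
  finally have s: "sapp l False g ((u + of_nat l * z) / J) = (-1) powi d * ee ((of_int d * of_nat l)^2 * g + 2 * of_int d * of_nat l * (u / J)) * sapp l False g (u / J)" .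
  have E: "ee (of_int c * (u + of_nat l * z)^2 / J) * ee ((of_int d * of_nat l)^2 * g + 2 * of_int d * of_nat l * (u / J))
   = ee ((of_nat l)^2 * z + 2 * of_nat l * u) * ee (of_int c * u^2 / J)"
   unfolding ee_add[symmetric]
  proof (rule ee_eqI[where n = "(int l)\<^sup>2 * b * d"])
   let ?X = "of_int c * (u + of_nat l * z)^2 / J + ((of_int d * of_nat l)^2 * g + 2 * of_int d * of_nat l * (u / J)) -
     ((of_nat l)^2 * z + 2 * of_nat l * u + of_int c * u^2 / J)"
   have "?X * J = of_int c * (u + of_nat l * z)^2 + (of_int d * of_nat l)^2 * (g * J) + 2 * of_int d * of_nat l * u
     - ((of_nat l)^2 * z + 2 * of_nat l * u) * J - of_int c * u^2"
    using J0 by (simp add: field_simps)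
   also have "... = of_int ((int l)^2 * b * d) * J + (of_int a * of_int d - of_int b * of_int c - 1) * (of_int d * (of_nat l)^2 * z)"
    unfolding gJ by (simp add: J algebra_simps power2_eq_square)
   finally have "?X * J = of_int ((int l)^2 * b * d) * J" unfolding det' by simp
   thus "?X = of_int ((int l)^2 * b * d)" using mult_right_cancel[OF J0] by blast
  qed
  have pd: "(-1 :: complex) powi d = esgn e"
  proof -
   have "odd (a * d - b * c)" using det by simp
   thus ?thesis unfolding minus_one_powi using e by auto
  qed
  have gen: "X * (s * E * F) - K * (s * M * B) = s * M * (Y * F - K * B)" if "X * E = M * Y" for X s E F K M B Y :: complex
  proof -
   have "X * (s * E * F) = s * (X * E) * F" by (simp only: mult_ac)
   thus ?thesis unfolding that by (simp add: algebra_simps)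
  qed
  show ?thesis unfolding G_def s sapp_add_period[OF lodd z u] pd by (rule gen[OF E])
 qed
 \<comment> \<open>With this weight the change of (Im u)^2 under the step l z compensates exactly
   the modulus of ee (l^2 z + 2 l u).\<close>
 define \<alpha> where "\<alpha> = 2 * pi / Im z"
 have \<alpha>: "\<alpha> > 0" using z by (simp add: \<alpha>_def)
 have "EX c. (ALL u. u ~: spoles l z --> G u = c) & (\<alpha> > 0 --> c = 0)"
 proof (rule quasi_periodic_constant[OF hol spoles_discrete[OF l0 z] res, where \<omega> = "of_nat l * z"])
  show "u + 1 \<in> spoles l z \<longleftrightarrow> u \<in> spoles l z" for u using spoles_shift[OF l0, of u 0 z 1] by simp
  show "u + of_nat l * z \<in> spoles l z \<longleftrightarrow> u \<in> spoles l z" for u using spoles_shift[OF l0, of u 1 z 0] by simp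
  show "norm (G (u + 1)) = norm (G u)" if "u ~: spoles l z" for u using G1[OF that] by (simp add: norm_mult)
  show "norm (G (u + of_nat l * z)) * exp (\<alpha> * (Im (u + of_nat l * z))^2) = norm (G u) * exp (\<alpha> * (Im u)^2)"
   if "u ~: spoles l z" for u
  proof -
   have i: "Im (of_nat l * z) = real l * Im z" "Im ((of_nat l)^2 * z + 2 * of_nat l * u) = (real l)^2 * Im z + 2 * real l * Im u"
    by (simp_all add: power2_eq_square)
   have "- 2 * pi * ((real l)^2 * Im z + 2 * real l * Im u) + \<alpha> * (Im u + real l * Im z)^2 = \<alpha> * (Im u)^2"
    using z by (simp add: \<alpha>_def field_simps power2_eq_square)
   hence E: "exp (- 2 * pi * ((real l)^2 * Im z + 2 * real l * Im u)) * exp (\<alpha> * (Im u + real l * Im z)^2) = exp (\<alpha> * (Im u)^2)"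
    unfolding exp_add[symmetric] by (rule arg_cong)
   have n: "norm (G (u + of_nat l * z)) = exp (- 2 * pi * ((real l)^2 * Im z + 2 * real l * Im u)) * norm (G u)"
    unfolding G2[OF that] norm_mult norm_ee i by simp
   have m: "Im (u + of_nat l * z) = Im u + real l * Im z" by simp
   have gen: "Y * g' * B = g' * C" if "Y * B = C" for Y g' B C :: real using that by (simp add: mult_ac)
   show ?thesis unfolding n m by (rule gen[OF E])
  qed
 qed (use l0 z \<alpha> in auto)
 hence "G u = 0" using u \<alpha> by blast
 thus ?thesis by (simp add: G_def)
qed

section \<open>Specialisation to torsion points\<close>

lemma real_spoles:
 assumes z: "Im z > 0" and t: "t > 0" "~ int t dvd j"
 shows "of_int j / of_nat t ~: spoles l z"
proof
 assume "of_int j / of_nat t \<in> spoles l z"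
 then obtain m k v where e: "of_int j / of_nat t = of_int m * sshift l z v + (of_int k :: complex)" by (auto simp: spoles_def)
 have "Im (of_int j / of_nat t) = Im (of_int m * sshift l z v + of_int k)" by (simp only: e)
 moreover have "of_int j / of_nat t = complex_of_real (of_int j / real t)" by simp
 hence "Im (of_int j / of_nat t) = 0" by (simp only: Im_complex_of_real)
 ultimately have "of_int m * Im z = 0" by simp
 hence "m = 0" using z by simp
 hence "of_int j = (of_int (k * int t) :: complex)" using e t by (simp add: field_simps)
 hence "j = k * int t" by (simp only: of_int_eq_iff)
 thus False using t by simp
qed

text \<open>At u = J j / t the part c z j / t is an integral multiple of l z because (t l)^2 | c.
  The quasi-period factor of this shift and the quadratic exponential have exponents that differ by
  the integer l^2 c2 d j^2; they cancel, and a law of weight 1/2 is left that sends j to j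
  d.\<close>

theorem sapp_rational_transform:
 fixes a b c d j :: int and l t :: nat
 assumes l: "prime l" "l > 2" and det: "a * d - b * c = 1" and c: "(int t * int l)\<^sup>2 dvd c" and t: "odd t" and z: "Im z > 0"
  and e: "e \<longleftrightarrow> odd c" "e ==> even d" and K: "K ~= 0"
  and th: "!!z. Im z > 0 ==> th0 (mob (a,b,c,d) z) = K * csqrt (aut c d z) * thc e z"
  and j: "~ int t dvd j"
 shows "sapp l False (mob (a,b,c,d) z) (of_int j / of_nat t) = csqrt (aut c d z) / K * sapp l e z (of_int (j * d) / of_nat t)"
proof -
 have l0: "l > 0" and lodd: "odd l" using l prime_odd_nat by auto
 have t0: "t > 0" using t by (cases t) auto
 obtain c2 where c2: "c = (int t * int l)^2 * c2" using c by (elim dvdE)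
 define J where "J = of_int c * z + of_int d"
 have J0: "J ~= 0" unfolding J_def by (rule Im_moebius(2)[OF det z])
 have cop: "coprime (int t) d"
  by (rule coprime_divisors[OF _ dvd_refl SL2_coprime[OF det]]) (simp add: c2 power2_eq_square)
 have jd: "~ int t dvd j * d" using j cop by (simp add: coprime_dvd_mult_left_iff)
 define k where "k = int t * int l * c2 * j"
 define x where "x = of_int (j * d) / (of_nat t :: complex)"
 have x: "x ~: spoles l z" unfolding x_def by (rule real_spoles[OF z t0 jd])
 have kl: "of_int k * of_nat l = of_int c * of_int j / (of_nat t :: complex)"
  using t0 by (simp add: k_def c2 field_simps power2_eq_square)
 have u: "J * of_int j / of_nat t = x + of_int k * (of_nat l * z) + of_int 0"
  unfolding mult.assoc[symmetric] kl using t0 by (simp add: J_def x_def field_simps)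
 have "J * of_int j / of_nat t ~: spoles l z" unfolding u spoles_shift[OF l0] by (rule x)
 moreover have "(int l)\<^sup>2 dvd c" by (simp add: c2 power_mult_distrib)
 ultimately have "ee (of_int c * (J * of_int j / of_nat t)^2 / J) * sapp l False (mob (a,b,c,d) z) (J * of_int j / of_nat t / J) =
   csqrt J / K * sapp l e z (J * of_int j / of_nat t)"
  using sapp_transform[OF l det _ z e K th J_def refl] by blast
 moreover have "J * of_int j / of_nat t / J = of_int j / of_nat t" using J0 by simp
 moreover have "sapp l e z (J * of_int j / of_nat t) = ee ((of_int k * of_nat l)^2 * z + 2 * of_int k * of_nat l * x) * sapp l e z x"
 proof -
  have "e | even k" using e(1) t lodd by (auto simp: k_def c2)
  thus ?thesis unfolding u sapp_shift[OF lodd z x] minus_one_powi by auto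
 qed
 moreover have "ee (of_int c * (J * of_int j / of_nat t)^2 / J) = ee ((of_int k * of_nat l)^2 * z + 2 * of_int k * of_nat l * x)"
 proof (rule ee_eqI[where n = "- ((int l)^2 * c2 * d * j^2)"])
  have ctt: "of_int c = (of_nat t)^2 * ((of_nat l)^2 * (of_int c2 :: complex))" by (simp add: c2 power_mult_distrib)
  have "of_int c * (J * of_int j / of_nat t)^2 / J = of_int c * (of_int j)^2 * J / (of_nat t)^2"
   using J0 by (simp add: power2_eq_square)
  also have "... = (of_int c * of_int j / of_nat t)^2 * z + of_int c * of_int d * (of_int j)^2 / (of_nat t)^2"
   using t0 by (simp add: J_def field_simps power2_eq_square)
  finally have 1: "of_int c * (J * of_int j / of_nat t)^2 / J = (of_int k * of_nat l)^2 * z + of_int c * of_int d * (of_int j)^2 / (of_nat t)^2"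
   unfolding kl .
  have "2 * of_int k * of_nat l * x = 2 * (of_int k * of_nat l) * x" by simp
  also have "... = 2 * (of_int c * of_int d * (of_int j)^2 / (of_nat t)^2)" unfolding kl using t0 by (simp add: x_def field_simps power2_eq_square)
  finally have 2: "2 * of_int k * of_nat l * x = 2 * (of_int c * of_int d * (of_int j)^2 / (of_nat t)^2)" .
  have 3: "of_int c * of_int d * (of_int j)^2 / (of_nat t)^2 = (of_int ((int l)^2 * c2 * d * j^2) :: complex)"
   using t0 by (simp add: ctt)
  show "of_int c * (J * of_int j / of_nat t)^2 / J - ((of_int k * of_nat l)^2 * z + 2 * of_int k * of_nat l * x) = of_int (- ((int l)^2 * c2 * d * j^2))"
   unfolding 1 2 3 by simp
 qed
 ultimately have "ee ((of_int k * of_nat l)^2 * z + 2 * of_int k * of_nat l * x) * sapp l False (mob (a,b,c,d) z) (of_int j / of_nat t) =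
   ee ((of_int k * of_nat l)^2 * z + 2 * of_int k * of_nat l * x) * (csqrt J / K * sapp l e z x)" by (simp only: mult.left_commute)
 thus ?thesis unfolding J_def x_def by (simp only: mult_left_cancel[OF ee_nonzero])
qed

section \<open>Sieved generating functions and their weights\<close>

lemma has_sum_finite_sum:
 fixes f :: "'a => 'b => complex"
 assumes "finite A" "!!x. x \<in> A ==> (f x has_sum s x) B"
 shows "((%y. \<Sum>x\<in>A. f x y) has_sum (\<Sum>x\<in>A. s x)) B"
 using assms by (induction A rule: finite_induct) (auto intro: has_sum_add)

definition sgen :: "nat => complex => complex => complex" where
 "sgen l w z = (\<Sum>v\<in>{0..<int l}. sieve_coeff l v * ogen (ee (sshift l z v)) w)"

lemma prime_not_dvd_4: "prime l ==> l > 2 ==> ~ int l dvd 4"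
proof
 assume l: "prime l" "l > 2" "int l dvd 4"
 hence "int l dvd int 4" by simp
 hence "l dvd 2 ^ 2" by (simp only: of_nat_dvd_iff) simp
 hence "l dvd 2" using l(1) prime_dvd_power by blast
 thus False using l(2) dvd_imp_le by force
qed

text \<open>The shift by 16 v / l multiplies the n-th coefficient by ee (16 n v / l); 16 n and n are
  selected simultaneously.\<close>

lemma sgen_has_sum:
 assumes l: "prime l" "l > 2" and z: "Im z > 0" and w: "norm w = 1"
 shows "((%n. of_bool (nonres l (int n)) * rankcoeff w n * ee z ^ n) has_sum sgen l w z) UNIV"
proof -
 have l0: "l > 0" using l by simp
 have "((%n. rankcoeff w n * ee (sshift l z v) ^ n) has_sum ogen (ee (sshift l z v)) w) UNIV" for v
  by (rule rankcoeff_has_sum[OF norm_ee_lt_1 _ w]) (use z in auto)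
 hence "((%n. \<Sum>v\<in>{0..<int l}. sieve_coeff l v * (rankcoeff w n * ee (sshift l z v) ^ n)) has_sum sgen l w z) UNIV"
  unfolding sgen_def by (intro has_sum_finite_sum has_sum_cmult_right) auto
 moreover have "(\<Sum>v\<in>{0..<int l}. sieve_coeff l v * (rankcoeff w n * ee (sshift l z v) ^ n)) = of_bool (nonres l (int n)) * rankcoeff w n * ee z ^ n" for n
 proof -
  have "ee (sshift l z v) ^ n = ee (of_int (v * (int n * 4^2)) / of_nat l) * ee z ^ n" for v
   unfolding ee_power ee_add[symmetric] using l0 by (intro arg_cong[where f = ee]) (simp add: sshift_def field_simps)
  hence "(\<Sum>v\<in>{0..<int l}. sieve_coeff l v * (rankcoeff w n * ee (sshift l z v) ^ n)) =
    (\<Sum>v\<in>{0..<int l}. sieve_coeff l v * ee (of_int (v * (int n * 4^2)) / of_nat l)) * (rankcoeff w n * ee z ^ n)"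
   unfolding sum_distrib_right by (intro sum.cong refl) (simp add: mult_ac)
  also have "... = of_bool (nonres l (int n)) * (rankcoeff w n * ee z ^ n)"
   unfolding sieve_indicator[OF l0] nonres_mult_square[OF l prime_not_dvd_4[OF l]] ..
  finally show ?thesis by (simp only: mult.assoc)
 qed
 ultimately show ?thesis by simp
qed

lemma sgen_1:
 assumes z: "Im z > 0"
 shows "sgen l 1 z = (\<Sum>v\<in>{0..<int l}. sieve_coeff l v / th0 (sshift l z v))"
 unfolding sgen_def
proof (rule sum.cong[OF refl])
 fix v
 have s: "Im (sshift l z v) > 0" using z by simp
 have "th0 (sshift l z v) * ogen (ee (sshift l z v)) 1 = 1" using ogen_lambert(2)[OF s, of 1] by simp
 thus "sieve_coeff l v * ogen (ee (sshift l z v)) 1 = sieve_coeff l v / th0 (sshift l z v)"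
  using th0_nonzero[OF s] by (simp add: field_simps)
qed

lemma root_of_unity_neq:
 assumes t: "t > 0" and j: "~ int t dvd j"
 shows "ee (of_int j / of_nat t) ~= 1" and "odd t ==> 1 + ee (of_int j / of_nat t) ~= 0"
proof -
 have *: "ee (of_int j / of_nat t) ~= 1" if j: "~ int t dvd j" for j
 proof
  assume "ee (of_int j / of_nat t) = 1"
  then obtain k where "of_int j / of_nat t = (of_int k :: complex)" by (auto simp: ee_eq_1_iff)
  hence "of_int j = (of_int (k * int t) :: complex)" using t by (simp add: field_simps)
  hence "j = k * int t" by (simp only: of_int_eq_iff)
  thus False using j by simp
 qed
 show "ee (of_int j / of_nat t) ~= 1" by (rule *[OF j])
 show "1 + ee (of_int j / of_nat t) ~= 0" if "odd t"
 proof
  assume "1 + ee (of_int j / of_nat t) = 0"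
  hence "ee (of_int j / of_nat t) = - 1" by (simp add: add_eq_0_iff)
  hence "ee (of_int j / of_nat t) ^ 2 = 1" by simp
  moreover have "ee (of_int j / of_nat t) ^ 2 = ee (of_int (2 * j) / of_nat t)" by (simp add: ee_power)
  ultimately have "int t dvd 2 * j" using *[of "2 * j"] by auto
  moreover have "coprime (int t) 2" using that by (simp add: coprime_right_2_iff_odd)
  ultimately show False using j by (simp add: coprime_dvd_mult_right_iff)
 qed
qed

lemma norm_ee_rational [simp]: "norm (ee (of_int j / of_nat t)) = 1"
proof -
 have "of_int j / of_nat t = complex_of_real (of_int j / real t)" by simp
 thus ?thesis by (simp only: norm_ee Im_complex_of_real) simp
qed

text \<open>The Lambert identity has a constant -1 beside the Appell function; it does not depend on
  v and is removed because the weights sum to 0. Odd t keeps 1 + w away from 0.\<close>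

lemma sgen_root_of_unity:
 assumes l: "l > 0" and z: "Im z > 0" and t: "odd t" and j: "~ int t dvd j"
 defines "w \<equiv> ee (of_int j / of_nat t)"
 shows "sgen l w z = 2 * (1 - w) / (1 + w) * sapp l False z (of_int j / of_nat t)"
proof -
 have t0: "t > 0" using t by (cases t) auto
 have w: "w ~= 1" "1 + w ~= 0" using root_of_unity_neq[OF t0 j] t by (auto simp: w_def)
 have n: "norm w = 1" by (simp add: w_def)
 have o: "ogen (ee (sshift l z v)) w = (1 - w) / (1 + w) * (2 * appell False (sshift l z v) (of_int j / of_nat t) - 1)" for v
 proof -
  let ?s = "sshift l z v"
  have s: "Im ?s > 0" using z by simp
  have "th0 ?s * (1 + w) * ogen (ee ?s) w = (1 - w) * (2 * lambert (app0 ?s) ?s w - th0 ?s)"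
   by (rule ogen_lambert(1)[OF s n w(1)])
  hence "ogen (ee ?s) w = (1 - w) * (2 * lambert (app0 ?s) ?s w - th0 ?s) / (th0 ?s * (1 + w))"
   using th0_nonzero[OF s] w(2) by (simp add: eq_divide_imp mult.commute)
  also have "... = (1 - w) / (1 + w) * (2 * (lambert (app0 ?s) ?s w / th0 ?s) - 1)"
   using th0_nonzero[OF s] w(2) by (simp add: divide_simps)
  finally show ?thesis by (simp add: appell_def appc_False thc_def w_def[symmetric])
 qed
 define K where "K = (1 - w) / (1 + w)"
 have "sgen l w z = (\<Sum>v\<in>{0..<int l}. 2 * K * (sieve_coeff l v * appell False (sshift l z v) (of_int j / of_nat t)) - K * sieve_coeff l v)"
  unfolding sgen_def o K_def[symmetric] by (intro sum.cong refl) (simp add: algebra_simps)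
 also have "... = 2 * K * sapp l False z (of_int j / of_nat t) - K * (\<Sum>v\<in>{0..<int l}. sieve_coeff l v)"
  by (simp only: sum_subtractf sum_distrib_left[symmetric] sapp_def)
 finally show ?thesis by (simp add: sum_sieve_coeff[OF l] K_def)
qed

definition pbar :: "nat => nat" where "pbar n = card {PO. is_overpartition n PO}"

text \<open>The terms with 0 < j < t of the orthogonality relation. The term j = 0 is the
  overpartition series, which has weight -1/2 instead of 1/2 and is kept apart.\<close>

definition rankgen :: "nat => nat => nat => complex => complex" where
 "rankgen l t r z = (\<Sum>j\<in>{1..<int t}. ee (- (of_int (int r * j) / of_nat t)) * sgen l (ee (of_int j / of_nat t)) z)"

lemma Nbar_roots_of_unity:
 assumes t: "t > 0" and n: "n > 0"
 shows "(\<Sum>j\<in>{1..<int t}. ee (- (of_int (int r * j) / of_nat t)) * rankcoeff (ee (of_int j / of_nat t)) n) =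
  of_int (int (t * Nbar (int r) t n) - int (pbar n))"
proof -
 let ?O = "{PO. is_overpartition n PO}"
 have fin: "finite ?O" by (rule finite_overpartitions)
 let ?f = "%j. ee (- (of_int (int r * j) / of_nat t)) * rankcoeff (ee (of_int j / of_nat t)) n"
 have f: "?f j = (\<Sum>PO\<in>?O. ee (of_int (j * (overpartition_rank PO - int r)) / of_nat t))" for j
 proof -
  have "ee (- (of_int (int r * j) / of_nat t)) * ee (of_int j / of_nat t) powi k = ee (of_int (j * (k - int r)) / of_nat t)" for k
   unfolding ee_powi ee_add[symmetric] using t by (intro arg_cong[where f = ee]) (simp add: field_simps)
  thus ?thesis using n by (simp add: rankcoeff_def sum_distrib_left)
 qed
 have "(\<Sum>j\<in>{0..<int t}. ?f j) = (\<Sum>PO\<in>?O. \<Sum>j\<in>{0..<int t}. ee (of_int (j * (overpartition_rank PO - int r)) / of_nat t))"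
  unfolding f by (rule sum.swap)
 also have "... = (\<Sum>PO\<in>?O. if int t dvd overpartition_rank PO - int r then of_nat t else 0)"
  by (simp only: sum_roots_of_unity[OF t])
 also have "... = of_nat t * of_nat (card {PO\<in>?O. int t dvd overpartition_rank PO - int r})"
  by (simp only: sum.inter_filter[OF fin, symmetric] sum_constant mult.commute)
 also have "card {PO\<in>?O. int t dvd overpartition_rank PO - int r} = Nbar (int r) t n"
  unfolding Nbar_def by (intro arg_cong[where f = card]) (auto simp: cong_iff_dvd_diff)
 finally have A: "(\<Sum>j\<in>{0..<int t}. ?f j) = of_nat (t * Nbar (int r) t n)" by simp
 have "{0..<int t} = insert 0 {1..<int t}" using t by auto
 hence "(\<Sum>j\<in>{0..<int t}. ?f j) = ?f 0 + (\<Sum>j\<in>{1..<int t}. ?f j)" by simp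
 moreover have "?f 0 = of_nat (pbar n)" using rankcoeff_1[OF n] by (simp add: pbar_def)
 ultimately show ?thesis using A by (simp add: algebra_simps)
qed

lemma pbar_gen_has_sum:
 assumes l: "prime l" "l > 2" and z: "Im z > 0"
 shows "((%n. of_int (of_bool (nonres l (int n)) * int (pbar n)) * ee z ^ n) has_sum sgen l 1 z) UNIV"
proof -
 have "~ nonres l (int 0)" using not_nonres_neg_square[of l 0] by (simp add: power2_eq_square)
 hence e: "of_bool (nonres l (int n)) * rankcoeff 1 n = of_int (of_bool (nonres l (int n)) * int (pbar n))" for n
  by (cases "n = 0") (auto simp: rankcoeff_1 pbar_def)
 show ?thesis using sgen_has_sum[OF l z norm_one] unfolding e .
qed

lemma rankgen_has_sum:
 assumes l: "prime l" "l > 2" and z: "Im z > 0" and t: "t > 0"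
 shows "((%n. of_int (of_bool (nonres l (int n)) * (int (t * Nbar (int r) t n) - int (pbar n))) * ee z ^ n) has_sum rankgen l t r z) UNIV"
proof -
 have "((%n. \<Sum>j\<in>{1..<int t}. ee (- (of_int (int r * j) / of_nat t)) * (of_bool (nonres l (int n)) * rankcoeff (ee (of_int j / of_nat t)) n * ee z ^ n)) has_sum rankgen l t r z) UNIV"
  unfolding rankgen_def by (intro has_sum_finite_sum has_sum_cmult_right sgen_has_sum[OF l z]) auto
 moreover have "(\<Sum>j\<in>{1..<int t}. ee (- (of_int (int r * j) / of_nat t)) * (of_bool (nonres l (int n)) * rankcoeff (ee (of_int j / of_nat t)) n * ee z ^ n)) =
   of_int (of_bool (nonres l (int n)) * (int (t * Nbar (int r) t n) - int (pbar n))) * ee z ^ n" for n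
 proof (cases "n = 0")
  case True
  have "~ nonres l (int 0)" using not_nonres_neg_square[of l 0] by (simp add: power2_eq_square)
  thus ?thesis using True by simp
 next
  case False
  have "(\<Sum>j\<in>{1..<int t}. ee (- (of_int (int r * j) / of_nat t)) * (of_bool (nonres l (int n)) * rankcoeff (ee (of_int j / of_nat t)) n * ee z ^ n)) =
   (\<Sum>j\<in>{1..<int t}. ee (- (of_int (int r * j) / of_nat t)) * rankcoeff (ee (of_int j / of_nat t)) n) * (of_bool (nonres l (int n)) * ee z ^ n)"
   unfolding sum_distrib_right by (intro sum.cong refl) (simp add: mult_ac)
  thus ?thesis using Nbar_roots_of_unity[OF t, of n r] False by simp
 qed
 ultimately show ?thesis by simp
qed

lemma pbar_gen_transform:
 fixes a b c d :: int and l :: nat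
 assumes l: "prime l" "l > 2" and det: "a * d - b * c = 1" and c: "(int l)\<^sup>2 dvd c" and z: "Im z > 0" and K: "K ~= 0"
  and th: "!!z. Im z > 0 ==> th0 (mob (a,b,c,d) z) = K * csqrt (aut c d z) * thc e z"
 shows "sgen l 1 (mob (a,b,c,d) z) = (\<Sum>v\<in>{0..<int l}. sieve_coeff l v / thc e (sshift l z v)) / (K * csqrt (aut c d z))"
proof -
 have l0: "l > 0" using l by simp
 have ld: "~ int l dvd d"
 proof
  assume "int l dvd d"
  moreover have "int l dvd c" using c by (meson dvd_trans dvd_triv_left power2_eq_square dvd_power pos2)
  ultimately have "int l dvd a * d - b * c" by simp
  thus False using det l by simp
 qed
 have "sgen l 1 (mob (a,b,c,d) z) = (\<Sum>v\<in>{0..<int l}. sieve_coeff l v / (K * csqrt (aut c d z) * thc e (sshift l z (v * d^2))))"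
  unfolding sgen_1[OF Im_moebius(3)[OF det z]]
  by (intro sum.cong refl, subst th0_sshift[OF l0 det c z, of K e]) (simp_all add: th)
 also have "... = (\<Sum>v\<in>{0..<int l}. sieve_coeff l v * (1 / thc e (sshift l z (v * d^2)))) / (K * csqrt (aut c d z))"
  by (simp add: sum_divide_distrib mult_ac)
 also have "(\<Sum>v\<in>{0..<int l}. sieve_coeff l v * (1 / thc e (sshift l z (v * d^2)))) = (\<Sum>v\<in>{0..<int l}. sieve_coeff l v * (1 / thc e (sshift l z v)))"
 proof (rule sieve_reindex[OF l ld])
  fix v v' assume "[v = v'] (mod int l)"
  then obtain k where k: "v' = v + int l * k" by (metis cong_iff_lin)
  have s: "sshift l z v' = sshift l z v + 16 * of_int k" using l0 by (simp add: k sshift_def field_simps)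
  show "1 / thc e (sshift l z v) = 1 / thc e (sshift l z v')" unfolding s thc_T16_int ..
 qed
 finally show ?thesis by simp
qed

text \<open>For 16 | c two formulas for the same value of th0 are available; dividing by the
  non-zero th0 identifies the unspecified constant with the theta multiplier.\<close>

lemma theta_j_kappa:
 assumes det: "a * d - b * c = 1" and c: "16 dvd c"
 shows "EX K. K ~= 0 & (ALL z. Im z > 0 --> th0 (mob (a,b,c,d) z) = K * csqrt (aut c d z) * thc False z
  & K * csqrt (aut c d z) = theta_j (a,b,c,d) z)"
proof -
 obtain K where k: "K ~= 0" "!!z. Im z > 0 ==> th0 (mob (a,b,c,d) z) = K * csqrt (aut c d z) * thr c d z"
  using th0_general_transform[OF det] by blast
 have "even c" using c by (meson dvd_trans even_numeral)
 hence t: "thr c d = thc False" by (simp add: thr_def thc_def fun_eq_iff)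
 have "K * csqrt (aut c d z) = theta_j (a,b,c,d) z" if "Im z > 0" for z
  using k(2)[OF that] th0_transform[OF det c that] th0_nonzero[OF that] by (simp add: t thc_def)
 thus ?thesis using k unfolding t by blast
qed

lemma theta_j_nonzero:
 assumes det: "a * d - b * c = 1" and c: "16 dvd c" and z: "Im z > 0"
 shows "theta_j (a,b,c,d) z ~= 0"
 using theta_j_kappa[OF det c] Im_moebius(2)[OF det z] z by (metis csqrt_eq_0 mult_eq_0_iff)

lemma pbar_gen_Gamma0:
 assumes l: "prime l" "l > 2" and det: "a * d - b * c = 1" and c: "(int l)\<^sup>2 dvd c" "16 dvd c" and z: "Im z > 0"
 shows "sgen l 1 (mob (a,b,c,d) z) = sgen l 1 z / theta_j (a,b,c,d) z"
proof -
 obtain K where k: "K ~= 0" "!!z. Im z > 0 ==> th0 (mob (a,b,c,d) z) = K * csqrt (aut c d z) * thc False z"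
  "!!z. Im z > 0 ==> K * csqrt (aut c d z) = theta_j (a,b,c,d) z"
  using theta_j_kappa[OF det c(2)] by blast
 have "sgen l 1 (mob (a,b,c,d) z) = (\<Sum>v\<in>{0..<int l}. sieve_coeff l v / thc False (sshift l z v)) / (K * csqrt (aut c d z))"
  by (rule pbar_gen_transform[OF l det c(1) z k(1)]) (rule k(2))
 thus ?thesis unfolding k(3)[OF z] sgen_1[OF z] by (simp add: thc_def)
qed

lemma rankgen_transform:
 fixes a b c d :: int and l t :: nat
 assumes l: "prime l" "l > 2" and det: "a * d - b * c = 1" and c: "(int t * int l)\<^sup>2 dvd c" and t: "odd t" and z: "Im z > 0"
  and e: "e \<longleftrightarrow> odd c" "e ==> even d" and k: "k ~= 0"
  and th: "!!z. Im z > 0 ==> th0 (mob (a,b,c,d) z) = k * csqrt (aut c d z) * thc e z"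
 shows "rankgen l t r (mob (a,b,c,d) z) = csqrt (aut c d z) / k *
  (\<Sum>j\<in>{1..<int t}. ee (- (of_int (int r * j) / of_nat t)) * (2 * (1 - ee (of_int j / of_nat t)) / (1 + ee (of_int j / of_nat t)) * sapp l e z (of_int (j * d) / of_nat t)))"
proof -
 have l0: "l > 0" using l by simp
 have "sgen l (ee (of_int j / of_nat t)) (mob (a,b,c,d) z) =
  csqrt (aut c d z) / k * (2 * (1 - ee (of_int j / of_nat t)) / (1 + ee (of_int j / of_nat t)) * sapp l e z (of_int (j * d) / of_nat t))"
  if j: "j \<in> {1..<int t}" for j
 proof -
  have nd: "~ int t dvd j" using j by (auto dest: zdvd_imp_le)
  have "sapp l False (mob (a,b,c,d) z) (of_int j / of_nat t) = csqrt (aut c d z) / k * sapp l e z (of_int (j * d) / of_nat t)"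
   by (rule sapp_rational_transform[OF l det c t z e k _ nd]) (assumption | rule th)+
  thus ?thesis unfolding sgen_root_of_unity[OF l0 Im_moebius(3)[OF det z] t nd] by (simp only: mult.left_commute)
 qed
 thus ?thesis unfolding rankgen_def sum_distrib_left by (intro sum.cong refl) (simp only: mult.left_commute)
qed

lemma theta_j_square:
 assumes det: "a * d - b * c = 1" and c: "4 dvd c" and d: "[d = 1] (mod 4)"
 shows "(theta_j (a,b,c,d) z)\<^sup>2 = of_int c * z + of_int d"
proof -
 have "d mod 4 = 1" using d by (simp add: cong_def)
 hence "odd d" by presburger
 hence "(shimura_symbol c d)\<^sup>2 = 1" using shimura_symbol_coprime_sq SL2_coprime[OF det] by blast
 hence "(of_int (shimura_symbol c d) :: complex)\<^sup>2 = 1" by (metis of_int_1 of_int_power)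
 thus ?thesis using d by (simp add: theta_j_def eps_odd_def power_mult_distrib)
qed

text \<open>The condition d = 1 modulo t fixes each torsion point j / t up to an integer. The
  condition d = 1 modulo 4 gives theta_j^2 = c z + d, which converts the root divided by the
  constant into \<open>theta_j\<close> itself.\<close>

lemma rankgen_Gamma1:
 fixes a b c d :: int
 assumes l: "prime l" "l > 2" and det: "a * d - b * c = 1" and c: "(int t * int l)\<^sup>2 dvd c" "16 dvd c" and t: "odd t"
  and d: "[d = 1] (mod 4)" "[d = 1] (mod int t)" and z: "Im z > 0"
 shows "rankgen l t r (mob (a,b,c,d) z) = theta_j (a,b,c,d) z * rankgen l t r z"
proof -
 have l0: "l > 0" using l by simp
 have t0: "t > 0" using t by (cases t) auto
 obtain g where k: "g ~= 0" "!!z. Im z > 0 ==> th0 (mob (a,b,c,d) z) = g * csqrt (aut c d z) * thc False z"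
  "!!z. Im z > 0 ==> g * csqrt (aut c d z) = theta_j (a,b,c,d) z"
  using theta_j_kappa[OF det c(2)] by blast
 have "even c" using c(2) by (meson dvd_trans even_numeral)
 hence e: "False \<longleftrightarrow> odd c" "False ==> even d" by auto
 have c4: "4 dvd c" using c(2) by (rule dvd_trans[rotated]) simp
 obtain k' where k': "d = 1 + int t * k'" using d(2) by (metis cong_iff_lin cong_sym)
 have "csqrt (aut c d z) / g = (csqrt (aut c d z))^2 / (g * csqrt (aut c d z))"
  using Im_moebius(2)[OF det z] by (simp add: power2_eq_square)
 also have "... = theta_j (a,b,c,d) z"
  unfolding k(3)[OF z] power2_csqrt unfolding theta_j_square[OF det c4 d(1), symmetric]
  using theta_j_nonzero[OF det c(2) z] by (simp add: power2_eq_square)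
 finally have K: "csqrt (aut c d z) / g = theta_j (a,b,c,d) z" .
 have "sapp l False z (of_int (j * d) / of_nat t) = sapp l False z (of_int j / of_nat t)" for j
 proof -
  have "of_int (j * d) / of_nat t = of_int j / of_nat t + (of_int (j * k') :: complex)" using t0 by (simp add: k' field_simps)
  thus ?thesis by (simp only: sapp_add_int if_False mult_1)
 qed
 hence "ee (- (of_int (int r * j) / of_nat t)) * (2 * (1 - ee (of_int j / of_nat t)) / (1 + ee (of_int j / of_nat t)) * sapp l False z (of_int (j * d) / of_nat t)) =
  ee (- (of_int (int r * j) / of_nat t)) * sgen l (ee (of_int j / of_nat t)) z" if j: "j \<in> {1..<int t}" for j
 proof -
  have nd: "~ int t dvd j" using j by (auto dest: zdvd_imp_le)
  show ?thesis unfolding sgen_root_of_unity[OF l0 z t nd] \<open>!!j. sapp l False z (of_int (j * d) / of_nat t) = sapp l False z (of_int j / of_nat t)\<close> ..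
 qed
 hence S: "(\<Sum>j\<in>{1..<int t}. ee (- (of_int (int r * j) / of_nat t)) * (2 * (1 - ee (of_int j / of_nat t)) / (1 + ee (of_int j / of_nat t)) * sapp l False z (of_int (j * d) / of_nat t))) = rankgen l t r z"
  unfolding rankgen_def by (intro sum.cong refl)
 have "rankgen l t r (mob (a,b,c,d) z) = csqrt (aut c d z) / g *
  (\<Sum>j\<in>{1..<int t}. ee (- (of_int (int r * j) / of_nat t)) * (2 * (1 - ee (of_int j / of_nat t)) / (1 + ee (of_int j / of_nat t)) * sapp l False z (of_int (j * d) / of_nat t)))"
  by (rule rankgen_transform[OF l det c(1) t z e k(1)]) (assumption | rule k(2))+
 thus ?thesis unfolding S K .
qed

section \<open>Power series with integer coefficients\<close>

definition cfps :: "int fps => complex fps" where "cfps F = Abs_fps (%n. of_int (fps_nth F n))"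

lemma cfps_nth [simp]: "fps_nth (cfps F) n = of_int (fps_nth F n)" by (simp add: cfps_def)

lemma cfps_mult: "cfps (F * G) = cfps F * cfps G"
 by (rule fps_ext) (simp add: fps_mult_nth)

lemma cfps_1: "cfps 1 = 1"
 by (rule fps_ext) simp

text \<open>Couples a function on the unit disc with a formal series over the integers: congruences
  are proved formally, modularity analytically.\<close>

definition qint :: "(complex => complex) => int fps => bool" where
 "qint f F \<longleftrightarrow> (ALL q. norm q < 1 --> (%n. of_int (fps_nth F n) * q ^ n) sums f q)"

lemma qint_holomorphic: "qint f F ==> f holomorphic_on ball 0 1"
 by (rule power_series_holomorphic[where a = "%n. of_int (fps_nth F n)"]) (auto simp: qint_def)

lemma qint_expansion: "qint f F ==> f has_fps_expansion cfps F"
proof (rule has_fps_expansionI)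
 assume "qint f F"
 hence "(%n. fps_nth (cfps F) n * u ^ n) sums f u" if "u \<in> ball 0 1" for u using that by (simp add: qint_def)
 moreover have "eventually (%u. u \<in> ball 0 1) (nhds (0 :: complex))" by (rule eventually_nhds_in_open) auto
 ultimately show "eventually (%u. (%n. fps_nth (cfps F) n * u ^ n) sums f u) (nhds 0)"
  by (rule eventually_mono[rotated])
qed

lemma qintI:
 assumes "f holomorphic_on ball 0 1" "f has_fps_expansion cfps F"
 shows "qint f F"
 unfolding qint_def
proof (intro allI impI)
 fix q :: complex assume "norm q < 1"
 thus "(%n. of_int (fps_nth F n) * q ^ n) sums f q"
  using has_fps_expansion_imp_sums_complex[OF assms(2), of 1 q] assms(1) by (simp add: one_ereal_def)
qed

lemma qint_mult:
 assumes "qint f F" "qint g G" shows "qint (%q. f q * g q) (F * G)"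
 by (rule qintI, unfold cfps_mult)
  (rule holomorphic_on_mult has_fps_expansion_mult; rule qint_holomorphic qint_expansion; rule assms)+

lemma qint_1: "qint (%_. 1) 1"
 by (rule qintI) (auto simp: cfps_1)

lemma qint_power: "qint f F ==> qint (%q. f q ^ k) (F ^ k)"
 by (induction k) (auto intro: qint_1 qint_mult)

lemma qint_inverse:
 assumes f: "qint f F" and F: "fps_nth F 0 = 1" and nz: "!!q. norm q < 1 ==> f q ~= 0"
 shows "EX C. F * C = 1 & qint (%q. inverse (f q)) C"
proof -
 define C where "C = fps_right_inverse F 1"
 have FC: "F * C = 1" unfolding C_def by (rule fps_right_inverse) (simp add: F)
 hence "cfps F * cfps C = 1" by (metis cfps_mult cfps_1)
 hence inv: "inverse (cfps F) = cfps C" by (rule fps_inverse_unique)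
 have "qint (%q. inverse (f q)) C"
 proof (rule qintI)
  show "(%q. inverse (f q)) holomorphic_on ball 0 1"
   by (intro holomorphic_intros qint_holomorphic[OF f]) (use nz in auto)
  show "(%q. inverse (f q)) has_fps_expansion cfps C"
   unfolding inv[symmetric] by (rule has_fps_expansion_inverse[OF qint_expansion[OF f]]) (simp add: F)
 qed
 thus ?thesis using FC by blast
qed

definition fps_spread :: "nat => 'a :: comm_ring_1 fps => 'a fps" where
 "fps_spread k F = Abs_fps (%n. if k dvd n then fps_nth F (n div k) else 0)"

lemma qint_spread:
 assumes f: "qint f F" and k: "k > 0"
 shows "qint (%q. f (q ^ k)) (fps_spread k F)"
 unfolding qint_def
proof (intro allI impI)
 fix q :: complex assume q: "norm q < 1"
 have "norm (q ^ k) < 1" using q k by (simp add: norm_power power_less_one_iff)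
 hence "(%n. of_int (fps_nth F n) * (q ^ k) ^ n) sums f (q ^ k)" using f by (simp add: qint_def)
 moreover have "of_int (fps_nth F n) * (q ^ k) ^ n = of_int (fps_nth (fps_spread k F) (k * n)) * q ^ (k * n)" for n
  using k by (simp add: fps_spread_def power_mult)
 ultimately have "(%n. of_int (fps_nth (fps_spread k F) (k * n)) * q ^ (k * n)) sums f (q ^ k)" by simp
 moreover have "strict_mono (%n. k * n)" using k by (simp add: strict_mono_def)
 moreover have "of_int (fps_nth (fps_spread k F) n) * q ^ n = 0" if "n ~: range (%n. k * n)" for n
  using that by (auto simp: fps_spread_def image_iff elim!: dvdE)
 ultimately show "(%n. of_int (fps_nth (fps_spread k F) n) * q ^ n) sums f (q ^ k)"
  using sums_mono_reindex[of "%n. k * n" "%n. of_int (fps_nth (fps_spread k F) n) * q ^ n"] by blast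
qed

lemma qint_int_series:
 fixes e :: "int => nat" and s :: "int => int"
 assumes e: "!!n. nat (abs n) <= e n" and s: "!!n. (abs (s n)) <= 1" and e0: "!!n. e n = 0 \<longleftrightarrow> n = 0" and s0: "s 0 = 1"
 shows "EX F. fps_nth F 0 = 1 & qint (%q. \<Sum>\<^sub>\<infinity>n. of_int (s n) * q ^ e n) F"
proof -
 define F where "F = Abs_fps (%N. \<Sum>n | e n = N. s n)"
 have fin: "finite {n. e n = N}" for N
 proof (rule finite_subset)
  show "{n. e n = N} <= {- int N..int N}"
  proof
   fix n assume "n \<in> {n. e n = N}"
   hence "nat (abs n) <= N" using e[of n] by simp
   hence "(abs n) <= int N" by linarith
   thus "n \<in> {- int N..int N}" by auto
  qed
 qed simp
 have "qint (%q. \<Sum>\<^sub>\<infinity>n. of_int (s n) * q ^ e n) F"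
  unfolding qint_def
 proof (intro allI impI)
  fix q :: complex assume q: "norm q < 1"
  have "(%n. of_int (s n) * q ^ e n) summable_on UNIV"
  proof (rule summable_on_norm_bound(1))
   show "(%n::int. norm q ^ nat (abs n)) summable_on UNIV" by (rule summable_int_geometric) (use q in auto)
   fix n
   have "real_of_int (abs (s n)) <= 1" using s[of n] by linarith
   hence "norm (of_int (s n) * q ^ e n) <= 1 * norm q ^ e n"
    unfolding norm_mult norm_power by (intro mult_right_mono) auto
   also have "norm q ^ e n <= norm q ^ nat (abs n)" using q e by (intro power_decreasing) auto
   finally show "norm (of_int (s n) * q ^ e n) <= norm q ^ nat (abs n)" by simp
  qed
  hence hs: "((%n. of_int (s n) * q ^ e n) has_sum (\<Sum>\<^sub>\<infinity>n. of_int (s n) * q ^ e n)) UNIV" by (rule has_sum_infsum)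
  have bij: "bij_betw snd (Sigma UNIV (%N. {n. e n = N})) UNIV" by (rule bij_betwI') auto
  from hs have "((%x. of_int (s (snd x)) * q ^ e (snd x)) has_sum (\<Sum>\<^sub>\<infinity>n. of_int (s n) * q ^ e n)) (Sigma UNIV (%N. {n. e n = N}))"
   by (subst has_sum_reindex_bij_betw[OF bij, of "%n. of_int (s n) * q ^ e n"])
  hence "((%N. \<Sum>n | e n = N. of_int (s n) * q ^ e n) has_sum (\<Sum>\<^sub>\<infinity>n. of_int (s n) * q ^ e n)) UNIV"
   by (rule has_sum_Sigma') (simp only: snd_conv has_sum_finite[OF fin])
  moreover have "(\<Sum>n | e n = N. of_int (s n) * q ^ e n) = of_int (fps_nth F N) * q ^ N" for N
   by (simp add: F_def sum_distrib_right)
  ultimately show "(%N. of_int (fps_nth F N) * q ^ N) sums (\<Sum>\<^sub>\<infinity>n. of_int (s n) * q ^ e n)"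
   by (simp add: has_sum_imp_sums)
 qed
 moreover have "fps_nth F 0 = 1" by (simp add: F_def e0 s0)
 ultimately show ?thesis by blast
qed

lemma qint_uminus_arg:
 assumes f: "qint f F" shows "qint (%q. f (- q)) (Abs_fps (%n. (-1) ^ n * fps_nth F n))"
 unfolding qint_def fps_nth_Abs_fps
proof (intro allI impI)
 fix q :: complex assume "norm q < 1"
 hence "(%n. of_int (fps_nth F n) * (- q) ^ n) sums f (- q)" using f by (simp add: qint_def)
 moreover have "of_int ((-1) ^ n * fps_nth F n) * q ^ n = of_int (fps_nth F n) * (- q) ^ n" for n
  by (subst power_minus[of q]) simp
 ultimately show "(%n. of_int ((-1) ^ n * fps_nth F n) * q ^ n) sums f (- q)" by (simp only:)
qed

lemma qint_unique: "qint f F ==> qint f G ==> F = G"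
proof -
 assume "qint f F" "qint f G"
 hence "cfps F = cfps G" using fps_expansion_unique_complex qint_expansion by blast
 hence "fps_nth (cfps F) n = fps_nth (cfps G) n" for n by simp
 thus "F = G" by (intro fps_ext) simp
qed

text \<open>Passes from series in ee (z / 2) to series in ee z. The root chosen by
  \<open>csqrt\<close> does not matter for an even function.\<close>

lemma qint_even:
 assumes f: "qint f F" and even: "!!q. f (- q) = f q"
 shows "EX g. qint g (Abs_fps (%n. fps_nth F (2 * n))) & (ALL q. norm q < 1 --> g (q^2) = f q)"
proof -
 have "Abs_fps (%n. (-1) ^ n * fps_nth F n) = F"
  using qint_unique[OF qint_uminus_arg[OF f]] f even by simp
 hence "(-1) ^ n * fps_nth F n = fps_nth F n" for n by (metis fps_nth_Abs_fps)
 hence odd: "fps_nth F n = 0" if "odd n" for n using that by (metis add.inverse_unique equal_neg_zero minus_one_power_iff mult_minus_left mult_1)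
 define g where "g = (%q. f (csqrt q))"
 have g: "(%n. of_int (fps_nth F (2 * n)) * (q^2) ^ n) sums f q" if q: "norm q < 1" for q
 proof -
  have "(%n. of_int (fps_nth F n) * q ^ n) sums f q" using f q by (simp add: qint_def)
  moreover have "strict_mono (%n::nat. 2 * n)" by (simp add: strict_mono_def)
  moreover have "of_int (fps_nth F n) * q ^ n = 0" if "n ~: range (%n. 2 * n)" for n
   using that odd[of n] by (auto simp: image_iff elim: evenE)
  ultimately have "(%n. of_int (fps_nth F (2 * n)) * q ^ (2 * n)) sums f q"
   using sums_mono_reindex[of "%n. 2 * n" "%n. of_int (fps_nth F n) * q ^ n"] by blast
  thus ?thesis by (simp add: power_mult)
 qed
 have "qint g (Abs_fps (%n. fps_nth F (2 * n)))"
  unfolding qint_def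
 proof (intro allI impI)
  fix q :: complex assume "norm q < 1"
  hence "norm (csqrt q) < 1" by (simp add: norm_csqrt)
  from g[OF this] show "(%n. of_int (fps_nth (Abs_fps (%n. fps_nth F (2 * n))) n) * q ^ n) sums g q"
   by (simp add: g_def)
 qed
 moreover have "g (q^2) = f q" for q
 proof -
  have "csqrt (q^2) = q | csqrt (q^2) = - q" using power2_csqrt[of "q\<^sup>2"] power2_eq_iff by blast
  thus ?thesis using even by (auto simp: g_def)
 qed
 ultimately show ?thesis by blast
qed

text \<open>th1 and th2 are prefactors times one integral series in ee (z / 2), evaluated at
  opposite arguments; their product is even, hence a series in ee z. The eighth power of the
  prefactors is ee (z + 1/2) = - ee z.\<close>

theorem X8_q_expansion:
 "EX f F. fps_nth F 0 = 1 & qint f F & (ALL z. Im z > 0 --> X8 z = - ee z * f (ee z)) & (ALL q. norm q < 1 --> f q ~= 0)"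
proof -
 have sq: "nat (abs n) <= nat (n^2)" for n :: int
  by (metis abs_ge_zero nat_mono abs_le_square_iff abs_of_nonneg int_one_le_iff_zero_less mult_cancel_left1 mult_le_cancel_left power2_eq_square zero_le_power2 abs_mult_self_eq not_less order_refl)
 have sq2: "nat (abs n) <= nat (2 * n^2 + n)" for n :: int
 proof -
  have "int (nat (abs n)) <= int (nat (n^2))" using sq[of n] by (simp only: of_nat_le_iff)
  hence "(abs n) <= n^2" by simp
  thus ?thesis by (intro nat_mono) linarith
 qed
 have q0: "nat (2 * n^2 + n) = 0 \<longleftrightarrow> n = 0" for n :: int using sq2[of n] by auto
 obtain A where A: "fps_nth A 0 = 1" "qint (%q. \<Sum>\<^sub>\<infinity>n::int. of_int (if even n then 1 else -1) * q ^ nat (n^2)) A"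
 proof -
  have "EX F. fps_nth F 0 = 1 & qint (%q. \<Sum>\<^sub>\<infinity>n::int. of_int (if even n then 1 else -1) * q ^ nat (n^2)) F"
   by (rule qint_int_series[OF sq]) auto
  thus ?thesis using that by blast
 qed
 obtain B where B: "fps_nth B 0 = 1" "qint (%q. \<Sum>\<^sub>\<infinity>n::int. of_int 1 * q ^ nat (2 * n^2 + n)) B"
  using qint_int_series[of "%n. nat (2 * n^2 + n)" "%n. 1"] sq2 q0 by auto
 define a where "a = (%q::complex. \<Sum>\<^sub>\<infinity>n::int. of_int (if even n then 1 else -1) * q ^ nat (n^2))"
 define b where "b = (%q::complex. \<Sum>\<^sub>\<infinity>n::int. of_int 1 * q ^ nat (2 * n^2 + n))"
 have BB: "qint (%q. b q * b (- q)) (B * Abs_fps (%n. (-1) ^ n * fps_nth B n))"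
  using B(2) unfolding b_def[symmetric] by (intro qint_mult qint_uminus_arg)
 obtain g where g: "qint g (Abs_fps (%n. fps_nth (B * Abs_fps (%n. (-1) ^ n * fps_nth B n)) (2 * n)))"
   "!!q. norm q < 1 ==> g (q^2) = b q * b (- q)"
  using qint_even[OF BB] by (auto simp: mult.commute)
 define F where "F = (A * Abs_fps (%n. fps_nth (B * Abs_fps (%n. (-1) ^ n * fps_nth B n)) (2 * n))) ^ 8"
 define f where "f = (%q. (a q * g q) ^ 8)"
 have fF: "qint f F" unfolding f_def F_def using A(2) g(1) unfolding a_def[symmetric] by (intro qint_power qint_mult)
 have F0: "fps_nth F 0 = 1" by (simp add: F_def A B fps_power_zeroth)
 have X: "X8 z = - ee z * f (ee z)" if z: "Im z > 0" for z
 proof -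
  have half: "ee (of_int n / 2) = of_int (if even n then 1 else -1)" for n
  proof (cases "even n")
   case True
   then obtain k where "n = 2 * k" by (elim evenE)
   thus ?thesis by simp
  next
   case False
   then obtain k where "n = 2 * k + 1" by (elim oddE)
   thus ?thesis by (simp add: add_divide_distrib ee_add ee_half)
  qed
  have a: "th0 z = a (ee z)"
   unfolding th0_def gtheta_def a_def
  proof (intro infsum_cong)
   fix n :: int
   have "ee ((of_int n)^2 * z + of_int n * (1/2)) = ee (of_int n / 2) * ee (of_nat (nat (n^2)) * z)"
    unfolding ee_add[symmetric] by (rule arg_cong[where f = ee]) simp
   thus "ee ((of_int n)^2 * z + of_int n * (1/2)) = of_int (if even n then 1 else -1) * ee z ^ nat (n^2)"
    unfolding half ee_power .
  qed
  let ?y = "ee (z / 2)"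
  have y: "?y\<^sup>2 = ee z" by (simp add: ee_power)
  have ny: "norm ?y < 1" using norm_ee_lt_1[of "z / 2"] z by simp
  have nn: "2 * n^2 + n >= 0" for n :: int
  proof -
   have "0 <= n * (2 * n + 1)" by (cases "n >= 0") (auto simp: zero_le_mult_iff)
   thus ?thesis by (simp add: power2_eq_square algebra_simps)
  qed
  have e2: "of_nat (nat (2 * n^2 + n)) = (2 * (of_int n)^2 + of_int n :: complex)" for n :: int
   using of_nat_nat[OF nn[of n], where 'a = complex] by simp
  have b1: "gtheta z (z / 2) = b ?y"
   unfolding gtheta_def b_def
  proof (intro infsum_cong)
   fix n :: int
   show "ee ((of_int n)^2 * z + of_int n * (z / 2)) = of_int 1 * ?y ^ nat (2 * n^2 + n)"
    unfolding ee_power e2 by (simp add: field_simps)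
  qed
  have b2: "gtheta z (z / 2 + 1/2) = b (- ?y)"
   unfolding gtheta_def b_def
  proof (intro infsum_cong)
   fix n :: int
   have "- ?y = ee (z / 2 + 1 / 2)" by (simp add: ee_add ee_half)
   hence "(- ?y) ^ nat (2 * n^2 + n) = ee ((2 * (of_int n)^2 + of_int n) * (z / 2 + 1 / 2))" by (simp only: ee_power e2)
   also have "... = ee ((of_int n)^2 * z + of_int n * (z / 2 + 1 / 2))"
    by (rule ee_eqI[where n = "n\<^sup>2"]) (simp add: field_simps)
   finally show "ee ((of_int n)^2 * z + of_int n * (z / 2 + 1 / 2)) = of_int 1 * (- ?y) ^ nat (2 * n^2 + n)" by simp
  qed
  have "th0 z * th1 z * th2 z = ee (z / 16) * ee ((z + 1) / 16) * (a (ee z) * (b ?y * b (- ?y)))"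
   by (simp add: a th1_def th2_def b1 b2)
  also have "b ?y * b (- ?y) = g (ee z)" using g(2)[OF ny] y by simp
  finally have "X8 z = (ee (z / 16) * ee ((z + 1) / 16)) ^ 8 * f (ee z)"
   unfolding X8_def f_def by (simp only: power_mult_distrib)
  also have "(ee (z / 16) * ee ((z + 1) / 16)) ^ 8 = ee (z + 1/2)"
   unfolding ee_add[symmetric] ee_power by (rule arg_cong[where f = ee]) (simp add: field_simps)
  finally show ?thesis by (simp add: ee_add ee_half)
 qed
 have nz: "f q ~= 0" if q: "norm q < 1" for q
 proof (cases "q = 0")
  case True
  have "(%n. of_int (fps_nth F n) * (0 :: complex) ^ n) sums f 0"
   using fF unfolding qint_def by (metis norm_zero zero_less_one)
  moreover have "(%n. of_int (fps_nth F n) * (0 :: complex) ^ n) sums of_int (fps_nth F 0)"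
   using powser_sums_zero[of "%n. of_int (fps_nth F n)"] by simp
  ultimately have "f 0 = of_int (fps_nth F 0)" using sums_unique2 by blast
  thus ?thesis using True F0 by simp
 next
  case False
  obtain z where z: "ee z = q" using ee_surj[OF False] by blast
  have "Im z > 0" using q unfolding z[symmetric] norm_ee by (simp add: zero_less_mult_iff)
  thus ?thesis using X[of z] X8_nonzero[of z] z by auto
 qed
 show ?thesis using F0 fF X nz by blast
qed

section \<open>Congruences modulo powers of l\<close>

lemma freshman_dvd:
 fixes A B :: "'a :: comm_ring_1"
 assumes l: "prime l"
 shows "of_nat l dvd (A + B) ^ l - A ^ l - B ^ l"
proof -
 have "(A + B) ^ l = (\<Sum>k\<le>l. of_nat (l choose k) * A ^ k * B ^ (l - k))" by (rule binomial_ring)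
 also have "{..l} = insert 0 (insert l {1..<l})" using prime_gt_0_nat[OF l] by auto
 also have "(\<Sum>k\<in>insert 0 (insert l {1..<l}). of_nat (l choose k) * A ^ k * B ^ (l - k)) =
  B ^ l + (A ^ l + (\<Sum>k\<in>{1..<l}. of_nat (l choose k) * A ^ k * B ^ (l - k)))"
  using prime_gt_0_nat[OF l] by (subst sum.insert, simp, simp, subst sum.insert) auto
 finally have "(A + B) ^ l - A ^ l - B ^ l = (\<Sum>k\<in>{1..<l}. of_nat (l choose k) * A ^ k * B ^ (l - k))" by simp
 moreover have "of_nat l dvd (of_nat (l choose k) * A ^ k * B ^ (l - k) :: 'a)" if "k \<in> {1..<l}" for k
 proof -
  have "l dvd (l choose k)" using that by (intro dvd_choose_prime) (use l in auto)
  hence "(of_nat l :: 'a) dvd of_nat (l choose k)" by (auto elim!: dvdE)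
  thus ?thesis by (intro dvd_mult2)
 qed
 ultimately show ?thesis by (simp only: dvd_sum)
qed

lemma fermat_int: "prime l ==> int l dvd (a :: int) ^ l - a"
proof (induction a rule: int_induct[where k = 0])
 case base
 thus ?case using prime_gt_0_nat by (simp add: zero_power)
next
 case (step1 i)
 have "int l dvd ((i + 1) ^ l - i ^ l - 1 ^ l) + (i ^ l - i)"
  using freshman_dvd[OF step1(3), of i 1] step1(2)[OF step1(3)] by (intro dvd_add) auto
 also have "((i + 1) ^ l - i ^ l - 1 ^ l) + (i ^ l - i) = (i + 1) ^ l - (i + 1)" by simp
 finally show ?case .
next
 case (step2 i)
 have "int l dvd (i ^ l - i) - ((i - 1 + 1) ^ l - (i - 1) ^ l - 1 ^ l)"
  using freshman_dvd[OF step2(3), of "i - 1" 1] step2(2)[OF step2(3)] by (rule dvd_diff[rotated])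
 also have "(i ^ l - i) - ((i - 1 + 1) ^ l - (i - 1) ^ l - 1 ^ l) = (i - 1) ^ l - (i - 1)" by simp
 finally show ?case .
qed

lemma fps_of_nat_dvd_iff: "(of_nat k :: int fps) dvd F \<longleftrightarrow> (ALL n. int k dvd fps_nth F n)"
proof
 assume "of_nat k dvd F"
 then obtain G where "F = of_nat k * G" by (elim dvdE)
 thus "ALL n. int k dvd fps_nth F n" by (simp add: fps_of_nat[symmetric])
next
 assume a: "ALL n. int k dvd fps_nth F n"
 have "F = of_nat k * Abs_fps (%n. fps_nth F n div int k)"
  by (rule fps_ext) (use a in \<open>simp add: fps_of_nat[symmetric]\<close>)
 thus "of_nat k dvd F" by (metis dvd_triv_left)
qed

text \<open>For polynomials this is an induction on the number of terms, by the freshman's dream and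
  Fermat's theorem. A single coefficient of a power only sees a truncation, so the congruence passes
  to power series.\<close>

lemma fps_frobenius:
 fixes F :: "int fps"
 assumes l: "prime l"
 shows "of_nat l dvd F ^ l - fps_spread l F"
proof -
 have l0: "l > 0" using l prime_gt_0_nat by blast
 define T where "T = (%n. \<Sum>i<n. fps_const (fps_nth F i) * fps_X ^ i)"
 define S where "S = (%n. \<Sum>i<n. fps_const (fps_nth F i) * fps_X ^ (i * l))"
 have TS: "of_nat l dvd T n ^ l - S n" for n
 proof (induction n)
  case 0
  thus ?case using l0 by (simp add: T_def S_def zero_power)
 next
  case (Suc n)
  let ?m = "fps_const (fps_nth F n) * fps_X ^ n"
  have m: "?m ^ l = fps_const (fps_nth F n ^ l) * fps_X ^ (n * l)"
   by (simp add: power_mult_distrib fps_const_power power_mult)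
  have "of_nat l dvd fps_const (fps_nth F n ^ l - fps_nth F n)"
   unfolding fps_of_nat_dvd_iff using fermat_int[OF l, of "fps_nth F n"] by simp
  hence "of_nat l dvd fps_const (fps_nth F n ^ l - fps_nth F n) * fps_X ^ (n * l)" by (rule dvd_mult2)
  moreover have "of_nat l dvd (T n + ?m) ^ l - T n ^ l - ?m ^ l" by (rule freshman_dvd[OF l])
  ultimately have "of_nat l dvd ((T n + ?m) ^ l - T n ^ l - ?m ^ l) + (T n ^ l - S n) + fps_const (fps_nth F n ^ l - fps_nth F n) * fps_X ^ (n * l)"
   using Suc by (intro dvd_add)
  also have "... = T (Suc n) ^ l - S (Suc n)"
   unfolding m by (simp add: T_def S_def algebra_simps flip: fps_const_sub)
  finally show ?case .
 qed
 have "int l dvd fps_nth (F ^ l - fps_spread l F) k" for k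
 proof -
  define n where "n = Suc k"
  have Tn: "fps_nth (T n) i = (if i < n then fps_nth F i else 0)" for i
   by (simp add: T_def fps_sum_nth sum.delta if_distrib[of "%x. _ * x"] cong: if_cong)
  have "fps_X ^ n dvd F - T n"
  proof -
   have "F - T n = fps_X ^ n * Abs_fps (%i. fps_nth F (i + n))"
    by (rule fps_ext) (auto simp: Tn fps_X_power_mult_nth not_less)
   thus ?thesis by (metis dvd_triv_left)
  qed
  also have "F - T n dvd F ^ l - T n ^ l" by (metis dvd_triv_left power_diff_sumr2)
  finally obtain R where R: "F ^ l - T n ^ l = fps_X ^ n * R" by (elim dvdE)
  have "fps_nth (fps_X ^ n * R) k = 0" by (simp only: fps_X_power_mult_nth) (simp add: n_def)
  hence "fps_nth (F ^ l - T n ^ l) k = 0" unfolding R .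
  hence 1: "fps_nth (F ^ l) k = fps_nth (T n ^ l) k" by simp
  have 2: "fps_nth (S n) k = fps_nth (fps_spread l F) k"
  proof (cases "l dvd k")
   case True
   then obtain j where j: "k = l * j" by (elim dvdE)
   have jn: "j < n" using l0 by (cases l) (auto simp: n_def j)
   have "fps_nth (S n) k = (\<Sum>i<n. fps_nth F i * (if k = i * l then 1 else 0))" by (simp add: S_def fps_sum_nth)
   also have "... = (\<Sum>i<n. if i = j then fps_nth F i else 0)" using l0 by (intro sum.cong refl) (auto simp: j)
   also have "... = fps_nth F j" using jn by (simp add: sum.delta)
   finally show ?thesis using l0 by (simp add: fps_spread_def j)
  next
   case False
   have "fps_nth (S n) k = (\<Sum>i<n. fps_nth F i * (if k = i * l then 1 else 0))" by (simp add: S_def fps_sum_nth)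
   also have "... = (\<Sum>i<n. 0)" using False by (intro sum.cong refl) auto
   finally show ?thesis using False by (simp add: fps_spread_def)
  qed
  have "int l dvd fps_nth (T n ^ l - S n) k" using TS fps_of_nat_dvd_iff by blast
  thus ?thesis using 1 2 by simp
 qed
 thus ?thesis using fps_of_nat_dvd_iff by blast
qed

lemma fps_spread_spread: "k > 0 ==> fps_spread k (fps_spread l F) = fps_spread (l * k) F"
proof (rule fps_ext)
 fix n assume k: "k > 0"
 have "(k dvd n & l dvd n div k) \<longleftrightarrow> l * k dvd n"
 proof (cases "k dvd n")
  case True
  thus ?thesis using dvd_div_iff_mult[of k n l] k by blast
 next
  case False
  thus ?thesis using dvd_mult_right by blast
 qed
 moreover have "n div k div l = n div (l * k)" by (simp add: div_mult2_eq[symmetric] mult.commute)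
 ultimately show "fps_nth (fps_spread k (fps_spread l F)) n = fps_nth (fps_spread (l * k) F) n"
  by (auto simp: fps_spread_def)
qed

lemma fps_frobenius_power:
 fixes F :: "int fps"
 assumes l: "prime l"
 shows "of_nat l dvd F ^ (l ^ k) - fps_spread (l ^ k) F"
proof (induction k)
 case 0
 have "fps_spread 1 F = F" by (rule fps_ext) (simp add: fps_spread_def)
 thus ?case by simp
next
 case (Suc k)
 have "F ^ (l ^ k) - fps_spread (l ^ k) F dvd (F ^ (l ^ k)) ^ l - (fps_spread (l ^ k) F) ^ l"
  by (metis dvd_triv_left power_diff_sumr2)
 hence "of_nat l dvd (F ^ (l ^ k)) ^ l - (fps_spread (l ^ k) F) ^ l" using Suc dvd_trans by blast
 hence "of_nat l dvd ((F ^ (l ^ k)) ^ l - (fps_spread (l ^ k) F) ^ l) + ((fps_spread (l ^ k) F) ^ l - fps_spread l (fps_spread (l ^ k) F))"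
  using fps_frobenius[OF l] by (intro dvd_add)
 thus ?case using prime_gt_0_nat[OF l] by (simp add: fps_spread_spread power_mult[symmetric] mult.commute)
qed

text \<open>Each l-th power gains a factor l: in W^l - 1 = (W - 1) (1 + W + ... + W^(l-1)) the
  second factor is congruent to l, hence to 0, modulo l.\<close>

lemma power_prime_power_cong_1:
 fixes Z :: "'a :: comm_ring_1"
 assumes "of_nat l dvd Z - 1"
 shows "of_nat (l ^ Suc k) dvd Z ^ (l ^ k) - 1"
proof (induction k)
 case (Suc k)
 define W where "W = Z ^ (l ^ k)"
 have W: "of_nat (l ^ Suc k) dvd W - 1" using Suc by (simp only: W_def)
 have "of_nat l dvd W - 1" using W by (metis dvd_mult_left of_nat_mult power_Suc)
 hence i: "of_nat l dvd W ^ i - 1" for i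
  by (metis dvd_trans dvd_triv_left power_diff_1_eq)
 have "of_nat l dvd (\<Sum>i<l. W ^ i - 1) + of_nat l" using i by (intro dvd_add dvd_sum) auto
 also have "(\<Sum>i<l. W ^ i - 1) + of_nat l = (\<Sum>i<l. W ^ i)" by (simp add: sum_subtractf)
 finally have "of_nat (l ^ Suc k) * of_nat l dvd (W - 1) * (\<Sum>i<l. W ^ i)" using W by (rule mult_dvd_mono[rotated])
 also have "(W - 1) * (\<Sum>i<l. W ^ i) = W ^ l - 1" by (simp add: power_diff_1_eq)
 also have "W ^ l = Z ^ (l ^ Suc k)" by (simp add: W_def power_mult[symmetric] mult.commute)
 finally show ?case by (simp only: power_Suc of_nat_mult mult_ac)
qed (use assms in simp)

text \<open>Frobenius makes F^L divided by F(q^L) congruent to 1 modulo l, and the power l^k raises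
  the modulus to l^(k+1). Odd L makes the signs in X8 = - q f cancel, just as the powers of q
  do.\<close>

theorem X8_quotient_expansion:
 assumes l: "prime l" "odd l"
 shows "EX f F. qint f F & of_nat (l ^ Suc k) dvd F - 1 &
  (ALL z. Im z > 0 --> f (ee z) = (X8 z ^ (l ^ M) / X8 (of_nat (l ^ M) * z)) ^ (l ^ k))"
proof -
 obtain f F where f: "fps_nth F 0 = 1" "qint f F" "!!z. Im z > 0 ==> X8 z = - ee z * f (ee z)" "!!q. norm q < 1 ==> f q ~= 0"
  using X8_q_expansion by blast
 let ?L = "l ^ M"
 have L0: "?L > 0" using prime_gt_0_nat[OF l(1)] by simp
 have sp: "qint (%q. f (q ^ ?L)) (fps_spread ?L F)" by (rule qint_spread[OF f(2) L0])
 have "norm (q ^ ?L) < 1" if "norm q < 1" for q :: complex using that L0 by (simp add: norm_power power_less_one_iff)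
 hence nz: "f (q ^ ?L) ~= 0" if "norm q < 1" for q using f(4) that by blast
 obtain C where C: "fps_spread ?L F * C = 1" "qint (%q. inverse (f (q ^ ?L))) C"
  using qint_inverse[OF sp _ nz] f(1) by (auto simp: fps_spread_def)
 define G where "G = (F ^ ?L * C) ^ (l ^ k)"
 have G: "qint (%q. (f q ^ ?L * inverse (f (q ^ ?L))) ^ (l ^ k)) G"
  unfolding G_def by (intro qint_power qint_mult f(2) C(2))
 have "(F ^ ?L - fps_spread ?L F) * C = F ^ ?L * C - 1" using C(1) by (simp add: algebra_simps)
 hence "of_nat l dvd F ^ ?L * C - 1" using fps_frobenius_power[OF l(1), of F M] by (metis dvd_mult2)
 hence "of_nat (l ^ Suc k) dvd G - 1" unfolding G_def by (rule power_prime_power_cong_1)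
 moreover have "(f (ee z) ^ ?L * inverse (f (ee z ^ ?L))) ^ (l ^ k) = (X8 z ^ ?L / X8 (of_nat ?L * z)) ^ (l ^ k)" if z: "Im z > 0" for z
 proof -
  have "Im (of_nat n * z) > 0" if "n > 0" for n :: nat using that z by simp
  hence Lz: "Im (of_nat ?L * z) > 0" using L0 by blast
  have e: "ee (of_nat ?L * z) = ee z ^ ?L" by (simp only: ee_power)
  have "X8 z ^ ?L = - (ee z ^ ?L) * f (ee z) ^ ?L" unfolding f(3)[OF z] using l(2) by (simp add: power_mult_distrib)
  moreover have "X8 (of_nat ?L * z) = - (ee z ^ ?L) * f (ee z ^ ?L)" unfolding f(3)[OF Lz] e ..
  moreover have "(- Q * A) / (- Q * B) = A * inverse B" if "Q ~= 0" for Q A B :: complex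
   using that by (metis divide_inverse mult_divide_mult_cancel_left neg_equal_0_iff_equal)
  moreover have "ee z ^ ?L ~= 0" by simp
  ultimately show ?thesis by metis
 qed
 ultimately show ?thesis using G by blast
qed

lemma has_sum_qint:
 assumes "!!z. Im z > 0 ==> ((%n. of_int (p n) * ee z ^ n) has_sum g z) UNIV"
 shows "EX f. qint f (Abs_fps p) & (ALL z. Im z > 0 --> f (ee z) = g z)"
proof -
 define f where "f = (%q. \<Sum>n. of_int (p n) * q ^ n :: complex)"
 have s: "(%n. of_int (p n) * ee z ^ n) sums g z" if "Im z > 0" for z
  using assms[OF that] by (rule has_sum_imp_sums)
 have "(%n. of_int (p n) * q ^ n) sums f q" if q: "norm q < 1" for q
 proof (cases "q = 0")
  case True
  thus ?thesis using powser_sums_zero[of "%n. of_int (p n)"] by (simp add: f_def sums_iff)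
 next
  case False
  obtain z where z: "ee z = q" using ee_surj[OF False] by blast
  have "Im z > 0" using q unfolding z[symmetric] norm_ee by (simp add: zero_less_mult_iff)
  from s[OF this] show ?thesis unfolding z f_def by (rule sums_summable[THEN summable_sums])
 qed
 moreover have "f (ee z) = g z" if "Im z > 0" for z using s[OF that] by (simp add: f_def sums_iff)
 ultimately show ?thesis unfolding qint_def by (intro exI[of _ f]) simp
qed

section \<open>Limits at infinity\<close>

definition hinf :: "complex filter" where "hinf = filtercomap Im at_top"

lemma filterlim_Im_hinf: "filterlim Im at_top hinf"
 unfolding hinf_def by (rule filterlim_filtercomap)

lemma eventually_hinf: "eventually P hinf \<longleftrightarrow> (EX Y. ALL z. Im z >= Y --> P z)"
 unfolding hinf_def by (auto simp: eventually_filtercomap_at_top_linorder)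

lemma filterlim_same_Im: "(!!z. Im (f z) = Im z) ==> filterlim f hinf hinf"
 unfolding filterlim_iff eventually_hinf by metis

text \<open>The rate is dictated by 1 / th1, which grows like |ee (- z / 16)| = exp (pi Im z / 8):
  an error of this kind still tends to 0 after multiplication by that growth.\<close>

definition esmall :: "(complex => complex) => bool" where
 "esmall h \<longleftrightarrow> ((%z. of_real (exp (pi * Im z / 8)) * h z) ---> 0) hinf"

lemma esmall_tendsto:
 assumes "esmall h" shows "(h ---> 0) hinf"
proof (rule Lim_null_comparison)
 have "((%z. norm (of_real (exp (pi * Im z / 8)) * h z)) ---> 0) hinf"
  using assms unfolding esmall_def by (rule tendsto_norm_zero)
 thus "((%z. exp (pi * Im z / 8) * norm (h z)) ---> 0) hinf" by (simp add: norm_mult)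
 show "eventually (%z. norm (h z) <= exp (pi * Im z / 8) * norm (h z)) hinf"
  unfolding eventually_hinf
 proof (intro exI[of _ 0] allI impI)
  fix z :: complex assume "Im z >= 0"
  hence "1 <= exp (pi * Im z / 8)" by simp
  thus "norm (h z) <= exp (pi * Im z / 8) * norm (h z)" using mult_right_mono[of 1 "exp (pi * Im z / 8)" "norm (h z)"] by simp
 qed
qed

lemma esmall_diff:
 assumes "esmall f" "esmall g" shows "esmall (%z. f z - g z)"
 using tendsto_diff[OF assms[unfolded esmall_def]] unfolding esmall_def right_diff_distrib by (simp only: diff_zero)

lemma esmall_mult_tendsto:
 assumes "esmall f" "(g ---> c) hinf" shows "esmall (%z. f z * g z)"
 using tendsto_mult[OF assms(1)[unfolded esmall_def] assms(2)] unfolding esmall_def mult.assoc by (simp only: mult_zero_left)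

lemma esmall_quotient:
 assumes f: "esmall (%z. f z - C)" and g: "esmall (%z. g z - 1)"
 shows "esmall (%z. f z / g z - C)"
proof -
 have g1: "(g ---> 1) hinf" using esmall_tendsto[OF g] by (simp add: LIM_zero_iff)
 have "((%z. 1 / g z) ---> 1 / 1) hinf" by (intro tendsto_intros g1) simp
 hence "esmall (%z. ((f z - C) - (g z - 1) * C) * (1 / g z))"
  by (intro esmall_mult_tendsto[OF esmall_diff[OF f esmall_mult_tendsto[OF g tendsto_const]]])
 moreover have "eventually (%z. g z ~= 0) hinf" using tendsto_imp_eventually_ne[OF g1] by simp
 hence "eventually (%z. of_real (exp (pi * Im z / 8)) * (((f z - C) - (g z - 1) * C) * (1 / g z)) = of_real (exp (pi * Im z / 8)) * (f z / g z - C)) hinf"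
 proof eventually_elim
  case (elim z)
  have gen: "((x - C) - (y - 1) * C) * (1 / y) = x / y - C" if "y ~= 0" for x y :: complex
   using that by (simp add: field_simps)
  show ?case unfolding gen[OF elim] ..
 qed
 ultimately show ?thesis unfolding esmall_def by (rule iffD1[OF tendsto_cong, rotated])
qed

text \<open>All terms except n = 0 are together of order exp (- pi Im z), which leaves exp (- 7 pi
  Im z / 8) after the weight.\<close>

lemma esmall_tail:
 fixes f :: "complex => int => complex"
 assumes b: "!!z n. Im z >= 1 ==> n ~= 0 ==> norm (f z n) <= c * exp (- (pi * Im z)) ^ nat (abs n)" and c: "c >= 0"
  and f0: "!!z. f z 0 = C"
 shows "esmall (%z. infsum (f z) UNIV - C)"
 unfolding esmall_def
proof (rule Lim_null_comparison)
 show "eventually (%z. norm (of_real (exp (pi * Im z / 8)) * (infsum (f z) UNIV - C)) <= 2 * c * int_tail * exp (- (7 * pi / 8) * Im z)) hinf"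
  unfolding eventually_hinf
 proof (intro exI[of _ 1] allI impI)
  fix z :: complex assume z: "Im z >= 1"
  have "2 <= 1 + pi" using pi_gt3 by simp
  also have "... <= exp pi" by (rule exp_ge_add_one_self)
  also have "... <= exp (pi * Im z)" using z by simp
  finally have r: "exp (- (pi * Im z)) <= 1/2" by (simp add: exp_minus field_simps)
  have "norm (infsum (f z) UNIV - f z 0) <= 2 * c * exp (- (pi * Im z)) * int_tail"
   by (rule infsum_tail_bound(2)[OF b[OF z] _ r c]) auto
  hence "norm (of_real (exp (pi * Im z / 8)) * (infsum (f z) UNIV - C)) <= exp (pi * Im z / 8) * (2 * c * exp (- (pi * Im z)) * int_tail)"
   unfolding f0 norm_mult by (simp add: mult_left_mono)
  also have "... = 2 * c * int_tail * (exp (pi * Im z / 8) * exp (- (pi * Im z)))" by (simp only: mult_ac)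
  also have "exp (pi * Im z / 8) * exp (- (pi * Im z)) = exp (- (7 * pi / 8) * Im z)"
   unfolding exp_add[symmetric] by (rule arg_cong[where f = exp]) (simp add: field_simps)
  finally show "norm (of_real (exp (pi * Im z / 8)) * (infsum (f z) UNIV - C)) <= 2 * c * int_tail * exp (- (7 * pi / 8) * Im z)" .
 qed
 have "((%y::real. 2 * c * int_tail * exp (- (7 * pi / 8) * y)) ---> 0) at_top" by real_asymp
 from filterlim_compose[OF this filterlim_Im_hinf]
 show "((%z. 2 * c * int_tail * exp (- (7 * pi / 8) * Im z)) ---> 0) hinf" .
qed

lemma norm_appc:
 assumes y: "Im z >= 0"
 shows "norm (appc e z n) <= exp (- (pi * Im z)) ^ nat (abs n)"
proof -
 have nn: "(abs n) <= n^2"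
 proof (cases "n = 0")
  case False
  hence "1 <= (abs n)" by simp
  hence "(abs n) * 1 <= (abs n) * (abs n)" by (rule mult_left_mono) simp
  thus ?thesis by (simp add: power2_eq_square)
 qed simp
 have rn: "(abs (real_of_int n)) <= (real_of_int n)^2"
  using nn by (metis of_int_abs of_int_le_iff of_int_power)
 have "exp (- (pi * Im z)) ^ nat (abs n) = exp (- (pi * Im z * (abs (real_of_int n))))"
  by (simp add: exp_of_nat_mult[symmetric] mult_ac)
 moreover have "pi * Im z * (abs (real_of_int n)) <= 2 * pi * Im ((of_int n)^2 * z + of_int n * (if e then z / 2 else 1 / 2))"
 proof (cases e)
  case True
  have i: "Im ((of_int n)^2 * z + of_int n * (z / 2)) = (real_of_int n)^2 * Im z + real_of_int n * Im z / 2"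
   by (simp add: power2_eq_square)
  have "(abs (real_of_int n)) <= 2 * (real_of_int n)^2 + real_of_int n" using rn by linarith
  hence "(pi * Im z) * (abs (real_of_int n)) <= (pi * Im z) * (2 * (real_of_int n)^2 + real_of_int n)" using y by (intro mult_left_mono) auto
  thus ?thesis using True by (simp only: if_True i) (simp add: algebra_simps)
 next
  case False
  have i: "Im ((of_int n)^2 * z + of_int n * (1 / 2)) = (real_of_int n)^2 * Im z" by (simp add: power2_eq_square)
  have "(abs (real_of_int n)) <= 2 * (real_of_int n)^2" using rn by linarith
  hence "(pi * Im z) * (abs (real_of_int n)) <= (pi * Im z) * (2 * (real_of_int n)^2)" using y by (intro mult_left_mono) auto
  thus ?thesis using False by (simp only: if_False i) (simp add: algebra_simps)
 qed
 ultimately show ?thesis unfolding appc_def norm_ee by simp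
qed

definition thg :: "bool => complex => complex" where "thg e z = infsum (appc e z) UNIV"

lemma thc_thg: "thc e z = (if e then ee (z / 16) else 1) * thg e z"
 by (simp add: thc_def thg_def th0_def th1_def gtheta_def appc_def[abs_def])

lemma thg_esmall: "esmall (%z. thg e z - 1)"
 unfolding thg_def by (rule esmall_tail[where c = 1]) (use norm_appc in \<open>auto simp: appc_def\<close>)

lemma lambert_esmall:
 assumes w: "norm w = 1"
 shows "esmall (%z. lambert (appc e z) z w - 1 / (1 - w))"
 unfolding lambert_def
proof (rule esmall_tail[where c = 2])
 fix z :: complex and n :: int assume z: "Im z >= 1" and n: "n ~= 0"
 have "1/2 <= norm (1 - w * ee (of_int n * z))"
 proof -
  have nw: "norm (w * ee (of_int n * z)) = exp (- (2 * pi * (of_int n * Im z)))" by (simp add: norm_mult w norm_ee)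
  have "(1::real) <= of_int (abs n)" using n by simp
  hence "1 * 1 <= of_int (abs n) * Im z" using z by (intro mult_mono) auto
  hence "2 * pi * 1 <= 2 * pi * (of_int (abs n) * Im z)" by (intro mult_left_mono) auto
  hence pn: "1 <= 2 * pi * (of_int (abs n) * Im z)" using pi_gt3 by linarith
  have E: "2 <= exp (2 * pi * (of_int (abs n) * Im z))"
   using exp_ge_add_one_self[of "2 * pi * (of_int (abs n) * Im z)"] pn by linarith
  show ?thesis
  proof (cases "n > 0")
   case True
   hence "norm (w * ee (of_int n * z)) <= 1/2" using E unfolding nw by (simp add: exp_minus field_simps)
   thus ?thesis using norm_triangle_ineq2[of 1 "w * ee (of_int n * z)"] by simp
  next
   case False
   hence "2 <= norm (w * ee (of_int n * z))" using E n unfolding nw by simp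
   thus ?thesis using norm_triangle_ineq3[of 1 "w * ee (of_int n * z)"] by simp
  qed
 qed
 hence "norm (appc e z n) / norm (1 - w * ee (of_int n * z)) <= exp (- (pi * Im z)) ^ nat (abs n) / (1/2)"
  using norm_appc[of z e n] z by (intro frac_le) auto
 thus "norm (appc e z n / (1 - w * ee (of_int n * z))) <= 2 * exp (- (pi * Im z)) ^ nat (abs n)" by (simp add: norm_divide)
qed (auto simp: appc_def)

text \<open>The shifts of the leading term carry the class -1 = -(1^2) for odd c and the class 0 for
  even c. Neither is selected, so only the remainder with F - C contributes.\<close>

lemma sieve_limit:
 assumes l: "l > 0" and F: "esmall (%z. F z - C)"
 shows "((%z. \<Sum>v\<in>{0..<int l}. sieve_coeff l v * (ee (if e then - (sshift l z v) / 16 else 0) * F (sshift l z v))) ---> 0) hinf"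
proof -
 let ?E = "%z. ee (if e then - z / 16 else 0)"
 have Z: "(\<Sum>v\<in>{0..<int l}. sieve_coeff l v * ?E (sshift l z v)) = 0" for z
 proof (cases e)
  case True
  have s: "ee (- (sshift l z v) / 16) = ee (of_int (v * (- (1^2))) / of_nat l) * ee (- z / 16)" for v
   unfolding ee_add[symmetric] sshift_def using l by (intro arg_cong[where f = ee]) (simp add: field_simps)
  show ?thesis unfolding if_P[OF True] s mult.assoc[symmetric] sum_distrib_right[symmetric] sieve_indicator[OF l]
   by (simp only: not_nonres_neg_square of_bool_eq mult_zero_left)
 next
  case False
  thus ?thesis by (simp add: sum_sieve_coeff[OF l])
 qed
 have lim: "((%z. ?E z * (F z - C)) ---> 0) hinf"
 proof (rule Lim_null_comparison)
  have "((%z. norm (of_real (exp (pi * Im z / 8)) * (F z - C))) ---> 0) hinf"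
   using F unfolding esmall_def by (rule tendsto_norm_zero)
  thus "((%z. exp (pi * Im z / 8) * norm (F z - C)) ---> 0) hinf" by (simp add: norm_mult)
  show "eventually (%z. norm (?E z * (F z - C)) <= exp (pi * Im z / 8) * norm (F z - C)) hinf"
   unfolding eventually_hinf
  proof (intro exI[of _ 0] allI impI)
   fix z :: complex assume "Im z >= 0"
   hence "norm (?E z) <= exp (pi * Im z / 8)" by (simp add: norm_ee)
   thus "norm (?E z * (F z - C)) <= exp (pi * Im z / 8) * norm (F z - C)" unfolding norm_mult by (rule mult_right_mono) simp
  qed
 qed
 have "((%z. ?E (sshift l z v) * (F (sshift l z v) - C)) ---> 0) hinf" for v
  by (rule filterlim_compose[OF lim filterlim_same_Im]) simp
 hence "((%z. \<Sum>v\<in>{0..<int l}. sieve_coeff l v * (?E (sshift l z v) * (F (sshift l z v) - C))) ---> (\<Sum>v\<in>{0..<int l}. sieve_coeff l v * 0)) hinf"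
  by (intro tendsto_sum tendsto_mult tendsto_const)
 moreover have "(\<Sum>v\<in>{0..<int l}. sieve_coeff l v * (?E (sshift l z v) * (F (sshift l z v) - C))) =
  (\<Sum>v\<in>{0..<int l}. sieve_coeff l v * (?E (sshift l z v) * F (sshift l z v)))" for z
 proof -
  have "(\<Sum>v\<in>{0..<int l}. sieve_coeff l v * (?E (sshift l z v) * (F (sshift l z v) - C))) =
  (\<Sum>v\<in>{0..<int l}. sieve_coeff l v * (?E (sshift l z v) * F (sshift l z v))) - (\<Sum>v\<in>{0..<int l}. sieve_coeff l v * ?E (sshift l z v)) * C"
   by (simp only: sum_distrib_right right_diff_distrib sum_subtractf mult.assoc)
  thus ?thesis unfolding Z by simp
 qed
 ultimately show ?thesis by simp
qed

lemma divide_thc: "c / thc e z = c * (ee (if e then - z / 16 else 0) * (1 / thg e z))"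
proof (cases e)
 case True
 have "- z / 16 = - (z / 16)" by simp
 hence "ee (- z / 16) = inverse (ee (z / 16))" by (simp only: ee_minus)
 moreover have "c / (x * y) = c * (inverse x * (1 / y))" for x y :: complex by (simp add: divide_inverse)
 ultimately show ?thesis using True unfolding thc_thg by (simp only: if_True)
next
 case False
 thus ?thesis unfolding thc_thg by (simp only: if_False ee_0 mult_1 times_divide_eq_right mult_1_right)
qed

lemma inverse_thc_limit:
 assumes l: "l > 0"
 shows "((%z. \<Sum>v\<in>{0..<int l}. sieve_coeff l v / thc e (sshift l z v)) ---> 0) hinf"
proof -
 have "esmall (%z. 1 - 1)" by (simp add: esmall_def)
 hence "esmall (%z. 1 / thg e z - 1)" by (rule esmall_quotient[OF _ thg_esmall])
 from sieve_limit[OF l this, of e] show ?thesis unfolding divide_thc .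
qed

lemma sapp_limit:
 assumes l: "l > 0"
 shows "((%z. sapp l e z (of_int j / of_nat t)) ---> 0) hinf"
proof -
 let ?u = "of_int j / of_nat t"
 have "esmall (%z. lambert (appc e z) z (ee ?u) / thg e z - 1 / (1 - ee ?u))"
  by (rule esmall_quotient[OF lambert_esmall thg_esmall]) simp
 hence "esmall (%z. (lambert (appc e z) z (ee ?u) / thg e z - 1 / (1 - ee ?u)) * (if e then ee (?u / 2) else 1))"
  by (rule esmall_mult_tendsto) (rule tendsto_const)
 hence "esmall (%z. lambert (appc e z) z (ee ?u) / thg e z * (if e then ee (?u / 2) else 1) - 1 / (1 - ee ?u) * (if e then ee (?u / 2) else 1))"
  unfolding left_diff_distrib .
 moreover have "appell e z ?u = ee (if e then - z / 16 else 0) * (lambert (appc e z) z (ee ?u) / thg e z * (if e then ee (?u / 2) else 1))" for z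
  unfolding appell_def divide_thc by simp
 ultimately show ?thesis using sieve_limit[OF l, of _ _ e] unfolding sapp_def by (simp only:)
qed

lemma X8_bounds: "eventually (%z. norm (ee z) / 2 <= norm (X8 z) & norm (X8 z) <= 2 * norm (ee z)) hinf"
proof -
 obtain f F where f: "fps_nth F 0 = 1" "qint f F" "!!z. Im z > 0 ==> X8 z = - ee z * f (ee z)"
  using X8_q_expansion by blast
 have "isCont f 0" by (rule isCont_holomorphic[OF qint_holomorphic[OF f(2)]]) auto
 moreover have "f 0 = 1"
 proof -
  have "(%n. of_int (fps_nth F n) * (0 :: complex) ^ n) sums f 0"
   using f(2) unfolding qint_def by (metis norm_zero zero_less_one)
  moreover have "(%n. of_int (fps_nth F n) * (0 :: complex) ^ n) sums of_int (fps_nth F 0)"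
   using powser_sums_zero[of "%n. of_int (fps_nth F n)"] by simp
  ultimately have "f 0 = of_int (fps_nth F 0)" using sums_unique2 by blast
  thus ?thesis by (simp add: f(1))
 qed
 moreover have "(ee ---> 0) hinf"
 proof (rule Lim_null_comparison)
  show "eventually (%z. norm (ee z) <= exp (- 2 * pi * Im z)) hinf" by (simp add: norm_ee)
  have "((%y::real. exp (- 2 * pi * y)) ---> 0) at_top" by real_asymp
  from filterlim_compose[OF this filterlim_Im_hinf] show "((%z. exp (- 2 * pi * Im z)) ---> 0) hinf" .
 qed
 ultimately have "((%z. f (ee z)) ---> 1) hinf" using isCont_tendsto_compose by metis
 hence "((%z. norm (f (ee z))) ---> 1) hinf" using tendsto_norm by fastforce
 from order_tendstoD(1)[OF this, of "1/2"] order_tendstoD(2)[OF this, of 2]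
 have "eventually (%z. norm (f (ee z)) > 1/2) hinf" "eventually (%z. norm (f (ee z)) < 2) hinf" by auto
 moreover have "eventually (%z. Im z > 0) hinf" unfolding eventually_hinf by (intro exI[of _ 1]) auto
 ultimately show ?thesis
 proof eventually_elim
  case (elim z)
  have "norm (X8 z) = norm (ee z) * norm (f (ee z))" using f(3)[OF elim(3)] by (simp add: norm_mult)
  moreover have "norm (ee z) * (1/2) <= norm (ee z) * norm (f (ee z))" "norm (ee z) * norm (f (ee z)) <= norm (ee z) * 2"
   using elim by (intro mult_left_mono; simp)+
  ultimately show ?case by simp
 qed
qed

section \<open>Growth of the generating functions\<close>

lemma norm_has_sum_le:
 fixes f :: "'a => complex"
 assumes f: "(f has_sum S) A" and g: "(g has_sum T) A" and le: "!!x. x \<in> A ==> norm (f x) <= g x"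
 shows "norm S <= T"
proof -
 have fs: "(%x. norm (f x)) summable_on A" using f summable_on_def summable_on_iff_abs_summable_on_complex by blast
 have "norm S <= infsum (%x. norm (f x)) A" using norm_infsum_bound[OF fs] f by (simp add: infsumI)
 also have "... <= T" by (rule has_sum_mono[OF has_sum_infsum[OF fs] g le])
 finally show ?thesis .
qed

lemma pbar_0: "rankcoeff 1 n = of_nat (if n = 0 then 1 else pbar n)"
 by (simp add: rankcoeff_1 pbar_def rankcoeff_def)

text \<open>The coefficients are dominated by those of 1 / th0, which are non-negative; its value on
  the imaginary axis at the same height bounds the sum of absolute values.\<close>

lemma generating_function_bound:
 fixes p :: "nat => int"
 assumes g: "((%n. of_int (p n) * ee z ^ n) has_sum S) UNIV" and p: "!!n. (abs (p n)) <= int B * int (if n = 0 then 1 else pbar n)" and z: "Im z > 0"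
 shows "norm S <= real B * (1 / norm (th0 (\<i> * Im z)))"
proof -
 let ?s = "\<i> * complex_of_real (Im z)"
 have s: "Im ?s > 0" using z by simp
 have eq: "ee ?s = of_real (norm (ee z))" unfolding norm_ee by (simp add: ee_def exp_of_real[symmetric] mult_ac)
 have "((%n. rankcoeff 1 n * ee ?s ^ n) has_sum ogen (ee ?s) 1) UNIV"
  by (rule rankcoeff_has_sum) (use norm_ee_lt_1[OF s] in auto)
 moreover have o: "ogen (ee ?s) 1 = 1 / th0 ?s"
 proof -
  have "th0 ?s * ogen (ee ?s) 1 = 1" using ogen_lambert(2)[OF s, of 1] by simp
  thus ?thesis using th0_nonzero[OF s] by (simp add: field_simps)
 qed
 moreover have "rankcoeff 1 n * ee ?s ^ n = of_real (real (if n = 0 then 1 else pbar n) * norm (ee z) ^ n)" for n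
  unfolding pbar_0 eq by simp
 ultimately have hs: "((%n. complex_of_real (real (if n = 0 then 1 else pbar n) * norm (ee z) ^ n)) has_sum 1 / th0 ?s) UNIV" by simp
 hence "((%n. Re (complex_of_real (real (if n = 0 then 1 else pbar n) * norm (ee z) ^ n))) has_sum Re (1 / th0 ?s)) UNIV"
  by (rule has_sum_Re)
 hence "((%n. real B * (real (if n = 0 then 1 else pbar n) * norm (ee z) ^ n)) has_sum real B * Re (1 / th0 ?s)) UNIV"
  unfolding Re_complex_of_real by (rule has_sum_cmult_right)
 hence "norm S <= real B * Re (1 / th0 ?s)"
 proof (rule norm_has_sum_le[OF g])
  fix n
  have "real_of_int (abs (p n)) <= real_of_int (int B * int (if n = 0 then 1 else pbar n))" using p[of n] by (simp only: of_int_le_iff)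
  hence "(abs (real_of_int (p n))) <= real B * real (if n = 0 then 1 else pbar n)" by simp
  hence "(abs (real_of_int (p n))) * norm (ee z) ^ n <= real B * real (if n = 0 then 1 else pbar n) * norm (ee z) ^ n" by (rule mult_right_mono) simp
  thus "norm (of_int (p n) * ee z ^ n) <= real B * (real (if n = 0 then 1 else pbar n) * norm (ee z) ^ n)"
   by (simp only: norm_mult norm_power norm_of_int mult.assoc)
 qed
 also have "... <= real B * norm (1 / th0 ?s)" by (intro mult_left_mono complex_Re_le_cmod) auto
 finally show ?thesis by (simp add: norm_divide)
qed

text \<open>Inversion expresses th0 (i s) by th1 (i / s), a series of positive terms with leading
  factor exp (- pi / (8 s)). The polynomial factor 1 + s absorbs the square root.\<close>

lemma inverse_th0_bound:
 assumes s: "s > 0"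
 shows "1 / norm (th0 (\<i> * of_real s)) <= (1 + s) * exp (pi / (8 * s))"
proof -
 let ?t = "\<i> * of_real (1 / s)"
 have t: "Im ?t > 0" using s by simp
 have "- 1 / ?t = \<i> * of_real s" using s by (simp add: field_simps)
 hence e1: "th0 (\<i> * of_real s) = 2 * csqrt (- \<i> * ?t / 2) * th1 ?t" using th0_S[OF t] by simp
 have "- \<i> * ?t / 2 = of_real (1 / (2 * s))" by simp
 hence n1: "norm (csqrt (- \<i> * ?t / 2)) = sqrt (1 / (2 * s))" using s by (simp add: norm_csqrt)
 have n2: "exp (- (pi / (8 * s))) <= norm (th1 ?t)"
 proof -
  have "appc True ?t n = of_real (exp (- (2 * pi / s * ((of_int n)^2 + of_int n / 2))))" for n
  proof -
   have gen: "2 * p * \<i> * (N * (\<i> * r) + M * (\<i> * r / 2)) = - (2 * p * r * (N + M / 2))" for p N M r :: complex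
    by (simp add: algebra_simps)
   have eq: "2 * of_real pi * \<i> * ((of_int n)^2 * ?t + of_int n * (?t / 2)) = of_real (- (2 * pi / s * ((of_int n)^2 + of_int n / 2)))"
    unfolding gen by simp
   show ?thesis unfolding appc_def ee_def if_True eq exp_of_real ..
  qed
  moreover have "(appc True ?t has_sum thg True ?t) UNIV"
   unfolding thg_def by (rule has_sum_infsum[OF abs_summable_summable[OF appc_summable[OF t]]])
  ultimately have "((%n. complex_of_real (exp (- (2 * pi / s * ((of_int n)^2 + of_int n / 2))))) has_sum thg True ?t) UNIV"
   by (metis (no_types, lifting) has_sum_cong)
  hence R: "((%n::int. exp (- (2 * pi / s * ((of_int n)^2 + of_int n / 2)))) has_sum Re (thg True ?t)) UNIV"
   using has_sum_Re by fastforce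
  have "(\<Sum>n\<in>{0::int}. exp (- (2 * pi / s * ((of_int n)^2 + of_int n / 2)))) <= Re (thg True ?t)"
   by (rule has_sum_mono_neutral[OF has_sum_finite R]) auto
  hence "1 <= Re (thg True ?t)" by simp
  hence 1: "1 <= norm (thg True ?t)" using complex_Re_le_cmod[of "thg True ?t"] by linarith
  have "th1 ?t = ee (?t / 16) * thg True ?t" using thc_thg[of True ?t] by (simp add: thc_def)
  moreover have "norm (ee (?t / 16)) = exp (- (pi / (8 * s)))" by (simp add: norm_ee)
  ultimately show ?thesis using mult_left_mono[OF 1, of "exp (- (pi / (8 * s)))"] by (simp add: norm_mult)
 qed
 have "2 * sqrt (1 / (2 * s)) * exp (- (pi / (8 * s))) <= norm (th0 (\<i> * of_real s))"
  unfolding e1 norm_mult n1 norm_numeral by (intro mult_left_mono n2) (use s in auto)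
 moreover have pos: "0 < 2 * sqrt (1 / (2 * s)) * exp (- (pi / (8 * s)))" using s by simp
 ultimately have "1 / norm (th0 (\<i> * of_real s)) <= 1 / (2 * sqrt (1 / (2 * s)) * exp (- (pi / (8 * s))))"
  by (intro frac_le[OF zero_le_one order_refl])
 also have "... = (1 / (2 * sqrt (1 / (2 * s)))) * exp (pi / (8 * s))" by (simp add: exp_minus field_simps)
 also have "... <= (1 + s) * exp (pi / (8 * s))"
 proof (rule mult_right_mono)
  have "1 / (2 * sqrt (1 / (2 * s))) = sqrt (2 * s) / 2" using s by (simp add: real_sqrt_divide)
  also have "sqrt (2 * s) <= 2 * (1 + s)" by (rule real_le_lsqrt) (use s in \<open>auto simp: power2_eq_square algebra_simps\<close>)
  finally show "1 / (2 * sqrt (1 / (2 * s))) <= 1 + s" by simp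
 qed simp
 finally show ?thesis .
qed

text \<open>There are finitely many matrices modulo N; one chosen preimage for each class gives a
  common bound for the bottom rows.\<close>

lemma SL2_representatives:
 assumes N: "N > (0 :: int)"
 shows "EX M::int. M >= 0 & (ALL a b c d. a * d - b * c = 1 --> (EX a0 b0 c0 d0. a0 * d0 - b0 * c0 = 1 &
  [a = a0] (mod N) & [b = b0] (mod N) & [c = c0] (mod N) & [d = d0] (mod N) & (abs c0) <= M & (abs d0) <= M))"
proof -
 define red where "red = (%(a, b, c, d). (a mod N, b mod N, c mod N, d mod N))"
 have "red ` SL2Z <= {0..<N} \<times> {0..<N} \<times> {0..<N} \<times> {0..<N}" using N by (auto simp: red_def)
 hence fin: "finite (red ` SL2Z)" by (rule finite_subset) auto
 define R where "R = inv_into SL2Z red ` red ` SL2Z"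
 have finR: "finite R" using fin by (simp add: R_def)
 define h where "h = (%(a :: int, b :: int, c :: int, d :: int). (abs c) + (abs d))"
 define M where "M = (\<Sum>g\<in>R. h g)"
 have h0: "h g >= 0" for g by (auto simp: h_def split: prod.splits)
 have M: "h g <= M" if "g \<in> R" for g unfolding M_def by (rule member_le_sum[OF that]) (use h0 finR in auto)
 show ?thesis
 proof (rule exI[of _ M], intro conjI allI impI)
  show "M >= 0" unfolding M_def by (intro sum_nonneg h0)
  fix a b c d :: int assume "a * d - b * c = 1"
  hence g: "(a, b, c, d) \<in> SL2Z" by (simp add: SL2Z_def)
  obtain a0 b0 c0 d0 where g0: "inv_into SL2Z red (red (a, b, c, d)) = (a0, b0, c0, d0)" by (metis prod_cases4)
  have "(a0, b0, c0, d0) \<in> SL2Z" using inv_into_into[of "red (a, b, c, d)" red SL2Z] g g0 by simp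
  hence A: "a0 * d0 - b0 * c0 = 1" by (simp add: SL2Z_def)
  have "red (a, b, c, d) = red (a0, b0, c0, d0)" using f_inv_into_f[of "red (a, b, c, d)" red SL2Z] g g0 by simp
  hence E: "a mod N = a0 mod N" "b mod N = b0 mod N" "c mod N = c0 mod N" "d mod N = d0 mod N" unfolding red_def prod.case by blast+
  have "(a0, b0, c0, d0) \<in> R" using g g0 by (force simp: R_def)
  hence "(abs c0) + (abs d0) <= M" using M[of "(a0, b0, c0, d0)"] by (simp add: h_def)
  hence "(abs c0) <= M" "(abs d0) <= M" by linarith+
  with A E show "EX a0 b0 c0 d0. a0 * d0 - b0 * c0 = 1 &
   [a = a0] (mod N) & [b = b0] (mod N) & [c = c0] (mod N) & [d = d0] (mod N) & (abs c0) <= M & (abs d0) <= M"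
   unfolding cong_def by blast
 qed
qed

lemma norm_automorphy_ge_1:
 assumes det: "a * d - b * c = (1 :: int)" and z: "Im z >= 1"
 shows "1 <= norm (aut c d z)"
proof (cases "c = 0")
 case True
 hence "d = 1 | d = -1" using det zmult_eq_1_iff by auto
 thus ?thesis using True by auto
next
 case False
 hence "1 <= real_of_int (abs c)" by linarith
 hence "1 * 1 <= real_of_int (abs c) * Im z" using z by (intro mult_mono) auto
 also have "... = (abs (Im (aut c d z)))" using z by (simp add: abs_mult)
 also have "... <= norm (aut c d z)" by (rule abs_Im_le_cmod)
 finally show ?thesis by simp
qed

text \<open>C must not depend on the matrix, because the power K is fixed once for all cusps. Modulo
  the principal congruence subgroup, under which G is known, every matrix reduces to one of finitely
  many representatives, and there the bound through th0 is explicit.\<close>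

lemma growth_at_cusps:
 fixes G :: "complex => complex" and N :: int and s B :: real
 assumes N: "N > 0" and s: "(abs s) <= 1" and B: "B >= 0"
  and bound: "!!z. Im z > 0 ==> norm (G z) <= B * (1 / norm (th0 (\<i> * Im z)))"
  and inv: "!!a b c d z. a * d - b * c = 1 ==> [a = 1] (mod N) ==> [b = 0] (mod N) ==> [c = 0] (mod N) ==> [d = 1] (mod N) ==> Im z > 0 ==>
   norm (G (mob (a,b,c,d) z)) = norm (aut c d z) powr s * norm (G z)"
 shows "EX C. ALL a b c d z. a * d - b * c = 1 --> Im z >= 1 -->
   norm (aut c d z) powr (- s) * norm (G (mob (a,b,c,d) z)) <= B * exp (C * Im z)"
proof -
 obtain M where M: "M >= 0" "!!a b c d. a * d - b * c = 1 ==> EX a0 b0 c0 d0. a0 * d0 - b0 * c0 = 1 &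
  [a = a0] (mod N) & [b = b0] (mod N) & [c = c0] (mod N) & [d = d0] (mod N) & (abs c0) <= M & (abs d0) <= M"
  using SL2_representatives[OF N] by blast
 define A where "A = real_of_int (M * (N + 2))"
 have A0: "A >= 0" using M(1) N by (simp add: A_def)
 show ?thesis
 proof (intro exI[of _ "A + 1 + A^2"] allI impI)
  fix a b c d :: int and z :: complex
  assume det: "a * d - b * c = 1" and z: "Im z >= 1"
  \<comment> \<open>Translating by a multiple of N keeps the real part bounded without changing the
    class modulo N; only then is the automorphy factor bounded in terms of Im z.\<close>
  define k where "k = \<lfloor>Re z / of_int N\<rfloor>"
  define x where "x = z - of_int (k * N)"
  have imz: "Im x = Im z" "Im x > 0" "Im x >= 1" using z by (auto simp: x_def)
  have rez: "(abs (Re x)) <= of_int N"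
  proof -
   have "of_int k <= Re z / of_int N" "Re z / of_int N < of_int k + 1" by (simp_all add: k_def)
   hence "of_int k * of_int N <= Re z" "Re z < (of_int k + 1) * of_int N" using N by (simp_all add: field_simps)
   thus ?thesis by (simp add: x_def algebra_simps)
  qed
  define b1 where "b1 = b + k * N * a"
  define d1 where "d1 = d + k * N * c"
  have det1: "a * d1 - b1 * c = 1" using det by (simp add: b1_def d1_def algebra_simps)
  have J1: "of_int c * x + of_int d1 = of_int c * z + (of_int d :: complex)" by (simp add: x_def d1_def algebra_simps)
  have mob1: "mob (a,b1,c,d1) x = mob (a,b,c,d) z"
   by (simp add: moebius_act_def x_def b1_def d1_def algebra_simps)
  obtain a0 b0 c0 d0 where g0: "a0 * d0 - b0 * c0 = 1" "[a = a0] (mod N)" "[b1 = b0] (mod N)" "[c = c0] (mod N)" "[d1 = d0] (mod N)"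
   "(abs c0) <= M" "(abs d0) <= M" using M(2)[OF det1] by blast
  define w where "w = mob (a0,b0,c0,d0) x"
  let ?J0 = "of_int c0 * x + of_int d0 :: complex"
  have w: "Im w > 0" "Im w = Im x / (norm ?J0)^2" unfolding w_def using Im_moebius[OF g0(1) imz(2)] by auto
  have J0: "1 <= norm ?J0" by (rule norm_automorphy_ge_1[OF g0(1) imz(3)])
  \<comment> \<open>The quotient of the matrix by its representative, congruent to the identity
    modulo N.\<close>
  define a2 where "a2 = a * d0 - b1 * c0"
  define b2 where "b2 = b1 * a0 - a * b0"
  define c2 where "c2 = c * d0 - d1 * c0"
  define d2 where "d2 = d1 * a0 - c * b0"
  have mm: "mmul (a2,b2,c2,d2) (a0,b0,c0,d0) = (a,b1,c,d1)"
  proof -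
   have "a2 * a0 + b2 * c0 = a * (a0 * d0 - b0 * c0)" "a2 * b0 + b2 * d0 = b1 * (a0 * d0 - b0 * c0)"
    "c2 * a0 + d2 * c0 = c * (a0 * d0 - b0 * c0)" "c2 * b0 + d2 * d0 = d1 * (a0 * d0 - b0 * c0)"
    by (simp_all add: a2_def b2_def c2_def d2_def algebra_simps)
   thus ?thesis by (simp add: mmul_def g0(1))
  qed
  have det2: "a2 * d2 - b2 * c2 = 1"
  proof -
   have "a2 * d2 - b2 * c2 = (a0 * d0 - b0 * c0) * (a * d1 - b1 * c)" by (simp add: a2_def b2_def c2_def d2_def algebra_simps)
   thus ?thesis by (simp add: g0(1) det1)
  qed
  have "[a2 = a0 * d0 - b0 * c0] (mod N)" "[b2 = b0 * a0 - a0 * b0] (mod N)" "[c2 = c0 * d0 - d0 * c0] (mod N)" "[d2 = d0 * a0 - c0 * b0] (mod N)"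
   unfolding a2_def b2_def c2_def d2_def by (intro cong_diff cong_mult g0 cong_refl)+
  hence cg: "[a2 = 1] (mod N)" "[b2 = 0] (mod N)" "[c2 = 0] (mod N)" "[d2 = 1] (mod N)"
   using g0(1) by (simp_all add: mult.commute)
  have J0nz: "?J0 ~= 0" using J0 by auto
  have Jw: "of_int c * z + of_int d = (of_int c2 * w + of_int d2) * ?J0"
  proof -
   have "(of_int c2 * w + of_int d2) * ?J0 = of_int c2 * (w * ?J0) + of_int d2 * ?J0" by (simp add: algebra_simps)
   also have "w * ?J0 = of_int a0 * x + of_int b0" using J0nz by (simp add: w_def moebius_act_def)
   also have "of_int c2 * (of_int a0 * x + of_int b0) + of_int d2 * ?J0 = of_int (c2 * a0 + d2 * c0) * x + of_int (c2 * b0 + d2 * d0)"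
    by (simp add: algebra_simps)
   also have "... = of_int c * x + of_int d1" using mm by (simp add: mmul_def)
   finally show ?thesis using J1 by simp
  qed
  have J2nz: "of_int c2 * w + of_int d2 ~= (0 :: complex)" by (rule Im_moebius(2)[OF det2 w(1)])
  have mob: "mob (a,b,c,d) z = mob (a2,b2,c2,d2) w"
   unfolding mob1[symmetric] mm[symmetric] w_def
   by (rule moebius_mmul(1)) (use J0nz J2nz in \<open>auto simp: w_def\<close>)
  have "norm (aut c d z) powr (- s) * norm (G (mob (a,b,c,d) z)) =
    (norm (of_int c2 * w + of_int d2) powr (- s) * norm ?J0 powr (- s)) * (norm (of_int c2 * w + of_int d2) powr s * norm (G w))"
   unfolding mob Jw norm_mult inv[OF det2 cg w(1)] by (simp add: powr_mult)
  also have "... = norm ?J0 powr (- s) * norm (G w)" using J2nz by (simp add: powr_minus field_simps)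
  also have "... <= exp (A * Im z) * (B * exp ((1 + A^2) * Im z))"
  proof (rule mult_mono)
   have "norm ?J0 <= norm (of_int c0 * x) + norm (of_int d0 :: complex)" by (rule norm_triangle_ineq)
   also have "... <= of_int M * (of_int N + Im z) + of_int M"
   proof (rule add_mono)
    have "norm x <= (abs (Re x)) + (abs (Im x))" by (rule cmod_le)
    hence "norm x <= of_int N + Im z" using rez imz by linarith
    moreover have "(abs (real_of_int c0)) <= of_int M" using g0(6) by (metis of_int_abs of_int_le_iff)
    ultimately show "norm (of_int c0 * x) <= of_int M * (of_int N + Im z)" unfolding norm_mult using M(1) by (intro mult_mono) auto
    show "norm (of_int d0 :: complex) <= of_int M" using g0(7) by (metis norm_of_int of_int_abs of_int_le_iff)
   qed
   also have "... <= of_int M * (of_int N * Im z + Im z) + of_int M * Im z"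
   proof -
    have "real_of_int M * 1 <= of_int M * Im z" "real_of_int N * 1 <= of_int N * Im z"
     using z M(1) N by (intro mult_left_mono; simp)+
    thus ?thesis using M(1) by (intro add_mono mult_left_mono) auto
   qed
   also have "... = A * Im z" by (simp add: A_def algebra_simps)
   finally have JA: "norm ?J0 <= A * Im z" .
   have "norm ?J0 powr (- s) <= norm ?J0 powr 1" using J0 s by (intro powr_mono) auto
   also have "... = norm ?J0" using J0 by simp
   also have "... <= exp (norm ?J0)" using exp_ge_add_one_self[of "norm ?J0"] by linarith
   also have "... <= exp (A * Im z)" using JA by simp
   finally show "norm ?J0 powr (- s) <= exp (A * Im z)" .
   have "norm (G w) <= B * (1 / norm (th0 (\<i> * Im w)))" by (rule bound[OF w(1)])
   also have "... <= B * ((1 + Im w) * exp (pi / (8 * Im w)))" by (intro mult_left_mono inverse_th0_bound[OF w(1)] B)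
   also have "(1 + Im w) * exp (pi / (8 * Im w)) <= exp (Im z) * exp (A^2 * Im z)"
   proof (rule mult_mono)
    have "1 <= (norm ?J0)^2" using J0 by (simp add: one_le_power)
    hence "Im w <= Im z" unfolding w(2) imz(1) using z by (simp add: divide_le_eq mult_le_cancel_left1)
    thus "1 + Im w <= exp (Im z)" using exp_ge_add_one_self[of "Im z"] by linarith
    have "pi / (8 * Im w) <= 1 / Im w" using w(1) pi_less_4 by (simp add: field_simps)
    also have "... = (norm ?J0)^2 / Im z" by (simp add: w(2) imz(1))
    also have "... <= (A * Im z)^2 / Im z" using JA z by (intro divide_right_mono power_mono) auto
    also have "... = A^2 * Im z" using z by (simp add: power2_eq_square)
    finally show "exp (pi / (8 * Im w)) <= exp (A^2 * Im z)" by simp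
   qed auto
   also have "exp (Im z) * exp (A^2 * Im z) = exp ((1 + A^2) * Im z)"
    unfolding exp_add[symmetric] by (simp add: algebra_simps)
   finally show "norm (G w) <= B * exp ((1 + A^2) * Im z)" using B by (simp add: mult_left_mono)
  qed auto
  also have "... = B * (exp (A * Im z) * exp ((1 + A^2) * Im z))" by simp
  also have "exp (A * Im z) * exp ((1 + A^2) * Im z) = exp ((A + 1 + A^2) * Im z)"
   unfolding exp_add[symmetric] by (simp add: algebra_simps)
  finally show "norm (aut c d z) powr (- s) * norm (G (mob (a,b,c,d) z)) <= B * exp ((A + 1 + A^2) * Im z)" .
 qed
qed

section \<open>The quotient of discriminants at all cusps\<close>

text \<open>Of weight 12 (L - 1) K on Gamma0(L). At infinity the orders of numerator and denominator
  agree, so it stays bounded there; at cusps with L not dividing c the numerator wins.\<close>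

definition Equot :: "nat => nat => complex => complex" where
 "Equot L K z = (X8 z ^ L / X8 (of_nat L * z)) ^ K"

lemma Equot_transform_general:
 fixes J D :: complex
 assumes "X8 z' = J ^ 12 * X8 z" "X8 (of_nat L * z') = (J / D) ^ 12 * X8 s" "J ~= 0" "D ~= 0" "L > 0"
 shows "Equot L K z' = J ^ (12 * (L - 1) * K) * (D ^ 12 * X8 z ^ L / X8 s) ^ K"
proof -
 obtain L' where L': "L = Suc L'" using \<open>L > 0\<close> gr0_implies_Suc by blast
 have "X8 z' ^ L / X8 (of_nat L * z') = (J ^ 12) ^ L * X8 z ^ L / ((J / D) ^ 12 * X8 s)"
  unfolding assms(1,2) power_mult_distrib ..
 also have "(J ^ 12) ^ L = J ^ (12 * (L - 1)) * J ^ 12" unfolding L' power_mult[symmetric] power_add[symmetric] by (simp add: add.commute)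
 also have "J ^ (12 * (L - 1)) * J ^ 12 * X8 z ^ L / ((J / D) ^ 12 * X8 s) = J ^ (12 * (L - 1)) * (D ^ 12 * X8 z ^ L / X8 s)"
  using assms(3,4) by (simp add: power_divide)
 finally have E: "X8 z' ^ L / X8 (of_nat L * z') = J ^ (12 * (L - 1)) * (D ^ 12 * X8 z ^ L / X8 s)" .
 show ?thesis unfolding Equot_def E power_mult_distrib[of "J ^ (12 * (L - 1))"] by (simp only: power_mult)
qed

lemma Equot_Gamma0:
 assumes det: "a * d - b * c = 1" and c: "int L dvd c" and L: "L > 0" and z: "Im z > 0"
 shows "Equot L K (mob (a,b,c,d) z) = (aut c d z) ^ (12 * (L - 1) * K) * Equot L K z"
proof -
 obtain c1 where c1: "c = int L * c1" using c by (elim dvdE)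
 have Lz: "Im (of_nat L * z) > 0" using z L by simp
 have det1: "a * d - (b * int L) * c1 = 1" using det by (simp add: c1 mult_ac)
 have "of_nat L * mob (a,b,c,d) z = mob (a, b * int L, c1, d) (of_nat L * z)"
  by (simp add: moebius_act_def c1 algebra_simps add_divide_distrib)
 hence "X8 (of_nat L * mob (a,b,c,d) z) = ((aut c d z) / 1) ^ 12 * X8 (of_nat L * z)"
  using X8_transform[OF det1 Lz] by (simp add: c1 mult_ac)
 from Equot_transform_general[OF X8_transform[OF det z] this Im_moebius(2)[OF det z] one_neq_zero L]
 show ?thesis by (simp add: Equot_def)
qed

lemma eventually_hinf_affine:
 assumes "eventually P hinf" and "\<alpha> > 0" and "!!z. Im (f z) = \<alpha> * Im z"
 shows "eventually (%z. P (f z)) hinf"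
proof -
 obtain Y where Y: "!!z. Im z >= Y ==> P z" using assms(1) unfolding eventually_hinf by blast
 have "P (f z)" if "Im z >= Y / \<alpha>" for z using that assms(2,3) by (intro Y) (simp add: field_simps)
 thus ?thesis unfolding eventually_hinf by blast
qed

lemma Equot_bounded:
 assumes L: "L > 0"
 shows "eventually (%z. norm (Equot L K z) <= (2 ^ Suc L) ^ K) hinf"
proof -
 have "eventually (%z. norm (ee (of_nat L * z)) / 2 <= norm (X8 (of_nat L * z)) & norm (X8 (of_nat L * z)) <= 2 * norm (ee (of_nat L * z))) hinf"
  by (rule eventually_hinf_affine[OF X8_bounds, where \<alpha> = "real L"]) (use L in auto)
 with X8_bounds show ?thesis
 proof eventually_elim
  case (elim z)
  have e: "norm (ee (of_nat L * z)) = norm (ee z) ^ L" by (simp add: ee_power[symmetric] norm_power)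
  have p: "0 < norm (ee z) ^ L" by simp
  have "norm (X8 z) ^ L <= (2 * norm (ee z)) ^ L" using elim by (intro power_mono) auto
  hence "norm (X8 z) ^ L / norm (X8 (of_nat L * z)) <= (2 * norm (ee z)) ^ L / (norm (ee z) ^ L / 2)"
   using elim e p by (intro frac_le) auto
  also have "... = 2 ^ Suc L" using p by (simp add: power_mult_distrib)
  finally show ?case unfolding Equot_def norm_power norm_divide by (intro power_mono) auto
 qed
qed

text \<open>With g = gcd (c, L) and L = g D, the denominator becomes X8 at (g z + B) / D, of order g
  / D. This is at most g <= L - 1, while the numerator has order L, so each of the K factors decays
  at least like exp (- 2 pi Im z).\<close>

lemma Equot_other_cusps:
 assumes det: "a * d - b * c = 1" and L: "L > 0" "~ int L dvd c"
 shows "EX C >= 0. eventually (%z. norm (Equot L K (mob (a,b,c,d) z)) \<le>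
  norm (aut c d z) ^ (12 * (L - 1) * K) * (C * exp (- (2 * pi * real K * Im z)))) hinf"
proof -
 define g where "g = gcd c (int L)"
 have g0: "g > 0" using L(1) by (simp add: g_def)
 obtain c' D where cD: "c = g * c'" "int L = g * D" unfolding g_def by (metis gcd_dvd1 gcd_dvd2 dvdE)
 have D0: "D > 0" using cD(2) g0 L(1) by (metis of_nat_0_less_iff zero_less_mult_pos)
 have "g ~= int L" using L(2) gcd_dvd1[of c "int L"] unfolding g_def by metis
 moreover have "g <= int L" unfolding cD(2) using g0 D0 by (simp add: mult_le_cancel_left1)
 ultimately have gL: "g <= int L - 1" by linarith
 have cop: "coprime c' D"
 proof -
  have "gcd (g * c') (g * D) = g" unfolding cD(1)[symmetric] cD(2)[symmetric] by (simp only: g_def)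
  hence "(abs g) * gcd c' D = (abs g) * 1" using g0 by (simp add: gcd_mult_left)
  hence "gcd c' D = 1" using g0 by simp
  thus ?thesis unfolding coprime_iff_gcd_eq_1 .
 qed
 obtain x y where xy: "x * c' + y * D = 1" using bezout_int[of c' D] cop unfolding coprime_iff_gcd_eq_1 by metis
 \<comment> \<open>Chosen so that (L a, L b; c, d) = (a', b'; c', d') (g, B; 0, D) with a first
   factor of determinant 1.\<close>
 define B where "B = x * d"
 define d' where "d' = y * d"
 have d: "c' * B + d' * D = d"
 proof -
  have "c' * B + d' * D = (x * c' + y * D) * d" by (simp add: B_def d'_def algebra_simps)
  thus ?thesis by (simp add: xy)
 qed
 define a' where "a' = D * a"
 define b' where "b' = g * b - a * B"
 have det': "a' * d' - b' * c' = 1"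
 proof -
  have "a' * d' - b' * c' = a * (c' * B + d' * D) - b * (g * c')" by (simp add: a'_def b'_def algebra_simps)
  thus ?thesis using det by (simp add: d cD(1)[symmetric])
 qed
 define s where "s = (%z. (aut g B z) / (of_int D :: complex))"
 have ims: "Im (s z) = (of_int g / of_int D) * Im z" for z
 proof -
  have "s z = of_real (of_int g / of_int D) * z + of_real (of_int B / of_int D)" by (simp add: s_def add_divide_distrib)
  thus ?thesis by simp
 qed
 have LC: "of_nat L = of_int g * (of_int D :: complex)" by (metis cD(2) of_int_mult of_int_of_nat_eq)
 define C where "C = (of_int D ^ 12 * 2 ^ Suc L :: real) ^ K"
 have "eventually (%z. norm (ee (s z)) / 2 <= norm (X8 (s z)) & norm (X8 (s z)) <= 2 * norm (ee (s z))) hinf"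
  by (rule eventually_hinf_affine[OF X8_bounds _ ims]) (use g0 D0 in simp)
 moreover have "eventually (%z. Im z > 0) hinf" unfolding eventually_hinf by (intro exI[of _ 1]) auto
 ultimately have "eventually (%z. norm (Equot L K (mob (a,b,c,d) z)) \<le>
  norm (aut c d z) ^ (12 * (L - 1) * K) * (C * exp (- (2 * pi * real K * Im z)))) hinf"
  using X8_bounds
 proof eventually_elim
  case (elim z)
  let ?J = "of_int c * z + of_int d :: complex"
  have Dc: "(of_int D :: complex) ~= 0" using D0 by simp
  have J0: "?J ~= 0" by (rule Im_moebius(2)[OF det elim(2)])
  have sp: "Im (s z) > 0" unfolding ims using elim(2) g0 D0 by simp
  have J': "of_int c' * s z + of_int d' = ?J / of_int D"
  proof -
   have "of_int d = of_int c' * of_int B + of_int d' * (of_int D :: complex)" by (metis d of_int_add of_int_mult)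
   thus ?thesis using Dc by (simp add: s_def cD(1) field_simps)
  qed
  have num: "of_int a' * s z + of_int b' = of_int g * (aut a b z)"
   using Dc by (simp add: s_def a'_def b'_def field_simps)
  have "of_nat L * mob (a,b,c,d) z = mob (a',b',c',d') (s z)"
   unfolding moebius_act_def prod.case J' num LC using J0 Dc by (simp add: field_simps)
  hence X: "X8 (of_nat L * mob (a,b,c,d) z) = (?J / of_int D) ^ 12 * X8 (s z)"
   using X8_transform[OF det' sp] J' by simp
  have "norm (X8 z) ^ L <= (2 * norm (ee z)) ^ L" using elim by (intro power_mono) auto
  hence "of_int D ^ 12 * norm (X8 z) ^ L / norm (X8 (s z)) <= of_int D ^ 12 * (2 * norm (ee z)) ^ L / (norm (ee (s z)) / 2)"
   using elim D0 by (intro frac_le mult_left_mono) auto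
  also have "... = of_int D ^ 12 * 2 ^ Suc L * (norm (ee z) ^ L / norm (ee (s z)))" by (simp add: power_mult_distrib)
  also have "norm (ee z) ^ L / norm (ee (s z)) <= exp (- (2 * pi * Im z))"
  proof -
   have "real_of_int g / of_int D <= of_int g / 1" using g0 D0 by (intro divide_left_mono) auto
   also have "... <= real L - 1" using gL by linarith
   finally have "(of_int g / of_int D) * Im z <= (real L - 1) * Im z" using elim(2) by (intro mult_right_mono) auto
   hence "2 * pi * Im (s z) <= 2 * pi * ((real L - 1) * Im z)" unfolding ims by (intro mult_left_mono) auto
   hence "real L * (- 2 * pi * Im z) - (- 2 * pi * Im (s z)) <= - (2 * pi * Im z)" by (simp add: algebra_simps)
   thus ?thesis unfolding norm_ee exp_of_nat_mult[symmetric] exp_diff[symmetric] by simp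
  qed
  finally have "of_int D ^ 12 * norm (X8 z) ^ L / norm (X8 (s z)) <= of_int D ^ 12 * 2 ^ Suc L * exp (- (2 * pi * Im z))"
   using D0 by (simp add: mult_left_mono)
  hence "(of_int D ^ 12 * norm (X8 z) ^ L / norm (X8 (s z))) ^ K <= (of_int D ^ 12 * 2 ^ Suc L * exp (- (2 * pi * Im z))) ^ K"
   by (intro power_mono) (use D0 in auto)
  also have "... = C * exp (- (2 * pi * Im z)) ^ K" unfolding C_def by (rule power_mult_distrib)
  also have "exp (- (2 * pi * Im z)) ^ K = exp (- (2 * pi * real K * Im z))" by (simp add: exp_of_nat_mult[symmetric] mult_ac)
  finally have *: "(of_int D ^ 12 * norm (X8 z) ^ L / norm (X8 (s z))) ^ K <= C * exp (- (2 * pi * real K * Im z))" .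
  have "norm (Equot L K (mob (a,b,c,d) z)) = norm ?J ^ (12 * (L - 1) * K) * (of_int D ^ 12 * norm (X8 z) ^ L / norm (X8 (s z))) ^ K"
   unfolding Equot_transform_general[OF X8_transform[OF det elim(2)] X J0 Dc L(1)]
   using D0 by (simp add: norm_mult norm_power norm_divide)
  also have "... <= norm ?J ^ (12 * (L - 1) * K) * (C * exp (- (2 * pi * real K * Im z)))" by (intro mult_left_mono *) auto
  finally show ?case .
 qed
 moreover have "C >= 0" using D0 by (simp add: C_def)
 ultimately show ?thesis by blast
qed

section \<open>Vanishing at the cusps\<close>

text \<open>If L divides c, the quotient is bounded up to its automorphy factor and G tends to 0 by
  the sieve. Otherwise exp (- 2 pi K Im z) outweighs the growth exp (C Im z) of G.\<close>

lemma cusp_limit: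
 fixes G :: "complex => complex" and s B C :: real
 assumes L: "L > 0" and det: "a * d - b * c = 1" and C: "C < 2 * pi * real K"
  and growth: "!!z. Im z >= 1 ==> norm (aut c d z) powr (- s) * norm (G (mob (a,b,c,d) z)) <= B * exp (C * Im z)"
  and lim: "int L dvd c ==> ((%z. norm (aut c d z) powr (- s) * norm (G (mob (a,b,c,d) z))) ---> 0) hinf"
 shows "((%z. norm (aut c d z) powr (- (real (12 * (L - 1) * K) + s)) *
  norm (Equot L K (mob (a,b,c,d) z) * G (mob (a,b,c,d) z))) ---> 0) hinf"
proof -
 let ?W = "12 * (L - 1) * K" and ?J = "%z. of_int c * z + of_int d :: complex"
 let ?\<phi> = "%z. norm (?J z) powr (- s) * norm (G (mob (a,b,c,d) z))"
 have split: "norm (?J z) powr (- (real ?W + s)) * norm (Equot L K (mob (a,b,c,d) z) * G (mob (a,b,c,d) z))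
  <= e * ?\<phi> z" if z: "Im z >= 1" and e: "norm (Equot L K (mob (a,b,c,d) z)) <= norm (?J z) ^ ?W * e" for z e
 proof -
  have J: "norm (?J z) > 0" using norm_automorphy_ge_1[OF det z] by linarith
  have "norm (?J z) powr (- (real ?W + s)) = norm (?J z) powr (- s) / norm (?J z) ^ ?W"
  proof -
   have "- (real ?W + s) = - s - real ?W" by simp
   thus ?thesis by (simp only: powr_diff powr_realpow[OF J])
  qed
  hence "norm (?J z) powr (- (real ?W + s)) * norm (Equot L K (mob (a,b,c,d) z) * G (mob (a,b,c,d) z)) =
   (norm (Equot L K (mob (a,b,c,d) z)) / norm (?J z) ^ ?W) * ?\<phi> z" by (simp add: norm_mult)
  also have "... <= e * ?\<phi> z"
   using e J by (intro mult_right_mono) (auto simp: divide_le_eq mult.commute)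
  finally show ?thesis .
 qed
 have ev1: "eventually (%z. Im z >= 1) hinf" unfolding eventually_hinf by (intro exI[of _ 1]) auto
 show ?thesis
 proof (cases "int L dvd c")
  case True
  show ?thesis
  proof (rule Lim_null_comparison)
   show "((%z. (2 ^ Suc L) ^ K * ?\<phi> z) ---> 0) hinf" using tendsto_mult_left[OF lim[OF True], of "(2 ^ Suc L) ^ K"] by simp
   show "eventually (%z. norm (norm (?J z) powr (- (real ?W + s)) * norm (Equot L K (mob (a,b,c,d) z) * G (mob (a,b,c,d) z))) <= (2 ^ Suc L) ^ K * ?\<phi> z) hinf"
    using ev1 Equot_bounded[OF L, of K]
   proof eventually_elim
    case (elim z)
    have "norm (Equot L K (mob (a,b,c,d) z)) = norm (?J z) ^ ?W * norm (Equot L K z)"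
     using Equot_Gamma0[OF det True L, of z K] elim(1) by (simp add: norm_mult norm_power)
    also have "... <= norm (?J z) ^ ?W * (2 ^ Suc L) ^ K" using elim(2) by (intro mult_left_mono) auto
    finally show ?case using split[OF elim(1)] by simp
   qed
  qed
 next
  case False
  obtain C' where C': "C' >= 0" "eventually (%z. norm (Equot L K (mob (a,b,c,d) z)) <= norm (?J z) ^ ?W * (C' * exp (- (2 * pi * real K * Im z)))) hinf"
   using Equot_other_cusps[OF det L False] by blast
  show ?thesis
  proof (rule Lim_null_comparison)
   define \<alpha> where "\<alpha> = 2 * pi * real K - C"
   have "\<alpha> > 0" using C by (simp add: \<alpha>_def)
   hence "((%y. C' * B * exp (- \<alpha> * y)) ---> 0) at_top" by real_asymp
   from filterlim_compose[OF this filterlim_Im_hinf]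
   show "((%z. C' * B * exp (- \<alpha> * Im z)) ---> 0) hinf" .
   show "eventually (%z. norm (norm (?J z) powr (- (real ?W + s)) * norm (Equot L K (mob (a,b,c,d) z) * G (mob (a,b,c,d) z))) <= C' * B * exp (- \<alpha> * Im z)) hinf"
    using ev1 C'(2)
   proof eventually_elim
    case (elim z)
    have "norm (?J z) powr (- (real ?W + s)) * norm (Equot L K (mob (a,b,c,d) z) * G (mob (a,b,c,d) z)) <= C' * exp (- (2 * pi * real K * Im z)) * ?\<phi> z"
     by (rule split[OF elim])
    also have "... <= C' * exp (- (2 * pi * real K * Im z)) * (B * exp (C * Im z))"
     using growth[OF elim(1)] C'(1) by (intro mult_left_mono) auto
    also have "... = C' * B * (exp (- (2 * pi * real K * Im z)) * exp (C * Im z))" by (simp only: mult_ac)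
    also have "exp (- (2 * pi * real K * Im z)) * exp (C * Im z) = exp (- \<alpha> * Im z)"
     unfolding exp_add[symmetric] by (rule arg_cong[where f = exp]) (simp add: \<alpha>_def algebra_simps)
    finally show ?case by simp
   qed
  qed
 qed
qed

lemma eps_odd_power4: "eps_odd d ^ 4 = 1"
 by (simp add: eps_odd_def)

lemma norm_eps_odd: "norm (eps_odd d) = 1"
 by (simp add: eps_odd_def)

lemma theta_j_power4:
 assumes det: "a * d - b * c = 1" and c: "4 dvd c"
 shows "theta_j (a,b,c,d) z ^ 4 = (aut c d z)^2"
  and "norm (theta_j (a,b,c,d) z) = norm (aut c d z) powr (1/2)"
proof -
 have "even c" using c by (meson dvd_trans even_numeral)
 hence "even (b * c)" by simp
 moreover have "a * d = b * c + 1" using det by simp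
 ultimately have "odd d" by (metis even_mult_iff even_add odd_one)
 hence s: "(shimura_symbol c d)\<^sup>2 = 1" using shimura_symbol_coprime_sq SL2_coprime[OF det] by blast
 hence sc: "(of_int (shimura_symbol c d) :: complex)\<^sup>2 = 1" by (metis of_int_1 of_int_power)
 have "(of_int (shimura_symbol c d) :: complex) ^ 4 = ((of_int (shimura_symbol c d))^2)^2" by (simp flip: power_mult)
 hence s4: "(of_int (shimura_symbol c d) :: complex) ^ 4 = 1" using sc by simp
 have e4: "inverse (eps_odd d) ^ 4 = 1" by (simp add: power_inverse eps_odd_power4)
 have q4: "csqrt x ^ 4 = x^2" for x
 proof -
  have "csqrt x ^ 4 = ((csqrt x)^2)^2" by (simp only: power_mult[symmetric]) simp
  thus ?thesis by (simp only: power2_csqrt)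
 qed
 show "theta_j (a,b,c,d) z ^ 4 = (aut c d z)^2"
  unfolding theta_j_def prod.case power_mult_distrib s4 e4 q4 by simp
 have "(abs (shimura_symbol c d)) = 1" using s by (simp add: power2_eq_1_iff) auto
 hence "norm (of_int (shimura_symbol c d) :: complex) = 1" by (simp add: norm_of_int flip: of_int_abs)
 thus "norm (theta_j (a,b,c,d) z) = norm (aut c d z) powr (1/2)"
  unfolding theta_j_def prod.case norm_mult norm_inverse norm_eps_odd by (simp add: norm_csqrt powr_half_sqrt)
qed

lemma Nbar_le_pbar: "Nbar r t n <= pbar n"
 unfolding Nbar_def pbar_def by (rule card_mono[OF finite_overpartitions]) auto

text \<open>For odd c and d a translation replaces d by the even d + c and changes neither c nor the
  limit. Thus no Appell function attached to th2 is required.\<close>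

lemma tendsto_hinf_odd_cusp:
 assumes good: "!!a b c d. a * d - b * c = 1 ==> P c ==> ~ (odd c & odd d) ==>
   ((%z. norm (aut c d z) powr s * norm (G (mob (a,b,c,d) z))) ---> 0) hinf"
  and det: "a * d - b * c = (1 :: int)" and c: "P c"
 shows "((%z. norm (aut c d z) powr s * norm (G (mob (a,b,c,d) z))) ---> 0) hinf"
proof (cases "odd c & odd d")
 case True
 have det': "a * (d + c) - (b + a) * c = 1" using det by (simp add: algebra_simps)
 have lim: "((%z. norm (of_int c * z + of_int (d + c)) powr s * norm (G (mob (a,b + a,c,d + c) z))) ---> 0) hinf"
  by (rule good[OF det' c]) (use True in auto)
 have "filterlim (%z. z - 1) hinf hinf" by (rule filterlim_same_Im) simp
 from filterlim_compose[OF lim this]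
 have "((%z. norm (of_int c * (z - 1) + of_int (d + c)) powr s * norm (G (mob (a,b + a,c,d + c) (z - 1)))) ---> 0) hinf" .
 moreover have "of_int c * (z - 1) + of_int (d + c) = of_int c * z + (of_int d :: complex)" for z by (simp add: algebra_simps)
 ultimately show ?thesis by (simp only: moebius_T diff_add_cancel)
qed (use good[OF det c] in blast)

lemma parity_kappa:
 assumes det: "a * d - b * c = 1" and par: "~ (odd c & odd d)"
 shows "EX k. k ~= 0 & (ALL z. Im z > 0 --> th0 (mob (a,b,c,d) z) = k * csqrt (aut c d z) * thc (odd c) z)"
proof -
 have "thr c d = thc (odd c)" using par by (auto simp: thr_def thc_def fun_eq_iff)
 thus ?thesis using th0_general_transform[OF det] by simp
qed

lemma pbar_gen_cusp:
 fixes a b c d :: int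
 assumes l: "prime l" "l > 2" and det: "a * d - b * c = 1" and c: "(int l)\<^sup>2 dvd c"
 shows "((%z. norm (aut c d z) powr (1/2) * norm (sgen l 1 (mob (a,b,c,d) z))) ---> 0) hinf"
proof (rule tendsto_hinf_odd_cusp[where P = "%c. (int l)\<^sup>2 dvd c", OF _ det c])
 fix a b c d :: int
 assume det: "a * d - b * c = 1" and c: "(int l)\<^sup>2 dvd c" and par: "~ (odd c & odd d)"
 have l0: "l > 0" using l by simp
 obtain K where k: "K ~= 0" "!!z. Im z > 0 ==> th0 (mob (a,b,c,d) z) = K * csqrt (aut c d z) * thc (odd c) z"
  using parity_kappa[OF det par] by blast
 let ?S = "%z. \<Sum>v\<in>{0..<int l}. sieve_coeff l v / thc (odd c) (sshift l z v)"
 have "((%z. norm (?S z / K)) ---> norm (0 / K)) hinf"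
  by (intro tendsto_norm tendsto_divide inverse_thc_limit[OF l0] tendsto_const k(1))
 hence lim: "((%z. norm (?S z / K)) ---> 0) hinf" by simp
 have "eventually (%z. Im z > 0) hinf" unfolding eventually_hinf by (intro exI[of _ 1]) auto
 hence "eventually (%z. norm (?S z / K) = norm (aut c d z) powr (1/2) * norm (sgen l 1 (mob (a,b,c,d) z))) hinf"
 proof eventually_elim
  case (elim z)
  have J: "of_int c * z + of_int d ~= (0 :: complex)" by (rule Im_moebius(2)[OF det elim])
  have g: "sgen l 1 (mob (a,b,c,d) z) = ?S z / (K * csqrt (aut c d z))"
   by (rule pbar_gen_transform[OF l det c elim k(1)]) (rule k(2))
  show ?case unfolding g norm_divide norm_mult norm_csqrt using J k(1) by (simp add: powr_half_sqrt)
 qed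
 from iffD1[OF tendsto_cong[OF this] lim]
 show "((%z. norm (aut c d z) powr (1/2) * norm (sgen l 1 (mob (a,b,c,d) z))) ---> 0) hinf" .
qed

lemma rankgen_cusp:
 fixes a b c d :: int
 assumes l: "prime l" "l > 2" and det: "a * d - b * c = 1" and c: "(int t * int l)\<^sup>2 dvd c" and t: "odd t"
 shows "((%z. norm (aut c d z) powr (- (1/2)) * norm (rankgen l t r (mob (a,b,c,d) z))) ---> 0) hinf"
proof (rule tendsto_hinf_odd_cusp[where P = "%c. (int t * int l)\<^sup>2 dvd c", OF _ det c])
 fix a b c d :: int
 assume det: "a * d - b * c = 1" and c: "(int t * int l)\<^sup>2 dvd c" and par: "~ (odd c & odd d)"
 have l0: "l > 0" using l by simp
 obtain K where k: "K ~= 0" "!!z. Im z > 0 ==> th0 (mob (a,b,c,d) z) = K * csqrt (aut c d z) * thc (odd c) z"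
  using parity_kappa[OF det par] by blast
 let ?S = "%z. \<Sum>j\<in>{1..<int t}. ee (- (of_int (int r * j) / of_nat t)) * (2 * (1 - ee (of_int j / of_nat t)) / (1 + ee (of_int j / of_nat t)) * sapp l (odd c) z (of_int (j * d) / of_nat t))"
 have "(?S ---> (\<Sum>j\<in>{1..<int t}. ee (- (of_int (int r * j) / of_nat t)) * (2 * (1 - ee (of_int j / of_nat t)) / (1 + ee (of_int j / of_nat t)) * 0))) hinf"
  by (intro tendsto_sum tendsto_mult tendsto_const sapp_limit[OF l0])
 hence "(?S ---> 0) hinf" by simp
 hence "((%z. norm (?S z / K)) ---> norm (0 / K)) hinf"
  by (intro tendsto_norm tendsto_divide tendsto_const k(1))
 hence lim: "((%z. norm (?S z / K)) ---> 0) hinf" by simp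
 have "eventually (%z. Im z > 0) hinf" unfolding eventually_hinf by (intro exI[of _ 1]) auto
 hence "eventually (%z. norm (?S z / K) = norm (aut c d z) powr (- (1/2)) * norm (rankgen l t r (mob (a,b,c,d) z))) hinf"
 proof eventually_elim
  case (elim z)
  have J: "of_int c * z + of_int d ~= (0 :: complex)" by (rule Im_moebius(2)[OF det elim])
  have "odd c ==> even d" using par by blast
  hence g: "rankgen l t r (mob (a,b,c,d) z) = csqrt (aut c d z) / K * ?S z"
   by (intro rankgen_transform[OF l det c t elim refl _ k(1)] k(2))
  show ?case unfolding g norm_divide norm_mult norm_csqrt using J k(1) by (simp add: powr_minus powr_half_sqrt)
 qed
 from iffD1[OF tendsto_cong[OF this] lim]
 show "((%z. norm (aut c d z) powr (- (1/2)) * norm (rankgen l t r (mob (a,b,c,d) z))) ---> 0) hinf" .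
qed

lemma qint_modular_function:
 assumes f: "qint f F" and g: "!!z. Im z > 0 ==> g z = f (ee z)"
 shows "g holomorphic_on upper_half_plane" and "has_q_expansion g (%n. of_int (fps_nth F n))"
proof -
 have im: "ee ` upper_half_plane <= ball 0 1" using norm_ee_lt_1 by (auto simp: upper_half_plane_def)
 have "(f \<circ> ee) holomorphic_on upper_half_plane"
  by (intro holomorphic_on_compose_gen[OF _ qint_holomorphic[OF f] im] holomorphic_on_ee holomorphic_intros)
 thus "g holomorphic_on upper_half_plane"
  by (rule holomorphic_transform) (use g in \<open>auto simp: upper_half_plane_def\<close>)
 show "has_q_expansion g (%n. of_int (fps_nth F n))"
  unfolding has_q_expansion_def
 proof
  fix x assume x: "x \<in> upper_half_plane"
  hence z': "Im x > 0" by (simp add: upper_half_plane_def)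
  have "(%n. of_int (fps_nth F n) * ee x ^ n) sums f (ee x)" using f norm_ee_lt_1[OF z'] by (simp add: qint_def)
  moreover have "ee x ^ n = exp (2 * of_real pi * \<i> * of_nat n * x)" for n unfolding ee_power by (simp add: ee_def mult_ac)
  ultimately show "(%n. of_int (fps_nth F n) * exp (2 * of_real pi * \<i> * of_nat n * x)) sums g x" using g[OF z'] by simp
 qed
qed

lemma principal_character: "N > 0 ==> dirichlet_char N (%a. if coprime a (int N) then 1 else 0)"
proof -
 have "coprime (a + int N) (int N) = coprime a (int N)" for a by (simp add: coprime_iff_gcd_eq_1)
 thus "N > 0 ==> dirichlet_char N (%a. if coprime a (int N) then 1 else 0)"
  by (auto simp: dirichlet_char_def coprime_mult_left_iff)
qed

text \<open>The fourth power of \<open>theta_j\<close> is (c z + d)^2 for every odd d, so integral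
  automorphy factors of even weight are powers of \<open>theta_j\<close>.\<close>

lemma automorphy_power:
 assumes det: "a * d - b * c = 1" and c: "4 dvd c" and W: "W = 2 * V"
 shows "(aut c d z) ^ W = theta_j (a,b,c,d) z ^ (2 * W)"
proof -
 have "theta_j (a,b,c,d) z ^ (2 * W) = (theta_j (a,b,c,d) z ^ 4) ^ V" unfolding W power_mult[symmetric] by simp
 thus ?thesis unfolding theta_j_power4(1)[OF det c] W by (simp only: power_mult)
qed

section \<open>Assembly of the two cusp forms\<close>

theorem theorem6p1:
  fixes l m t :: nat and r :: nat and u :: nat
  assumes "prime l" and "l \<ge> 5" and "m > 0" and "t = l ^ m" and "r < t"
  shows "\<exists>(chi :: int \<Rightarrow> complex) (lam::int) (lam'::int) (N::nat) (N'::nat)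
           (h :: complex \<Rightarrow> complex) (hr :: complex \<Rightarrow> complex) (a :: nat \<Rightarrow> complex) (b :: nat \<Rightarrow> complex).
           cusp_form_Gamma0 lam N chi h \<and> cusp_form_Gamma1 lam' N' hr \<and>
           has_q_expansion h a \<and> has_q_expansion hr b \<and>
           (\<forall>n::nat. \<exists>k::int.
              (if n \<ge> 1 \<and> Legendre (- int n) (int l) = -1
               then of_nat (t * Nbar (int r) t n) else 0) - (a n + b n)
              = of_int (int l ^ u * k))"
proof -
 have l: "prime l" "l > 2" using assms(1,2) by auto
 have lodd: "odd l" using l prime_odd_nat by auto
 have l0: "l > 0" using l by simp
 have todd: "odd t" using lodd assms(4) by simp
 have t0: "t > 0" using todd by (cases t) auto
 define M where "M = 2 * m + 2"
 define L where "L = l ^ M"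
 define N where "N = 16 * L"
 have L0: "L > 0" and Lodd: "odd L" using l0 lodd by (simp_all add: L_def)
 have N0: "N > 0" using L0 by (simp add: N_def)
 have "2 * m + 2 = Suc m * 2" by simp
 hence "L = (l ^ m * l)^2" unfolding L_def M_def by (simp only: power_mult power_Suc2)
 hence Lt: "int L = (int t * int l)^2" by (simp add: assms(4))
 have Ll: "(int l)\<^sup>2 dvd int L" by (simp add: Lt power_mult_distrib)
 \<comment> \<open>p and q add up to the sieved coefficients t Nbar; p belongs to weight -1/2 and q
   to weight 1/2.\<close>
 define p where "p = (%n. of_bool (nonres l (int n)) * int (pbar n))"
 define q where "q = (%n. of_bool (nonres l (int n)) * (int (t * Nbar (int r) t n) - int (pbar n)))"
 define g where "g = sgen l 1"
 define gr where "gr = rankgen l t r"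
 have gs: "((%n. of_int (p n) * ee z ^ n) has_sum g z) UNIV" if "Im z > 0" for z
  unfolding p_def g_def by (rule pbar_gen_has_sum[OF l that])
 have grs: "((%n. of_int (q n) * ee z ^ n) has_sum gr z) UNIV" if "Im z > 0" for z
  unfolding q_def gr_def by (rule rankgen_has_sum[OF l that t0])
 have pb: "(abs (p n)) <= int 1 * int (if n = 0 then 1 else pbar n)" for n
  using not_nonres_neg_square[of l 0] by (simp add: p_def)
 have qb: "(abs (q n)) <= int t * int (if n = 0 then 1 else pbar n)" for n
 proof (cases "nonres l (int n)")
  case True
  have n0: "n ~= 0" using True not_nonres_neg_square[of l 0] by (cases n) auto
  have "int (t * Nbar (int r) t n) <= int (t * pbar n)" using Nbar_le_pbar[of "int r" t n] by (simp only: of_nat_le_iff mult_le_mono2)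
  moreover have "int (pbar n) <= int (t * pbar n)" using t0 by (simp only: of_nat_le_iff) (cases t; simp)
  ultimately have "(abs (int (t * Nbar (int r) t n) - int (pbar n))) <= int (t * pbar n)" by linarith
  thus ?thesis using True n0 by (simp add: q_def)
 qed (simp add: q_def)
 have Ndvd: "16 dvd c" "int L dvd c" "4 dvd c" if "int N dvd c" for c
 proof -
  have "16 dvd int N" "int L dvd int N" "4 dvd int N" by (simp_all add: N_def)
  thus "16 dvd c" "int L dvd c" "4 dvd c" using that dvd_trans by blast+
 qed
 have gT: "g (mob (a,b,c,d) z) = g z / theta_j (a,b,c,d) z" if "a * d - b * c = 1" "int N dvd c" "Im z > 0" for a b c d z
  unfolding g_def by (rule pbar_gen_Gamma0[OF l that(1) dvd_trans[OF Ll Ndvd(2)[OF that(2)]] Ndvd(1)[OF that(2)] that(3)])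
 have grT: "gr (mob (a,b,c,d) z) = theta_j (a,b,c,d) z * gr z" if h: "a * d - b * c = 1" "int N dvd c" "[d = 1] (mod int N)" "Im z > 0" for a b c d z
 proof -
  have "4 dvd int N" "int t dvd int N" by (simp_all add: N_def Lt power2_eq_square)
  hence "[d = 1] (mod 4)" "[d = 1] (mod int t)" using h(3) cong_dvd_modulus by blast+
  thus ?thesis unfolding gr_def using h Ndvd[OF h(2)] todd by (intro rankgen_Gamma1[OF l h(1)]) (simp_all add: Lt)
 qed
 obtain C1 where C1: "!!a b c d z. a * d - b * c = 1 ==> Im z >= 1 ==>
   norm (aut c d z) powr (- (- (1/2))) * norm (g (mob (a,b,c,d) z)) <= 1 * exp (C1 * Im z)"
 proof -
  have "EX C. ALL a b c d z. a * d - b * c = 1 --> Im z >= 1 -->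
   norm (aut c d z) powr (- (- (1/2))) * norm (g (mob (a,b,c,d) z)) <= 1 * exp (C * Im z)"
  proof (rule growth_at_cusps[where N = "int N"])
   show "norm (g z) <= 1 * (1 / norm (th0 (\<i> * Im z)))" if "Im z > 0" for z
    using generating_function_bound[OF gs[OF that] pb that] by simp
   fix a b c d :: int and z :: complex
   assume h: "a * d - b * c = 1" "[c = 0] (mod int N)" "Im z > 0"
   have c: "int N dvd c" using h(2) by (simp add: cong_0_iff)
   show "norm (g (mob (a,b,c,d) z)) = norm (aut c d z) powr (- (1/2)) * norm (g z)"
    unfolding gT[OF h(1) c h(3)] norm_divide theta_j_power4(2)[OF h(1) Ndvd(3)[OF c]] by (simp add: powr_minus field_simps)
  qed (use N0 in auto)
  thus ?thesis using that by blast
 qed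
 obtain C2 where C2: "!!a b c d z. a * d - b * c = 1 ==> Im z >= 1 ==>
   norm (aut c d z) powr (- (1/2)) * norm (gr (mob (a,b,c,d) z)) <= real t * exp (C2 * Im z)"
 proof -
  have "EX C. ALL a b c d z. a * d - b * c = 1 --> Im z >= 1 -->
   norm (aut c d z) powr (- (1/2)) * norm (gr (mob (a,b,c,d) z)) <= real t * exp (C * Im z)"
  proof (rule growth_at_cusps[where N = "int N"])
   show "norm (gr z) <= real t * (1 / norm (th0 (\<i> * Im z)))" if "Im z > 0" for z
    by (rule generating_function_bound[OF grs[OF that] qb that])
   fix a b c d :: int and z :: complex
   assume h: "a * d - b * c = 1" "[c = 0] (mod int N)" "[d = 1] (mod int N)" "Im z > 0"
   have c: "int N dvd c" using h(2) by (simp add: cong_0_iff)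
   show "norm (gr (mob (a,b,c,d) z)) = norm (aut c d z) powr (1/2) * norm (gr z)"
    unfolding grT[OF h(1) c h(3,4)] norm_mult theta_j_power4(2)[OF h(1) Ndvd(3)[OF c]] ..
  qed (use N0 in auto)
  thus ?thesis using that by blast
 qed
 \<comment> \<open>u secures the modulus, C1 and C2 secure the decay at the cusps: K = l ^ k exceeds
   k, hence both growth constants. Enlarging k only strengthens the congruence, whose modulus is l ^
   (k + 1).\<close>
 define k where "k = max u (nat \<lceil>max C1 C2\<rceil>)"
 define K where "K = l ^ k"
 have K: "C1 < 2 * pi * real K" "C2 < 2 * pi * real K"
 proof -
  have "k < l ^ k" by (rule power_gt_expt) (use l in simp)
  hence "real k < real K" unfolding K_def of_nat_less_iff .
  moreover have "max C1 C2 <= real k" unfolding k_def by linarith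
  moreover have "real K <= 2 * pi * real K" using pi_gt3 by (simp add: mult_le_cancel_right1)
  ultimately show "C1 < 2 * pi * real K" "C2 < 2 * pi * real K" by linarith+
 qed
 define W where "W = 12 * (L - 1) * K"
 define V where "V = 6 * (L - 1) * K"
 have WV: "W = 2 * V" by (simp add: W_def V_def)
 define E where "E = Equot L K"
 have ET: "E (mob (a,b,c,d) z) = theta_j (a,b,c,d) z ^ (2 * W) * E z" if "a * d - b * c = 1" "int N dvd c" "Im z > 0" for a b c d z
 proof -
  have "E (mob (a,b,c,d) z) = (aut c d z) ^ W * E z"
   unfolding E_def W_def by (rule Equot_Gamma0[OF that(1) Ndvd(2)[OF that(2)] L0 that(3)])
  thus ?thesis unfolding automorphy_power[OF that(1) Ndvd(3)[OF that(2)] WV] .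
 qed
 obtain fE FE where fE: "qint fE FE" "of_nat (l ^ Suc k) dvd FE - 1" "!!z. Im z > 0 ==> fE (ee z) = E z"
  using X8_quotient_expansion[OF l(1) lodd, of k M] unfolding E_def Equot_def L_def K_def by blast
 obtain fp where fp: "qint fp (Abs_fps p)" "!!z. Im z > 0 ==> fp (ee z) = g z" using has_sum_qint[OF gs] by blast
 obtain fq where fq: "qint fq (Abs_fps q)" "!!z. Im z > 0 ==> fq (ee z) = gr z" using has_sum_qint[OF grs] by blast
 define h where "h = (%z. E z * g z)"
 define hr where "hr = (%z. E z * gr z)"
 define a where "a = (%n. of_int (fps_nth (FE * Abs_fps p) n) :: complex)"
 define b where "b = (%n. of_int (fps_nth (FE * Abs_fps q) n) :: complex)"
 have hq: "h holomorphic_on upper_half_plane" "has_q_expansion h a"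
  unfolding a_def by (rule qint_modular_function[OF qint_mult[OF fE(1) fp(1)]], simp add: h_def fE(3) fp(2))+
 have hrq: "hr holomorphic_on upper_half_plane" "has_q_expansion hr b"
  unfolding b_def by (rule qint_modular_function[OF qint_mult[OF fE(1) fq(1)]], simp add: hr_def fE(3) fq(2))+
 have tj: "theta_j (a,b,c,d) z ~= 0" if "a * d - b * c = 1" "int N dvd c" "Im z > 0" for a b c d z
  by (rule theta_j_nonzero[OF that(1) Ndvd(1)[OF that(2)] that(3)])
 \<comment> \<open>The multiplier of \<open>theta_j\<close> already accounts for the whole
   transformation on Gamma0, so the principal character suffices.\<close>
 define chi where "chi = (%a. if coprime a (int N) then 1 else 0 :: complex)"
 \<comment> \<open>E contributes \<open>theta_j\<close> to the power 2 W and g divides by one more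
   factor; the exponent 2 W - 1 = 2 (W - 1) + 1 gives the index W - 1, against W for
   \<open>hr\<close>.\<close>
 have cusp0: "cusp_form_Gamma0 (int W - 1) N chi h"
  unfolding cusp_form_Gamma0_def half_int_cusp_form_def
 proof (intro conjI ballI hq(1))
  show "N > 0" by (rule N0)
  show "4 dvd N" by (simp add: N_def)
  show "dirichlet_char N chi" unfolding chi_def by (rule principal_character[OF N0])
 next
  fix G x assume G: "G \<in> Gamma0 N" and x: "x \<in> upper_half_plane"
  obtain a b c d where abcd: "G = (a, b, c, d)" by (metis prod_cases4)
  have det: "a * d - b * c = 1" and c: "int N dvd c" using G by (auto simp: Gamma0_def abcd)
  have x: "Im x > 0" using x by (simp add: upper_half_plane_def)
  have "coprime d (int N)"
   by (rule coprime_divisors[OF dvd_refl c]) (use SL2_coprime[OF det] in \<open>simp add: coprime_commute\<close>)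
  hence chi: "chi d = 1" by (simp add: chi_def)
  have "2 * (int W - 1) + 1 = int (2 * W) - 1" by simp
  hence "theta_j (a,b,c,d) x powi (2 * (int W - 1) + 1) = theta_j (a,b,c,d) x ^ (2 * W) / theta_j (a,b,c,d) x"
   using tj[OF det c x] by (simp only: power_int_diff power_int_of_nat power_int_1_right simp_thms)
  hence "h (mob (a,b,c,d) x) = chi d * theta_j (a,b,c,d) x powi (2 * (int W - 1) + 1) * h x"
   unfolding h_def ET[OF det c x] gT[OF det c x] chi by simp
  thus "case G of (a,b,c,d) => h (mob G x) = chi d * theta_j G x powi (2 * (int W - 1) + 1) * h x" by (simp only: abcd prod.case)
 next
  fix G assume "G \<in> SL2Z"
  then obtain a b c d where abcd: "G = (a, b, c, d)" and det: "a * d - b * c = 1" by (auto simp: SL2Z_def)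
  have "((%z. norm (aut c d z) powr (- (real (12 * (L - 1) * K) + - (1/2))) *
   norm (Equot L K (mob (a,b,c,d) z) * g (mob (a,b,c,d) z))) ---> 0) hinf"
  proof (rule cusp_limit[OF L0 det K(1)])
   show "norm (aut c d z) powr (- (- (1/2))) * norm (g (mob (a,b,c,d) z)) <= 1 * exp (C1 * Im z)" if "Im z >= 1" for z
    by (rule C1[OF det that])
   assume "int L dvd c"
   hence "(int l)\<^sup>2 dvd c" using Ll dvd_trans by blast
   from pbar_gen_cusp[OF l det this]
   show "((%z. norm (aut c d z) powr (- (- (1/2))) * norm (g (mob (a,b,c,d) z))) ---> 0) hinf"
    by (simp only: g_def minus_minus)
  qed
  moreover have "of_int (int W - 1) + 1/2 = real (12 * (L - 1) * K) + - (1/2)" by (simp add: W_def)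
  ultimately show "case G of (a,b,c,d) => ((%x. norm (of_int c * x + of_int d) powr (- (of_int (int W - 1) + 1/2)) * norm (h (mob G x))) ---> 0) (filtercomap Im at_top)"
   by (simp only: abcd prod.case hinf_def h_def E_def)
 qed
 have cusp1: "cusp_form_Gamma1 (int W) N hr"
  unfolding cusp_form_Gamma1_def half_int_cusp_form_def
 proof (intro conjI ballI hrq(1))
  show "N > 0" by (rule N0)
  show "4 dvd N" by (simp add: N_def)
 next
  fix G x assume G: "G \<in> Gamma1 N" and x: "x \<in> upper_half_plane"
  obtain a b c d where abcd: "G = (a, b, c, d)" by (metis prod_cases4)
  have det: "a * d - b * c = 1" and c: "int N dvd c" and d: "[d = 1] (mod int N)" using G by (auto simp: Gamma1_def abcd)
  have x: "Im x > 0" using x by (simp add: upper_half_plane_def)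
  have "2 * int W + 1 = int (2 * W + 1)" by simp
  hence "theta_j (a,b,c,d) x powi (2 * int W + 1) = theta_j (a,b,c,d) x ^ (2 * W + 1)" by (simp only: power_int_of_nat)
  hence "hr (mob (a,b,c,d) x) = 1 * theta_j (a,b,c,d) x powi (2 * int W + 1) * hr x"
   unfolding hr_def ET[OF det c x] grT[OF det c d x] by simp
  thus "case G of (a,b,c,d) => hr (mob G x) = 1 * theta_j G x powi (2 * int W + 1) * hr x" by (simp only: abcd prod.case)
 next
  fix G assume "G \<in> SL2Z"
  then obtain a b c d where abcd: "G = (a, b, c, d)" and det: "a * d - b * c = 1" by (auto simp: SL2Z_def)
  have "((%z. norm (aut c d z) powr (- (real (12 * (L - 1) * K) + 1/2)) *
   norm (Equot L K (mob (a,b,c,d) z) * gr (mob (a,b,c,d) z))) ---> 0) hinf"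
  proof (rule cusp_limit[OF L0 det K(2)])
   show "norm (aut c d z) powr (- (1/2)) * norm (gr (mob (a,b,c,d) z)) <= real t * exp (C2 * Im z)" if "Im z >= 1" for z
    by (rule C2[OF det that])
   assume "int L dvd c"
   hence "(int t * int l)\<^sup>2 dvd c" by (simp only: Lt)
   from rankgen_cusp[OF l det this todd]
   show "((%z. norm (aut c d z) powr (- (1/2)) * norm (gr (mob (a,b,c,d) z))) ---> 0) hinf"
    by (simp only: gr_def)
  qed
  moreover have "of_int (int W) + 1/2 = real (12 * (L - 1) * K) + 1/2" by (simp add: W_def)
  ultimately show "case G of (a,b,c,d) => ((%x. norm (of_int c * x + of_int d) powr (- (of_int (int W) + 1/2)) * norm (hr (mob G x))) ---> 0) (filtercomap Im at_top)"
   by (simp only: abcd prod.case hinf_def hr_def E_def)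
 qed
 have cong: "EX k'::int. (if n >= 1 & Legendre (- int n) (int l) = -1 then of_nat (t * Nbar (int r) t n) else 0) - (a n + b n) = of_int (int l ^ u * k')" for n
 proof -
  let ?A = "Abs_fps p + Abs_fps q"
  have n0: "nonres l (int n) ==> n >= 1" using not_nonres_neg_square[of l 0] by (cases n) auto
  have lhs: "(if n >= 1 & Legendre (- int n) (int l) = -1 then of_nat (t * Nbar (int r) t n) else 0) = (of_int (fps_nth ?A n) :: complex)"
  proof (cases "nonres l (int n)")
   case True
   thus ?thesis using n0 by (simp add: p_def q_def nonres_def)
  next
   case False
   thus ?thesis by (simp add: p_def q_def nonres_def)
  qed
  \<comment> \<open>The difference in question is minus a coefficient of (FE - 1) times the sum of
    both series, and FE is 1 modulo l ^ (k + 1).\<close>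
  have "of_nat (l ^ Suc k) dvd (FE - 1) * ?A" using fE(2) by (rule dvd_mult2)
  hence "int (l ^ Suc k) dvd fps_nth ((FE - 1) * ?A) n" using fps_of_nat_dvd_iff by blast
  moreover have "l ^ u dvd l ^ Suc k" by (rule le_imp_power_dvd) (simp add: k_def)
  hence "int (l ^ u) dvd int (l ^ Suc k)" by (simp only: of_nat_dvd_iff)
  ultimately have "int (l ^ u) dvd fps_nth ((FE - 1) * ?A) n" using dvd_trans by blast
  then obtain k' where k': "fps_nth ((FE - 1) * ?A) n = int (l ^ u) * k'" by (elim dvdE)
  have "fps_nth ((FE - 1) * ?A) n = fps_nth (FE * Abs_fps p) n + fps_nth (FE * Abs_fps q) n - fps_nth ?A n"
   by (simp only: left_diff_distrib distrib_left mult_1 fps_sub_nth fps_add_nth)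
  hence "fps_nth ?A n - (fps_nth (FE * Abs_fps p) n + fps_nth (FE * Abs_fps q) n) = int l ^ u * (- k')"
   using k' by simp
  hence "of_int (fps_nth ?A n) - (a n + b n) = of_int (int l ^ u * (- k'))"
   unfolding a_def b_def by (metis of_int_add of_int_diff)
  thus ?thesis unfolding lhs by blast
 qed
 show ?thesis
  by (rule exI[of _ chi], rule exI[of _ "int W - 1"], rule exI[of _ "int W"], rule exI[of _ N], rule exI[of _ N],
    rule exI[of _ h], rule exI[of _ hr], rule exI[of _ a], rule exI[of _ b])
   (intro conjI allI cusp0 cusp1 hq(2) hrq(2) cong)
qed

end
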